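(* Let $p\in\mathbb N$ with $p\le d+1$, $a>1$, $M_n\ge c_0n^{4/3}$, and let $\tau=C_0c$ with $C_0$ sufficiently large. Let $\hat f_n=\hat f_n^{\hat j_n}$. Then for all integers $s$ with $s+1\le p$, $$\sup_{f\in\mathcal W_p}\Big[\mathbb E_f\|(\hat f_n-f)^{(s)}\|_{L^2}^2\vee\sup_{x\in[0,1]}\mathbb E_f|(\hat f_n-f)^{(s)}(x)|^2\Big]\lesssim(n\alpha^2\log^{-(1+2a)}n)^{-\frac{2(p-s)}{2p+2}}\vee(n/\log n)^{-\frac{2(p-s)}{2p+1}},$$ up to a constant depending only on $a$, $d$ and $M$.
   Context: Fix $M>0$. $\mathcal W_p=\{f\in C^p[0,1]:f\ge0,\int_0^1f=1,\sum_{j=0}^p\|f^{(j)}\|_{L^\infty}<M\}$. $X_1,\dots,X_n$ are i.i.d. with density $f$; $\mathbb E_f$ is over data and noise. Spline wavelets: $\mathcal V_j$ is the span of the degree-$d$ B-splines $B_{k,j}$ ($1\le k\le 2^j+d$) on the knots $\xi_1=\dots=\xi_{d+1}=0$, $\xi_k=(k-d-1)2^{-j}$, $\xi_{2^j+d+1}=\dots=\xi_{2^j+2d+1}=1$, and $\mathbf B_{k,j}=B_{k,j}/\|B_{k,j}\|_{L^2}$. $P_{\mathcal V_j}$ is the $L^2$-orthogonal projection onto $\mathcal V_j$, and $\mathcal U_j$ is the orthogonal complement of $\mathcal V_j$ in $\mathcal V_{j+1}$. $j_0$ is the smallest integer $\ge1$ with $2^{j_0}\ge 2d+1$. For $j\ge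 j_0$, $\{\psi_{j,k}\}_{k\in\mathcal M_j}$ ($|\mathcal M_j|=2^j$) is Jia's (2006) compactly supported spline wavelet Riesz basis of $\mathcal U_j$: dilations/translations $2^{j/2}\psi(2^j\cdot-k)$ and boundary versions of fixed generators supported in $[0,2d+1]$, normalized to unit $L^2$-norm, with $c_\psi$ the maximum sup-norm of the normalized generators. Set $\mathcal M_{j_0-1}=\{1,\dots,2^{j_0}+d\}$ and $\psi_{j_0-1,k}=\mathbf B_{k,j_0}$. $S_j$ is the frame operator of $\{\psi_{j,k}\}_k$, and $\tilde\psi_{j,k}=S_j^{-1}\psi_{j,k}$. Private data: $Z_{ijk}=\psi_{j,k}(X_i)+\sigma_{\alpha,j}Y_{ijk}$ ($Y$ i.i.d. standard Laplace) for $j_0-1\le j\le j_{\max}$, with $\sigma_{\alpha,j_0-1}=4(d+1)^2\alpha^{-1}2^{j_0/2}$ and $\sigma_{\alpha,j}=4(3d+1)c_\psi\alpha^{-1}\frac a{a-1}j^a2^{j/2}$; $\bar Z_{jk}=n^{-1}\sum_iZ_{ijk}$. For a level $J$, $\hat f_n^{J}=\sum_{j=j_0-1}^{J}\sum_{k\in\mathcal M_j}\bar Z_{jk}\tilde\psi_{j,k}$. Level selection: $j_{\max}=(\log n)/3$ and $\mathcal J=\{1,\dots,j_{\max}\}$. With grid $x_t=t/M_n$, $t=0,\dots,M_n$, $\hat j_n$ is the minimal $j\in\mathcal J$ such that for all $l\in\mathcal J$ with $l>j$ and all $s\in\{0,\dots,p\}$, $$\|(\hat f_n^j-\hat f_n^l)^{(s)}\|_{L^2}^2\vee\max_{0\le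 t\le M_n}|(\hat f_n^j-\hat f_n^l)^{(s)}(x_t)|^2\le\tau n^{-1}2^{2ls}l(2^l+2^{2l}l^{2a}\alpha^{-2}).$$ Here $\tau=C_0c$, with $c$ a sufficiently large constant depending on $a,p,d,M$ and the wavelet basis.
   Formalization: Adds nα² ≥ 1 (as α → 0 with n fixed the noise variance, of order 1/(nα²), exceeds the stated rate) and n ≥ 8 (so that 𝒥 is nonempty); the constant may also depend on c_0, τ and the wavelet basis, which is any basis with the listed properties of Jia's. *)

theory Defs
  imports "HOL-Probability.Probability"
begin

text \<open>Knots xi_k (k = 1 .. 2^j+2d+1) of level j for degree d:
  xi_k = 0 for k <= d+1, (k-d-1) 2^-j in between, 1 for k >= 2^j+d+1.\<close>
definition knot :: "nat \<Rightarrow> nat \<Rightarrow> nat \<Rightarrow> real" where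
  "knot d j k = max 0 (min 1 ((real k - real d - 1) / 2 ^ j))"

text \<open>Cox--de Boor recursion; bsp d j r i is the B-spline of degree r with
  knots xi_i,...,xi_(i+r+1).  Degree 0 pieces are half-open [xi_i, xi_(i+1)),
  except that the last nondegenerate piece is closed at 1 (right-continuity
  convention with the usual closure at the right end point).  Division by
  zero is 0, the standard 0/0 = 0 convention.\<close>
fun bsp :: "nat \<Rightarrow> nat \<Rightarrow> nat \<Rightarrow> nat \<Rightarrow> real \<Rightarrow> real" where
  "bsp d j 0 i x =
     (if (knot d j i \<le> x \<and> x < knot d j (i+1)) \<or>
         (x = 1 \<and> knot d j i < knot d j (i+1) \<and> knot d j (i+1) = 1) then 1 else 0)"
| "bsp d j (Suc r) i x =
     (x - knot d j i) / (knot d j (i+r+1) - knot d j i) * bsp d j r i x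
   + (knot d j (i+r+2) - x) / (knot d j (i+r+2) - knot d j (i+1)) * bsp d j r (i+1) x"

definition Bspl :: "nat \<Rightarrow> nat \<Rightarrow> nat \<Rightarrow> real \<Rightarrow> real" where
  "Bspl d j k = bsp d j d k"

definition inner01 :: "(real \<Rightarrow> real) \<Rightarrow> (real \<Rightarrow> real) \<Rightarrow> real" where
  "inner01 g h = (LINT x:{0..1}|lborel. g x * h x)"

definition l2sq :: "(real \<Rightarrow> real) \<Rightarrow> real" where
  "l2sq g = inner01 g g"

definition nBspl :: "nat \<Rightarrow> nat \<Rightarrow> nat \<Rightarrow> real \<Rightarrow> real" where
  "nBspl d j k = (\<lambda>x. Bspl d j k x / sqrt (l2sq (Bspl d j k)))"

definition Vsp :: "nat \<Rightarrow> nat \<Rightarrow> (real \<Rightarrow> real) set" where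
  "Vsp d j = {(\<lambda>x. \<Sum>k\<in>{1..2^j+d}. c k * Bspl d j k x) | c. True}"

definition Usp :: "nat \<Rightarrow> nat \<Rightarrow> (real \<Rightarrow> real) set" where
  "Usp d j = {g \<in> Vsp d (Suc j). \<forall>h\<in>Vsp d j. inner01 g h = 0}"

definition j0 :: "nat \<Rightarrow> nat" where
  "j0 d = (LEAST j::nat. 1 \<le> j \<and> 2 * d + 1 \<le> 2 ^ j)"

definition Mset :: "nat \<Rightarrow> nat \<Rightarrow> nat set" where
  "Mset d j = (if j = j0 d - 1 then {1..2 ^ j0 d + d} else {1..2 ^ j})"

definition jia_wavelets :: "nat \<Rightarrow> (nat \<Rightarrow> nat \<Rightarrow> real \<Rightarrow> real) \<Rightarrow> real \<Rightarrow> bool" where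
  "jia_wavelets d \<psi> c\<psi> \<longleftrightarrow>
     (\<forall>j\<ge>j0 d. \<forall>k\<in>{1..2^j}. \<psi> j k \<in> Usp d j \<and> l2sq (\<psi> j k) = 1)
   \<and> (\<forall>j\<ge>j0 d. \<forall>g\<in>Usp d j. \<exists>c. g = (\<lambda>x. \<Sum>k\<in>{1..2^j}. c k * \<psi> j k x))
   \<and> (\<exists>A B. 0 < A \<and> 0 < B \<and> (\<forall>j\<ge>j0 d. \<forall>c::nat \<Rightarrow> real.
         A * (\<Sum>k\<in>{1..2^j}. (c k)\<^sup>2) \<le> l2sq (\<lambda>x. \<Sum>k\<in>{1..2^j}. c k * \<psi> j k x)
       \<and> l2sq (\<lambda>x. \<Sum>k\<in>{1..2^j}. c k * \<psi> j k x) \<le> B * (\<Sum>k\<in>{1..2^j}. (c k)\<^sup>2)))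
   \<and> (\<exists>G :: (real \<Rightarrow> real) set. finite G \<and> G \<noteq> {}
       \<and> (\<forall>\<eta>\<in>G. bounded (range \<eta>) \<and> (\<forall>y. \<eta> y \<noteq> 0 \<longrightarrow> 0 \<le> y \<and> y \<le> 2 * real d + 1))
       \<and> (\<forall>j\<ge>j0 d. \<forall>k\<in>{1..2^j}. \<exists>\<eta>\<in>G. \<exists>m::int.
            \<forall>x\<in>{0..1}. \<psi> j k x = 2 powr (real j / 2) * \<eta> (2 ^ j * x - real_of_int m))
       \<and> c\<psi> = Max ((\<lambda>\<eta>. SUP y. \<bar>\<eta> y\<bar>) ` G))"

definition psiF :: "nat \<Rightarrow> (nat \<Rightarrow> nat \<Rightarrow> real \<Rightarrow> real) \<Rightarrow> nat \<Rightarrow> nat \<Rightarrow> real \<Rightarrow> real" where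
  "psiF d \<psi> j k = (if j = j0 d - 1 then nBspl d (j0 d) k else \<psi> j k)"

definition Wsp :: "nat \<Rightarrow> nat \<Rightarrow> (real \<Rightarrow> real) set" where
  "Wsp d j = (if j = j0 d - 1 then Vsp d (j0 d) else Usp d j)"

definition frameop :: "nat \<Rightarrow> (nat \<Rightarrow> nat \<Rightarrow> real \<Rightarrow> real) \<Rightarrow> nat \<Rightarrow> (real \<Rightarrow> real) \<Rightarrow> real \<Rightarrow> real" where
  "frameop d \<psi> j g = (\<lambda>x. \<Sum>k\<in>Mset d j. inner01 g (psiF d \<psi> j k) * psiF d \<psi> j k x)"

definition dualpsi :: "nat \<Rightarrow> (nat \<Rightarrow> nat \<Rightarrow> real \<Rightarrow> real) \<Rightarrow> nat \<Rightarrow> nat \<Rightarrow> real \<Rightarrow> real" where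
  "dualpsi d \<psi> j k = (THE g. g \<in> Wsp d j \<and> frameop d \<psi> j g = psiF d \<psi> j k)"

definition sigma :: "nat \<Rightarrow> real \<Rightarrow> real \<Rightarrow> real \<Rightarrow> nat \<Rightarrow> real" where
  "sigma d a c\<psi> \<alpha> j =
     (if j = j0 d - 1 then 4 * (real d + 1)\<^sup>2 / \<alpha> * 2 powr (real (j0 d) / 2)
      else 4 * (3 * real d + 1) * c\<psi> / \<alpha> * (a / (a - 1)) * real j powr a * 2 powr (real j / 2))"

definition jmax :: "nat \<Rightarrow> nat" where
  "jmax n = nat \<lfloor>log 2 (real n) / 3\<rfloor>"

definition NIdx :: "nat \<Rightarrow> nat \<Rightarrow> (nat \<times> nat \<times> nat) set" where
  "NIdx d n = {(i, j, k). i < n \<and> j0 d - 1 \<le> j \<and> j \<le> jmax n \<and> k \<in> Mset d j}"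

definition Zbar :: "nat \<Rightarrow> real \<Rightarrow> real \<Rightarrow> (nat \<Rightarrow> nat \<Rightarrow> real \<Rightarrow> real) \<Rightarrow> real \<Rightarrow> nat
     \<Rightarrow> (nat \<Rightarrow> real) \<Rightarrow> (nat \<times> nat \<times> nat \<Rightarrow> real) \<Rightarrow> nat \<Rightarrow> nat \<Rightarrow> real" where
  "Zbar d a c\<psi> \<psi> \<alpha> n X Y j k =
     (\<Sum>i<n. psiF d \<psi> j k (X i) + sigma d a c\<psi> \<alpha> j * Y (i, j, k)) / real n"

definition fhat :: "nat \<Rightarrow> real \<Rightarrow> real \<Rightarrow> (nat \<Rightarrow> nat \<Rightarrow> real \<Rightarrow> real) \<Rightarrow> real \<Rightarrow> nat
     \<Rightarrow> (nat \<Rightarrow> real) \<Rightarrow> (nat \<times> nat \<times> nat \<Rightarrow> real) \<Rightarrow> nat \<Rightarrow> real \<Rightarrow> real" where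
  "fhat d a c\<psi> \<psi> \<alpha> n X Y J =
     (\<lambda>x. \<Sum>j\<in>{j0 d - 1..J}. \<Sum>k\<in>Mset d j. Zbar d a c\<psi> \<psi> \<alpha> n X Y j k * dualpsi d \<psi> j k x)"

text \<open>s-th derivative on [0,1]: iterated one-sided derivative (right derivative
  on [0,1), left derivative at 1).  For C^p functions on [0,1] this is the usual
  derivative; for splines it is the right-continuous version.\<close>
fun sderiv :: "nat \<Rightarrow> (real \<Rightarrow> real) \<Rightarrow> real \<Rightarrow> real" where
  "sderiv 0 g = g"
| "sderiv (Suc s) g = (\<lambda>x. if x < 1
      then Lim (at_right 0) (\<lambda>h. (sderiv s g (x + h) - sderiv s g x) / h)
      else Lim (at_left 0) (\<lambda>h. (sderiv s g (x + h) - sderiv s g x) / h))"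

definition jhat :: "nat \<Rightarrow> nat \<Rightarrow> real \<Rightarrow> real \<Rightarrow> (nat \<Rightarrow> nat \<Rightarrow> real \<Rightarrow> real) \<Rightarrow> real \<Rightarrow> real
     \<Rightarrow> nat \<Rightarrow> nat \<Rightarrow> (nat \<Rightarrow> real) \<Rightarrow> (nat \<times> nat \<times> nat \<Rightarrow> real) \<Rightarrow> nat" where
  "jhat d p a c\<psi> \<psi> \<tau> \<alpha> Mn n X Y =
     (LEAST j. j \<in> {1..jmax n} \<and>
        (\<forall>l\<in>{1..jmax n}. j < l \<longrightarrow> (\<forall>s\<le>p.
           (let D = sderiv s (\<lambda>x. fhat d a c\<psi> \<psi> \<alpha> n X Y j x - fhat d a c\<psi> \<psi> \<alpha> n X Y l x);
                thr = \<tau> / real n * 2 ^ (2 * l * s) * real l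
                      * (2 ^ l + 2 ^ (2 * l) * real l powr (2 * a) / \<alpha>\<^sup>2)
            in l2sq D \<le> thr \<and> (\<forall>t\<le>Mn. (D (real t / real Mn))\<^sup>2 \<le> thr)))))"

definition fest :: "nat \<Rightarrow> nat \<Rightarrow> real \<Rightarrow> real \<Rightarrow> (nat \<Rightarrow> nat \<Rightarrow> real \<Rightarrow> real) \<Rightarrow> real \<Rightarrow> real
     \<Rightarrow> nat \<Rightarrow> nat \<Rightarrow> (nat \<Rightarrow> real) \<Rightarrow> (nat \<times> nat \<times> nat \<Rightarrow> real) \<Rightarrow> real \<Rightarrow> real" where
  "fest d p a c\<psi> \<psi> \<tau> \<alpha> Mn n X Y =
     fhat d a c\<psi> \<psi> \<alpha> n X Y (jhat d p a c\<psi> \<psi> \<tau> \<alpha> Mn n X Y)"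

definition Cp01 :: "nat \<Rightarrow> (real \<Rightarrow> real) \<Rightarrow> bool" where
  "Cp01 p f \<longleftrightarrow>
     (\<forall>j<p. \<forall>x\<in>{0..1}. (sderiv j f has_real_derivative sderiv (Suc j) f x) (at x within {0..1}))
   \<and> (\<forall>j\<le>p. continuous_on {0..1} (sderiv j f))"

definition Wp :: "nat \<Rightarrow> real \<Rightarrow> (real \<Rightarrow> real) set" where
  "Wp p M = {f. Cp01 p f \<and> (\<forall>x\<in>{0..1}. 0 \<le> f x) \<and> (LINT x:{0..1}|lborel. f x) = 1
              \<and> (\<Sum>j\<le>p. SUP x\<in>{0..1}. \<bar>sderiv j f x\<bar>) < M}"

definition laplace :: "real measure" where
  "laplace = density lborel (\<lambda>y. ennreal (exp (- \<bar>y\<bar>) / 2))"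

definition dataM :: "(real \<Rightarrow> real) \<Rightarrow> nat \<Rightarrow> (nat \<Rightarrow> real) measure" where
  "dataM f n = PiM {..<n} (\<lambda>_. density lborel (\<lambda>x. ennreal (indicator {0..1} x * f x)))"

definition noiseM :: "nat \<Rightarrow> nat \<Rightarrow> (nat \<times> nat \<times> nat \<Rightarrow> real) measure" where
  "noiseM d n = PiM (NIdx d n) (\<lambda>_. laplace)"

definition Ef :: "nat \<Rightarrow> (real \<Rightarrow> real) \<Rightarrow> nat
     \<Rightarrow> ((nat \<Rightarrow> real) \<Rightarrow> (nat \<times> nat \<times> nat \<Rightarrow> real) \<Rightarrow> real) \<Rightarrow> ennreal" where
  "Ef d f n R = (\<integral>\<^sup>+ \<omega>. ennreal (R (fst \<omega>) (snd \<omega>)) \<partial>(dataM f n \<Otimes>\<^sub>M noiseM d n))"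

definition rate :: "nat \<Rightarrow> nat \<Rightarrow> real \<Rightarrow> real \<Rightarrow> nat \<Rightarrow> real" where
  "rate p s a \<alpha> n =
     max ((real n * \<alpha>\<^sup>2 / ln (real n) powr (1 + 2 * a)) powr (- (2 * (real p - real s)) / (2 * real p + 2)))
         ((real n / ln (real n)) powr (- (2 * (real p - real s)) / (2 * real p + 1)))"

end

theory Submission
  imports Defs "HOL-Computational_Algebra.Polynomial" "HOL-Library.Function_Algebras"
begin

text \<open>The estimator at level \<open>J\<close> is, up to centred noise, the orthogonal projection of \<open>f\<close> onto the
  nested spline space of level \<open>J + 1\<close>. The wavelets annihilate polynomials and the dual functions are
  localised (a commutator argument with the banded Gram matrices), so the bias at derivative order \<open>s\<close>
  is of order \<open>2^(-J (p - s))\<close> uniformly in \<open>x\<close>. The deviation at a point is a sum of independent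
  bounded and Laplace variables of total variance of order \<open>vlev\<close>, and its exponential moments are
  controlled up to the scale \<open>sqrt J\<close>. All random functions are piecewise polynomials, so their
  derivatives are bounded by their values at a fixed number of norming points per cell, and on a fine
  grid they are controlled by their grid values. Lepski's argument then runs pointwise in the
  data: if the selected level is below the oracle level, the selection test bounds the error; if it is
  above, some deviation exceeded its threshold, which is so improbable that a weighted AM-GM inequality
  absorbs the error incurred. The bound on the squared error is a sum of deviations at norming points,
  constant in \<open>x\<close> on cells, so the same bound serves the pointwise and the integrated risk.\<close>

section \<open>The inner product on bounded measurable functions\<close>

text \<open>Three obstacles shape the proof. The level is chosen by the data, and the selected
  estimator is never shown to be measurable: its error is dominated everywhere by a measurable
  majorant, and the nonnegative integral is monotone for arbitrary integrands. For the same reason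
  no events occur; an indicator is replaced by an exponential weight of known expectation. Second,
  \<open>jia_wavelets\<close> controls the wavelets but not their duals at points: pointwise facts
  about the duals come from inverting Gram matrices, and the limit of the projections is identified
  in mean square and then carried to points through piecewise polynomials. Third, exponential
  moments are under control only in a limited range; the cap (log n)/3 on the level gives l 2^l
  \<le> n, which lets the range grow like the square root of l and so makes deviations at the order
  of 2^l norming points negligible together. Functions are handled as bounded and measurable on
  [0,1] and arbitrary outside, since a density in \<open>Wp\<close> is constrained only
  there.\<close>

definition bdd01 :: "(real \<Rightarrow> real) \<Rightarrow> bool" where
  "bdd01 g \<longleftrightarrow> set_borel_measurable lborel {0..1} g \<and> (\<exists>C. \<forall>x\<in>{0..1}. \<bar>g x\<bar> \<le> C)"

lemma bdd01_cong: "(\<And>x. x \<in> {0..1} \<Longrightarrow> g x = h x) \<Longrightarrow> bdd01 g \<longleftrightarrow> bdd01 h"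
proof -
  assume eq: "\<And>x. x \<in> {0..1} \<Longrightarrow> g x = h x"
  have "(\<lambda>x. indicator {0..1} x *\<^sub>R g x) = (\<lambda>x. indicator {0..1} x *\<^sub>R h x)"
    by (rule ext) (auto simp: indicator_def eq)
  then show ?thesis using eq by (simp add: bdd01_def set_borel_measurable_def)
qed

lemma bdd01I:
  assumes "g \<in> borel_measurable borel" and "\<And>x. x \<in> {0..1} \<Longrightarrow> \<bar>g x\<bar> \<le> C"
  shows "bdd01 g"
proof -
  have "set_borel_measurable lborel {0..1} g" using assms(1) by (auto simp: set_borel_measurable_def)
  then show ?thesis using assms(2) unfolding bdd01_def by blast
qed

lemma bdd01_const: "bdd01 (\<lambda>x. c)"
  by (rule bdd01I[where C="\<bar>c\<bar>"]) auto

lemma bdd01_add: assumes "bdd01 g" "bdd01 h" shows "bdd01 (\<lambda>x. g x + h x)"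
proof -
  obtain C D where C: "\<forall>x\<in>{0..1}. \<bar>g x\<bar> \<le> C" and D: "\<forall>x\<in>{0..1}. \<bar>h x\<bar> \<le> D"
    using assms by (auto simp: bdd01_def)
  have "(\<lambda>x. indicator {0..1} x *\<^sub>R g x + indicator {0..1} x *\<^sub>R h x) \<in> borel_measurable lborel"
    using assms by (intro borel_measurable_add) (auto simp: bdd01_def set_borel_measurable_def)
  moreover have "\<forall>x\<in>{0..1}. \<bar>g x + h x\<bar> \<le> C + D" using C D by (meson abs_triangle_ineq add_mono order_trans)
  ultimately show ?thesis by (auto simp: bdd01_def set_borel_measurable_def algebra_simps)
qed

lemma bdd01_mult: assumes "bdd01 g" "bdd01 h" shows "bdd01 (\<lambda>x. g x * h x)"
proof -
  obtain C D where C: "\<forall>x\<in>{0..1}. \<bar>g x\<bar> \<le> C" and D: "\<forall>x\<in>{0..1}. \<bar>h x\<bar> \<le> D"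
    using assms by (auto simp: bdd01_def)
  have "(\<lambda>x. (indicator {0..1} x *\<^sub>R g x) * (indicator {0..1} x *\<^sub>R h x)) \<in> borel_measurable lborel"
    using assms by (intro borel_measurable_times) (auto simp: bdd01_def set_borel_measurable_def)
  moreover have "(\<lambda>x. (indicator {0..1} x *\<^sub>R g x) * (indicator {0..1} x *\<^sub>R h x))
      = (\<lambda>x. indicator {0..1} x *\<^sub>R (g x * h x))" by (rule ext) (auto simp: indicator_def)
  moreover have "\<forall>x\<in>{0..1}. \<bar>g x * h x\<bar> \<le> C * D"
  proof
    fix x :: real assume x: "x \<in> {0..1}"
    show "\<bar>g x * h x\<bar> \<le> C * D" unfolding abs_mult
      using C[rule_format, OF x] D[rule_format, OF x] by (intro mult_mono) auto
  qed
  ultimately show ?thesis by (auto simp: bdd01_def set_borel_measurable_def)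
qed

lemma bdd01_cmult: "bdd01 g \<Longrightarrow> bdd01 (\<lambda>x. c * g x)"
  by (rule bdd01_mult[OF bdd01_const])

lemma bdd01_diff: "bdd01 g \<Longrightarrow> bdd01 h \<Longrightarrow> bdd01 (\<lambda>x. g x - h x)"
  using bdd01_add[of g "\<lambda>x. -1 * h x"] bdd01_cmult[of h "-1"] by simp

lemma bdd01_sum: "(\<And>i. i \<in> I \<Longrightarrow> bdd01 (g i)) \<Longrightarrow> bdd01 (\<lambda>x. \<Sum>i\<in>I. g i x)"
  by (induction I rule: infinite_finite_induct) (auto intro: bdd01_add bdd01_const)

lemma bdd01_integrable: assumes "bdd01 g" shows "set_integrable lborel {0..1} g"
proof -
  obtain C where C: "\<forall>x\<in>{0..1}. \<bar>g x\<bar> \<le> C" using assms by (auto simp: bdd01_def)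
  show ?thesis unfolding set_integrable_def
  proof (rule integrableI_bounded_set[where A="{0..1}" and B=C])
    show "(\<lambda>x. indicator {0..1} x *\<^sub>R g x) \<in> borel_measurable lborel"
      using assms by (auto simp: bdd01_def set_borel_measurable_def)
  qed (use C in auto)
qed

lemma bdd01_measurable:
  assumes "bdd01 g" and "\<And>x. x \<notin> {0..1} \<Longrightarrow> g x = 0"
  shows "g \<in> borel_measurable borel"
proof -
  have "(\<lambda>x. indicator {0..1} x *\<^sub>R g x) = g" by (rule ext) (use assms(2) in \<open>auto simp: indicator_def\<close>)
  then show ?thesis using assms(1) by (auto simp: bdd01_def set_borel_measurable_def)
qed

lemma inner01_cong:
  "(\<And>x. x \<in> {0..1} \<Longrightarrow> g x = g' x) \<Longrightarrow> (\<And>x. x \<in> {0..1} \<Longrightarrow> h x = h' x) \<Longrightarrow> inner01 g h = inner01 g' h'"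
  unfolding inner01_def by (rule set_lebesgue_integral_cong) auto

lemma l2sq_cong: "(\<And>x. x \<in> {0..1} \<Longrightarrow> g x = g' x) \<Longrightarrow> l2sq g = l2sq g'"
  unfolding l2sq_def by (rule inner01_cong)

lemma inner01_commute: "inner01 g h = inner01 h g"
  by (simp add: inner01_def mult.commute)

lemma inner01_add_left:
  assumes "bdd01 g" "bdd01 g'" "bdd01 h"
  shows "inner01 (\<lambda>x. g x + g' x) h = inner01 g h + inner01 g' h"
  unfolding inner01_def
  using set_integral_add(2)[OF bdd01_integrable[OF bdd01_mult[OF assms(1,3)]]
      bdd01_integrable[OF bdd01_mult[OF assms(2,3)]]]
  by (simp add: algebra_simps)

lemma inner01_cmult_left: "inner01 (\<lambda>x. c * g x) h = c * inner01 g h"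
  unfolding inner01_def by (simp add: mult.assoc)

lemma inner01_zero_left [simp]: "inner01 (\<lambda>x. 0) h = 0"
  using inner01_cmult_left[of 0 h h] by simp

lemma inner01_sum_left:
  assumes "bdd01 h" "\<And>i. i \<in> I \<Longrightarrow> bdd01 (g i)"
  shows "inner01 (\<lambda>x. \<Sum>i\<in>I. g i x) h = (\<Sum>i\<in>I. inner01 (g i) h)"
  using assms(2)
proof (induction I rule: infinite_finite_induct)
  case (insert i I)
  have "inner01 (\<lambda>x. g i x + (\<Sum>i\<in>I. g i x)) h = inner01 (g i) h + inner01 (\<lambda>x. \<Sum>i\<in>I. g i x) h"
    using insert by (intro inner01_add_left assms(1) bdd01_sum) auto
  then show ?case using insert by simp
qed auto

lemma inner01_lincomb_left:
  assumes "bdd01 h" "\<And>i. i \<in> I \<Longrightarrow> bdd01 (g i)"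
  shows "inner01 (\<lambda>x. \<Sum>i\<in>I. c i * g i x) h = (\<Sum>i\<in>I. c i * inner01 (g i) h)"
proof -
  have "inner01 (\<lambda>x. \<Sum>i\<in>I. c i * g i x) h = (\<Sum>i\<in>I. inner01 (\<lambda>x. c i * g i x) h)"
    using assms by (intro inner01_sum_left) (auto intro: bdd01_cmult)
  then show ?thesis by (simp add: inner01_cmult_left)
qed

lemma inner01_lincomb_right:
  assumes "bdd01 h" "\<And>i. i \<in> I \<Longrightarrow> bdd01 (g i)"
  shows "inner01 h (\<lambda>x. \<Sum>i\<in>I. c i * g i x) = (\<Sum>i\<in>I. c i * inner01 h (g i))"
  using inner01_lincomb_left[OF assms] by (simp add: inner01_commute)

lemma inner01_diff_left:
  assumes "bdd01 g" "bdd01 g'" "bdd01 h"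
  shows "inner01 (\<lambda>x. g x - g' x) h = inner01 g h - inner01 g' h"
  using inner01_add_left[of g "\<lambda>x. -1 * g' x" h] inner01_cmult_left[of "-1" g' h] assms bdd01_cmult[of g' "-1"]
  by simp

lemma inner01_mono:
  assumes "bdd01 g" "bdd01 h" "bdd01 g'" "bdd01 h'" "\<And>x. x \<in> {0..1} \<Longrightarrow> g x * h x \<le> g' x * h' x"
  shows "inner01 g h \<le> inner01 g' h'"
  unfolding inner01_def
  by (rule set_integral_mono) (use assms in \<open>auto intro: bdd01_integrable bdd01_mult\<close>)

lemma l2sq_nonneg: "0 \<le> l2sq g"
  unfolding l2sq_def inner01_def set_lebesgue_integral_def
  by (rule integral_nonneg_AE) (auto simp: indicator_def)

lemma l2sq_mono:
  assumes "bdd01 g" "bdd01 h" "\<And>x. x \<in> {0..1} \<Longrightarrow> \<bar>g x\<bar> \<le> \<bar>h x\<bar>"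
  shows "l2sq g \<le> l2sq h"
  unfolding l2sq_def
proof (rule inner01_mono)
  fix x :: real assume "x \<in> {0..1}"
  then show "g x * g x \<le> h x * h x" using assms(3)[of x] abs_le_square_iff[of "g x" "h x"]
    by (simp only: power2_eq_square)
qed (use assms in auto)

lemma l2sq_const: "l2sq (\<lambda>x. c) = c\<^sup>2"
  unfolding l2sq_def inner01_def by (simp add: set_integral_const power2_eq_square)

lemma l2sq_cmult: "l2sq (\<lambda>x. c * g x) = c\<^sup>2 * l2sq g"
proof -
  have "inner01 (\<lambda>x. c * g x) (\<lambda>x. c * g x) = c * inner01 (\<lambda>x. c * g x) g"
    by (subst inner01_cmult_left) (simp add: inner01_commute)
  then show ?thesis by (simp add: l2sq_def inner01_cmult_left power2_eq_square)
qed

lemma l2sq_add: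
  assumes "bdd01 g" "bdd01 h"
  shows "l2sq (\<lambda>x. g x + h x) = l2sq g + 2 * inner01 g h + l2sq h"
proof -
  have "bdd01 (\<lambda>x. g x + h x)" using assms by (rule bdd01_add)
  then have "l2sq (\<lambda>x. g x + h x) = inner01 g (\<lambda>x. g x + h x) + inner01 h (\<lambda>x. g x + h x)"
    unfolding l2sq_def by (intro inner01_add_left assms)
  also have "\<dots> = inner01 (\<lambda>x. g x + h x) g + inner01 (\<lambda>x. g x + h x) h" by (simp add: inner01_commute)
  also have "\<dots> = l2sq g + 2 * inner01 g h + l2sq h"
    using assms by (simp add: inner01_add_left l2sq_def inner01_commute[of h g])
  finally show ?thesis .
qed

lemma inner01_eq_0:
  assumes "bdd01 g" "bdd01 h" "l2sq g = 0" shows "inner01 g h = 0"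
proof (rule ccontr)
  assume ne: "inner01 g h \<noteq> 0"
  \<comment> \<open>Since \<open>l2sq g = 0\<close>, the squared norm of t g + h is affine in t;
    this t gives it the value -1.\<close>
  define t where "t = - (l2sq h + 1) / (2 * inner01 g h)"
  have "0 \<le> l2sq (\<lambda>x. t * g x + h x)" by (rule l2sq_nonneg)
  also have "\<dots> = t\<^sup>2 * l2sq g + 2 * (t * inner01 g h) + l2sq h"
    using assms by (simp add: l2sq_add bdd01_cmult l2sq_cmult inner01_cmult_left)
  also have "\<dots> = -1" using ne assms(3) by (simp add: t_def field_simps)
  finally show False by simp
qed

section \<open>Piecewise polynomials on a uniform partition\<close>

text \<open>The same closure convention as in \<open>bsp\<close>: with the last cell closed at 1 the
  cells partition [0,1], so a B-spline is a polynomial on every cell without exceptional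
  points.\<close>

definition cell :: "nat \<Rightarrow> nat \<Rightarrow> real set" where
  "cell N c = {real c / real N..<real (Suc c) / real N} \<union> (if Suc c = N then {1} else {})"

definition cidx :: "nat \<Rightarrow> real \<Rightarrow> nat" where
  "cidx N x = min (N - 1) (nat \<lfloor>real N * x\<rfloor>)"

lemma cidx_less: "0 < N \<Longrightarrow> cidx N x < N"
  by (simp add: cidx_def)

lemma mem_cell_iff:
  assumes "0 < N"
  shows "(c < N \<and> x \<in> cell N c) \<longleftrightarrow> (x \<in> {0..1} \<and> c = cidx N x)"
proof
  assume c: "c < N \<and> x \<in> cell N c"
  show "x \<in> {0..1} \<and> c = cidx N x"
  proof (cases "x = 1")
    case True
    have "c = N - 1"
      using c True assms by (auto simp: cell_def field_simps split: if_splits)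
    then show ?thesis using True by (simp add: cidx_def)
  next
    case False
    then have b: "real c / real N \<le> x" "x < real (Suc c) / real N" using c by (auto simp: cell_def split: if_splits)
    have "real (Suc c) / real N \<le> 1" using c assms by simp
    moreover have "0 \<le> real c / real N" by simp
    ultimately have x: "x \<in> {0..1}" using b by (metis atLeastAtMost_iff less_eq_real_def order_trans)
    have "\<lfloor>real N * x\<rfloor> = int c" using b assms by (intro floor_unique) (auto simp: field_simps)
    then show ?thesis using x c by (auto simp: cidx_def)
  qed
next
  assume x: "x \<in> {0..1} \<and> c = cidx N x"
  then have c: "c < N" using assms by (simp add: cidx_less)
  show "c < N \<and> x \<in> cell N c"
  proof (cases "x = 1")
    case True
    then have "c = N - 1" using x by (simp add: cidx_def)
    then show ?thesis using True c by (simp add: cell_def)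
  next
    case False
    have nn: "0 \<le> \<lfloor>real N * x\<rfloor>" using x by simp
    have "real N * x < real N" using False x assms by simp
    then have "nat \<lfloor>real N * x\<rfloor> < N" using nn by linarith
    then have c': "c = nat \<lfloor>real N * x\<rfloor>" using x by (simp add: cidx_def)
    have "real c \<le> real N * x" "real N * x < real (Suc c)" unfolding c' using nn by linarith+
    then show ?thesis using c assms by (auto simp: cell_def field_simps)
  qed
qed

lemma cell_cidx: "0 < N \<Longrightarrow> x \<in> {0..1} \<Longrightarrow> x \<in> cell N (cidx N x)"
  using mem_cell_iff[of N "cidx N x" x] by simp

lemma cell_subset: "c < N \<Longrightarrow> cell N c \<subseteq> {0..1}"
  using mem_cell_iff[of N c] by auto

definition ppoly :: "nat \<Rightarrow> nat \<Rightarrow> (real \<Rightarrow> real) \<Rightarrow> bool" where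
  "ppoly d N g \<longleftrightarrow> (\<forall>c<N. \<exists>q. degree q \<le> d \<and> (\<forall>x\<in>cell N c. g x = poly q x))"

lemma ppolyE:
  assumes "ppoly d N g" "c < N"
  obtains q where "degree q \<le> d" "\<forall>x\<in>cell N c. g x = poly q x"
  using assms unfolding ppoly_def by blast

lemma ppoly_add: assumes "ppoly d N g" "ppoly d N h" shows "ppoly d N (\<lambda>x. g x + h x)"
  unfolding ppoly_def
proof (intro allI impI)
  fix c assume c: "c < N"
  obtain q where "degree q \<le> d" "\<forall>x\<in>cell N c. g x = poly q x" using ppolyE[OF assms(1) c] .
  moreover obtain r where "degree r \<le> d" "\<forall>x\<in>cell N c. h x = poly r x" using ppolyE[OF assms(2) c] .
  ultimately show "\<exists>q. degree q \<le> d \<and> (\<forall>x\<in>cell N c. g x + h x = poly q x)"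
    by (intro exI[of _ "q + r"]) (auto intro: degree_add_le)
qed

lemma ppoly_cmult: assumes "ppoly d N g" shows "ppoly d N (\<lambda>x. a * g x)"
  unfolding ppoly_def
proof (intro allI impI)
  fix c assume c: "c < N"
  obtain q where "degree q \<le> d" "\<forall>x\<in>cell N c. g x = poly q x" using ppolyE[OF assms c] .
  then show "\<exists>q. degree q \<le> d \<and> (\<forall>x\<in>cell N c. a * g x = poly q x)"
    by (intro exI[of _ "smult a q"]) (auto intro: order_trans[OF degree_smult_le])
qed

lemma ppoly_zero: "ppoly d N (\<lambda>x. 0)"
  unfolding ppoly_def by (intro allI impI exI[of _ 0]) simp

lemma ppoly_sum: "(\<And>i. i \<in> I \<Longrightarrow> ppoly d N (g i)) \<Longrightarrow> ppoly d N (\<lambda>x. \<Sum>i\<in>I. g i x)"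
  by (induction I rule: infinite_finite_induct) (auto intro: ppoly_add ppoly_zero)

lemma ppoly_diff: "ppoly d N g \<Longrightarrow> ppoly d N h \<Longrightarrow> ppoly d N (\<lambda>x. g x - h x)"
  using ppoly_add[of d N g "\<lambda>x. -1 * h x"] ppoly_cmult[of d N h "-1"] by simp

text \<open>A uniform partition is nested in its refinement by an integer factor m, and cell indices
  then divide. Besides refining piecewise polynomials, this yields in the end that all coarser
  norming points are determined by the finest cell of x.\<close>

lemma cidx_div:
  assumes "0 < m" "0 < N" "x \<in> {0..1}" shows "cidx N x = cidx (m * N) x div m"
proof -
  have 1: "x \<in> cell (m * N) (cidx (m * N) x)" "cidx (m * N) x < m * N"
    using assms by (auto intro!: cell_cidx cidx_less)
  define e where "e = cidx (m * N) x"
  define c where "c = e div m"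
  have e: "e < m * N" using 1 e_def by simp
  have c: "c < N" using e by (simp add: c_def less_mult_imp_div_less mult.commute)
  have ce1: "c * m \<le> e" by (simp add: c_def)
  have "e mod m < m" using assms(1) by simp
  then have "e < c * m + m" using div_mult_mod_eq[of e m] unfolding c_def by linarith
  then have ce: "c * m \<le> e" "Suc e \<le> Suc c * m" using ce1 by auto
  have mN: "real (m * N) > 0" using assms by simp
  have "x \<in> cell N c"
  proof (cases "x = 1")
    case True
    then have "e = m * N - 1" unfolding e_def by (simp add: cidx_def flip: of_nat_mult)
    then have "Suc e = m * N" using assms e by simp
    then have "N \<le> Suc c" using ce(2) assms(1) by (metis mult.commute mult_le_cancel2)
    then show ?thesis using c True by (auto simp: cell_def)
  next
    case False
    then have b: "real e / real (m * N) \<le> x" "x < real (Suc e) / real (m * N)"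
      using 1 by (auto simp: cell_def e_def split: if_splits)
    have "real c / real N = real (c * m) / real (m * N)" using assms by simp
    also have "\<dots> \<le> real e / real (m * N)" using ce(1) mN by (intro divide_right_mono) (auto simp del: of_nat_mult)
    finally have 2: "real c / real N \<le> x" using b by simp
    have "real (Suc e) / real (m * N) \<le> real (Suc c * m) / real (m * N)"
      using ce(2) mN by (intro divide_right_mono) (auto simp del: of_nat_mult of_nat_Suc)
    also have "\<dots> = real (Suc c) / real N" unfolding of_nat_mult using assms by (simp del: of_nat_Suc)
    finally show ?thesis using 2 b by (simp add: cell_def)
  qed
  then show ?thesis using mem_cell_iff[of N c x] c assms by (simp add: c_def e_def)
qed

lemma ppoly_refine: assumes "ppoly d N g" "0 < m" "0 < N" shows "ppoly d (m * N) g"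
  unfolding ppoly_def
proof (intro allI impI)
  fix e assume e: "e < m * N"
  have "e div m < N" using e by (simp add: less_mult_imp_div_less mult.commute)
  from ppolyE[OF assms(1) this] obtain q
    where q: "degree q \<le> d" "\<forall>x\<in>cell N (e div m). g x = poly q x" .
  have "g x = poly q x" if "x \<in> cell (m * N) e" for x
  proof -
    have "x \<in> {0..1}" "e = cidx (m * N) x" using mem_cell_iff[of "m * N" e x] that e assms by auto
    then have "x \<in> cell N (e div m)" using cidx_div[of m N x] cell_cidx[of N x] assms by simp
    then show ?thesis using q by simp
  qed
  then show "\<exists>q. degree q \<le> d \<and> (\<forall>x\<in>cell (m * N) e. g x = poly q x)" using q by auto
qed

lemma ppoly_refine_pow2: assumes "ppoly d (2 ^ i) g" "i \<le> j" shows "ppoly d (2 ^ j) g"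
  using ppoly_refine[OF assms(1), of "2 ^ (j - i)"] assms(2) by (simp flip: power_add)

lemma ppoly_bdd01: assumes "ppoly d N g" "0 < N" shows "bdd01 g"
proof -
  define Q where "Q c = (SOME q. \<forall>x\<in>cell N c. g x = poly q x)" for c
  have Q: "g x = poly (Q c) x" if "c < N" "x \<in> cell N c" for c x
  proof -
    have "\<exists>q. \<forall>x\<in>cell N c. g x = poly q x" using assms(1) that(1) unfolding ppoly_def by blast
    from someI_ex[OF this] show ?thesis using that(2) by (simp add: Q_def)
  qed
  have eq: "g x = (\<Sum>c<N. indicator (cell N c) x * poly (Q c) x)" if "x \<in> {0..1}" for x
  proof -
    have "(\<Sum>c<N. indicator (cell N c) x * poly (Q c) x) = (\<Sum>c<N. if c = cidx N x then g x else 0)"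
    proof (rule sum.cong[OF refl])
      fix c assume "c \<in> {..<N}"
      then have "c < N" by simp
      moreover have "x \<in> cell N c \<longleftrightarrow> c = cidx N x"
        using mem_cell_iff[OF assms(2), of c x] that \<open>c < N\<close> by blast
      ultimately show "indicator (cell N c) x * poly (Q c) x = (if c = cidx N x then g x else 0)"
        using Q[of c x] by (cases "c = cidx N x") auto
    qed
    then show ?thesis using cidx_less[OF assms(2)] by simp
  qed
  have "bdd01 (\<lambda>x. indicator (cell N c) x * poly (Q c) x)" if c: "c < N" for c
  proof -
    have "compact (poly (Q c) ` {0..1})" by (intro compact_continuous_image continuous_intros) auto
    then obtain C where C: "\<forall>x\<in>{0..1}. \<bar>poly (Q c) x\<bar> \<le> C"
      by (metis (no_types, lifting) bounded_real compact_imp_bounded imageI)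
    have "0 \<le> C" using C[rule_format, of 0] by simp
    show ?thesis
    proof (rule bdd01I[where C=C])
      have "poly (Q c) \<in> borel_measurable borel" by (intro borel_measurable_continuous_onI continuous_intros)
      moreover have "cell N c \<in> sets borel" by (simp add: cell_def)
      ultimately show "(\<lambda>x. indicator (cell N c) x * poly (Q c) x) \<in> borel_measurable borel" by measurable
    qed (use C \<open>0 \<le> C\<close> in \<open>auto simp: indicator_def\<close>)
  qed
  then have "bdd01 (\<lambda>x. \<Sum>c<N. indicator (cell N c) x * poly (Q c) x)" by (intro bdd01_sum) auto
  then show ?thesis using bdd01_cong[OF eq] by simp
qed

section \<open>One-sided derivatives of piecewise smooth functions\<close>

lemma Lim_right_quotient:
  fixes g \<phi> :: "real \<Rightarrow> real"
  assumes "a < 1" "0 \<le> a" "(\<phi> has_real_derivative D) (at a within {0..1})"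
    and "a < b" "\<And>y. a \<le> y \<Longrightarrow> y < b \<Longrightarrow> g y = \<phi> y"
  shows "Lim (at_right 0) (\<lambda>h. (g (a + h) - g a) / h) = D"
proof (rule tendsto_Lim)
  have "(\<phi> has_real_derivative D) (at a within {a..1})"
    by (rule has_field_derivative_subset[OF assms(3)]) (use assms in auto)
  then have "((\<lambda>y. (\<phi> y - \<phi> a) / (y - a)) \<longlongrightarrow> D) (at_right a)"
    using at_within_Icc_at_right[OF assms(1)] by (simp add: has_field_derivative_iff)
  then have "((\<lambda>h. (\<phi> (h + a) - \<phi> a) / h) \<longlongrightarrow> D) (at_right 0)"
    by (simp add: filterlim_at_right_to_0[of _ _ a])
  moreover have "\<forall>\<^sub>F h in at_right 0. (\<phi> (h + a) - \<phi> a) / h = (g (a + h) - g a) / h"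
    using eventually_at_right_real[of 0 "b - a"] assms(4)
    by (auto elim!: eventually_mono simp: assms(5) add.commute)
  ultimately show "((\<lambda>h. (g (a + h) - g a) / h) \<longlongrightarrow> D) (at_right 0)"
    by (rule Lim_transform_eventually)
qed simp

lemma Lim_left_quotient:
  fixes g \<phi> :: "real \<Rightarrow> real"
  assumes "(\<phi> has_real_derivative D) (at 1 within {0..1})"
    and "b < 1" "\<And>y. b \<le> y \<Longrightarrow> y \<le> 1 \<Longrightarrow> g y = \<phi> y"
  shows "Lim (at_left 0) (\<lambda>h. (g (1 + h) - g 1) / h) = D"
proof (rule tendsto_Lim)
  have "((\<lambda>y. (\<phi> y - \<phi> 1) / (y - 1)) \<longlongrightarrow> D) (at_left 1)"
    using assms(1) at_within_Icc_at_left[of "0::real" 1] by (simp add: has_field_derivative_iff)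
  moreover have "filterlim (\<lambda>h::real. h + 1) (at_left 1) (at_left 0)"
    unfolding filterlim_at
    by (auto intro!: tendsto_eq_intros simp: eventually_at_left_field intro: exI[of _ "-1"])
  ultimately have "((\<lambda>h. (\<phi> (h + 1) - \<phi> 1) / (h + 1 - 1)) \<longlongrightarrow> D) (at_left 0)"
    by (rule filterlim_compose)
  then have "((\<lambda>h. (\<phi> (h + 1) - \<phi> 1) / h) \<longlongrightarrow> D) (at_left 0)" by simp
  moreover have "\<forall>\<^sub>F h in at_left 0. (\<phi> (h + 1) - \<phi> 1) / h = (g (1 + h) - g 1) / h"
    using eventually_at_left_real[of "b - 1" 0] assms(2)
    by (auto elim!: eventually_mono simp: assms(3) add.commute)
  ultimately show "((\<lambda>h. (g (1 + h) - g 1) / h) \<longlongrightarrow> D) (at_left 0)"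
    by (rule Lim_transform_eventually)
qed simp

text \<open>An abstract tower of successive derivatives, so that one lemma serves both a pure
  polynomial (zero tower) and a polynomial minus a density.\<close>

definition derivs01 :: "nat \<Rightarrow> (nat \<Rightarrow> real \<Rightarrow> real) \<Rightarrow> bool" where
  "derivs01 m F \<longleftrightarrow> (\<forall>j<m. \<forall>x\<in>{0..1}. (F j has_real_derivative F (Suc j) x) (at x within {0..1}))"

text \<open>The induction carries the identity on the whole cell because the next one-sided quotient
  must stay inside it: a right quotient does so in a half-open cell, and 1 occurs only in the last
  cell, where the left quotient is taken.\<close>

lemma sderiv_cell:
  assumes N: "0 < N" and c: "c < N" and F: "derivs01 m F"
    and eq: "\<And>x. x \<in> cell N c \<Longrightarrow> g x = poly q x - F 0 x"
    and "s \<le> m" "x \<in> cell N c"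
  shows "sderiv s g x = poly ((pderiv ^^ s) q) x - F s x"
  using assms(5,6)
proof (induction s arbitrary: x)
  case 0
  then show ?case by (simp add: eq)
next
  case (Suc s)
  define \<phi> where "\<phi> y = poly ((pderiv ^^ s) q) y - F s y" for y
  have x01: "x \<in> {0..1}" using Suc.prems cell_subset[OF c] by auto
  have der: "(\<phi> has_real_derivative (poly ((pderiv ^^ Suc s) q) x - F (Suc s) x)) (at x within {0..1})"
    unfolding \<phi>_def
    by (intro DERIV_diff) (use F Suc.prems x01 in \<open>auto simp: derivs01_def intro: has_field_derivative_at_within\<close>)
  have IH: "sderiv s g y = \<phi> y" if "y \<in> cell N c" for y
    using Suc.IH[of y] Suc.prems that by (simp add: \<phi>_def)
  show ?case
  proof (cases "x = 1")
    case True
    then have SN: "Suc c = N" using Suc.prems c by (auto simp: cell_def field_simps split: if_splits)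
    have "Lim (at_left 0) (\<lambda>h. (sderiv s g (1 + h) - sderiv s g 1) / h) = poly ((pderiv ^^ Suc s) q) x - F (Suc s) x"
    proof (rule Lim_left_quotient[where \<phi>=\<phi> and b="real c / real N"])
      show "real c / real N < 1" using c N by simp
      fix y assume y: "real c / real N \<le> y" "y \<le> 1"
      have "y \<in> cell N c" using y SN N by (cases "y = 1") (auto simp: cell_def)
      then show "sderiv s g y = \<phi> y" by (rule IH)
    qed (use der True in simp)
    then show ?thesis using True by simp
  next
    case False
    then have b: "real c / real N \<le> x" "x < real (Suc c) / real N" using Suc.prems by (auto simp: cell_def split: if_splits)
    have "Lim (at_right 0) (\<lambda>h. (sderiv s g (x + h) - sderiv s g x) / h) = poly ((pderiv ^^ Suc s) q) x - F (Suc s) x"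
    proof (rule Lim_right_quotient[where \<phi>=\<phi> and b="real (Suc c) / real N"])
      fix y assume y: "x \<le> y" "y < real (Suc c) / real N"
      have "y \<in> cell N c" using y b by (auto simp: cell_def)
      then show "sderiv s g y = \<phi> y" by (rule IH)
    qed (use der b x01 False in auto)
    then show ?thesis using False x01 by simp
  qed
qed

lemma derivs01_zero: "derivs01 m (\<lambda>j x. 0)"
  by (simp add: derivs01_def)

lemma Cp01_derivs01: "Cp01 p f \<Longrightarrow> derivs01 p (\<lambda>j. sderiv j f)"
  by (auto simp: Cp01_def derivs01_def)

lemma sderiv_cell_poly:
  assumes "0 < N" "c < N" "\<And>x. x \<in> cell N c \<Longrightarrow> g x = poly q x" "x \<in> cell N c"
  shows "sderiv s g x = poly ((pderiv ^^ s) q) x"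
  using sderiv_cell[OF assms(1,2) derivs01_zero, of g q s s x] assms(3,4) by simp

text \<open>\<open>Lim\<close> need not be additive, so \<open>sderiv\<close> is split only where
  all pieces are smooth on a common cell. By this rule the error is separated into deviation and
  bias, and the difference of two levels into two errors.\<close>

lemma sderiv_ppoly_diff_fun:
  assumes g: "ppoly d N g" and h: "ppoly d N h" and N: "0 < N" and x: "x \<in> {0..1}"
    and f: "Cp01 p f" and s: "s \<le> p"
  shows "sderiv s (\<lambda>x. g x + h x - f x) x = sderiv s g x + sderiv s (\<lambda>x. h x - f x) x"
proof -
  define c where "c = cidx N x"
  have c: "c < N" "x \<in> cell N c" using cidx_less cell_cidx N x by (auto simp: c_def)
  obtain q where q: "\<forall>x\<in>cell N c. g x = poly q x" using ppolyE[OF g c(1)] by blast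
  obtain r where r: "\<forall>x\<in>cell N c. h x = poly r x" using ppolyE[OF h c(1)] by blast
  note F = Cp01_derivs01[OF f]
  have "sderiv s (\<lambda>x. g x + h x - f x) x = poly ((pderiv ^^ s) (q + r)) x - sderiv s f x"
    by (rule sderiv_cell[OF N c(1) F _ s c(2)]) (use q r in auto)
  moreover have "sderiv s (\<lambda>x. h x - f x) x = poly ((pderiv ^^ s) r) x - sderiv s f x"
    by (rule sderiv_cell[OF N c(1) F _ s c(2)]) (use q r in auto)
  moreover have "sderiv s g x = poly ((pderiv ^^ s) q) x"
    by (rule sderiv_cell_poly[OF N c(1) _ c(2)]) (use q r in auto)
  ultimately show ?thesis by (simp add: higher_pderiv_add)
qed

section \<open>Norming points\<close>

text \<open>Only reproduction is recorded: it makes every derivative of q a linear expression in d +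
  1 values of q.\<close>

lemma lagrange_basis:
  fixes y :: "nat \<Rightarrow> real"
  assumes "inj_on y {..d}"
  shows "\<exists>L. \<forall>q. degree q \<le> d \<longrightarrow> q = (\<Sum>i\<le>d. smult (poly q (y i)) (L i))"
proof -
  define L where "L i = smult (1 / (\<Prod>j\<in>{..d}-{i}. y i - y j)) (\<Prod>j\<in>{..d}-{i}. [:- y j, 1:])" for i
  have ell: "poly (L i) (y k) = (if k = i then 1 else 0)" if "i \<le> d" "k \<le> d" for i k
  proof (cases "k = i")
    case True
    have "(\<Prod>j\<in>{..d}-{i}. y i - y j) \<noteq> 0"
      using assms that by (auto simp: inj_on_def)
    then show ?thesis using True by (simp add: L_def poly_prod)
  next
    case False
    then have "(\<Prod>j\<in>{..d}-{i}. y k - y j) = 0" using that by (intro prod_zero) auto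
    then show ?thesis using False by (simp add: L_def poly_prod)
  qed
  have deg: "degree (L i) \<le> d" if "i \<le> d" for i
  proof -
    have "degree (\<Prod>j\<in>{..d}-{i}. [:- y j, 1:]) \<le> (\<Sum>j\<in>{..d}-{i}. degree [:- y j, 1:])"
      by (rule degree_prod_sum_le[unfolded o_def]) auto
    also have "\<dots> = d" using that by simp
    finally show ?thesis unfolding L_def using degree_smult_le order_trans by blast
  qed
  have "q = (\<Sum>i\<le>d. smult (poly q (y i)) (L i))" if q: "degree q \<le> d" for q
  proof (rule poly_eqI_degree[where A="y ` {..d}"])
    fix x assume "x \<in> y ` {..d}"
    then obtain k where k: "k \<le> d" "x = y k" by auto
    have "poly (\<Sum>i\<le>d. smult (poly q (y i)) (L i)) x = (\<Sum>i\<le>d. if i = k then poly q (y k) else 0)"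
      unfolding poly_sum by (rule sum.cong) (auto simp: k ell)
    then show "poly q x = poly (\<Sum>i\<le>d. smult (poly q (y i)) (L i)) x" using k by simp
  next
    have "card (y ` {..d}) = Suc d" using card_image[OF assms] by simp
    moreover have "degree (\<Sum>i\<le>d. smult (poly q (y i)) (L i)) \<le> d"
      using deg by (intro degree_sum_le) (auto intro: order_trans[OF degree_smult_le])
    ultimately show "degree (\<Sum>i\<le>d. smult (poly q (y i)) (L i)) < card (y ` {..d})" by simp
    show "degree q < card (y ` {..d})" using q \<open>card (y ` {..d}) = Suc d\<close> by simp
  qed
  then show ?thesis by blast
qed

lemma poly_deriv_bound_unit:
  "\<exists>C\<ge>0. \<forall>q s x. degree q \<le> d \<longrightarrow> s \<le> S \<longrightarrow> x \<in> {0..1} \<longrightarrow>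
     \<bar>poly ((pderiv ^^ s) q) x\<bar> \<le> C * (\<Sum>i\<le>d. \<bar>poly q (real i / (real d + 1))\<bar>)"
proof -
  define y where "y i = real i / (real d + 1)" for i
  have "inj_on y {..d}" by (auto simp: inj_on_def y_def)
  from lagrange_basis[OF this] obtain L
    where l: "\<And>q. degree q \<le> d \<Longrightarrow> q = (\<Sum>i\<le>d. smult (poly q (y i)) (L i))" by blast
  have *: "\<exists>B. \<forall>x\<in>{0..1}. \<bar>poly r x\<bar> \<le> B" for r :: "real poly"
  proof -
    have "compact (poly r ` {0..1})" by (intro compact_continuous_image continuous_intros) auto
    then show ?thesis by (metis (no_types, lifting) bounded_real compact_imp_bounded imageI)
  qed
  define B :: "real poly \<Rightarrow> real" where "B r = (SOME b. \<forall>x\<in>{0..1}. \<bar>poly r x\<bar> \<le> b)" for r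
  have B: "\<bar>poly r x\<bar> \<le> B r" if "x \<in> {0..1}" for r x
    using someI_ex[OF *[of r]] that by (simp add: B_def)
  have B0: "0 \<le> B r" for r using B[of 0 r] by simp
  define C where "C = (\<Sum>s\<le>S. \<Sum>i\<le>d. B ((pderiv ^^ s) (L i)))"
  have C0: "0 \<le> C" unfolding C_def by (intro sum_nonneg B0)
  show ?thesis
  proof (intro exI conjI allI impI)
    show "0 \<le> C" by (rule C0)
    fix q :: "real poly" and s :: nat and x :: real assume q: "degree q \<le> d" and s: "s \<le> S" and x: "x \<in> {0..1}"
    have "(pderiv ^^ s) q = (\<Sum>i\<le>d. smult (poly q (y i)) ((pderiv ^^ s) (L i)))"
      by (subst l[OF q]) (simp add: higher_pderiv_sum higher_pderiv_smult)
    then have "\<bar>poly ((pderiv ^^ s) q) x\<bar> = \<bar>\<Sum>i\<le>d. poly q (y i) * poly ((pderiv ^^ s) (L i)) x\<bar>"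
      by (simp add: poly_sum)
    also have "\<dots> \<le> (\<Sum>i\<le>d. \<bar>poly q (y i) * poly ((pderiv ^^ s) (L i)) x\<bar>)" by (rule sum_abs)
    also have "\<dots> \<le> (\<Sum>i\<le>d. C * \<bar>poly q (y i)\<bar>)"
    proof (rule sum_mono)
      fix i assume i: "i \<in> {..d}"
      have "\<bar>poly ((pderiv ^^ s) (L i)) x\<bar> \<le> B ((pderiv ^^ s) (L i))" by (rule B[OF x])
      also have "\<dots> \<le> (\<Sum>i\<le>d. B ((pderiv ^^ s) (L i)))" using i by (intro member_le_sum B0) auto
      also have "\<dots> \<le> C" unfolding C_def using s by (intro member_le_sum[of s "{..S}"] sum_nonneg B0) auto
      finally show "\<bar>poly q (y i) * poly ((pderiv ^^ s) (L i)) x\<bar> \<le> C * \<bar>poly q (y i)\<bar>"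
        unfolding abs_mult by (subst mult.commute) (rule mult_right_mono, auto)
    qed
    finally show "\<bar>poly ((pderiv ^^ s) q) x\<bar> \<le> C * (\<Sum>i\<le>d. \<bar>poly q (real i / (real d + 1))\<bar>)"
      by (simp add: y_def sum_distrib_left)
  qed
qed

text \<open>The step is 1/(d+1) and not 1/d: the last point then stays strictly left of the right
  end, so all points lie in the half-open cell where the polynomial representation holds.\<close>

definition npt :: "nat \<Rightarrow> nat \<Rightarrow> nat \<Rightarrow> nat \<Rightarrow> real" where
  "npt d N c i = (real c + real i / (real d + 1)) / real N"

lemma npt_cell: "c < N \<Longrightarrow> i \<le> d \<Longrightarrow> npt d N c i \<in> cell N c"
proof -
  assume a: "c < N" "i \<le> d"
  have "real i / (real d + 1) < 1" "0 \<le> real i / (real d + 1)" using a by (auto simp: field_simps)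
  then show ?thesis using a by (auto simp: npt_def cell_def intro!: divide_right_mono divide_strict_right_mono)
qed

lemma npt_01: "c < N \<Longrightarrow> i \<le> d \<Longrightarrow> npt d N c i \<in> {0..1}"
  using npt_cell cell_subset by blast

lemma higher_pderiv_affine:
  "(pderiv ^^ s) (pcompose q [:a, b:]) = smult (b ^ s) (pcompose ((pderiv ^^ s) q) [:a, b:])"
proof (induction s)
  case (Suc s)
  have "pderiv [:a, b:] = [:b:]" by (simp add: pderiv_pCons)
  then show ?case using Suc
    by (simp add: pderiv_smult pderiv_pcompose mult.commute smult_smult)
qed simp

text \<open>Norm equivalence on the finite-dimensional space of polynomials, transported to a cell
  of length 1/N by an affine substitution; each derivative costs a factor N.\<close>

lemma poly_cell_bound:
  "\<exists>C\<ge>0. \<forall>q s N c x. degree q \<le> d \<longrightarrow> s \<le> S \<longrightarrow> 0 < N \<longrightarrow> c < N \<longrightarrow> x \<in> {real c / real N..real (Suc c) / real N} \<longrightarrow>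
     \<bar>poly ((pderiv ^^ s) q) x\<bar> \<le> C * real N ^ s * (\<Sum>i\<le>d. \<bar>poly q (npt d N c i)\<bar>)"
proof -
  obtain C where C0: "0 \<le> C" and C: "\<And>q s x. degree q \<le> d \<Longrightarrow> s \<le> S \<Longrightarrow> x \<in> {0..1} \<Longrightarrow>
     \<bar>poly ((pderiv ^^ s) q) x\<bar> \<le> C * (\<Sum>i\<le>d. \<bar>poly q (real i / (real d + 1))\<bar>)"
    using poly_deriv_bound_unit[of d S] by blast
  show ?thesis
  proof (intro exI conjI allI impI)
    show "0 \<le> C" by (rule C0)
    fix q :: "real poly" and s N c :: nat and x :: real
    assume q: "degree q \<le> d" and s: "s \<le> S" and N: "0 < N" and c: "c < N"
      and x: "x \<in> {real c / real N..real (Suc c) / real N}"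
    define r where "r = pcompose q [:real c / real N, 1 / real N:]"
    define t where "t = real N * x - real c"
    have t: "t \<in> {0..1}" using x N by (auto simp: t_def field_simps)
    have "degree r \<le> degree q * degree [:real c / real N, 1 / real N:]" unfolding r_def by (rule degree_pcompose_le)
    also have "\<dots> \<le> d * 1" by (rule mult_le_mono) (use q in auto)
    finally have r: "degree r \<le> d" by simp
    have e: "poly [:real c / real N, 1 / real N:] t = x" using N by (simp add: t_def field_simps)
    have "poly ((pderiv ^^ s) r) t = (1 / real N) ^ s * poly ((pderiv ^^ s) q) x"
      by (simp only: r_def higher_pderiv_affine poly_smult poly_pcompose e)
    then have "poly ((pderiv ^^ s) q) x = real N ^ s * poly ((pderiv ^^ s) r) t"
      using N by (simp add: power_one_over field_simps)
    moreover have "poly r (real i / (real d + 1)) = poly q (npt d N c i)" for i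
      using N by (simp add: r_def poly_pcompose npt_def add_divide_distrib)
    ultimately show "\<bar>poly ((pderiv ^^ s) q) x\<bar> \<le> C * real N ^ s * (\<Sum>i\<le>d. \<bar>poly q (npt d N c i)\<bar>)"
      using mult_left_mono[OF C[OF r s t], of "real N ^ s"] by (simp add: abs_mult mult_ac)
  qed
qed

lemma cell_Icc: "0 < N \<Longrightarrow> c < N \<Longrightarrow> x \<in> cell N c \<Longrightarrow> x \<in> {real c / real N..real (Suc c) / real N}"
  by (auto simp: cell_def split: if_splits simp del: of_nat_Suc)

lemma sderiv_ppoly_bound:
  "\<exists>C\<ge>0. \<forall>g s N x. ppoly d N g \<longrightarrow> s \<le> S \<longrightarrow> 0 < N \<longrightarrow> x \<in> {0..1} \<longrightarrow>
     \<bar>sderiv s g x\<bar> \<le> C * real N ^ s * (\<Sum>i\<le>d. \<bar>g (npt d N (cidx N x) i)\<bar>)"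
proof -
  obtain C where C0: "0 \<le> C" and C: "\<And>q s N c x. degree q \<le> d \<Longrightarrow> s \<le> S \<Longrightarrow> 0 < N \<Longrightarrow> c < N \<Longrightarrow>
     x \<in> {real c / real N..real (Suc c) / real N} \<Longrightarrow>
     \<bar>poly ((pderiv ^^ s) q) x\<bar> \<le> C * real N ^ s * (\<Sum>i\<le>d. \<bar>poly q (npt d N c i)\<bar>)"
    using poly_cell_bound[of d S] by blast
  show ?thesis
  proof (intro exI conjI allI impI)
    show "0 \<le> C" by (rule C0)
    fix g s N and x :: real assume g: "ppoly d N g" and s: "s \<le> S" and N: "0 < N" and x: "x \<in> {0..1}"
    define c where "c = cidx N x"
    have c: "c < N" "x \<in> cell N c" using cidx_less cell_cidx N x by (auto simp: c_def)
    obtain q where q: "degree q \<le> d" "\<forall>x\<in>cell N c. g x = poly q x" using ppolyE[OF g c(1)] by blast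
    have "sderiv s g x = poly ((pderiv ^^ s) q) x"
      by (rule sderiv_cell_poly[OF N c(1) _ c(2)]) (use q in auto)
    moreover have "g (npt d N c i) = poly q (npt d N c i)" if "i \<le> d" for i
      using q npt_cell[OF c(1) that] by auto
    ultimately show "\<bar>sderiv s g x\<bar> \<le> C * real N ^ s * (\<Sum>i\<le>d. \<bar>g (npt d N (cidx N x) i)\<bar>)"
      using C[OF q(1) s N c(1) cell_Icc[OF N c]] by (simp flip: c_def)
  qed
qed

section \<open>B-splines\<close>

lemma knot_mono: "i \<le> k \<Longrightarrow> knot d j i \<le> knot d j k"
  unfolding knot_def by (intro max.mono min.mono divide_right_mono) auto

lemma knot_ge0: "0 \<le> knot d j i" and knot_le1: "knot d j i \<le> 1"
  by (auto simp: knot_def)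

lemma knot_eq0: "i \<le> d + 1 \<Longrightarrow> knot d j i = 0"
proof -
  assume "i \<le> d + 1"
  then have "real i \<le> real (d + 1)" by (rule of_nat_mono)
  then have "(real i - real d - 1) / 2 ^ j \<le> 0" by (simp add: divide_le_0_iff)
  then show ?thesis by (simp add: knot_def)
qed

lemma knot_eq1: "2 ^ j + d + 1 \<le> i \<Longrightarrow> knot d j i = 1"
proof -
  assume "2 ^ j + d + 1 \<le> i"
  then have "real (2 ^ j + d + 1) \<le> real i" by (rule of_nat_mono)
  then have "1 \<le> (real i - real d - 1) / 2 ^ j" by (simp add: field_simps)
  then show ?thesis by (simp add: knot_def)
qed

lemma knot_mid: "c \<le> 2 ^ j \<Longrightarrow> knot d j (d + 1 + c) = real c / real (2 ^ j)"
proof -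
  assume "c \<le> 2 ^ j"
  then have "real c \<le> real (2 ^ j)" by (rule of_nat_mono)
  then have "real c / real (2 ^ j) \<le> 1" by simp
  then show ?thesis by (simp add: knot_def)
qed

lemma knot_diff: "knot d j (k + r) - knot d j k \<le> real r / 2 ^ j"
proof -
  have "(real (k + r) - real d - 1) / 2 ^ j = (real k - real d - 1) / 2 ^ j + real r / 2 ^ j"
    by (simp add: add_divide_distrib diff_divide_distrib)
  moreover have "max 0 (min 1 (t + s)) - max 0 (min 1 t) \<le> s" if "0 \<le> s" for s t :: real
    using that by linarith
  ultimately show ?thesis unfolding knot_def by simp
qed

text \<open>The last conjunct is what the recursion needs: coincident boundary knots make some
  denominators zero, but a nonzero B-spline has a nondegenerate knot span, so where a summand
  matters its denominator is positive.\<close>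

lemma bsp_support:
  assumes "bsp d j r i x \<noteq> 0"
  shows "knot d j i \<le> x \<and> (x < knot d j (i + r + 1) \<or> x = 1 \<and> knot d j (i + r + 1) = 1)
    \<and> knot d j i < knot d j (i + r + 1)"
  using assms
proof (induction r arbitrary: i)
  case 0
  then show ?case using knot_le1[of d j i] by (auto split: if_splits)
next
  case (Suc r)
  have m: "knot d j i \<le> knot d j (i + 1)" "knot d j (i + r + 1) \<le> knot d j (i + r + 2)"
    by (auto intro: knot_mono)
  have l: "knot d j (i + r + 2) \<le> 1" by (rule knot_le1)
  consider "bsp d j r i x \<noteq> 0" | "bsp d j r (i + 1) x \<noteq> 0" using Suc.prems by fastforce
  then show ?case
  proof cases
    case 1
    from Suc.IH[OF 1] m l show ?thesis by (auto simp: add.assoc)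
  next
    case 2
    from Suc.IH[OF 2] m l show ?thesis by (auto simp: add.assoc)
  qed
qed

lemma bsp_nonneg: "0 \<le> bsp d j r i x"
proof (induction r arbitrary: i)
  case (Suc r)
  have "0 \<le> (x - knot d j i) / (knot d j (i + r + 1) - knot d j i) * bsp d j r i x"
    using bsp_support[of d j r i x] Suc.IH[of i] by (cases "bsp d j r i x = 0") auto
  moreover have "0 \<le> (knot d j (i + r + 2) - x) / (knot d j (i + r + 2) - knot d j (i + 1)) * bsp d j r (i + 1) x"
    using bsp_support[of d j r "i + 1" x] Suc.IH[of "i + 1"]
    by (cases "bsp d j r (i + 1) x = 0") (auto simp: add.assoc)
  ultimately show ?case by simp
qed simp

lemma bsp_outside: "x \<notin> {0..1} \<Longrightarrow> bsp d j r i x = 0"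
  using bsp_support[of d j r i x] knot_ge0[of d j i] knot_le1[of d j "i + r + 1"]
  by (metis atLeastAtMost_iff le_less_trans less_eq_real_def order_trans)

lemma bsp0_cell:
  assumes "c < 2 ^ j"
  shows "bsp d j 0 (d + 1 + c) x = indicator (cell (2 ^ j) c) x"
proof -
  have k: "knot d j (d + 1 + c) = real c / real (2 ^ j)" "knot d j (d + 1 + c + 1) = real (Suc c) / real (2 ^ j)"
    using knot_mid[of c j d] knot_mid[of "Suc c" j d] assms by auto
  have lt: "real c / real (2 ^ j) < real (Suc c) / real (2 ^ j)" by (intro divide_strict_right_mono) auto
  have "real (Suc c) / real (2 ^ j) = 1 \<longleftrightarrow> real (Suc c) = real (2 ^ j)" by (subst divide_eq_1_iff) simp
  also have "\<dots> \<longleftrightarrow> Suc c = 2 ^ j" by (simp only: of_nat_eq_iff)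
  finally have e: "real (Suc c) / real (2 ^ j) = 1 \<longleftrightarrow> Suc c = 2 ^ j" .
  show ?thesis unfolding bsp.simps k e using lt by (auto simp: cell_def indicator_def simp del: of_nat_Suc of_nat_power dest: sym)
qed

lemma bsp0_sum:
  assumes "x \<in> {0..1}" shows "(\<Sum>k\<in>{d + 1..2 ^ j + d}. bsp d j 0 k x) = 1"
proof -
  have "(\<Sum>k\<in>{d + 1..2 ^ j + d}. bsp d j 0 k x) = (\<Sum>c\<in>{0..<2 ^ j}. bsp d j 0 (d + 1 + c) x)"
    by (rule sum.reindex_bij_witness[where i="\<lambda>c. d + 1 + c" and j="\<lambda>k. k - (d + 1)"]) auto
  also have "\<dots> = (\<Sum>c\<in>{0..<2 ^ j}. if c = cidx (2 ^ j) x then 1 else 0)"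
  proof (rule sum.cong[OF refl])
    fix c assume c: "c \<in> {0..<(2::nat) ^ j}"
    have "x \<in> cell (2 ^ j) c \<longleftrightarrow> c = cidx (2 ^ j) x"
      using mem_cell_iff[of "2 ^ j" c x] assms c by simp
    then show "bsp d j 0 (d + 1 + c) x = (if c = cidx (2 ^ j) x then 1 else 0)"
      using bsp0_cell[of c j d x] c by (simp add: indicator_def)
  qed
  also have "\<dots> = 1" using cidx_less[of "2 ^ j" x] by simp
  finally show ?thesis .
qed

lemma ppoly_linear_mult: assumes "ppoly r N g" shows "ppoly (Suc r) N (\<lambda>x. (a + b * x) * g x)"
  unfolding ppoly_def
proof (intro allI impI)
  fix c assume c: "c < N"
  obtain q where q: "degree q \<le> r" "\<forall>x\<in>cell N c. g x = poly q x" using ppolyE[OF assms c] .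
  have "degree ([:a, b:] * q) \<le> degree [:a, b:] + degree q" by (rule degree_mult_le)
  also have "\<dots> \<le> Suc r" using q by simp
  finally show "\<exists>q. degree q \<le> Suc r \<and> (\<forall>x\<in>cell N c. (a + b * x) * g x = poly q x)"
    using q by (intro exI[of _ "[:a, b:] * q"]) (auto simp: algebra_simps)
qed

lemma bsp_ppoly: "ppoly r (2 ^ j) (bsp d j r i)"
proof (induction r arbitrary: i)
  case 0
  consider "i < d + 1" | "2 ^ j + d + 1 \<le> i" | c where "i = d + 1 + c" "c < 2 ^ j"
    by (metis add.assoc add.commute add_less_cancel_left le_Suc_ex not_less)
  then show ?case
  proof cases
    case 1
    then have "bsp d j 0 i = (\<lambda>x. 0)" using knot_eq0[of i d j] knot_eq0[of "i + 1" d j] by (auto intro!: ext)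
    then show ?thesis using ppoly_zero by simp
  next
    case 2
    then have "bsp d j 0 i = (\<lambda>x. 0)" using knot_eq1[of j d i] knot_eq1[of j d "i + 1"] by (auto intro!: ext)
    then show ?thesis using ppoly_zero by simp
  next
    case (3 c)
    show ?thesis unfolding ppoly_def
    proof (intro allI impI)
      fix c' :: nat assume c': "c' < 2 ^ j"
      have "bsp d j 0 i x = poly [:if c = c' then 1 else 0:] x" if "x \<in> cell (2 ^ j) c'" for x
        using bsp0_cell[OF 3(2), of d x] 3 mem_cell_iff[of "2 ^ j" c x] mem_cell_iff[of "2 ^ j" c' x] that c'
        by (auto simp del: bsp.simps)
      then show "\<exists>q. degree q \<le> 0 \<and> (\<forall>x\<in>cell (2 ^ j) c'. bsp d j 0 i x = poly q x)"
        by (intro exI[of _ "[:if c = c' then 1 else 0:]"]) (auto simp del: bsp.simps)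
    qed
  qed
next
  case (Suc r)
  define D E where "D = knot d j (i + r + 1) - knot d j i" and "E = knot d j (i + r + 2) - knot d j (i + 1)"
  have "bsp d j (Suc r) i = (\<lambda>x. (- knot d j i / D + (1 / D) * x) * bsp d j r i x
      + (knot d j (i + r + 2) / E + (- 1 / E) * x) * bsp d j r (i + 1) x)"
    by (rule ext) (simp add: D_def E_def diff_divide_distrib)
  then show ?case by (simp only:) (intro ppoly_add ppoly_linear_mult Suc.IH)
qed

section \<open>Marsden's identity and the reproduction of polynomials\<close>

lemma bsp_prod_sum:
  assumes x: "x \<in> {0..1}" and "r \<le> d"
  shows "(\<Sum>k\<in>{d + 1 - r..2 ^ j + d}. (\<Prod>i<r. knot d j (k + 1 + i) - y) * bsp d j r k x) = (x - y) ^ r"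
  using assms(2)
proof (induction r)
  case 0
  then show ?case using bsp0_sum[OF x, of d j] by (simp del: bsp.simps)
next
  case (Suc r)
  define b where "b k = bsp d j r k x" for k
  define \<xi> where "\<xi> = knot d j"
  define \<rho> where "\<rho> r k = (\<Prod>i<r. \<xi> (k + 1 + i) - y)" for r k
  \<comment> \<open>\<open>A k\<close> and \<open>C k\<close> are what the degree-r spline with
    index k contributes to the sum: \<open>A k\<close> through the first term of the recursion at
    index k, \<open>C k\<close> through the second term at index k - 1. Shifting the index collects
    both on the same spline.\<close>
  define A where "A k = \<rho> (Suc r) k * ((x - \<xi> k) / (\<xi> (k + r + 1) - \<xi> k) * b k)" for k
  define C where "C k = (\<xi> k - y) * \<rho> r k * ((\<xi> (k + r + 1) - x) / (\<xi> (k + r + 1) - \<xi> k) * b k)" for k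
  let ?N = "2 ^ j + d"
  have rho: "\<rho> (Suc r) k = (\<xi> (Suc k) - y) * \<rho> r (Suc k)" for k
    unfolding \<rho>_def prod.lessThan_Suc_shift by simp
  have rho': "\<rho> (Suc r) k = \<rho> r k * (\<xi> (k + r + 1) - y)" for k
    unfolding \<rho>_def by (simp add: add_ac)
  \<comment> \<open>The two splines pushed out of the index range have all their knots at 0 or all
    at 1, hence vanish; this is where the (d+1)-fold end knots enter.\<close>
  have b0: "b (d - r) = 0"
    using bsp_support[of d j r "d - r" x] knot_eq0[of "d - r" d j] knot_eq0[of "d - r + r + 1" d j] Suc.prems
    by (auto simp: b_def)
  have bN: "b (Suc ?N) = 0"
    using bsp_support[of d j r "Suc ?N" x] knot_eq1[of j d "Suc ?N"] knot_eq1[of j d "Suc ?N + r + 1"]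
    by (auto simp: b_def)
  have "(\<Sum>k\<in>{d + 1 - Suc r..?N}. (\<Prod>i<Suc r. knot d j (k + 1 + i) - y) * bsp d j (Suc r) k x)
      = (\<Sum>k\<in>{d - r..?N}. A k + C (Suc k))"
  proof (rule sum.cong)
    fix k
    have "(\<Prod>i<Suc r. knot d j (k + 1 + i) - y) * bsp d j (Suc r) k x
       = \<rho> (Suc r) k * ((x - \<xi> k) / (\<xi> (k + r + 1) - \<xi> k) * b k
          + (\<xi> (k + r + 2) - x) / (\<xi> (k + r + 2) - \<xi> (k + 1)) * b (k + 1))"
      by (simp only: bsp.simps \<rho>_def \<xi>_def b_def)
    also have "\<dots> = A k + \<rho> (Suc r) k * ((\<xi> (k + r + 2) - x) / (\<xi> (k + r + 2) - \<xi> (k + 1)) * b (k + 1))"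
      by (simp add: A_def distrib_left)
    also have "\<rho> (Suc r) k * ((\<xi> (k + r + 2) - x) / (\<xi> (k + r + 2) - \<xi> (k + 1)) * b (k + 1)) = C (Suc k)"
      unfolding rho C_def by simp
    finally show "(\<Prod>i<Suc r. knot d j (k + 1 + i) - y) * bsp d j (Suc r) k x = A k + C (Suc k)" .
  qed auto
  also have "\<dots> = (\<Sum>k\<in>{d - r..?N}. A k) + (\<Sum>k\<in>{d - r..?N}. C (Suc k))" by (rule sum.distrib)
  also have "(\<Sum>k\<in>{d - r..?N}. A k) = (\<Sum>k\<in>{Suc (d - r)..?N}. A k)"
    by (subst sum.atLeast_Suc_atMost) (auto simp: A_def b0)
  also have "(\<Sum>k\<in>{d - r..?N}. C (Suc k)) = (\<Sum>k\<in>{Suc (d - r)..Suc ?N}. C k)"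
    by (rule sum.shift_bounds_cl_Suc_ivl[symmetric])
  also have "\<dots> = (\<Sum>k\<in>{Suc (d - r)..?N}. C k)"
    by (subst sum.nat_ivl_Suc') (auto simp: C_def bN)
  also have "(\<Sum>k\<in>{Suc (d - r)..?N}. A k) + (\<Sum>k\<in>{Suc (d - r)..?N}. C k) = (\<Sum>k\<in>{d + 1 - r..?N}. (x - y) * (\<rho> r k * b k))"
    unfolding sum.distrib[symmetric]
  proof (rule sum.cong)
    show "{Suc (d - r)..?N} = {d + 1 - r..?N}" using Suc.prems by auto
    fix k
    show "A k + C k = (x - y) * (\<rho> r k * b k)"
    proof (cases "b k = 0")
      case False
      then have "\<xi> k < \<xi> (k + r + 1)" using bsp_support[of d j r k x] by (simp add: b_def \<xi>_def)
      then have D: "\<xi> (k + r + 1) - \<xi> k \<noteq> 0" by simp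
      have "A k + C k = \<rho> r k * b k * (((\<xi> (k + r + 1) - y) * (x - \<xi> k) + (\<xi> k - y) * (\<xi> (k + r + 1) - x)) / (\<xi> (k + r + 1) - \<xi> k))"
        unfolding A_def C_def rho' by (simp add: add_divide_distrib distrib_left mult_ac)
      \<comment> \<open>Linear interpolation of the affine function t - y between the knots
        \<open>\<xi> k\<close> and \<open>\<xi> (k + r + 1)\<close>, evaluated at x.\<close>
      also have "(\<xi> (k + r + 1) - y) * (x - \<xi> k) + (\<xi> k - y) * (\<xi> (k + r + 1) - x) = (x - y) * (\<xi> (k + r + 1) - \<xi> k)"
        by (simp add: algebra_simps)
      finally show ?thesis using D by simp
    qed (simp add: A_def C_def)
  qed
  also have "\<dots> = (x - y) * (x - y) ^ r"
    using Suc.IH Suc.prems by (simp add: sum_distrib_left[symmetric] \<rho>_def \<xi>_def b_def)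
  finally show ?case by simp
qed

lemma marsden:
  assumes "x \<in> {0..1}"
  shows "(\<Sum>k\<in>{1..2 ^ j + d}. (\<Prod>i<d. knot d j (k + 1 + i) - y) * Bspl d j k x) = (x - y) ^ d"
  using bsp_prod_sum[OF assms order_refl, of d j y] by (simp add: Bspl_def)

lemma coeff_prod_linear: "coeff (\<Prod>i<d. [:a i, -1:]) d = (-1 :: real) ^ d \<and> degree (\<Prod>i<d. [:a i, -1 :: real:]) \<le> d"
proof (induction d)
  case (Suc d)
  define p where "p = (\<Prod>i<d. [:a i, -1 :: real:])"
  have e: "(\<Prod>i<Suc d. [:a i, -1 :: real:]) = smult (a d) p + pCons 0 (smult (-1) p)"
    by (simp add: p_def mult.commute[of _ "[:a d, -1:]"] del: smult_minus_left)
  have "coeff p (Suc d) = 0" using Suc by (intro coeff_eq_0) (simp add: p_def)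
  then have "coeff (\<Prod>i<Suc d. [:a i, -1 :: real:]) (Suc d) = (-1) ^ Suc d"
    unfolding e using Suc by (simp add: p_def)
  moreover have "degree (\<Prod>i<Suc d. [:a i, -1 :: real:]) \<le> degree p + degree [:a d, -1 :: real:]"
    unfolding p_def prod.lessThan_Suc by (rule degree_mult_le)
  ultimately show ?case using Suc by (simp add: p_def)
qed simp

text \<open>Both sides of Marsden's identity are polynomials in the free variable y, so coefficients
  can be compared; that of y^(d-r) produces the monomial x^r, and r = 0 gives the partition of
  unity.\<close>

lemma marsden_coeff:
  assumes x: "x \<in> {0..1}" and "r \<le> d"
  shows "(\<Sum>k\<in>{1..2 ^ j + d}. Bspl d j k x * coeff (\<Prod>i<d. [:knot d j (k + 1 + i), -1:]) (d - r))
    = real (d choose (d - r)) * (-1) ^ (d - r) * x ^ r"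
proof -
  define R where "R k = (\<Prod>i<d. [:knot d j (k + 1 + i), -1:])" for k
  have "[:x, -1:] ^ d = (\<Sum>k\<in>{1..2 ^ j + d}. smult (Bspl d j k x) (R k))"
  proof (rule poly_ext)
    fix y
    show "poly ([:x, -1:] ^ d) y = poly (\<Sum>k\<in>{1..2 ^ j + d}. smult (Bspl d j k x) (R k)) y"
      using marsden[OF x, of d j y] by (simp add: poly_sum poly_prod R_def mult.commute)
  qed
  then have "coeff ([:x, -1:] ^ d) (d - r) = (\<Sum>k\<in>{1..2 ^ j + d}. Bspl d j k x * coeff (R k) (d - r))"
    by (simp add: coeff_sum)
  moreover have "coeff ([:x, -1:] ^ d) (d - r) = real (d choose (d - r)) * (-1) ^ (d - r) * x ^ r"
    using assms by (subst coeff_linear_poly_power) auto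
  ultimately show ?thesis by (simp add: R_def)
qed

lemma monomial_Bspl:
  assumes "r \<le> d"
  shows "\<exists>c. \<forall>x\<in>{0..1}. x ^ r = (\<Sum>k\<in>{1..2 ^ j + d}. c k * Bspl d j k x)"
proof -
  define R where "R k = (\<Prod>i<d. [:knot d j (k + 1 + i), -1:])" for k
  define b where "b = real (d choose (d - r)) * (-1) ^ (d - r)"
  have b0: "b \<noteq> 0" by (simp add: b_def)
  have "x ^ r = (\<Sum>k\<in>{1..2 ^ j + d}. coeff (R k) (d - r) / b * Bspl d j k x)" if x: "x \<in> {0..1}" for x
  proof -
    have "x ^ r = (\<Sum>k\<in>{1..2 ^ j + d}. Bspl d j k x * coeff (R k) (d - r)) / b"
      using b0 marsden_coeff[OF x assms, of j] by (simp add: R_def b_def)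
    then show ?thesis by (simp add: sum_divide_distrib mult.commute)
  qed
  then show ?thesis by (intro exI[of _ "\<lambda>k. coeff (R k) (d - r) / b"] ballI)
qed

lemma Bspl_sum_1:
  assumes x: "x \<in> {0..1}" shows "(\<Sum>k\<in>{1..2 ^ j + d}. Bspl d j k x) = 1"
proof -
  have "(\<Sum>k\<in>{1..2 ^ j + d}. Bspl d j k x) * (-1) ^ d = (-1) ^ d"
    using marsden_coeff[OF x, of 0 d j] by (simp add: coeff_prod_linear sum_distrib_right)
  then show ?thesis by simp
qed

section \<open>The spline spaces as linear spaces of functions\<close>

lemma Bspl_outside: "x \<notin> {0..1} \<Longrightarrow> Bspl d j k x = 0"
  by (simp add: Bspl_def bsp_outside)

lemma Vsp_outside: "g \<in> Vsp d j \<Longrightarrow> x \<notin> {0..1} \<Longrightarrow> g x = 0"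
  by (auto simp: Vsp_def Bspl_outside)

lemma Vsp_ppoly: "g \<in> Vsp d j \<Longrightarrow> ppoly d (2 ^ j) g"
  by (auto simp: Vsp_def Bspl_def intro!: ppoly_sum ppoly_cmult bsp_ppoly)

lemma Vsp_bdd01: "g \<in> Vsp d j \<Longrightarrow> bdd01 g"
  by (rule ppoly_bdd01[OF Vsp_ppoly]) auto

lemma Vsp_lincomb:
  assumes "\<And>i. i \<in> I \<Longrightarrow> g i \<in> Vsp d j"
  shows "(\<lambda>x. \<Sum>i\<in>I. c i * g i x) \<in> Vsp d j"
proof -
  have "\<forall>i\<in>I. \<exists>a. g i = (\<lambda>x. \<Sum>k\<in>{1..2 ^ j + d}. a k * Bspl d j k x)" using assms by (auto simp: Vsp_def)
  then obtain a where a: "\<forall>i\<in>I. g i = (\<lambda>x. \<Sum>k\<in>{1..2 ^ j + d}. a i k * Bspl d j k x)" by (auto dest!: bchoice)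
  have "(\<Sum>i\<in>I. c i * g i x) = (\<Sum>k\<in>{1..2 ^ j + d}. (\<Sum>i\<in>I. c i * a i k) * Bspl d j k x)" for x
  proof -
    have "(\<Sum>i\<in>I. c i * g i x) = (\<Sum>i\<in>I. \<Sum>k\<in>{1..2 ^ j + d}. c i * a i k * Bspl d j k x)"
      by (rule sum.cong) (auto simp: a sum_distrib_left mult.assoc)
    also have "\<dots> = (\<Sum>k\<in>{1..2 ^ j + d}. \<Sum>i\<in>I. c i * a i k * Bspl d j k x)" by (rule sum.swap)
    finally show ?thesis by (simp add: sum_distrib_right)
  qed
  then show ?thesis unfolding Vsp_def by (intro CollectI exI[of _ "\<lambda>k. \<Sum>i\<in>I. c i * a i k"]) auto
qed

lemma Vsp_add: "g \<in> Vsp d j \<Longrightarrow> h \<in> Vsp d j \<Longrightarrow> (\<lambda>x. g x + h x) \<in> Vsp d j"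
  using Vsp_lincomb[of "{0, 1::nat}" "\<lambda>i. if i = 0 then g else h" d j "\<lambda>_. 1"] by simp

lemma Vsp_cmult: "g \<in> Vsp d j \<Longrightarrow> (\<lambda>x. a * g x) \<in> Vsp d j"
  using Vsp_lincomb[of "{0::nat}" "\<lambda>_. g" d j "\<lambda>_. a"] by simp

lemma Vsp_diff: "g \<in> Vsp d j \<Longrightarrow> h \<in> Vsp d j \<Longrightarrow> (\<lambda>x. g x - h x) \<in> Vsp d j"
  using Vsp_add[of g d j "\<lambda>x. -1 * h x"] Vsp_cmult[of h d j "-1"] by simp

lemma Bspl_Vsp: "k \<in> {1..2 ^ j + d} \<Longrightarrow> Bspl d j k \<in> Vsp d j"
  unfolding Vsp_def
  by (intro CollectI exI[of _ "\<lambda>i. if i = k then 1 else 0"] conjI ext) (auto simp: if_distrib[of "\<lambda>c. c * _"] cong: if_cong)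

section \<open>Truncated powers and nestedness of the spline spaces\<close>

text \<open>Indices up to \<open>d\<close> are the monomials; index \<open>d + i\<close> is the truncated power at the interior
  knot \<open>i / 2^j\<close>.\<close>
definition tpow :: "nat \<Rightarrow> nat \<Rightarrow> nat \<Rightarrow> real \<Rightarrow> real" where
  "tpow d j m x = (if x \<notin> {0..1} then 0 else if m \<le> d then x ^ m
     else if real (m - d) / 2 ^ j \<le> x then (x - real (m - d) / 2 ^ j) ^ d else 0)"

lemma tpow_Vsp:
  assumes "m < 2 ^ j + d" shows "tpow d j m \<in> Vsp d j"
proof (cases "m \<le> d")
  case True
  then obtain c where c: "\<forall>x\<in>{0..1}. x ^ m = (\<Sum>k\<in>{1..2 ^ j + d}. c k * Bspl d j k x)"
    using monomial_Bspl by blast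
  have "tpow d j m = (\<lambda>x. \<Sum>k\<in>{1..2 ^ j + d}. c k * Bspl d j k x)"
  proof
    fix x show "tpow d j m x = (\<Sum>k\<in>{1..2 ^ j + d}. c k * Bspl d j k x)"
      using c True by (cases "x \<in> {0..1}") (auto simp: tpow_def Bspl_outside)
  qed
  then show ?thesis by (auto simp: Vsp_def)
next
  case False
  define i where "i = m - d"
  define y where "y = real i / 2 ^ j"
  have i: "0 < i" "i < 2 ^ j" using assms False by (auto simp: i_def)
  have y: "y = knot d j (d + 1 + i)" using knot_mid[of i j d] i by (simp add: y_def)
  have "real i < real (2 ^ j)" using i(2) by (rule of_nat_less_iff[THEN iffD2])
  then have y1: "y < 1" by (simp add: y_def)
  define \<rho> where "\<rho> k = (\<Prod>l<d. knot d j (k + 1 + l) - y)" for k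
  \<comment> \<open>The truncated power is Marsden's expansion of (x - y)^d without the splines that
    start left of the knot y. To the right of y nothing is lost: such a spline either has y among
    its interior knots, so that its Marsden coefficient contains a zero factor, or its support ends
    at y or earlier.\<close>
  define c where "c k = (if d + 1 + i \<le> k then \<rho> k else 0)" for k
  have "tpow d j m x = (\<Sum>k\<in>{1..2 ^ j + d}. c k * Bspl d j k x)" for x
  proof (cases "x \<in> {0..1}")
    case x: True
    show ?thesis
    proof (cases "y \<le> x")
      case True
      have "(x - y) ^ d = (\<Sum>k\<in>{1..2 ^ j + d}. \<rho> k * Bspl d j k x)"
        using marsden[OF x, of d j y] by (simp add: \<rho>_def)
      also have "\<dots> = (\<Sum>k\<in>{1..2 ^ j + d}. c k * Bspl d j k x)"
      proof (rule sum.cong[OF refl])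
        fix k
        show "\<rho> k * Bspl d j k x = c k * Bspl d j k x"
        proof (cases "d + 1 + i \<le> k")
          case False
          consider "i + d - k < d" "k \<le> i + d" | "k + d + 1 \<le> d + 1 + i" using False by linarith
          then show ?thesis
          proof cases
            case 1
            have "k + 1 + (i + d - k) = d + 1 + i" using 1 by simp
            then have "knot d j (k + 1 + (i + d - k)) - y = 0" by (simp only: y)
            then have "\<exists>l\<in>{..<d}. knot d j (k + 1 + l) - y = 0" using 1 by blast
            then have "\<rho> k = 0" unfolding \<rho>_def by (intro prod_zero) auto
            then show ?thesis by (simp add: c_def)
          next
            case 2
            have "knot d j (k + d + 1) \<le> y" unfolding y by (rule knot_mono[OF 2])
            then have "Bspl d j k x = 0"
              unfolding Bspl_def using bsp_support[of d j d k x] True y1 by fastforce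
            then show ?thesis by simp
          qed
        qed (simp add: c_def)
      qed
      finally show ?thesis using True x False by (simp add: tpow_def y_def i_def)
    next
      case lt: False
      have "c k * Bspl d j k x = 0" for k
      proof (cases "d + 1 + i \<le> k")
        case True
        then have "y \<le> knot d j k" unfolding y by (rule knot_mono)
        then have "Bspl d j k x = 0"
          unfolding Bspl_def using bsp_support[of d j d k x] lt by fastforce
        then show ?thesis by simp
      qed (simp add: c_def)
      then have "(\<Sum>k\<in>{1..2 ^ j + d}. c k * Bspl d j k x) = 0" by (intro sum.neutral) blast
      then show ?thesis using lt False by (simp add: tpow_def y_def i_def)
    qed
  next
    case False
    then show ?thesis by (simp add: tpow_def Bspl_outside)
  qed
  then show ?thesis unfolding Vsp_def by (intro CollectI exI[of _ c] conjI ext) auto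
qed

text \<open>Triangularity: inside the first cell only the monomials are nonzero, and the midpoint of
  cell i is reached by no truncated power with a later knot. So the coefficients vanish one after
  the other from left to right.\<close>

lemma tpow_independent:
  assumes z: "\<And>x. x \<in> {0..1} \<Longrightarrow> (\<Sum>m<2 ^ j + d. a m * tpow d j m x) = 0" and m: "m < 2 ^ j + d"
  shows "a m = 0"
proof -
  have low: "a m = 0" if "m \<le> d" for m
  proof -
    define q where "q = (\<Sum>m\<le>d. monom (a m) m)"
    have "poly q x = 0" if x: "x \<in> {0<..<1 / 2 ^ j}" for x
    proof -
      have "(1::real) / 2 ^ j \<le> 1" by simp
      then have x1: "x < 1" using x by (meson greaterThanLessThan_iff less_le_trans)
      have "poly q x = (\<Sum>m\<le>d. a m * x ^ m)" by (simp add: q_def poly_sum poly_monom)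
      also have "\<dots> = (\<Sum>m\<le>d. a m * tpow d j m x)" using x x1 by (intro sum.cong) (auto simp: tpow_def)
      also have "\<dots> = (\<Sum>m<2 ^ j + d. a m * tpow d j m x)"
      proof (rule sum.mono_neutral_left)
        show "{..d} \<subseteq> {..<2 ^ j + d}" by (auto simp: le_less_trans)
        show "\<forall>i\<in>{..<2 ^ j + d} - {..d}. a i * tpow d j i x = 0"
        proof
          fix i assume "i \<in> {..<2 ^ j + d} - {..d}"
          then have i: "d < i" by auto
          then have "1 / 2 ^ j \<le> real (i - d) / 2 ^ j" by (intro divide_right_mono) auto
          then have "x < real (i - d) / 2 ^ j" using x by auto
          then show "a i * tpow d j i x = 0" using i by (simp add: tpow_def)
        qed
      qed simp
      also have "\<dots> = 0" using z x x1 by auto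
      finally show ?thesis .
    qed
    then have "{0<..<1 / 2 ^ j} \<subseteq> {x. poly q x = 0}" by auto
    moreover have "infinite {0<..<(1::real) / 2 ^ j}" by (rule infinite_Ioo) simp
    ultimately have "q = 0" using poly_roots_finite finite_subset by blast
    then have "coeff q m = 0" by simp
    then show ?thesis using that by (simp add: q_def coeff_sum)
  qed
  show ?thesis
    using m
  proof (induction m rule: less_induct)
    case (less m)
    show ?case
    proof (cases "m \<le> d")
      case False
      define i where "i = m - d"
      define x where "x = (real i + 1/2) / 2 ^ j"
      have i: "0 < i" "i < 2 ^ j" "m = d + i" using less.prems False by (auto simp: i_def)
      have "real (Suc i) \<le> real (2 ^ j)" using i(2) by (intro of_nat_mono) simp
      then have x: "x \<in> {0..1}" by (simp add: x_def)
      have t0: "a l * tpow d j l x = 0" if "l < 2 ^ j + d" "l \<noteq> m" for l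
      proof (cases "l < m")
        case True
        then show ?thesis using less.IH that by simp
      next
        case False
        then have "i + 1 \<le> l - d" using i that by auto
        then have "real (i + 1) \<le> real (l - d)" by (rule of_nat_mono)
        then have "x < real (l - d) / 2 ^ j" unfolding x_def by (intro divide_strict_right_mono) auto
        then show ?thesis using False i that by (simp add: tpow_def)
      qed
      have "(\<Sum>l<2 ^ j + d. a l * tpow d j l x) = (\<Sum>l\<in>{m}. a l * tpow d j l x)"
        by (rule sum.mono_neutral_right) (use t0 less.prems in auto)
      then have "a m * tpow d j m x = 0" using z[OF x] by simp
      moreover have "tpow d j m x = (1 / (2 * 2 ^ j)) ^ d"
      proof -
        have "real (m - d) / 2 ^ j \<le> x" unfolding x_def i(3) by (intro divide_right_mono) auto
        moreover have "x - real (m - d) / 2 ^ j = 1 / (2 * 2 ^ j)"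
          by (simp add: x_def i(3) add_divide_distrib)
        ultimately show ?thesis using False x by (simp add: tpow_def)
      qed
      ultimately show ?thesis by simp
    qed (use low in simp)
  qed
qed

text \<open>The ambient vector space in which the two spanning families are compared by
  cardinality.\<close>

interpretation fun_vs: vector_space "\<lambda>(c::real) (g::real \<Rightarrow> real) x. c * g x"
  by unfold_locales (auto simp: fun_eq_iff algebra_simps)

lemma sum_fun_apply: "(\<Sum>i\<in>I. g i) x = (\<Sum>i\<in>I. g i x)" for g :: "'a \<Rightarrow> real \<Rightarrow> real"
  by (induction I rule: infinite_finite_induct) auto

lemma tpow_inj: "inj_on (tpow d j) {..<2 ^ j + d}"
proof (rule inj_onI)
  fix m l assume ml: "m \<in> {..<2 ^ j + d}" "l \<in> {..<2 ^ j + d}" "tpow d j m = tpow d j l"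
  show "m = l"
  proof (rule ccontr)
    assume ne: "m \<noteq> l"
    define a where "a i = (if i = m then 1 else if i = l then -1 else (0::real))" for i
    have "(\<Sum>i<2 ^ j + d. a i * tpow d j i x) = 0" for x
    proof -
      have "(\<Sum>i<2 ^ j + d. a i * tpow d j i x) = (\<Sum>i\<in>{m, l}. a i * tpow d j i x)"
        by (rule sum.mono_neutral_right) (use ml in \<open>auto simp: a_def\<close>)
      then show ?thesis using ne ml by (simp add: a_def)
    qed
    from tpow_independent[OF this, of m] ml show False by (simp add: a_def)
  qed
qed

lemma tpow_fun_independent: "fun_vs.independent (tpow d j ` {..<2 ^ j + d})"
proof (rule fun_vs.independent_if_scalars_zero)
  fix f :: "(real \<Rightarrow> real) \<Rightarrow> real" and v
  assume s: "(\<Sum>v\<in>tpow d j ` {..<2 ^ j + d}. (\<lambda>x. f v * v x)) = 0" and v: "v \<in> tpow d j ` {..<2 ^ j + d}"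
  have "(\<Sum>m<2 ^ j + d. f (tpow d j m) * tpow d j m x) = 0" for x
    using fun_cong[OF s, of x] by (simp add: sum_fun_apply sum.reindex[OF tpow_inj] o_def)
  from tpow_independent[OF this] v show "f v = 0" by auto
qed simp


lemma Vsp_subset_span:
  assumes "g = (\<lambda>x. \<Sum>k\<in>I. c k * h k x)"
  shows "g \<in> fun_vs.span (h ` I)"
proof -
  have "g = (\<Sum>k\<in>I. (\<lambda>x. c k * h k x))" using assms by (auto simp: fun_eq_iff sum_fun_apply)
  also have "\<dots> \<in> fun_vs.span (h ` I)"
    by (intro fun_vs.span_sum fun_vs.span_scale fun_vs.span_base) auto
  finally show ?thesis .
qed

lemma tpow_span: "tpow d j ` {..<2 ^ j + d} \<subseteq> fun_vs.span (Bspl d j ` {1..2 ^ j + d})"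
proof
  fix v assume "v \<in> tpow d j ` {..<2 ^ j + d}"
  then have "v \<in> Vsp d j" using tpow_Vsp by auto
  then show "v \<in> fun_vs.span (Bspl d j ` {1..2 ^ j + d})" using Vsp_subset_span unfolding Vsp_def by blast
qed

lemma card_tpow: "card (tpow d j ` {..<2 ^ j + d}) = 2 ^ j + d"
  using card_image[OF tpow_inj] by simp

text \<open>The truncated powers are as numerous as the B-splines that span them, so both families
  are bases of the same space.\<close>
lemma Bspl_tpow:
  assumes k: "k \<in> {1..2 ^ j + d}"
  shows "\<exists>a. Bspl d j k = (\<lambda>x. \<Sum>m<2 ^ j + d. a m * tpow d j m x)"
proof -
  let ?S = "tpow d j ` {..<2 ^ j + d}" and ?T = "Bspl d j ` {1..2 ^ j + d}"
  have "Bspl d j k \<in> fun_vs.span ?S"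
  proof (rule ccontr)
    assume n: "Bspl d j k \<notin> fun_vs.span ?S"
    then have nS: "Bspl d j k \<notin> ?S" using fun_vs.span_base[of "Bspl d j k" ?S] by auto
    have ind: "fun_vs.independent (insert (Bspl d j k) ?S)"
      by (rule fun_vs.independent_insertI[OF n tpow_fun_independent])
    have "Bspl d j k \<in> fun_vs.span ?T" by (rule fun_vs.span_base) (use k in simp)
    then have sub: "insert (Bspl d j k) ?S \<subseteq> fun_vs.span ?T"
      using tpow_span[of d j] by (rule insert_subsetI)
    have "card (insert (Bspl d j k) ?S) \<le> card ?T"
      using fun_vs.independent_span_bound[OF _ ind sub] by simp
    also have "\<dots> \<le> 2 ^ j + d" using card_image_le[of "{1..2 ^ j + d}" "Bspl d j"] by simp
    finally show False using nS by (simp add: card_tpow)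
  qed
  then have "Bspl d j k \<in> range (\<lambda>u. \<Sum>v\<in>?S. (\<lambda>x. u v * v x))"
    using fun_vs.span_finite[of ?S] by simp
  then obtain u where "Bspl d j k = (\<Sum>v\<in>?S. (\<lambda>x. u v * v x))" by (rule rangeE)
  then have "Bspl d j k = (\<lambda>x. \<Sum>m<2 ^ j + d. u (tpow d j m) * tpow d j m x)"
    by (auto simp: fun_eq_iff sum_fun_apply sum.reindex[OF tpow_inj])
  then show ?thesis by (intro exI[of _ "\<lambda>m. u (tpow d j m)"])
qed

text \<open>Were one B-spline redundant, the remaining 2^j + d - 1 would span 2^j + d independent
  truncated powers, against the exchange lemma.\<close>

lemma Bspl_independent:
  assumes z: "\<And>x. (\<Sum>k\<in>{1..2 ^ j + d}. c k * Bspl d j k x) = 0" and k: "k \<in> {1..2 ^ j + d}"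
  shows "c k = 0"
proof (rule ccontr)
  assume ck: "c k \<noteq> 0"
  let ?S = "tpow d j ` {..<2 ^ j + d}" and ?I = "{1..2 ^ j + d} - {k}"
  have "Bspl d j k = (\<lambda>x. \<Sum>l\<in>?I. (- c l / c k) * Bspl d j l x)"
  proof
    fix x
    have "c k * Bspl d j k x + (\<Sum>l\<in>?I. c l * Bspl d j l x) = 0"
      using z[of x] sum.remove[of "{1..2 ^ j + d}" k "\<lambda>k. c k * Bspl d j k x"] k by simp
    then have "Bspl d j k x = - (\<Sum>l\<in>?I. c l * Bspl d j l x) / c k" using ck by (simp add: field_simps)
    also have "\<dots> = (\<Sum>l\<in>?I. (- c l / c k) * Bspl d j l x)"
      by (simp add: sum_divide_distrib sum_negf)
    finally show "Bspl d j k x = (\<Sum>l\<in>?I. (- c l / c k) * Bspl d j l x)" .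
  qed
  then have "Bspl d j k \<in> fun_vs.span (Bspl d j ` ?I)" by (rule Vsp_subset_span)
  then have sub: "Bspl d j ` {1..2 ^ j + d} \<subseteq> fun_vs.span (Bspl d j ` ?I)"
  proof (intro image_subsetI)
    fix l assume k': "Bspl d j k \<in> fun_vs.span (Bspl d j ` ?I)" and "l \<in> {1..2 ^ j + d}"
    then show "Bspl d j l \<in> fun_vs.span (Bspl d j ` ?I)"
      by (cases "l = k") (use k' in \<open>auto intro: fun_vs.span_base\<close>)
  qed
  have "?S \<subseteq> fun_vs.span (Bspl d j ` ?I)"
    by (rule subset_trans[OF tpow_span fun_vs.span_minimal[OF sub fun_vs.subspace_span]])
  then have "card ?S \<le> card (Bspl d j ` ?I)"
    using fun_vs.independent_span_bound[OF _ tpow_fun_independent] by simp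
  also have "\<dots> \<le> card ?I" by (rule card_image_le) simp
  also have "\<dots> < 2 ^ j + d" using k by (simp add: card_Diff_singleton)
  finally show False by (simp add: card_tpow)
qed

text \<open>Nestedness is immediate for truncated powers because i/2^j = 2i/2^(j+1); the index
  \<open>d + 2 * (m - d)\<close> encodes this doubling. For the B-splines themselves it would take
  knot insertion.\<close>

lemma tpow_Suc:
  assumes "m < 2 ^ j + d" shows "tpow d j m \<in> Vsp d (Suc j)"
proof (cases "m \<le> d")
  case True
  have "tpow d j m = tpow d (Suc j) m" using True by (auto simp: tpow_def)
  then show ?thesis using tpow_Vsp[of m "Suc j" d] assms by simp
next
  case False
  define m' where "m' = d + 2 * (m - d)"
  have "tpow d j m = tpow d (Suc j) m'"
  proof
    fix x
    have "real (m' - d) / 2 ^ Suc j = real (m - d) / 2 ^ j" by (simp add: m'_def)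
    moreover have "\<not> m' \<le> d" using False by (simp add: m'_def)
    ultimately show "tpow d j m x = tpow d (Suc j) m' x"
      using False by (simp only: tpow_def if_False)
  qed
  then show ?thesis using tpow_Vsp[of m' "Suc j" d] assms False by (simp add: m'_def)
qed

lemma Vsp_Suc: "Vsp d j \<subseteq> Vsp d (Suc j)"
proof
  fix g assume "g \<in> Vsp d j"
  then obtain c where g: "g = (\<lambda>x. \<Sum>k\<in>{1..2 ^ j + d}. c k * Bspl d j k x)" by (auto simp: Vsp_def)
  have "Bspl d j k \<in> Vsp d (Suc j)" if k: "k \<in> {1..2 ^ j + d}" for k
  proof -
    obtain a where "Bspl d j k = (\<lambda>x. \<Sum>m<2 ^ j + d. a m * tpow d j m x)" using Bspl_tpow[OF k] by blast
    then show ?thesis using Vsp_lincomb[of "{..<2 ^ j + d}" "tpow d j" d "Suc j" a] tpow_Suc by simp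
  qed
  then show "g \<in> Vsp d (Suc j)" unfolding g by (intro Vsp_lincomb)
qed

lemma poly_Vsp:
  assumes "degree q \<le> d" shows "(\<lambda>x. if x \<in> {0..1} then poly q x else 0) \<in> Vsp d j"
proof -
  have "(\<lambda>x. \<Sum>m\<le>d. coeff q m * tpow d j m x) \<in> Vsp d j"
    by (intro Vsp_lincomb tpow_Vsp) (auto simp: le_less_trans)
  moreover have "poly q x = (\<Sum>m\<le>d. coeff q m * x ^ m)" for x
    unfolding poly_altdef by (rule sum.mono_neutral_left) (use assms in \<open>auto simp: coeff_eq_0\<close>)
  then have "(\<lambda>x. \<Sum>m\<le>d. coeff q m * tpow d j m x) = (\<lambda>x. if x \<in> {0..1} then poly q x else 0)"
    by (auto simp: fun_eq_iff tpow_def intro!: sum.cong)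
  ultimately show ?thesis by simp
qed

section \<open>Density and separation in mean square\<close>

lemma Vsp_dense:
  assumes f: "continuous_on {0..1} f" and e: "0 < e"
  shows "\<exists>J. \<forall>j\<ge>J. \<exists>v\<in>Vsp d j. \<forall>x\<in>{0..1}. \<bar>f x - v x\<bar> \<le> e"
proof -
  have "uniformly_continuous_on {0..1} f" by (rule compact_uniformly_continuous[OF f]) simp
  then obtain \<delta> where \<delta>: "0 < \<delta>" "\<And>x y. x \<in> {0..1} \<Longrightarrow> y \<in> {0..1} \<Longrightarrow> dist y x < \<delta> \<Longrightarrow> dist (f y) (f x) < e"
    using e unfolding uniformly_continuous_on_def by meson
  obtain J where J: "(real d + 1) / \<delta> < 2 ^ J" using real_arch_pow[of 2 "(real d + 1) / \<delta>"] by auto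
  show ?thesis
  proof (intro exI allI impI)
    fix j assume "J \<le> j"
    then have "(2::real) ^ J \<le> 2 ^ j" by simp
    then have "(real d + 1) / \<delta> < 2 ^ j" using J by linarith
    then have h: "(real d + 1) / 2 ^ j < \<delta>" using \<delta>(1) by (simp add: field_simps)
    \<comment> \<open>Coefficients are sampled at the left knot: by the partition of unity the error
      at x averages f x - f(knot) over the splines alive at x, whose left knots are within (d+1)/2^j
      of x.\<close>
    define v where "v x = (\<Sum>k\<in>{1..2 ^ j + d}. f (knot d j k) * Bspl d j k x)" for x
    have "\<bar>f x - v x\<bar> \<le> e" if x: "x \<in> {0..1}" for x
    proof -
      have "f x - v x = (\<Sum>k\<in>{1..2 ^ j + d}. f x * Bspl d j k x) - v x"
        using Bspl_sum_1[OF x, of d j] by (simp flip: sum_distrib_left)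
      also have "\<dots> = (\<Sum>k\<in>{1..2 ^ j + d}. (f x - f (knot d j k)) * Bspl d j k x)"
        by (simp add: v_def sum_subtractf[symmetric] left_diff_distrib)
      finally have "\<bar>f x - v x\<bar> \<le> (\<Sum>k\<in>{1..2 ^ j + d}. \<bar>(f x - f (knot d j k)) * Bspl d j k x\<bar>)" by simp
      also have "\<dots> \<le> (\<Sum>k\<in>{1..2 ^ j + d}. e * Bspl d j k x)"
      proof (rule sum_mono)
        fix k
        show "\<bar>(f x - f (knot d j k)) * Bspl d j k x\<bar> \<le> e * Bspl d j k x"
        proof (cases "Bspl d j k x = 0")
          case False
          then have s: "knot d j k \<le> x" "x \<le> knot d j (k + d + 1)"
            using bsp_support[of d j d k x] by (auto simp: Bspl_def)
          have "\<bar>x - knot d j k\<bar> < \<delta>" using s h knot_diff[of d j k "d + 1"] by (simp add: add_ac)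
          then have "\<bar>f x - f (knot d j k)\<bar> < e"
            using \<delta>(2)[of "knot d j k" x] x knot_ge0 knot_le1 by (simp add: dist_real_def)
          moreover have "0 \<le> Bspl d j k x" by (simp add: Bspl_def bsp_nonneg)
          ultimately show ?thesis by (simp add: abs_mult mult_right_mono)
        qed simp
      qed
      also have "\<dots> = e" using Bspl_sum_1[OF x, of d j] by (simp flip: sum_distrib_left)
      finally show ?thesis .
    qed
    moreover have "v \<in> Vsp d j" unfolding Vsp_def v_def by (intro CollectI exI[of _ "\<lambda>k. f (knot d j k)"]) auto
    ultimately show "\<exists>v\<in>Vsp d j. \<forall>x\<in>{0..1}. \<bar>f x - v x\<bar> \<le> e" by blast
  qed
qed

lemma l2sq_lower:
  assumes g: "bdd01 g" and ab: "a < b" "{a..b} \<subseteq> {0..1}" and e: "0 \<le> e"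
    and lo: "\<And>y. y \<in> {a..b} \<Longrightarrow> e \<le> \<bar>g y\<bar>"
  shows "e\<^sup>2 * (b - a) \<le> l2sq g"
proof -
  define h :: "real \<Rightarrow> real" where "h y = e * indicator {a..b} y" for y
  have h: "bdd01 h" unfolding h_def by (rule bdd01I[where C=e]) (use e in \<open>auto simp: indicator_def\<close>)
  have "indicator {0..1} x *\<^sub>R (h x * h x) = e\<^sup>2 * indicator {a..b} x" for x
    using ab by (auto simp: h_def indicator_def power2_eq_square)
  then have "l2sq h = e\<^sup>2 * (b - a)"
    using ab(1) by (simp add: l2sq_def inner01_def set_lebesgue_integral_def)
  moreover have "l2sq h \<le> l2sq g"
    by (rule l2sq_mono[OF h g]) (use lo e in \<open>auto simp: h_def indicator_def\<close>)
  ultimately show ?thesis by simp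
qed

text \<open>On the cell of x the difference is continuous, so a strict inequality at x persists on a
  nondegenerate interval (to the right of x, or to the left if x = 1). This is the bridge from
  mean-square statements to statements at every point.\<close>

lemma ppoly_interval:
  assumes g: "ppoly d N g" and N: "0 < N" and f: "continuous_on {0..1} f" and x: "x \<in> {0..1}" and e: "e < \<bar>g x - f x\<bar>"
  shows "\<exists>a b. a < b \<and> {a..b} \<subseteq> {0..1} \<and> (\<forall>y\<in>{a..b}. e < \<bar>g y - f y\<bar>)"
proof -
  define c where "c = cidx N x"
  have c: "c < N" "x \<in> cell N c" using cidx_less cell_cidx N x by (auto simp: c_def)
  obtain q where q: "\<forall>x\<in>cell N c. g x = poly q x" using ppolyE[OF g c(1)] by blast
  define \<phi> where "\<phi> y = \<bar>poly q y - f y\<bar>" for y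
  have "continuous_on {0..1} \<phi>" unfolding \<phi>_def by (intro continuous_intros f)
  moreover have "0 < \<phi> x - e" using e q c by (simp add: \<phi>_def)
  ultimately obtain \<delta> where \<delta>: "0 < \<delta>" "\<And>y. y \<in> {0..1} \<Longrightarrow> dist y x < \<delta> \<Longrightarrow> dist (\<phi> y) (\<phi> x) < \<phi> x - e"
    using x unfolding continuous_on_iff by meson
  have pos: "e < \<bar>g y - f y\<bar>" if "y \<in> cell N c" "\<bar>y - x\<bar> < \<delta>" for y
  proof -
    have "y \<in> {0..1}" using that cell_subset[OF c(1)] by auto
    then have "dist (\<phi> y) (\<phi> x) < \<phi> x - e" using \<delta>(2) that by (simp add: dist_real_def)
    then have "e < \<phi> y" by (simp add: dist_real_def abs_less_iff)
    then show ?thesis using q that by (simp add: \<phi>_def)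
  qed
  show ?thesis
  proof (cases "x = 1")
    case True
    then have SN: "Suc c = N" using c by (auto simp: cell_def field_simps split: if_splits)
    define a where "a = max (real c / real N) (1 - \<delta> / 2)"
    have "real c / real N < 1" "0 \<le> real c / real N" using c by auto
    then have "a < 1" "0 \<le> a" using \<delta>(1) unfolding a_def by linarith+
    moreover have "y \<in> cell N c \<and> \<bar>y - x\<bar> < \<delta>" if "y \<in> {a..1}" for y
      using that SN True \<delta>(1) N by (cases "y = 1") (auto simp: a_def cell_def)
    ultimately show ?thesis using pos by (intro exI[of _ a] exI[of _ 1]) auto
  next
    case False
    then have b: "real c / real N \<le> x" "x < real (Suc c) / real N" using c by (auto simp: cell_def split: if_splits)
    define E where "E = real (Suc c) / real N"
    define b where "b = min (x + \<delta> / 2) ((x + E) / 2)"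
    have "x < E" using b by (simp add: E_def)
    then have "x < (x + E) / 2" "(x + E) / 2 < E" by auto
    then have "x < b" "b < E" using \<delta>(1) unfolding b_def min_less_iff_conj min_less_iff_disj by auto
    then have "x < b" "b < real (Suc c) / real N" by (auto simp: E_def)
    moreover have "real (Suc c) / real N \<le> 1" using c by simp
    ultimately have "x < b" "{x..b} \<subseteq> {0..1}" using x by auto
    moreover have "y \<in> cell N c \<and> \<bar>y - x\<bar> < \<delta>" if y: "y \<in> {x..b}" for y
    proof
      have "real c / real N \<le> y" "y < real (Suc c) / real N"
        using y b(1) \<open>b < real (Suc c) / real N\<close> by (auto intro: order_trans le_less_trans)
      then show "y \<in> cell N c" by (simp add: cell_def)
      have "b \<le> x + \<delta> / 2" by (simp add: b_def)
      then show "\<bar>y - x\<bar> < \<delta>" using y \<delta>(1) by auto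
    qed
    ultimately show ?thesis using pos by (intro exI[of _ x] exI[of _ b]) auto
  qed
qed

lemma ppoly_l2sq_eq_0:
  assumes g: "ppoly d N g" and N: "0 < N" and z: "l2sq g = 0" and x: "x \<in> {0..1}"
  shows "g x = 0"
proof (rule ccontr)
  assume "g x \<noteq> 0"
  then have "\<bar>g x\<bar> / 2 < \<bar>g x - 0\<bar>" by simp
  from ppoly_interval[OF g N continuous_on_const x this] obtain a b
    where ab: "a < b" "{a..b} \<subseteq> {0..1}" "\<forall>y\<in>{a..b}. \<bar>g x\<bar> / 2 < \<bar>g y\<bar>" by auto
  have "(\<bar>g x\<bar> / 2)\<^sup>2 * (b - a) \<le> l2sq g"
    by (rule l2sq_lower[OF ppoly_bdd01[OF g N] ab(1,2)]) (use ab in \<open>auto intro: less_imp_le\<close>)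
  moreover have "0 < (\<bar>g x\<bar> / 2)\<^sup>2 * (b - a)" using ab \<open>g x \<noteq> 0\<close> by simp
  ultimately show False using z by simp
qed

section \<open>Finite Riesz families\<close>

lemma inner01_cmult_right: "inner01 h (\<lambda>x. c * g x) = c * inner01 h g"
  by (simp add: inner01_commute[of h] inner01_cmult_left)

lemma inner01_add_right:
  assumes "bdd01 g" "bdd01 g'" "bdd01 h"
  shows "inner01 h (\<lambda>x. g x + g' x) = inner01 h g + inner01 h g'"
  using inner01_add_left[OF assms] by (simp add: inner01_commute)

lemma inner01_diff_right:
  assumes "bdd01 g" "bdd01 g'" "bdd01 h"
  shows "inner01 h (\<lambda>x. g x - g' x) = inner01 h g - inner01 h g'"
  using inner01_diff_left[OF assms] by (simp add: inner01_commute)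

lemma inner01_Cauchy_Schwarz:
  assumes "bdd01 g" "bdd01 h" shows "(inner01 g h)\<^sup>2 \<le> l2sq g * l2sq h"
proof (cases "l2sq g = 0")
  case True
  then show ?thesis using inner01_eq_0[OF assms] by simp
next
  case False
  then have pos: "0 < l2sq g" using l2sq_nonneg[of g] by simp
  define t where "t = - inner01 g h / l2sq g"
  have "0 \<le> l2sq (\<lambda>x. t * g x + h x)" by (rule l2sq_nonneg)
  also have "\<dots> = t\<^sup>2 * l2sq g + 2 * (t * inner01 g h) + l2sq h"
    using assms by (simp add: l2sq_add bdd01_cmult l2sq_cmult inner01_cmult_left)
  also have "\<dots> = l2sq h - (inner01 g h)\<^sup>2 / l2sq g"
    using pos by (simp add: t_def field_simps power2_eq_square)
  finally show ?thesis using pos by (simp add: field_simps)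
qed

lemma bdd01_lincomb: "(\<And>k. k \<in> K \<Longrightarrow> bdd01 (\<phi> k)) \<Longrightarrow> bdd01 (\<lambda>x. \<Sum>k\<in>K. c k * \<phi> k x)"
  by (intro bdd01_sum bdd01_cmult)

lemma l2sq_lincomb:
  assumes "\<And>k. k \<in> K \<Longrightarrow> bdd01 (\<phi> k)"
  shows "l2sq (\<lambda>x. \<Sum>k\<in>K. c k * \<phi> k x) = (\<Sum>l\<in>K. c l * (\<Sum>k\<in>K. c k * inner01 (\<phi> k) (\<phi> l)))"
proof -
  have b: "bdd01 (\<lambda>x. \<Sum>k\<in>K. c k * \<phi> k x)" by (intro bdd01_lincomb assms)
  show ?thesis unfolding l2sq_def
    using assms b by (simp add: inner01_lincomb_right inner01_lincomb_left)
qed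

text \<open>Existence by a Gram-Schmidt induction instead of matrix inversion: the residual r of the
  new function after projection on the old ones is orthogonal to them and nonzero by independence,
  so a multiple of r fixes the last equation without disturbing the others.\<close>

lemma gram_solve:
  assumes "finite K" "\<And>k. k \<in> K \<Longrightarrow> bdd01 (\<phi> k)"
    and "\<And>c. l2sq (\<lambda>x. \<Sum>k\<in>K. c k * \<phi> k x) = 0 \<Longrightarrow> \<forall>k\<in>K. c k = 0"
  shows "\<exists>c. \<forall>l\<in>K. inner01 (\<lambda>x. \<Sum>k\<in>K. c k * \<phi> k x) (\<phi> l) = L l"
  using assms
proof (induction K arbitrary: L rule: finite_induct)
  case (insert m K)
  have b: "\<And>k. k \<in> K \<Longrightarrow> bdd01 (\<phi> k)" and bm: "bdd01 (\<phi> m)" using insert.prems(1) by auto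
  have ind: "\<forall>k\<in>K. c k = 0" if z: "l2sq (\<lambda>x. \<Sum>k\<in>K. c k * \<phi> k x) = 0" for c
  proof
    fix k assume k: "k \<in> K"
    define c' where "c' k = (if k = m then 0 else c k)" for k
    have "(\<lambda>x. \<Sum>k\<in>insert m K. c' k * \<phi> k x) = (\<lambda>x. \<Sum>k\<in>K. c k * \<phi> k x)"
      using insert.hyps by (auto simp: c'_def intro!: ext sum.cong)
    then have "c' k = 0" using insert.prems(2)[of c'] z k by simp
    then show "c k = 0" using k insert.hyps by (auto simp: c'_def split: if_splits)
  qed
  note IH = insert.IH[OF b ind]
  obtain a where a: "\<forall>l\<in>K. inner01 (\<lambda>x. \<Sum>k\<in>K. a k * \<phi> k x) (\<phi> l) = inner01 (\<phi> m) (\<phi> l)"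
    using IH[of "\<lambda>l. inner01 (\<phi> m) (\<phi> l)"] by blast
  obtain c where c: "\<forall>l\<in>K. inner01 (\<lambda>x. \<Sum>k\<in>K. c k * \<phi> k x) (\<phi> l) = L l"
    using IH[of L] by blast
  define p where "p x = (\<Sum>k\<in>K. a k * \<phi> k x)" for x
  define r where "r x = \<phi> m x - p x" for x
  define g where "g x = (\<Sum>k\<in>K. c k * \<phi> k x)" for x
  have bp: "bdd01 p" and bg: "bdd01 g" unfolding p_def g_def by (intro bdd01_lincomb b, simp)+
  have br: "bdd01 r" unfolding r_def by (intro bdd01_diff bm bp)
  have r_l: "inner01 r (\<phi> l) = 0" if "l \<in> K" for l
  proof -
    have "inner01 p (\<phi> l) = inner01 (\<phi> m) (\<phi> l)" using a that by (simp add: p_def[abs_def])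
    then show ?thesis using inner01_diff_left[OF bm bp b[OF that]] by (simp add: r_def[abs_def])
  qed
  have "inner01 r p = 0"
    unfolding p_def[abs_def] using b br r_l by (simp add: inner01_lincomb_right)
  moreover have "l2sq r = inner01 r (\<phi> m) - inner01 r p"
    unfolding l2sq_def using inner01_diff_right[OF bm bp br] by (simp add: r_def[abs_def])
  ultimately have r_m: "inner01 r (\<phi> m) = l2sq r" by simp
  define a' where "a' k = (if k = m then 1 else - a k)" for k
  have ra: "r x = (\<Sum>k\<in>insert m K. a' k * \<phi> k x)" for x
  proof -
    have "(\<Sum>k\<in>insert m K. a' k * \<phi> k x) = \<phi> m x + (\<Sum>k\<in>K. a' k * \<phi> k x)"
      using insert.hyps by (simp add: a'_def)
    also have "(\<Sum>k\<in>K. a' k * \<phi> k x) = (\<Sum>k\<in>K. - (a k * \<phi> k x))"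
      using insert.hyps by (intro sum.cong) (auto simp: a'_def)
    finally show ?thesis by (simp add: r_def p_def sum_negf)
  qed
  have "l2sq r \<noteq> 0"
  proof
    assume "l2sq r = 0"
    then have "a' m = 0" using insert.prems(2)[of a'] by (simp add: ra[abs_def])
    then show False by (simp add: a'_def)
  qed
  define t where "t = (L m - inner01 g (\<phi> m)) / l2sq r"
  define c' where "c' k = (if k = m then 0 else c k) + t * a' k" for k
  have "(\<Sum>k\<in>insert m K. c' k * \<phi> k x) = g x + t * r x" for x
  proof -
    have "(\<Sum>k\<in>insert m K. c' k * \<phi> k x)
      = (\<Sum>k\<in>insert m K. (if k = m then 0 else c k) * \<phi> k x) + (\<Sum>k\<in>insert m K. t * (a' k * \<phi> k x))"
      unfolding sum.distrib[symmetric] by (rule sum.cong) (auto simp: c'_def algebra_simps)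
    also have "(\<Sum>k\<in>insert m K. (if k = m then 0 else c k) * \<phi> k x) = g x"
      using insert.hyps by (auto simp: g_def intro!: sum.cong)
    finally show ?thesis by (simp only: ra sum_distrib_left)
  qed
  then have "inner01 (\<lambda>x. \<Sum>k\<in>insert m K. c' k * \<phi> k x) h = inner01 g h + t * inner01 r h" if "bdd01 h" for h
    using that bg br by (simp add: inner01_add_left bdd01_cmult inner01_cmult_left)
  moreover have "inner01 g (\<phi> m) + t * inner01 r (\<phi> m) = L m" using \<open>l2sq r \<noteq> 0\<close> by (simp add: t_def r_m)
  moreover have "inner01 g (\<phi> l) + t * inner01 r (\<phi> l) = L l" if "l \<in> K" for l
    using that c r_l by (simp add: g_def[abs_def])
  ultimately show ?case using b bm by (intro exI[of _ c']) auto
qed simp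

text \<open>The inverse Gram matrix has l2 operator norm at most 1/A: the quadratic form of w equals
  the pairing of w with v, which Cauchy-Schwarz bounds by |w| |v|.\<close>

lemma gram_inverse_bound:
  assumes K: "finite K" "\<And>k. k \<in> K \<Longrightarrow> bdd01 (\<phi> k)" and A: "0 < A"
    and low: "\<And>c. A * (\<Sum>k\<in>K. (c k)\<^sup>2) \<le> l2sq (\<lambda>x. \<Sum>k\<in>K. c k * \<phi> k x)"
    and w: "\<And>l. l \<in> K \<Longrightarrow> (\<Sum>k\<in>K. w k * inner01 (\<phi> k) (\<phi> l)) = v l"
  shows "(\<Sum>k\<in>K. (w k)\<^sup>2) \<le> (\<Sum>k\<in>K. (v k)\<^sup>2) / A\<^sup>2"
proof -
  define W V where "W = (\<Sum>k\<in>K. (w k)\<^sup>2)" and "V = (\<Sum>k\<in>K. (v k)\<^sup>2)"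
  have W0: "0 \<le> W" and V0: "0 \<le> V" by (auto simp: W_def V_def intro: sum_nonneg)
  have "A * W \<le> l2sq (\<lambda>x. \<Sum>k\<in>K. w k * \<phi> k x)" using low unfolding W_def .
  also have "\<dots> = (\<Sum>l\<in>K. w l * v l)" using w by (simp add: l2sq_lincomb[OF K(2)])
  finally have 1: "A * W \<le> (\<Sum>l\<in>K. w l * v l)" .
  have "(A * W)\<^sup>2 \<le> (\<Sum>l\<in>K. w l * v l)\<^sup>2" using 1 A W0 by (intro power_mono) auto
  also have "\<dots> \<le> W * V" unfolding W_def V_def by (rule Cauchy_Schwarz_ineq_sum)
  finally have 2: "(A\<^sup>2 * W) * W \<le> V * W" by (simp add: power2_eq_square mult_ac)
  have "A\<^sup>2 * W \<le> V"
  proof (cases "W = 0")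
    case False
    then show ?thesis using 2 W0 by simp
  qed (use V0 in simp)
  then show ?thesis using A unfolding W_def V_def by (simp add: field_simps)
qed

section \<open>The dual wavelets\<close>

text \<open>The bound \<open>1 \<le> j0 d\<close> makes the truncated subtraction in the coarse
  index \<open>j0 d - 1\<close> genuine, so that this index differs from all wavelet levels.\<close>

lemma j0_prop: "1 \<le> j0 d \<and> 2 * d + 1 \<le> 2 ^ j0 d"
proof -
  have "2 * d + 1 \<le> 2 ^ (2 * d + 1)" using less_exp[of "2 * d + 1"] by simp
  then have "1 \<le> 2 * d + 1 \<and> 2 * d + 1 \<le> 2 ^ (2 * d + 1)" by simp
  then show ?thesis unfolding j0_def by (rule LeastI[where P="\<lambda>j. 1 \<le> j \<and> 2 * d + 1 \<le> 2 ^ j"])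
qed

locale jia =
  fixes d :: nat and \<psi> :: "nat \<Rightarrow> nat \<Rightarrow> real \<Rightarrow> real" and c\<psi> :: real
  assumes jia: "jia_wavelets d \<psi> c\<psi>"
begin

abbreviation \<phi> where "\<phi> \<equiv> psiF d \<psi>"
abbreviation K where "K \<equiv> Mset d"
abbreviation dual where "dual \<equiv> dualpsi d \<psi>"

lemma finite_K: "finite (K j)" by (simp add: Mset_def)

lemma psi_Usp: "j0 d \<le> j \<Longrightarrow> k \<in> {1..2 ^ j} \<Longrightarrow> \<psi> j k \<in> Usp d j \<and> l2sq (\<psi> j k) = 1"
  using jia unfolding jia_wavelets_def by blast

lemma level_cases:
  assumes "j0 d - 1 \<le> j"
  obtains "j = j0 d - 1" | "j0 d \<le> j" "j \<noteq> j0 d - 1"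
  using assms j0_prop[of d] by (cases "j = j0 d - 1") auto

lemma coarse_simps: "\<phi> (j0 d - 1) = nBspl d (j0 d)" "K (j0 d - 1) = {1..2 ^ j0 d + d}" "Wsp d (j0 d - 1) = Vsp d (j0 d)"
  by (auto simp: psiF_def Mset_def Wsp_def fun_eq_iff)

lemma fine_simps:
  assumes "j0 d \<le> j"
  shows "\<phi> j = \<psi> j" "K j = {1..2 ^ j}" "Wsp d j = Usp d j"
  using assms j0_prop[of d] by (auto simp: psiF_def Mset_def Wsp_def fun_eq_iff)

lemma Bspl_l2sq_pos: assumes "k \<in> {1..2 ^ j + d}" shows "0 < l2sq (Bspl d j k)"
proof (rule ccontr)
  assume "\<not> 0 < l2sq (Bspl d j k)"
  then have z: "l2sq (Bspl d j k) = 0" using l2sq_nonneg[of "Bspl d j k"] by simp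
  have "Bspl d j k x = 0" for x
    using ppoly_l2sq_eq_0[OF Vsp_ppoly[OF Bspl_Vsp[OF assms]] _ z, of x] Bspl_outside[of x d j k]
    by (cases "x \<in> {0..1}") auto
  then have "(\<Sum>i\<in>{1..2 ^ j + d}. (if i = k then 1 else 0) * Bspl d j i x) = 0" for x
    by (intro sum.neutral) auto
  from Bspl_independent[OF this assms] show False by simp
qed

lemma Bspl_l2_independent:
  assumes z: "l2sq (\<lambda>x. \<Sum>k\<in>{1..2 ^ j + d}. c k * Bspl d j k x) = 0" and k: "k \<in> {1..2 ^ j + d}"
  shows "c k = 0"
proof (rule Bspl_independent[OF _ k])
  fix x
  have v: "(\<lambda>x. \<Sum>k\<in>{1..2 ^ j + d}. c k * Bspl d j k x) \<in> Vsp d j" by (intro Vsp_lincomb Bspl_Vsp)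
  show "(\<Sum>k\<in>{1..2 ^ j + d}. c k * Bspl d j k x) = 0"
    using ppoly_l2sq_eq_0[OF Vsp_ppoly[OF v] _ z, of x] Vsp_outside[OF v, of x] by (cases "x \<in> {0..1}") auto
qed

lemma Wsp_Vsp: "j0 d - 1 \<le> j \<Longrightarrow> g \<in> Wsp d j \<Longrightarrow> g \<in> Vsp d (Suc j)"
  using j0_prop[of d] by (cases "j = j0 d - 1") (auto simp: Wsp_def Usp_def)

lemma Usp_lincomb:
  assumes "\<And>i. i \<in> I \<Longrightarrow> g i \<in> Usp d j"
  shows "(\<lambda>x. \<Sum>i\<in>I. c i * g i x) \<in> Usp d j"
  unfolding Usp_def
proof (intro CollectI conjI ballI)
  show "(\<lambda>x. \<Sum>i\<in>I. c i * g i x) \<in> Vsp d (Suc j)" using assms by (intro Vsp_lincomb) (auto simp: Usp_def)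
  fix h assume h: "h \<in> Vsp d j"
  then show "inner01 (\<lambda>x. \<Sum>i\<in>I. c i * g i x) h = 0"
    using assms by (subst inner01_lincomb_left) (auto simp: Usp_def intro: Vsp_bdd01 intro!: sum.neutral)
qed

lemma phi_Wsp:
  assumes "j0 d - 1 \<le> j" "k \<in> K j" shows "\<phi> j k \<in> Wsp d j"
  using assms(1)
proof (cases rule: level_cases)
  case 1
  have "nBspl d (j0 d) k = (\<lambda>x. (1 / sqrt (l2sq (Bspl d (j0 d) k))) * Bspl d (j0 d) k x)"
    by (simp add: nBspl_def fun_eq_iff)
  moreover have "\<dots> \<in> Vsp d (j0 d)"
    by (intro Vsp_cmult Bspl_Vsp) (use assms(2) in \<open>simp add: 1 Mset_def\<close>)
  ultimately show ?thesis unfolding 1 coarse_simps by simp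
next
  case 2
  then show ?thesis using psi_Usp[of j k] assms by (simp add: fine_simps)
qed

lemma phi_Vsp: "j0 d - 1 \<le> j \<Longrightarrow> k \<in> K j \<Longrightarrow> \<phi> j k \<in> Vsp d (Suc j)"
  by (intro Wsp_Vsp phi_Wsp)

lemma phi_bdd01: "j0 d - 1 \<le> j \<Longrightarrow> k \<in> K j \<Longrightarrow> bdd01 (\<phi> j k)"
  by (intro Vsp_bdd01[OF phi_Vsp])

lemma Wsp_lincomb:
  assumes "\<And>i. i \<in> I \<Longrightarrow> g i \<in> Wsp d j"
  shows "(\<lambda>x. \<Sum>i\<in>I. c i * g i x) \<in> Wsp d j"
proof (cases "j = j0 d - 1")
  case True
  then show ?thesis using assms Vsp_lincomb[of I g d "j0 d" c] by (simp add: Wsp_def)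
next
  case False
  then show ?thesis using assms Usp_lincomb[of I g j c] by (simp add: Wsp_def)
qed

lemma Wsp_span:
  assumes "j0 d - 1 \<le> j" "g \<in> Wsp d j" shows "\<exists>c. g = (\<lambda>x. \<Sum>k\<in>K j. c k * \<phi> j k x)"
  using assms(1)
proof (cases rule: level_cases)
  case 1
  let ?s = "\<lambda>k. sqrt (l2sq (Bspl d (j0 d) k))"
  from assms(2) obtain c where "g = (\<lambda>x. \<Sum>k\<in>{1..2 ^ j0 d + d}. c k * Bspl d (j0 d) k x)"
    unfolding 1 coarse_simps by (auto simp: Vsp_def)
  also have "\<dots> = (\<lambda>x. \<Sum>k\<in>{1..2 ^ j0 d + d}. (c k * ?s k) * nBspl d (j0 d) k x)"
  proof (rule ext, rule sum.cong[OF refl])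
    fix x k assume "k \<in> {1..2 ^ j0 d + d}"
    then have "?s k \<noteq> 0" using Bspl_l2sq_pos[of k "j0 d"] by simp
    then show "c k * Bspl d (j0 d) k x = (c k * ?s k) * nBspl d (j0 d) k x" by (simp add: nBspl_def)
  qed
  finally show ?thesis unfolding 1 coarse_simps by (rule exI[of _ "\<lambda>k. c k * ?s k"])
next
  case 2
  have "\<forall>g\<in>Usp d j. \<exists>c. g = (\<lambda>x. \<Sum>k\<in>{1..2 ^ j}. c k * \<psi> j k x)"
    using jia 2 unfolding jia_wavelets_def by blast
  then show ?thesis using assms(2) 2 by (simp add: fine_simps)
qed

definition Af :: real where
  "Af = (SOME A. 0 < A \<and> (\<exists>B>0. \<forall>j\<ge>j0 d. \<forall>c::nat \<Rightarrow> real.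
         A * (\<Sum>k\<in>{1..2^j}. (c k)\<^sup>2) \<le> l2sq (\<lambda>x. \<Sum>k\<in>{1..2^j}. c k * \<psi> j k x)
       \<and> l2sq (\<lambda>x. \<Sum>k\<in>{1..2^j}. c k * \<psi> j k x) \<le> B * (\<Sum>k\<in>{1..2^j}. (c k)\<^sup>2)))"

lemma Af_ex: "0 < Af \<and> (\<exists>B>0. \<forall>j\<ge>j0 d. \<forall>c::nat \<Rightarrow> real.
         Af * (\<Sum>k\<in>{1..2^j}. (c k)\<^sup>2) \<le> l2sq (\<lambda>x. \<Sum>k\<in>{1..2^j}. c k * \<psi> j k x)
       \<and> l2sq (\<lambda>x. \<Sum>k\<in>{1..2^j}. c k * \<psi> j k x) \<le> B * (\<Sum>k\<in>{1..2^j}. (c k)\<^sup>2))"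
  unfolding Af_def by (rule someI_ex) (use jia in \<open>unfold jia_wavelets_def, blast\<close>)

lemma Af_pos: "0 < Af"
  using Af_ex by (rule conjunct1)

lemma Af_low:
  "j0 d \<le> j \<Longrightarrow> Af * (\<Sum>k\<in>{1..2^j}. (c k)\<^sup>2) \<le> l2sq (\<lambda>x. \<Sum>k\<in>{1..2^j}. c k * \<psi> j k x)"
  using conjunct2[OF Af_ex] by blast

lemma phi_independent:
  assumes j: "j0 d - 1 \<le> j" and z: "l2sq (\<lambda>x. \<Sum>k\<in>K j. c k * \<phi> j k x) = 0"
  shows "\<forall>k\<in>K j. c k = 0"
proof
  fix k assume k: "k \<in> K j"
  show "c k = 0"
  using j
proof (cases rule: level_cases)
  case 1
  let ?s = "\<lambda>k. sqrt (l2sq (Bspl d (j0 d) k))"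
  have "(\<lambda>x. \<Sum>k\<in>K j. c k * \<phi> j k x) = (\<lambda>x. \<Sum>k\<in>{1..2 ^ j0 d + d}. (c k / ?s k) * Bspl d (j0 d) k x)"
    unfolding 1 coarse_simps by (simp add: nBspl_def)
  then have "c k / ?s k = 0" using Bspl_l2_independent[where j="j0 d" and c="\<lambda>k. c k / ?s k" and k=k] z k
    unfolding 1 coarse_simps by simp
  moreover have "0 < ?s k" using Bspl_l2sq_pos[of k "j0 d"] k unfolding 1 coarse_simps by simp
  ultimately show ?thesis by simp
next
  case 2
  have "Af * (\<Sum>k\<in>{1..2^j}. (c k)\<^sup>2) \<le> 0"
    using Af_low[OF 2(1), of c] z by (simp add: fine_simps[OF 2(1)])
  then have "(\<Sum>k\<in>{1..2^j}. (c k)\<^sup>2) \<le> 0" using Af_pos by (simp add: mult_le_0_iff)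
  then have "(\<Sum>k\<in>{1..2^j}. (c k)\<^sup>2) = 0" by (intro antisym sum_nonneg) auto
  then have "\<forall>k\<in>{1..2^j}. (c k)\<^sup>2 = 0" by (subst (asm) sum_nonneg_eq_0_iff) auto
  then show ?thesis using k 2 by (auto simp: fine_simps)
qed
qed

lemma Wsp_eqI:
  assumes j: "j0 d - 1 \<le> j" and g: "g \<in> Wsp d j" and h: "h \<in> Wsp d j"
    and eq: "\<And>l. l \<in> K j \<Longrightarrow> inner01 g (\<phi> j l) = inner01 h (\<phi> j l)"
  shows "g = h"
proof -
  obtain a where a: "g = (\<lambda>x. \<Sum>k\<in>K j. a k * \<phi> j k x)" using Wsp_span[OF j g] by blast
  obtain b where b: "h = (\<lambda>x. \<Sum>k\<in>K j. b k * \<phi> j k x)" using Wsp_span[OF j h] by blast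
  have bg: "bdd01 g" "bdd01 h" using g h Wsp_Vsp[OF j] Vsp_bdd01 by blast+
  have "(\<lambda>x. \<Sum>k\<in>K j. (a k - b k) * \<phi> j k x) = (\<lambda>x. g x - h x)"
    unfolding a b by (simp add: left_diff_distrib sum_subtractf)
  note e = this
  have "l2sq (\<lambda>x. g x - h x) = 0"
  proof -
    have bd: "bdd01 (\<lambda>x. g x - h x)" by (intro bdd01_diff bg)
    have "inner01 (\<lambda>x. g x - h x) (\<lambda>x. \<Sum>k\<in>K j. (a k - b k) * \<phi> j k x)
       = (\<Sum>k\<in>K j. (a k - b k) * inner01 (\<lambda>x. g x - h x) (\<phi> j k))"
      by (intro inner01_lincomb_right bd phi_bdd01 j)
    also have "\<dots> = 0" by (intro sum.neutral) (auto simp: inner01_diff_left bg phi_bdd01[OF j] eq)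
    finally show ?thesis using e by (simp add: l2sq_def)
  qed
  then have "a k - b k = 0" if "k \<in> K j" for k
    using phi_independent[OF j, of "\<lambda>k. a k - b k"] that e by simp
  then show ?thesis unfolding a b by (intro ext sum.cong) auto
qed

text \<open>For a basis the frame dual is the biorthogonal system: \<open>frameop\<close> sums
  \<open>inner01 g (\<phi> j l) * \<phi> j l\<close>, which equals \<open>\<phi> j k\<close> exactly
  when the inner products are Kronecker deltas. Solvability of the Gram system gives existence,
  independence the uniqueness on which \<open>THE\<close> rests.\<close>

lemma dual_prop:
  assumes j: "j0 d - 1 \<le> j" and k: "k \<in> K j"
  shows "dual j k \<in> Wsp d j \<and> (\<forall>l\<in>K j. inner01 (dual j k) (\<phi> j l) = (if l = k then 1 else 0))"
proof -
  obtain c where c: "\<forall>l\<in>K j. inner01 (\<lambda>x. \<Sum>k\<in>K j. c k * \<phi> j k x) (\<phi> j l) = (if l = k then 1 else 0)"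
    using gram_solve[of "K j" "\<phi> j" "\<lambda>l. if l = k then 1 else 0", OF finite_K phi_bdd01[OF j] phi_independent[OF j]] by blast
  define g where "g x = (\<Sum>k\<in>K j. c k * \<phi> j k x)" for x
  have gW: "g \<in> Wsp d j" unfolding g_def by (intro Wsp_lincomb phi_Wsp j)
  have gl: "inner01 g (\<phi> j l) = (if l = k then 1 else 0)" if "l \<in> K j" for l
    using c that by (simp add: g_def[abs_def])
  have "dual j k = g"
    unfolding dualpsi_def
  proof (rule the_equality, intro conjI gW)
    show "frameop d \<psi> j g = \<phi> j k"
    proof
      fix x
      have "frameop d \<psi> j g x = (\<Sum>l\<in>K j. if l = k then \<phi> j l x else 0)"
        unfolding frameop_def by (rule sum.cong) (auto simp: gl)
      then show "frameop d \<psi> j g x = \<phi> j k x" using k by (simp add: finite_K)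
    qed
  next
    fix h assume h: "h \<in> Wsp d j \<and> frameop d \<psi> j h = \<phi> j k"
    define e where "e l = inner01 h (\<phi> j l) - (if l = k then 1 else 0)" for l
    have "(\<Sum>l\<in>K j. e l * \<phi> j l x) = 0" for x
    proof -
      have "(\<Sum>l\<in>K j. e l * \<phi> j l x) = frameop d \<psi> j h x - (\<Sum>l\<in>K j. if l = k then \<phi> j l x else 0)"
        unfolding frameop_def e_def sum_subtractf[symmetric]
        by (rule sum.cong) (auto simp: left_diff_distrib)
      then show ?thesis using h k by (simp add: finite_K)
    qed
    then have "l2sq (\<lambda>x. \<Sum>l\<in>K j. e l * \<phi> j l x) = 0" using l2sq_const[of 0] by simp
    then have "e l = 0" if "l \<in> K j" for l using phi_independent[OF j, of e] that by simp
    then show "h = g" using h gl by (intro Wsp_eqI[OF j _ gW]) (auto simp: e_def)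
  qed
  then show ?thesis using gW gl by simp
qed

lemma dual_Vsp: "j0 d - 1 \<le> j \<Longrightarrow> k \<in> K j \<Longrightarrow> dual j k \<in> Vsp d (Suc j)"
  using dual_prop Wsp_Vsp by blast

lemma dual_bdd01: "j0 d - 1 \<le> j \<Longrightarrow> k \<in> K j \<Longrightarrow> bdd01 (dual j k)"
  by (intro Vsp_bdd01[OF dual_Vsp])

definition lproj :: "nat \<Rightarrow> (real \<Rightarrow> real) \<Rightarrow> real \<Rightarrow> real" where
  "lproj j f x = (\<Sum>k\<in>K j. inner01 f (\<phi> j k) * dual j k x)"

lemma lproj_Wsp: "j0 d - 1 \<le> j \<Longrightarrow> lproj j f \<in> Wsp d j"
  unfolding lproj_def[abs_def] using dual_prop by (intro Wsp_lincomb) auto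

lemma lproj_inner:
  assumes "j0 d - 1 \<le> j" "l \<in> K j"
  shows "inner01 (lproj j f) (\<phi> j l) = inner01 f (\<phi> j l)"
proof -
  have "inner01 (lproj j f) (\<phi> j l) = (\<Sum>k\<in>K j. inner01 f (\<phi> j k) * inner01 (dual j k) (\<phi> j l))"
    unfolding lproj_def[abs_def] using assms by (intro inner01_lincomb_left phi_bdd01 dual_bdd01)
  also have "\<dots> = (\<Sum>k\<in>K j. if k = l then inner01 f (\<phi> j k) else 0)"
    using assms dual_prop[of j] by (intro sum.cong) auto
  finally show ?thesis using assms by (simp add: finite_K)
qed

lemma lproj_orth:
  assumes j: "j0 d - 1 \<le> j" and f: "bdd01 f" and h: "h \<in> Wsp d j"
  shows "inner01 (\<lambda>x. f x - lproj j f x) h = 0"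
proof -
  obtain c where c: "h = (\<lambda>x. \<Sum>k\<in>K j. c k * \<phi> j k x)" using Wsp_span[OF j h] by blast
  have bl: "bdd01 (lproj j f)" using lproj_Wsp[OF j] Wsp_Vsp[OF j] Vsp_bdd01 by blast
  have "inner01 (\<lambda>x. f x - lproj j f x) h = (\<Sum>k\<in>K j. c k * inner01 (\<lambda>x. f x - lproj j f x) (\<phi> j k))"
    unfolding c using f bl j by (intro inner01_lincomb_right bdd01_diff phi_bdd01) auto
  also have "\<dots> = 0"
    by (intro sum.neutral) (auto simp: inner01_diff_left f bl phi_bdd01[OF j] lproj_inner[OF j])
  finally show ?thesis .
qed

text \<open>At a fixed x the Gram matrix maps the vector of dual values to the vector of wavelet
  values. Every pointwise estimate of the duals is obtained by inverting this relation.\<close>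

lemma dual_gram:
  assumes j: "j0 d - 1 \<le> j" and l: "l \<in> K j"
  shows "(\<Sum>k\<in>K j. dual j k x * inner01 (\<phi> j k) (\<phi> j l)) = \<phi> j l x"
proof -
  have "lproj j (\<phi> j l) = \<phi> j l"
    by (rule Wsp_eqI[OF j lproj_Wsp[OF j] phi_Wsp[OF j l]]) (simp add: lproj_inner[OF j])
  then have "\<phi> j l x = lproj j (\<phi> j l) x" by simp
  then show ?thesis by (simp add: lproj_def inner01_commute[of "\<phi> j l"] mult.commute)
qed

text \<open>Coefficients are recovered as inner products with the duals. The constant depends on the
  level, which is harmless: it serves only for the single coarse level, on which the Riesz bounds of
  \<open>jia_wavelets\<close> are silent.\<close>

lemma phi_riesz_lower:
  assumes j: "j0 d - 1 \<le> j"
  shows "(\<Sum>k\<in>K j. (c k)\<^sup>2) \<le> (\<Sum>k\<in>K j. l2sq (dual j k)) * l2sq (\<lambda>x. \<Sum>k\<in>K j. c k * \<phi> j k x)"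
proof -
  define g where "g x = (\<Sum>k\<in>K j. c k * \<phi> j k x)" for x
  have bg: "bdd01 g" unfolding g_def by (intro bdd01_lincomb phi_bdd01 j)
  have "(c l)\<^sup>2 \<le> l2sq (dual j l) * l2sq g" if l: "l \<in> K j" for l
  proof -
    have "inner01 (dual j l) g = (\<Sum>k\<in>K j. c k * inner01 (dual j l) (\<phi> j k))"
      unfolding g_def[abs_def] using l j by (intro inner01_lincomb_right dual_bdd01 phi_bdd01)
    also have "\<dots> = (\<Sum>k\<in>K j. if k = l then c k else 0)"
      using dual_prop[OF j l] by (intro sum.cong) auto
    also have "\<dots> = c l" using l by (simp add: finite_K)
    finally show ?thesis using inner01_Cauchy_Schwarz[OF dual_bdd01[OF j l] bg] by simp
  qed
  then have "(\<Sum>k\<in>K j. (c k)\<^sup>2) \<le> (\<Sum>k\<in>K j. l2sq (dual j k) * l2sq g)" by (rule sum_mono)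
  then show ?thesis by (simp add: sum_distrib_right g_def[abs_def])
qed

end

section \<open>Counting overlapping supports\<close>

text \<open>A wavelet index k matters only through its integer shift \<open>m k\<close>; bounded
  multiplicity turns sums over k into sums over integers.\<close>

lemma sum_fibre_le:
  fixes g :: "int \<Rightarrow> real" and m :: "nat \<Rightarrow> int"
  assumes A: "finite A" and N: "\<And>i. card {k \<in> A. m k = i} \<le> N0" and g: "\<And>i. 0 \<le> g i"
  shows "(\<Sum>k\<in>A. g (m k)) \<le> real N0 * (\<Sum>i\<in>m ` A. g i)"
proof -
  have "(\<Sum>k\<in>A. g (m k)) = (\<Sum>i\<in>m ` A. \<Sum>k\<in>{k \<in> A. m k = i}. g (m k))"
    using A by (intro sum.group[symmetric]) auto
  also have "\<dots> = (\<Sum>i\<in>m ` A. real (card {k \<in> A. m k = i}) * g i)"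
    by (intro sum.cong) auto
  also have "\<dots> \<le> (\<Sum>i\<in>m ` A. real N0 * g i)"
    using N g by (intro sum_mono mult_right_mono) auto
  finally show ?thesis by (simp add: sum_distrib_left)
qed

lemma card_int_near:
  fixes y R :: real assumes "0 \<le> R"
  shows "finite {i::int. \<bar>of_int i - y\<bar> \<le> R}" "real (card {i::int. \<bar>of_int i - y\<bar> \<le> R}) \<le> 2 * R + 1"
proof -
  have e: "{i::int. \<bar>of_int i - y\<bar> \<le> R} = {\<lceil>y - R\<rceil>..\<lfloor>y + R\<rfloor>}"
    by (auto simp: ceiling_le_iff le_floor_iff abs_le_iff)
  show "finite {i::int. \<bar>of_int i - y\<bar> \<le> R}" unfolding e by simp
  have "of_int (\<lfloor>y + R\<rfloor> - \<lceil>y - R\<rceil> + 1) \<le> 2 * R + 1" by linarith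
  then show "real (card {i::int. \<bar>of_int i - y\<bar> \<le> R}) \<le> 2 * R + 1"
    unfolding e using assms by simp
qed

lemma card_near_le:
  fixes m :: "nat \<Rightarrow> int"
  assumes A: "finite A" and N: "\<And>i. card {k \<in> A. m k = i} \<le> N0" and R: "0 \<le> R"
  shows "real (card {k \<in> A. \<bar>of_int (m k) - y\<bar> \<le> R}) \<le> real N0 * (2 * R + 1)"
proof -
  define A' where "A' = {k \<in> A. \<bar>of_int (m k) - y\<bar> \<le> R}"
  have N': "card {k \<in> A'. m k = i} \<le> N0" for i
    using card_mono[of "{k \<in> A. m k = i}" "{k \<in> A'. m k = i}"] A N[of i] by (force simp: A'_def)
  have "real (card A') = (\<Sum>k\<in>A'. 1)" by simp
  also have "\<dots> \<le> real N0 * (\<Sum>i\<in>m ` A'. 1)"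
    using sum_fibre_le[of A' m N0 "\<lambda>_. 1", OF _ N'] A by (simp add: A'_def)
  also have "\<dots> \<le> real N0 * (2 * R + 1)"
  proof (rule mult_left_mono)
    have "card (m ` A') \<le> card {i::int. \<bar>of_int i - y\<bar> \<le> R}"
      by (rule card_mono[OF card_int_near(1)[OF R]]) (auto simp: A'_def)
    then show "(\<Sum>i\<in>m ` A'. 1) \<le> 2 * R + 1" using card_int_near(2)[OF R, of y] by simp
  qed simp
  finally show ?thesis by (simp add: A'_def)
qed

lemma int_weight_sum:
  "\<exists>W\<ge>0. \<forall>I y. finite I \<longrightarrow> (\<Sum>i\<in>I. 1 / (1 + \<bar>of_int i - y\<bar>)\<^sup>2) \<le> (W :: real)"
proof -
  define f where "f n = 1 / (1 + real n)\<^sup>2" for n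
  have "summable (\<lambda>n. inverse ((real n) ^ 2))" by (rule inverse_power_summable) simp
  then have "summable (\<lambda>n. inverse ((real (Suc n)) ^ 2))" by (subst summable_Suc_iff)
  then have sm: "summable f" unfolding f_def[abs_def] by (simp add: inverse_eq_divide add.commute)
  have f0: "0 \<le> f n" for n by (simp add: f_def)
  have half: "(\<Sum>i\<in>I. f (nat \<bar>i - i0\<bar>)) \<le> suminf f"
    if "finite I" "inj_on (\<lambda>i. nat \<bar>i - i0\<bar>) I" for I :: "int set" and i0
  proof -
    have "(\<Sum>i\<in>I. f (nat \<bar>i - i0\<bar>)) = (\<Sum>n\<in>(\<lambda>i. nat \<bar>i - i0\<bar>) ` I. f n)"
      using that by (simp add: sum.reindex)
    also have "\<dots> \<le> suminf f" using that f0 by (intro sum_le_suminf sm) auto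
    finally show ?thesis .
  qed
  have "(\<Sum>i\<in>I. 1 / (1 + \<bar>of_int i - y\<bar>)\<^sup>2) \<le> 8 * suminf f" if I: "finite I" for I :: "int set" and y :: real
  proof -
    \<comment> \<open>Replacing y by its floor changes 1 + distance by a factor of at most 2, hence
      4 after squaring; the integers on either side of the floor contribute one copy of the series
      each.\<close>
    define i0 where "i0 = \<lfloor>y\<rfloor>"
    have "(\<Sum>i\<in>I. 1 / (1 + \<bar>of_int i - y\<bar>)\<^sup>2) \<le> (\<Sum>i\<in>I. 4 * f (nat \<bar>i - i0\<bar>))"
    proof (rule sum_mono)
      fix i
      have n: "real (nat \<bar>i - i0\<bar>) = \<bar>of_int i - of_int i0\<bar>" by simp
      have "0 \<le> y - of_int i0" "y - of_int i0 < 1" unfolding i0_def by linarith+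
      moreover have "1 + \<bar>a - b\<bar> \<le> 2 * (1 + \<bar>a - y\<bar>)" if "0 \<le> y - b" "y - b < 1" for a b :: real
        using that by (auto simp: abs_if)
      ultimately have "1 + \<bar>of_int i - of_int i0\<bar> \<le> 2 * (1 + \<bar>of_int i - y\<bar>)" by blast
      then have "(1 + \<bar>of_int i - of_int i0\<bar>)\<^sup>2 \<le> (2 * (1 + \<bar>of_int i - y\<bar>))\<^sup>2" by (intro power_mono) auto
      then have "(1 + \<bar>of_int i - of_int i0\<bar>)\<^sup>2 \<le> 4 * (1 + \<bar>of_int i - y\<bar>)\<^sup>2" by (simp only: power_mult_distrib) simp
      moreover have "0 < (1 + \<bar>real_of_int i - of_int i0\<bar>)\<^sup>2" "0 < (1 + \<bar>of_int i - y\<bar>)\<^sup>2"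
        by (auto intro!: zero_less_power add_pos_nonneg)
      ultimately show "1 / (1 + \<bar>of_int i - y\<bar>)\<^sup>2 \<le> 4 * f (nat \<bar>i - i0\<bar>)"
        unfolding f_def n by (simp add: field_simps del: of_int_diff)
    qed
    also have "\<dots> = 4 * ((\<Sum>i\<in>{i\<in>I. i0 \<le> i}. f (nat \<bar>i - i0\<bar>)) + (\<Sum>i\<in>{i\<in>I. i < i0}. f (nat \<bar>i - i0\<bar>)))"
    proof -
      have "I = {i\<in>I. i0 \<le> i} \<union> {i\<in>I. i < i0}" by auto
      then have "(\<Sum>i\<in>I. f (nat \<bar>i - i0\<bar>)) = (\<Sum>i\<in>{i\<in>I. i0 \<le> i} \<union> {i\<in>I. i < i0}. f (nat \<bar>i - i0\<bar>))" by simp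
      also have "\<dots> = (\<Sum>i\<in>{i\<in>I. i0 \<le> i}. f (nat \<bar>i - i0\<bar>)) + (\<Sum>i\<in>{i\<in>I. i < i0}. f (nat \<bar>i - i0\<bar>))"
        using I by (intro sum.union_disjoint) auto
      finally show ?thesis by (simp add: sum_distrib_left[symmetric])
    qed
    also have "\<dots> \<le> 4 * (suminf f + suminf f)"
      using I by (intro mult_left_mono add_mono half) (auto simp: inj_on_def)
    finally show ?thesis by simp
  qed
  moreover have "0 \<le> 8 * suminf f" using suminf_nonneg[OF sm f0] by simp
  ultimately show ?thesis by blast
qed

lemma sqrt_pow2: "2 powr (real j / 2) = sqrt (2 ^ j)"
proof -
  have "2 powr (real j / 2) = (2 powr real j) powr (1 / 2)" by (simp add: powr_powr)
  then show ?thesis by (simp add: powr_half_sqrt powr_realpow)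
qed

section \<open>Uniform bounds for the wavelet levels\<close>

context jia
begin

text \<open>That generator and shift together determine k follows from the Riesz inequality: two
  indices with the same pair would give equal functions on [0,1], contradicting independence. Hence
  a shift is shared by at most as many indices as there are generators.\<close>

lemma support_data:
  "\<exists>(B::real) (m :: nat \<Rightarrow> nat \<Rightarrow> int) N0. 0 \<le> B \<and>
    (\<forall>j\<ge>j0 d. \<forall>k\<in>{1..2 ^ j}. \<forall>x\<in>{0..1}. \<bar>\<psi> j k x\<bar> \<le> B * sqrt (2 ^ j)
       \<and> (\<psi> j k x \<noteq> 0 \<longrightarrow> \<bar>of_int (m j k) - 2 ^ j * x\<bar> \<le> 2 * real d + 1))
    \<and> (\<forall>j\<ge>j0 d. \<forall>i. card {k \<in> {1..2 ^ j}. m j k = i} \<le> N0)"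
proof -
  obtain G :: "(real \<Rightarrow> real) set" where G: "finite G" "G \<noteq> {}"
    "\<forall>\<eta>\<in>G. bounded (range \<eta>) \<and> (\<forall>y. \<eta> y \<noteq> 0 \<longrightarrow> 0 \<le> y \<and> y \<le> 2 * real d + 1)"
    "\<forall>j\<ge>j0 d. \<forall>k\<in>{1..2^j}. \<exists>\<eta>\<in>G. \<exists>m::int. \<forall>x\<in>{0..1}. \<psi> j k x = 2 powr (real j / 2) * \<eta> (2 ^ j * x - real_of_int m)"
    using jia unfolding jia_wavelets_def by blast
  have "\<forall>\<eta>\<in>G. \<exists>b. \<forall>y. \<bar>\<eta> y\<bar> \<le> b" using G(3) by (auto simp: bounded_real)
  from bchoice[OF this] obtain b where b: "\<forall>\<eta>\<in>G. \<forall>y. \<bar>\<eta> y\<bar> \<le> b \<eta>" by blast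
  have b0: "0 \<le> b \<eta>" if "\<eta> \<in> G" for \<eta> using b that by (meson abs_ge_zero order_trans)
  define B where "B = (\<Sum>\<eta>\<in>G. b \<eta>)"
  have bB: "b \<eta> \<le> B" if "\<eta> \<in> G" for \<eta> unfolding B_def using that b0 G(1) by (intro member_le_sum) auto
  define P where "P j k \<eta>m \<longleftrightarrow> fst \<eta>m \<in> G \<and> (\<forall>x\<in>{0..1}. \<psi> j k x = 2 powr (real j / 2) * fst \<eta>m (2 ^ j * x - real_of_int (snd \<eta>m)))"
    for j k and \<eta>m :: "(real \<Rightarrow> real) \<times> int"
  define s where "s j k = (SOME \<eta>m. P j k \<eta>m)" for j k
  have s: "P j k (s j k)" if jk: "j0 d \<le> j" "k \<in> {1..2 ^ j}" for j k
  proof -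
    obtain \<eta> m where "\<eta> \<in> G" "\<forall>x\<in>{0..1}. \<psi> j k x = 2 powr (real j / 2) * \<eta> (2 ^ j * x - real_of_int m)"
      using G(4) jk by blast
    then have "P j k (\<eta>, m)" by (simp add: P_def)
    then show ?thesis unfolding s_def by (rule someI)
  qed
  define m where "m j k = snd (s j k)" for j k
  have 1: "\<bar>\<psi> j k x\<bar> \<le> B * sqrt (2 ^ j)" "\<psi> j k x \<noteq> 0 \<longrightarrow> \<bar>of_int (m j k) - 2 ^ j * x\<bar> \<le> 2 * real d + 1"
    if j: "j0 d \<le> j" "k \<in> {1..2 ^ j}" and x: "x \<in> {0..1}" for j k x
  proof -
    have gG: "fst (s j k) \<in> G" and e: "\<psi> j k x = sqrt (2 ^ j) * fst (s j k) (2 ^ j * x - real_of_int (m j k))"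
      using s[OF j] x by (auto simp: P_def m_def sqrt_pow2)
    have "\<bar>fst (s j k) (2 ^ j * x - real_of_int (m j k))\<bar> \<le> B" using b gG bB[OF gG] by (meson order_trans)
    then show "\<bar>\<psi> j k x\<bar> \<le> B * sqrt (2 ^ j)" unfolding e by (simp add: abs_mult mult.commute mult_right_mono)
    show "\<psi> j k x \<noteq> 0 \<longrightarrow> \<bar>of_int (m j k) - 2 ^ j * x\<bar> \<le> 2 * real d + 1"
    proof
      assume "\<psi> j k x \<noteq> 0"
      then have "fst (s j k) (2 ^ j * x - real_of_int (m j k)) \<noteq> 0" unfolding e by auto
      then have "0 \<le> 2 ^ j * x - real_of_int (m j k) \<and> 2 ^ j * x - real_of_int (m j k) \<le> 2 * real d + 1"
        using G(3) gG by blast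
      then show "\<bar>of_int (m j k) - 2 ^ j * x\<bar> \<le> 2 * real d + 1" by linarith
    qed
  qed
  have 2: "card {k \<in> {1..2 ^ j}. m j k = i} \<le> card G" if j: "j0 d \<le> j" for j i
  proof (rule card_inj_on_le[where f="\<lambda>k. fst (s j k)"])
    show "(\<lambda>k. fst (s j k)) ` {k \<in> {1..2 ^ j}. m j k = i} \<subseteq> G" using s[OF j] by (auto simp: P_def)
    show "inj_on (\<lambda>k. fst (s j k)) {k \<in> {1..2 ^ j}. m j k = i}"
    proof (rule inj_onI)
      fix k l assume kl: "k \<in> {k \<in> {1..2 ^ j}. m j k = i}" "l \<in> {k \<in> {1..2 ^ j}. m j k = i}"
        and eq: "fst (s j k) = fst (s j l)"
      have same: "\<psi> j k x = \<psi> j l x" if "x \<in> {0..1}" for x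
        using s[OF j, of k] s[OF j, of l] kl eq that by (auto simp: P_def m_def)
      show "k = l"
      proof (rule ccontr)
        assume ne: "k \<noteq> l"
        define a where "a i = (if i = k then 1 else if i = l then -1 else (0::real))" for i
        have "(\<Sum>i\<in>K j. a i * \<phi> j i x) = 0" if "x \<in> {0..1}" for x
        proof -
          have "(\<Sum>i\<in>K j. a i * \<phi> j i x) = (\<Sum>i\<in>{k, l}. a i * \<phi> j i x)"
            by (rule sum.mono_neutral_right) (use kl j in \<open>auto simp: a_def fine_simps\<close>)
          then show ?thesis using ne same[OF that] j by (simp add: a_def fine_simps)
        qed
        then have "l2sq (\<lambda>x. \<Sum>i\<in>K j. a i * \<phi> j i x) = l2sq (\<lambda>x. 0)" by (intro l2sq_cong) auto
        then have "l2sq (\<lambda>x. \<Sum>i\<in>K j. a i * \<phi> j i x) = 0" using l2sq_const[of 0] by simp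
        from phi_independent[OF _ this] j kl have "a k = 0" by (auto simp: fine_simps)
        then show False by (simp add: a_def)
      qed
    qed
  qed (use G in auto)
  show ?thesis
    by (intro exI[of _ B] exI[of _ m] exI[of _ "card G"]) (use 1 2 b0 in \<open>auto simp: B_def intro!: sum_nonneg\<close>)
qed

text \<open>At a wavelet level boundedly many functions are alive at x, each of size 2^(j/2). The
  coarse family is one fixed level, for which any bound will do.\<close>

lemma phi_sq_sum:
  "\<exists>C\<ge>0. \<forall>j\<ge>j0 d - 1. \<forall>x\<in>{0..1}. (\<Sum>k\<in>K j. (\<phi> j k x)\<^sup>2) \<le> C * 2 ^ j"
proof -
  obtain B m N0 where B: "0 \<le> B"
    and sup: "\<And>j k x. j0 d \<le> j \<Longrightarrow> k \<in> {1..2 ^ j} \<Longrightarrow> x \<in> {0..1} \<Longrightarrow> \<bar>\<psi> j k x\<bar> \<le> B * sqrt (2 ^ j)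
       \<and> (\<psi> j k x \<noteq> 0 \<longrightarrow> \<bar>of_int (m j k :: int) - 2 ^ j * x\<bar> \<le> 2 * real d + 1)"
    and N0: "\<And>j i. j0 d \<le> j \<Longrightarrow> card {k \<in> {1..2 ^ j}. m j k = i} \<le> N0"
    using support_data by blast
  define R where "R = 2 * real d + 1"
  have "bdd01 (\<lambda>x. \<Sum>k\<in>K (j0 d - 1). \<phi> (j0 d - 1) k x * \<phi> (j0 d - 1) k x)"
    by (intro bdd01_sum bdd01_mult phi_bdd01) auto
  then obtain C0 where C0: "\<And>x. x \<in> {0..1} \<Longrightarrow> \<bar>\<Sum>k\<in>K (j0 d - 1). \<phi> (j0 d - 1) k x * \<phi> (j0 d - 1) k x\<bar> \<le> C0"
    unfolding bdd01_def by blast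
  have C00: "0 \<le> C0" using C0[of 0] by simp
  define C where "C = max C0 (real N0 * (2 * R + 1) * B\<^sup>2)"
  have "0 \<le> C" using C00 by (simp add: C_def)
  moreover have "(\<Sum>k\<in>K j. (\<phi> j k x)\<^sup>2) \<le> C * 2 ^ j" if j: "j0 d - 1 \<le> j" and x: "x \<in> {0..1}" for j x
    using j
  proof (cases rule: level_cases)
    case 1
    have "(\<Sum>k\<in>K j. (\<phi> j k x)\<^sup>2) \<le> C0 * 1" using C0[OF x] unfolding 1 by (simp add: power2_eq_square)
    also have "\<dots> \<le> C * 2 ^ j" using C00 by (intro mult_mono) (auto simp: C_def)
    finally show ?thesis .
  next
    case 2
    define S where "S = {k \<in> {1..2 ^ j}. \<bar>of_int (m j k) - 2 ^ j * x\<bar> \<le> R}"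
    have "(\<Sum>k\<in>K j. (\<phi> j k x)\<^sup>2) = (\<Sum>k\<in>{1..2 ^ j}. (\<psi> j k x)\<^sup>2)" using 2 by (simp add: fine_simps)
    also have "\<dots> = (\<Sum>k\<in>S. (\<psi> j k x)\<^sup>2)"
      by (rule sum.mono_neutral_right) (use sup[OF 2(1) _ x] in \<open>auto simp: S_def R_def\<close>)
    also have "\<dots> \<le> (\<Sum>k\<in>S. B\<^sup>2 * 2 ^ j)"
    proof (rule sum_mono)
      fix k assume "k \<in> S"
      then have "\<bar>\<psi> j k x\<bar> \<le> B * sqrt (2 ^ j)" using sup[OF 2(1) _ x] by (auto simp: S_def)
      then have "\<bar>\<psi> j k x\<bar>\<^sup>2 \<le> (B * sqrt (2 ^ j))\<^sup>2" by (intro power_mono) auto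
      then show "(\<psi> j k x)\<^sup>2 \<le> B\<^sup>2 * 2 ^ j" by (simp add: power_mult_distrib)
    qed
    also have "\<dots> = real (card S) * (B\<^sup>2 * 2 ^ j)" by simp
    also have "\<dots> \<le> (real N0 * (2 * R + 1)) * (B\<^sup>2 * 2 ^ j)"
      unfolding S_def by (intro mult_right_mono card_near_le N0[OF 2(1)]) (auto simp: R_def)
    also have "\<dots> = (real N0 * (2 * R + 1) * B\<^sup>2) * 2 ^ j" by (simp only: mult.assoc)
    also have "\<dots> \<le> C * 2 ^ j" by (intro mult_right_mono) (auto simp: C_def)
    finally show ?thesis .
  qed
  ultimately show ?thesis by blast
qed

lemma phi_riesz:
  "\<exists>A>0. \<forall>j\<ge>j0 d - 1. \<forall>c. A * (\<Sum>k\<in>K j. (c k)\<^sup>2) \<le> l2sq (\<lambda>x. \<Sum>k\<in>K j. c k * \<phi> j k x)"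
proof -
  define D where "D = 1 + (\<Sum>k\<in>K (j0 d - 1). l2sq (dual (j0 d - 1) k))"
  have D: "1 \<le> D" unfolding D_def using l2sq_nonneg by (simp add: sum_nonneg)
  define A where "A = min Af (1 / D)"
  have "0 < A" using Af_pos D by (simp add: A_def)
  moreover have "A * (\<Sum>k\<in>K j. (c k)\<^sup>2) \<le> l2sq (\<lambda>x. \<Sum>k\<in>K j. c k * \<phi> j k x)" if j: "j0 d - 1 \<le> j" for j c
    using j
  proof (cases rule: level_cases)
    case 1
    let ?g = "\<lambda>x. \<Sum>k\<in>K j. c k * \<phi> j k x"
    have "A * (\<Sum>k\<in>K j. (c k)\<^sup>2) \<le> 1 / D * (\<Sum>k\<in>K j. (c k)\<^sup>2)"
      by (intro mult_right_mono sum_nonneg) (auto simp: A_def)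
    also have "\<dots> \<le> 1 / D * (D * l2sq ?g)"
    proof (rule mult_left_mono)
      have "(\<Sum>k\<in>K j. (c k)\<^sup>2) \<le> (\<Sum>k\<in>K j. l2sq (dual j k)) * l2sq ?g" by (rule phi_riesz_lower[OF j])
      also have "\<dots> \<le> D * l2sq ?g" unfolding D_def 1 by (intro mult_right_mono l2sq_nonneg) auto
      finally show "(\<Sum>k\<in>K j. (c k)\<^sup>2) \<le> D * l2sq ?g" .
    qed (use D in auto)
    also have "\<dots> = l2sq ?g" using D by simp
    finally show ?thesis .
  next
    case 2
    have "A * (\<Sum>k\<in>K j. (c k)\<^sup>2) \<le> Af * (\<Sum>k\<in>K j. (c k)\<^sup>2)"
      by (intro mult_right_mono sum_nonneg) (auto simp: A_def)
    also have "\<dots> \<le> l2sq (\<lambda>x. \<Sum>k\<in>K j. c k * \<phi> j k x)" using Af_low[OF 2(1), of c] by (simp add: fine_simps[OF 2(1)])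
    finally show ?thesis .
  qed
  ultimately show ?thesis by blast
qed

lemma phi_riesz_upper:
  "\<exists>B\<ge>0. \<forall>j\<ge>j0 d - 1. \<forall>c. l2sq (\<lambda>x. \<Sum>k\<in>K j. c k * \<phi> j k x) \<le> B * (\<Sum>k\<in>K j. (c k)\<^sup>2)"
proof -
  obtain C where C: "0 \<le> C" "\<And>j x. j0 d - 1 \<le> j \<Longrightarrow> x \<in> {0..1} \<Longrightarrow> (\<Sum>k\<in>K j. (\<phi> j k x)\<^sup>2) \<le> C * 2 ^ j"
    using phi_sq_sum by blast
  obtain B0 where B0: "0 < B0" "\<And>j c. j0 d \<le> j \<Longrightarrow>
     l2sq (\<lambda>x. \<Sum>k\<in>{1..2^j}. c k * \<psi> j k x) \<le> B0 * (\<Sum>k\<in>{1..2^j}. (c k)\<^sup>2)"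
    using conjunct2[OF Af_ex] by blast
  define B where "B = max B0 (C * 2 ^ (j0 d - 1))"
  have "l2sq (\<lambda>x. \<Sum>k\<in>K j. c k * \<phi> j k x) \<le> B * (\<Sum>k\<in>K j. (c k)\<^sup>2)" if j: "j0 d - 1 \<le> j" for j c
    using j
  proof (cases rule: level_cases)
    case 1
    define E where "E = (\<Sum>k\<in>K j. (c k)\<^sup>2)"
    have E0: "0 \<le> E" unfolding E_def by (intro sum_nonneg) auto
    have "l2sq (\<lambda>x. \<Sum>k\<in>K j. c k * \<phi> j k x) \<le> l2sq (\<lambda>x. sqrt (E * (C * 2 ^ j)))"
    proof (rule l2sq_mono)
      fix x :: real assume x: "x \<in> {0..1}"
      have "(\<Sum>k\<in>K j. c k * \<phi> j k x)\<^sup>2 \<le> E * (\<Sum>k\<in>K j. (\<phi> j k x)\<^sup>2)"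
        unfolding E_def by (rule Cauchy_Schwarz_ineq_sum)
      also have "\<dots> \<le> E * (C * 2 ^ j)" by (intro mult_left_mono C(2) j x E0)
      finally have "\<bar>\<Sum>k\<in>K j. c k * \<phi> j k x\<bar> \<le> sqrt (E * (C * 2 ^ j))" by (rule real_le_rsqrt[OF power2_abs[THEN ord_eq_le_trans]])
      then show "\<bar>\<Sum>k\<in>K j. c k * \<phi> j k x\<bar> \<le> \<bar>sqrt (E * (C * 2 ^ j))\<bar>" by simp
    qed (intro bdd01_const bdd01_lincomb phi_bdd01 j, assumption, rule bdd01_const)
    also have "\<dots> = (C * 2 ^ j) * E" using E0 C(1) by (simp add: l2sq_const)
    also have "\<dots> \<le> B * E" using E0 1 by (intro mult_right_mono) (auto simp: B_def)
    finally show ?thesis unfolding E_def .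
  next
    case 2
    have "l2sq (\<lambda>x. \<Sum>k\<in>K j. c k * \<phi> j k x) \<le> B0 * (\<Sum>k\<in>K j. (c k)\<^sup>2)"
      using B0(2)[OF 2(1), of c] 2 by (simp add: fine_simps)
    also have "\<dots> \<le> B * (\<Sum>k\<in>K j. (c k)\<^sup>2)" by (intro mult_right_mono sum_nonneg) (auto simp: B_def)
    finally show ?thesis .
  qed
  moreover have "0 \<le> B" using B0 by (simp add: B_def)
  ultimately show ?thesis by blast
qed

lemma dual_sq_sum:
  "\<exists>C\<ge>0. \<forall>j\<ge>j0 d - 1. \<forall>x\<in>{0..1}. (\<Sum>k\<in>K j. (dual j k x)\<^sup>2) \<le> C * 2 ^ j"
proof -
  obtain C where C: "0 \<le> C" "\<And>j x. j0 d - 1 \<le> j \<Longrightarrow> x \<in> {0..1} \<Longrightarrow> (\<Sum>k\<in>K j. (\<phi> j k x)\<^sup>2) \<le> C * 2 ^ j"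
    using phi_sq_sum by blast
  obtain A where A: "0 < A" "\<And>j c. j0 d - 1 \<le> j \<Longrightarrow> A * (\<Sum>k\<in>K j. (c k)\<^sup>2) \<le> l2sq (\<lambda>x. \<Sum>k\<in>K j. c k * \<phi> j k x)"
    using phi_riesz by blast
  have "(\<Sum>k\<in>K j. (dual j k x)\<^sup>2) \<le> (C / A\<^sup>2) * 2 ^ j" if j: "j0 d - 1 \<le> j" and x: "x \<in> {0..1}" for j x
  proof -
    have "(\<Sum>k\<in>K j. (dual j k x)\<^sup>2) \<le> (\<Sum>k\<in>K j. (\<phi> j k x)\<^sup>2) / A\<^sup>2"
      by (rule gram_inverse_bound[where \<phi>="\<phi> j"]) (use j A finite_K phi_bdd01 dual_gram in auto)
    also have "\<dots> \<le> (C * 2 ^ j) / A\<^sup>2" by (intro divide_right_mono C j x) auto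
    finally show ?thesis by simp
  qed
  then show ?thesis using C(1) A(1) by (intro exI[of _ "C / A\<^sup>2"]) auto
qed

text \<open>Decay of the dual functions away from the diagonal. With \<open>G\<close> the Gram matrix and \<open>D\<close> the
  diagonal matrix of distances to \<open>x\<close>, the vector \<open>u\<close> of values of the duals at \<open>x\<close> solves
  \<open>G u = v\<close>, and \<open>G (D u) = D v + [G, D] u\<close> where the commutator \<open>[G, D]\<close> is bounded because \<open>G\<close>
  is banded.\<close>
lemma dual_abs_sum:
  "\<exists>C\<ge>0. \<forall>j\<ge>j0 d. \<forall>x\<in>{0..1}. (\<Sum>k\<in>K j. \<bar>dual j k x\<bar>)\<^sup>2 \<le> C * 2 ^ j"
proof -
  obtain B m N0 where B: "0 \<le> B"
    and sup: "\<And>j k x. j0 d \<le> j \<Longrightarrow> k \<in> {1..2 ^ j} \<Longrightarrow> x \<in> {0..1} \<Longrightarrow> \<bar>\<psi> j k x\<bar> \<le> B * sqrt (2 ^ j)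
       \<and> (\<psi> j k x \<noteq> 0 \<longrightarrow> \<bar>of_int (m j k :: int) - 2 ^ j * x\<bar> \<le> 2 * real d + 1)"
    and N0: "\<And>j i. j0 d \<le> j \<Longrightarrow> card {k \<in> {1..2 ^ j}. m j k = i} \<le> N0"
    using support_data by blast
  obtain C1 where C1: "0 \<le> C1" "\<And>j x. j0 d - 1 \<le> j \<Longrightarrow> x \<in> {0..1} \<Longrightarrow> (\<Sum>k\<in>K j. (\<phi> j k x)\<^sup>2) \<le> C1 * 2 ^ j"
    using phi_sq_sum by blast
  obtain C2 where C2: "0 \<le> C2" "\<And>j x. j0 d - 1 \<le> j \<Longrightarrow> x \<in> {0..1} \<Longrightarrow> (\<Sum>k\<in>K j. (dual j k x)\<^sup>2) \<le> C2 * 2 ^ j"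
    using dual_sq_sum by blast
  obtain A where A: "0 < A" "\<And>j c. j0 d - 1 \<le> j \<Longrightarrow> A * (\<Sum>k\<in>K j. (c k)\<^sup>2) \<le> l2sq (\<lambda>x. \<Sum>k\<in>K j. c k * \<phi> j k x)"
    using phi_riesz by blast
  obtain W :: real where W: "0 \<le> W" "\<And>I y. finite I \<Longrightarrow> (\<Sum>i\<in>I. 1 / (1 + \<bar>of_int i - y\<bar>)\<^sup>2) \<le> W"
    using int_weight_sum by blast
  define R where "R = 2 * (2 * real d + 1)"
  define N1 where "N1 = real N0 * (2 * R + 1)"
  have R0: "0 \<le> R" and N10: "0 \<le> N1" by (auto simp: R_def N1_def)
  define C3 where "C3 = 2 * R\<^sup>2 * (C1 + N1 * (N1 * C2)) / A\<^sup>2"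
  define C where "C = (2 * C2 + 2 * C3) * (real N0 * W)"
  have C30: "0 \<le> C3" unfolding C3_def using C1 C2 N10 A by (intro divide_nonneg_nonneg mult_nonneg_nonneg add_nonneg_nonneg) auto
  have "(\<Sum>k\<in>K j. \<bar>dual j k x\<bar>)\<^sup>2 \<le> C * 2 ^ j" if j: "j0 d \<le> j" and x: "x \<in> {0..1}" for j x
  proof -
    have j': "j0 d - 1 \<le> j" using j by simp
    have Kj: "K j = {1..2 ^ j}" "\<phi> j = \<psi> j" using fine_simps[OF j] by auto
    define u v where "u k = dual j k x" and "v k = \<psi> j k x" for k
    define D where "D k = \<bar>of_int (m j k) - 2 ^ j * x\<bar>" for k
    define g where "g k l = inner01 (\<psi> j k) (\<psi> j l)" for k l
    define near where "near k l \<longleftrightarrow> \<bar>of_int (m j k) - of_int (m j l) :: real\<bar> \<le> R" for k l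
    have Gu: "(\<Sum>k\<in>K j. u k * g k l) = v l" if "l \<in> K j" for l
      using dual_gram[OF j' that, of x] by (simp add: u_def v_def g_def Kj)
    have g1: "\<bar>g k l\<bar> \<le> 1" if "k \<in> K j" "l \<in> K j" for k l
    proof -
      have "(g k l)\<^sup>2 \<le> l2sq (\<psi> j k) * l2sq (\<psi> j l)"
        unfolding g_def using phi_bdd01[OF j'] that by (intro inner01_Cauchy_Schwarz) (auto simp: Kj)
      then have "(g k l)\<^sup>2 \<le> 1" using psi_Usp[OF j] that by (auto simp: Kj)
      then show ?thesis by (simp add: abs_square_le_1)
    qed
    have g0: "near k l" if "g k l \<noteq> 0" "k \<in> K j" "l \<in> K j" for k l
    proof -
      have "\<exists>y\<in>{0..1}. \<psi> j k y * \<psi> j l y \<noteq> 0"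
      proof (rule ccontr)
        assume "\<not> ?thesis"
        then have "g k l = inner01 (\<lambda>x. 0) (\<lambda>x. 0)"
          unfolding g_def inner01_def by (intro set_lebesgue_integral_cong) auto
        then show False using that by simp
      qed
      then obtain y where y: "y \<in> {0..1}" "\<psi> j k y \<noteq> 0" "\<psi> j l y \<noteq> 0" by auto
      have "\<bar>of_int (m j k) - 2 ^ j * y\<bar> \<le> 2 * real d + 1" "\<bar>of_int (m j l) - 2 ^ j * y\<bar> \<le> 2 * real d + 1"
        using sup[OF j _ y(1), of k] sup[OF j _ y(1), of l] y that by (auto simp: Kj)
      moreover have "\<bar>a - b\<bar> \<le> 2 * r" if "\<bar>a - z\<bar> \<le> r" "\<bar>b - z\<bar> \<le> r" for a b z r :: real
        using that by linarith
      ultimately show ?thesis unfolding near_def R_def by blast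
    qed
    have cnear: "real (card {k \<in> K j. near k l}) \<le> N1" for l
      using card_near_le[OF finite_atLeastAtMost N0[OF j] R0, of "of_int (m j l)"] by (simp add: near_def Kj N1_def)
    have nsym: "near k l \<longleftrightarrow> near l k" for k l by (simp add: near_def abs_minus_commute)
    have u2: "(\<Sum>k\<in>K j. (u k)\<^sup>2) \<le> C2 * 2 ^ j" unfolding u_def by (rule C2(2)[OF j' x])
    have v2: "(\<Sum>k\<in>K j. (v k)\<^sup>2) \<le> C1 * 2 ^ j" unfolding v_def using C1(2)[OF j' x] by (simp add: Kj)
    define b where "b l = (\<Sum>k\<in>K j. (D k * u k) * g k l)" for l
    have b_bound: "(b l)\<^sup>2 \<le> 2 * R\<^sup>2 * ((v l)\<^sup>2 + N1 * (\<Sum>k\<in>{k \<in> K j. near k l}. (u k)\<^sup>2))" if l: "l \<in> K j" for l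
    proof -
      \<comment> \<open>Writing D k = D l + (D k - D l) and using \<open>Gu\<close> for the first
        part isolates the commutator; its terms are at most R |u k| for near pairs and vanish for
        all others.\<close>
      have "b l = D l * v l + (\<Sum>k\<in>K j. (D k - D l) * (u k * g k l))"
        unfolding b_def Gu[OF l, symmetric] sum_distrib_left sum.distrib[symmetric]
        by (rule sum.cong) (auto simp: algebra_simps)
      then have "\<bar>b l\<bar> \<le> \<bar>D l * v l\<bar> + \<bar>\<Sum>k\<in>K j. (D k - D l) * (u k * g k l)\<bar>" by linarith
      also have "\<bar>D l * v l\<bar> \<le> R * \<bar>v l\<bar>"
      proof (cases "v l = 0")
        case False
        then have "D l \<le> 2 * real d + 1" using sup[OF j _ x, of l] l by (simp add: D_def v_def Kj)
        then have "\<bar>D l\<bar> \<le> R" by (simp add: D_def R_def)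
        then show ?thesis by (simp add: abs_mult mult_right_mono)
      qed simp
      also have "\<bar>\<Sum>k\<in>K j. (D k - D l) * (u k * g k l)\<bar> \<le> (\<Sum>k\<in>K j. \<bar>(D k - D l) * (u k * g k l)\<bar>)" by (rule sum_abs)
      also have "\<dots> = (\<Sum>k\<in>{k \<in> K j. near k l}. \<bar>(D k - D l) * (u k * g k l)\<bar>)"
        by (rule sum.mono_neutral_right) (use g0 l finite_K in auto)
      also have "\<dots> \<le> (\<Sum>k\<in>{k \<in> K j. near k l}. R * \<bar>u k\<bar>)"
      proof (rule sum_mono)
        fix k assume k: "k \<in> {k \<in> K j. near k l}"
        have "\<bar>D k - D l\<bar> \<le> R" 
          using k abs_triangle_ineq3[of "of_int (m j k) - 2 ^ j * x" "of_int (m j l) - 2 ^ j * x"]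
          unfolding D_def near_def by simp
        moreover have "\<bar>u k * g k l\<bar> \<le> \<bar>u k\<bar> * 1" unfolding abs_mult using g1[of k l] k l by (intro mult_left_mono) auto
        ultimately show "\<bar>(D k - D l) * (u k * g k l)\<bar> \<le> R * \<bar>u k\<bar>"
          unfolding abs_mult[of "D k - D l"] using R0 by (intro mult_mono) auto
      qed
      finally have "\<bar>b l\<bar> \<le> R * (\<bar>v l\<bar> + (\<Sum>k\<in>{k \<in> K j. near k l}. \<bar>u k\<bar>))"
        by (simp add: distrib_left sum_distrib_left)
      then have "\<bar>b l\<bar>\<^sup>2 \<le> (R * (\<bar>v l\<bar> + (\<Sum>k\<in>{k \<in> K j. near k l}. \<bar>u k\<bar>)))\<^sup>2" by (intro power_mono) auto
      also have "\<dots> = R\<^sup>2 * (\<bar>v l\<bar> + (\<Sum>k\<in>{k \<in> K j. near k l}. \<bar>u k\<bar>))\<^sup>2" by (rule power_mult_distrib)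
      also have "\<dots> \<le> R\<^sup>2 * (2 * (\<bar>v l\<bar>\<^sup>2 + (\<Sum>k\<in>{k \<in> K j. near k l}. \<bar>u k\<bar>)\<^sup>2))"
      proof (rule mult_left_mono)
        have "(a + c)\<^sup>2 \<le> 2 * (a\<^sup>2 + c\<^sup>2)" for a c :: real
          using zero_le_power2[of "a - c"] by (simp add: power2_eq_square algebra_simps)
        then show "(\<bar>v l\<bar> + (\<Sum>k\<in>{k \<in> K j. near k l}. \<bar>u k\<bar>))\<^sup>2 \<le> 2 * (\<bar>v l\<bar>\<^sup>2 + (\<Sum>k\<in>{k \<in> K j. near k l}. \<bar>u k\<bar>)\<^sup>2)" .
      qed simp
      also have "\<dots> \<le> R\<^sup>2 * (2 * (\<bar>v l\<bar>\<^sup>2 + N1 * (\<Sum>k\<in>{k \<in> K j. near k l}. (u k)\<^sup>2)))"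
      proof -
        have "(\<Sum>k\<in>{k \<in> K j. near k l}. 1 * \<bar>u k\<bar>)\<^sup>2 \<le> (\<Sum>k\<in>{k \<in> K j. near k l}. 1\<^sup>2) * (\<Sum>k\<in>{k \<in> K j. near k l}. \<bar>u k\<bar>\<^sup>2)"
          by (rule Cauchy_Schwarz_ineq_sum)
        also have "\<dots> \<le> N1 * (\<Sum>k\<in>{k \<in> K j. near k l}. \<bar>u k\<bar>\<^sup>2)"
          using cnear[of l] by (intro mult_right_mono sum_nonneg) auto
        finally show ?thesis by (intro mult_left_mono add_left_mono) auto
      qed
      finally show ?thesis by (simp add: algebra_simps)
    qed
    have swap: "(\<Sum>l\<in>K j. \<Sum>k\<in>{k \<in> K j. near k l}. (u k)\<^sup>2) \<le> N1 * (C2 * 2 ^ j)"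
    proof -
      have "(\<Sum>l\<in>K j. \<Sum>k\<in>{k \<in> K j. near k l}. (u k)\<^sup>2) = (\<Sum>k\<in>K j. \<Sum>l\<in>{l \<in> K j. near k l}. (u k)\<^sup>2)"
        by (rule sum.swap_restrict[OF finite_K finite_K])
      also have "\<dots> = (\<Sum>k\<in>K j. real (card {l \<in> K j. near l k}) * (u k)\<^sup>2)" using nsym by simp
      also have "\<dots> \<le> (\<Sum>k\<in>K j. N1 * (u k)\<^sup>2)" by (intro sum_mono mult_right_mono cnear) auto
      also have "\<dots> \<le> N1 * (C2 * 2 ^ j)" unfolding sum_distrib_left[symmetric] by (intro mult_left_mono u2 N10)
      finally show ?thesis .
    qed
    have "(\<Sum>k\<in>K j. (D k * u k)\<^sup>2) \<le> (\<Sum>l\<in>K j. (b l)\<^sup>2) / A\<^sup>2"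
    proof (rule gram_inverse_bound[where \<phi>="\<psi> j"])
      show "A * (\<Sum>k\<in>K j. (c k)\<^sup>2) \<le> l2sq (\<lambda>x. \<Sum>k\<in>K j. c k * \<psi> j k x)" for c
        using A(2)[OF j', of c] unfolding Kj .
      show "bdd01 (\<psi> j k)" if "k \<in> K j" for k using phi_bdd01[OF j' that] by (simp add: Kj)
      show "(\<Sum>k\<in>K j. (D k * u k) * inner01 (\<psi> j k) (\<psi> j l)) = b l" for l by (simp add: b_def g_def)
    qed (use A finite_K in auto)
    also have "\<dots> \<le> (\<Sum>l\<in>K j. 2 * R\<^sup>2 * ((v l)\<^sup>2 + N1 * (\<Sum>k\<in>{k \<in> K j. near k l}. (u k)\<^sup>2))) / A\<^sup>2"
      by (intro divide_right_mono sum_mono b_bound) auto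
    also have "\<dots> = 2 * R\<^sup>2 * ((\<Sum>l\<in>K j. (v l)\<^sup>2) + N1 * (\<Sum>l\<in>K j. \<Sum>k\<in>{k \<in> K j. near k l}. (u k)\<^sup>2)) / A\<^sup>2"
      by (simp only: sum_distrib_left sum.distrib distrib_left)
    also have "\<dots> \<le> 2 * R\<^sup>2 * (C1 * 2 ^ j + N1 * (N1 * (C2 * 2 ^ j))) / A\<^sup>2"
      by (intro divide_right_mono mult_left_mono add_mono v2 swap N10) auto
    also have "\<dots> = C3 * 2 ^ j" by (simp add: C3_def algebra_simps)
    finally have w2: "(\<Sum>k\<in>K j. (D k * u k)\<^sup>2) \<le> C3 * 2 ^ j" .
    \<comment> \<open>Cauchy-Schwarz with the weights 1 + D: the mean-square bounds for u and D u
      become a bound for the sum of |u|, since the squared inverse weights are summable uniformly in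
      j and x.\<close>
    have "(\<Sum>k\<in>K j. \<bar>u k\<bar>) = (\<Sum>k\<in>K j. ((1 + D k) * \<bar>u k\<bar>) * (1 / (1 + D k)))"
    proof (rule sum.cong[OF refl])
      fix k have "0 < 1 + D k" unfolding D_def by (intro add_pos_nonneg) auto
      then show "\<bar>u k\<bar> = ((1 + D k) * \<bar>u k\<bar>) * (1 / (1 + D k))" by simp
    qed
    then have "(\<Sum>k\<in>K j. \<bar>u k\<bar>)\<^sup>2 \<le> (\<Sum>k\<in>K j. ((1 + D k) * \<bar>u k\<bar>)\<^sup>2) * (\<Sum>k\<in>K j. (1 / (1 + D k))\<^sup>2)"
      by (simp only: Cauchy_Schwarz_ineq_sum)
    also have "\<dots> \<le> ((2 * C2 + 2 * C3) * 2 ^ j) * (real N0 * W)"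
    proof (rule mult_mono)
      have "(\<Sum>k\<in>K j. ((1 + D k) * \<bar>u k\<bar>)\<^sup>2) \<le> (\<Sum>k\<in>K j. 2 * (u k)\<^sup>2 + 2 * (D k * u k)\<^sup>2)"
      proof (rule sum_mono)
        fix k
        have "((1 + D k) * \<bar>u k\<bar>)\<^sup>2 = (u k + D k * u k)\<^sup>2"
          by (simp add: power_mult_distrib) (simp add: power2_eq_square algebra_simps)
        also have "\<dots> \<le> 2 * (u k)\<^sup>2 + 2 * (D k * u k)\<^sup>2"
          using zero_le_power2[of "u k - D k * u k"] by (simp add: power2_eq_square algebra_simps)
        finally show "((1 + D k) * \<bar>u k\<bar>)\<^sup>2 \<le> 2 * (u k)\<^sup>2 + 2 * (D k * u k)\<^sup>2" .
      qed
      also have "\<dots> = 2 * (\<Sum>k\<in>K j. (u k)\<^sup>2) + 2 * (\<Sum>k\<in>K j. (D k * u k)\<^sup>2)"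
        by (simp add: sum.distrib sum_distrib_left)
      also have "\<dots> \<le> (2 * C2 + 2 * C3) * 2 ^ j" using u2 w2 by (simp add: algebra_simps)
      finally show "(\<Sum>k\<in>K j. ((1 + D k) * \<bar>u k\<bar>)\<^sup>2) \<le> (2 * C2 + 2 * C3) * 2 ^ j" .
      have "(\<Sum>k\<in>K j. (1 / (1 + D k))\<^sup>2) = (\<Sum>k\<in>K j. 1 / (1 + \<bar>of_int (m j k) - 2 ^ j * x\<bar>)\<^sup>2)"
        by (simp add: D_def power_divide)
      also have "\<dots> \<le> real N0 * (\<Sum>i\<in>m j ` K j. 1 / (1 + \<bar>of_int i - 2 ^ j * x\<bar>)\<^sup>2)"
        by (rule sum_fibre_le[OF finite_K, where g="\<lambda>i. 1 / (1 + \<bar>of_int i - 2 ^ j * x\<bar>)\<^sup>2"])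
          (use N0[OF j] in \<open>auto simp: Kj\<close>)
      also have "\<dots> \<le> real N0 * W" by (intro mult_left_mono W finite_imageI finite_K) auto
      finally show "(\<Sum>k\<in>K j. (1 / (1 + D k))\<^sup>2) \<le> real N0 * W" .
    qed (use C2 C30 in \<open>auto intro!: sum_nonneg\<close>)
    finally show ?thesis by (simp add: u_def C_def mult_ac)
  qed
  moreover have "0 \<le> C" unfolding C_def using C2 C30 W by simp
  ultimately show ?thesis by blast
qed

end

section \<open>Bias of the spline estimators\<close>

text \<open>One polynomial serves all orders s at once. From s = p, where the polynomial contributes
  nothing, the bound descends by the mean value inequality on the segment between t and x; the
  factorials are given up, as only the power of |x - t| matters.\<close>

lemma taylor01:
  assumes F: "derivs01 p F" and M: "\<And>x. x \<in> {0..1} \<Longrightarrow> \<bar>F p x\<bar> \<le> M" and t: "t \<in> {0..1}"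
  shows "\<exists>q. degree q \<le> p - 1 \<and> (\<forall>s\<le>p. \<forall>x\<in>{0..1}. \<bar>F s x - poly ((pderiv ^^ s) q) x\<bar> \<le> M * \<bar>x - t\<bar> ^ (p - s))"
proof -
  define r where "r = (\<Sum>i<p. monom (F i t / fact i) i)"
  define q where "q = pcompose r [:- t, 1:]"
  have cr: "coeff r i = (if i < p then F i t / fact i else 0)" for i
    by (simp add: r_def coeff_sum)
  have dr: "degree r \<le> p - 1" by (rule degree_le) (auto simp: cr)
  have "degree q \<le> degree r * degree [:- t, 1:]" unfolding q_def by (rule degree_pcompose_le)
  then have dq: "degree q \<le> p - 1" using dr by simp
  have qs: "(pderiv ^^ s) q = pcompose ((pderiv ^^ s) r) [:- t, 1:]" for s
    unfolding q_def higher_pderiv_affine by simp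
  have at_t: "poly ((pderiv ^^ s) q) t = F s t" if "s < p" for s
    using that by (simp add: qs poly_pcompose poly_0_coeff_0 coeff_higher_pderiv cr pochhammer_fact[symmetric])
  have top: "(pderiv ^^ p) q = 0"
  proof -
    have "(pderiv ^^ p) r = 0" by (rule poly_eqI) (simp add: coeff_higher_pderiv cr)
    then show ?thesis by (simp add: qs)
  qed
  have M0: "0 \<le> M" using M[OF t] by linarith
  have "\<forall>x\<in>{0..1}. \<bar>F s x - poly ((pderiv ^^ s) q) x\<bar> \<le> M * \<bar>x - t\<bar> ^ (p - s)" if "s \<le> p" for s
    using that
  proof (induction s rule: inc_induct)
    case base
    then show ?case using M top by simp
  next
    case (step s)
    show ?case
    proof
      fix x :: real assume x: "x \<in> {0..1}"
      define E where "E y = F s y - poly ((pderiv ^^ s) q) y" for y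
      define E' where "E' y = F (Suc s) y - poly ((pderiv ^^ Suc s) q) y" for y
      define B where "B = M * \<bar>x - t\<bar> ^ (p - Suc s)"
      define S where "S = {min x t..max x t}"
      have S01: "S \<subseteq> {0..1}" using x t by (auto simp: S_def min_def max_def split: if_splits)
      have "norm (E x - E t) \<le> B * norm (x - t)"
      proof (rule field_differentiable_bound[where S=S and f'=E'])
        show "convex S" by (simp add: S_def)
        show "(E has_field_derivative E' y) (at y within S)" if "y \<in> S" for y
        proof -
          have "(F s has_real_derivative F (Suc s) y) (at y within {0..1})"
            using F step S01 that by (auto simp: derivs01_def)
          then have "(F s has_real_derivative F (Suc s) y) (at y within S)"
            by (rule has_field_derivative_subset) (rule S01)
          then show ?thesis unfolding E_def E'_def
            by (intro DERIV_diff) (auto intro: has_field_derivative_at_within)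
        qed
        show "norm (E' y) \<le> B" if "y \<in> S" for y
        proof -
          have "\<bar>E' y\<bar> \<le> M * \<bar>y - t\<bar> ^ (p - Suc s)" using step.IH that S01 by (auto simp: E'_def)
          also have "\<dots> \<le> B" unfolding B_def
            by (intro mult_left_mono power_mono M0) (use that in \<open>auto simp: S_def min_def max_def split: if_splits\<close>)
          finally show ?thesis by simp
        qed
        show "x \<in> S" "t \<in> S" by (auto simp: S_def)
      qed
      moreover have "E t = 0" using at_t step by (simp add: E_def)
      moreover have "B * norm (x - t) = M * \<bar>x - t\<bar> ^ (p - s)"
        using step by (simp add: B_def Suc_diff_Suc[symmetric] mult_ac)
      ultimately show "\<bar>F s x - poly ((pderiv ^^ s) q) x\<bar> \<le> M * \<bar>x - t\<bar> ^ (p - s)" by (simp add: E_def)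
    qed
  qed
  then show ?thesis using dq by blast
qed

lemma Wp_bound:
  assumes f: "f \<in> Wp p M" and s: "s \<le> p" and x: "x \<in> {0..1}"
  shows "\<bar>sderiv s f x\<bar> \<le> M"
proof -
  define b where "b j = (SUP x\<in>{0..1}. \<bar>sderiv j f x\<bar>)" for j
  have le: "\<bar>sderiv j f x\<bar> \<le> b j" if j: "j \<le> p" and x: "x \<in> {0..1}" for j x
  proof -
    have "compact ((\<lambda>x. \<bar>sderiv j f x\<bar>) ` {0..1})"
      using f j by (intro compact_continuous_image continuous_on_rabs) (auto simp: Wp_def Cp01_def)
    then have "bdd_above ((\<lambda>x. \<bar>sderiv j f x\<bar>) ` {0..1})" by (intro bounded_imp_bdd_above compact_imp_bounded)
    then show ?thesis unfolding b_def by (intro cSUP_upper x)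
  qed
  have b0: "0 \<le> b j" if "j \<le> p" for j using le[OF that, of 0] by simp
  have "b s \<le> (\<Sum>j\<le>p. b j)" using s b0 by (intro member_le_sum) auto
  also have "\<dots> < M" using f by (simp add: Wp_def b_def)
  finally show ?thesis using le[OF s x] by simp
qed

lemma Wp_derivs: "f \<in> Wp p M \<Longrightarrow> derivs01 p (\<lambda>j. sderiv j f)"
  by (intro Cp01_derivs01) (simp add: Wp_def)

lemma Wp_continuous: "f \<in> Wp p M \<Longrightarrow> continuous_on {0..1} f"
  by (auto simp: Wp_def Cp01_def dest: spec[of _ 0])

lemma continuous_bdd01: assumes "continuous_on {0..1} f" shows "bdd01 f"
proof -
  have "set_borel_measurable lborel {0..1} f"
    unfolding set_borel_measurable_def using borel_measurable_continuous_on_indicator[OF _ assms] by simp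
  moreover have "\<exists>C. \<forall>x\<in>{0..1}. \<bar>f x\<bar> \<le> C"
  proof -
    have "compact (f ` {0..1})" by (intro compact_continuous_image assms) auto
    then show ?thesis by (metis (no_types, lifting) bounded_real compact_imp_bounded imageI)
  qed
  ultimately show ?thesis by (simp add: bdd01_def)
qed

lemma Wp_bdd01: "f \<in> Wp p M \<Longrightarrow> bdd01 f"
  by (intro continuous_bdd01 Wp_continuous)

lemma l2sq_interval_le:
  assumes "a \<le> b" shows "l2sq (\<lambda>x. D * indicator {a..b} x) \<le> D\<^sup>2 * (b - a)"
proof -
  have "l2sq (\<lambda>x. D * indicator {a..b} x) = (LINT x|lborel. indicator {0..1} x * (D\<^sup>2 * indicator {a..b} x))"
    unfolding l2sq_def inner01_def set_lebesgue_integral_def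
    by (intro Bochner_Integration.integral_cong) (auto simp: indicator_def power2_eq_square)
  also have "\<dots> \<le> (LINT x|lborel. D\<^sup>2 * indicator {a..b} x)"
  proof (rule integral_mono')
    have "integrable lborel (indicator {a..b} :: real \<Rightarrow> real)"
      by (rule integrable_real_indicator) (auto simp: emeasure_lborel_Icc_eq)
    then show "integrable lborel (\<lambda>x. D\<^sup>2 * indicator {a..b} x)" by (rule integrable_mult_right)
  qed (auto simp: indicator_def)
  also have "\<dots> = D\<^sup>2 * (b - a)" using assms by simp
  finally show ?thesis .
qed

context jia
begin

text \<open>The wavelets are orthogonal to \<open>Vsp d j\<close>, which contains the Taylor
  polynomial of degree p - 1 about a point of the support; here p \<le> d + 1 enters. Only the
  remainder, of size h^p on an interval of length 2h with h of order 2^(-j), is left to pair with a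
  unit vector.\<close>

lemma coef_bound:
  assumes p: "1 \<le> p" "p \<le> d + 1" and M: "0 \<le> M"
  shows "\<exists>C\<ge>0. \<forall>j\<ge>j0 d. \<forall>k\<in>{1..2 ^ j}. \<forall>f\<in>Wp p M. (inner01 f (\<psi> j k))\<^sup>2 \<le> C * (1 / 2 ^ j) ^ (2 * p + 1)"
proof -
  obtain B m N0 where
    sup: "\<And>j k x. j0 d \<le> j \<Longrightarrow> k \<in> {1..2 ^ j} \<Longrightarrow> x \<in> {0..1} \<Longrightarrow> \<bar>\<psi> j k x\<bar> \<le> B * sqrt (2 ^ j)
       \<and> (\<psi> j k x \<noteq> 0 \<longrightarrow> \<bar>of_int (m j k :: int) - 2 ^ j * x\<bar> \<le> 2 * real d + 1)"
    and "\<And>j i. j0 d \<le> j \<Longrightarrow> card {k \<in> {1..2 ^ j}. m j k = i} \<le> (N0::nat)"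
    using support_data by blast
  define R where "R = 2 * (2 * real d + 1)"
  define C where "C = M\<^sup>2 * R ^ (2 * p) * (2 * R)"
  have C0: "0 \<le> C" by (simp add: C_def R_def)
  have "(inner01 f (\<psi> j k))\<^sup>2 \<le> C * (1 / 2 ^ j) ^ (2 * p + 1)"
    if j: "j0 d \<le> j" and k: "k \<in> {1..2 ^ j}" and f: "f \<in> Wp p M" for j k f
  proof (cases "\<exists>t\<in>{0..1}. \<psi> j k t \<noteq> 0")
    case False
    then have "inner01 f (\<psi> j k) = inner01 (\<lambda>x. 0) (\<lambda>x. 0)"
      unfolding inner01_def by (intro set_lebesgue_integral_cong) auto
    then show ?thesis using C0 by simp
  next
    case True
    then obtain t where t: "t \<in> {0..1}" "\<psi> j k t \<noteq> 0" by blast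
    have j': "j0 d - 1 \<le> j" using j by simp
    define h where "h = R / 2 ^ j"
    have h0: "0 \<le> h" by (simp add: h_def R_def)
    have near: "\<bar>x - t\<bar> \<le> h" if "x \<in> {0..1}" "\<psi> j k x \<noteq> 0" for x
    proof -
      have "\<bar>of_int (m j k) - 2 ^ j * x\<bar> \<le> 2 * real d + 1" "\<bar>of_int (m j k) - 2 ^ j * t\<bar> \<le> 2 * real d + 1"
        using sup[OF j k] t that by blast+
      moreover have "\<bar>x - t\<bar> \<le> 2 * r" if "\<bar>y - x\<bar> \<le> r" "\<bar>y - t\<bar> \<le> r" for x y t r :: real using that by linarith
      ultimately have "\<bar>2 ^ j * x - 2 ^ j * t\<bar> \<le> R" unfolding R_def by blast
      then have "2 ^ j * \<bar>x - t\<bar> \<le> R" by (simp add: abs_mult flip: right_diff_distrib)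
      then show ?thesis unfolding h_def by (simp add: field_simps)
    qed
    obtain q where q: "degree q \<le> p - 1" "\<And>s x. s \<le> p \<Longrightarrow> x \<in> {0..1} \<Longrightarrow>
        \<bar>sderiv s f x - poly ((pderiv ^^ s) q) x\<bar> \<le> M * \<bar>x - t\<bar> ^ (p - s)"
      using taylor01[OF Wp_derivs[OF f] Wp_bound[OF f order_refl] t(1)] by blast
    have q0: "\<bar>f x - poly q x\<bar> \<le> M * \<bar>x - t\<bar> ^ p" if "x \<in> {0..1}" for x using q(2)[of 0 x] that by simp
    define qq where "qq x = (if x \<in> {0..1} then poly q x else 0)" for x
    have qV: "qq \<in> Vsp d j" unfolding qq_def using q(1) p by (intro poly_Vsp) simp
    have bq: "bdd01 qq" by (rule Vsp_bdd01[OF qV])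
    have bf: "bdd01 f" by (rule Wp_bdd01[OF f])
    have bpsi: "bdd01 (\<psi> j k)" using phi_bdd01[OF j', of k] k by (simp add: fine_simps[OF j])
    define I where "I = {t - h..t + h}"
    have bI: "bdd01 (indicator I)" by (rule bdd01I[where C=1]) (auto simp: indicator_def I_def)
    define e where "e x = (f x - qq x) * indicator I x" for x
    have be: "bdd01 e" unfolding e_def by (intro bdd01_mult bdd01_diff bf bq bI)
    have "inner01 qq (\<psi> j k) = 0"
      using psi_Usp[OF j k] qV by (simp add: Usp_def inner01_commute[of qq])
    then have "inner01 f (\<psi> j k) = inner01 (\<lambda>x. f x - qq x) (\<psi> j k)" by (simp add: inner01_diff_left bf bq bpsi)
    also have "\<dots> = inner01 e (\<psi> j k)"
      unfolding inner01_def
      by (intro set_lebesgue_integral_cong) (use near in \<open>force simp: e_def I_def indicator_def abs_le_iff\<close>)+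
    finally have "(inner01 f (\<psi> j k))\<^sup>2 \<le> l2sq e * l2sq (\<psi> j k)" using inner01_Cauchy_Schwarz[OF be bpsi] by simp
    also have "\<dots> = l2sq e" using psi_Usp[OF j k] by simp
    also have "\<dots> \<le> l2sq (\<lambda>x. (M * h ^ p) * indicator I x)"
    proof (rule l2sq_mono[OF be bdd01_cmult[OF bI]])
      fix x :: real assume x: "x \<in> {0..1}"
      show "\<bar>e x\<bar> \<le> \<bar>(M * h ^ p) * indicator I x\<bar>"
      proof (cases "x \<in> I")
        case True
        then have "\<bar>x - t\<bar> \<le> h" by (auto simp: I_def)
        then have "M * \<bar>x - t\<bar> ^ p \<le> M * h ^ p" using M by (intro mult_left_mono power_mono) auto
        then show ?thesis using q0[OF x] True x M h0 by (simp add: e_def qq_def)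
      qed (simp add: e_def)
    qed
    also have "\<dots> \<le> (M * h ^ p)\<^sup>2 * (2 * h)"
      using l2sq_interval_le[of "t - h" "t + h" "M * h ^ p"] h0 by (simp add: I_def)
    also have "\<dots> = C * (1 / 2 ^ j) ^ (2 * p + 1)"
      by (simp add: C_def h_def power_mult_distrib power_divide power_mult[symmetric] mult.commute[of 2 p])
    finally show ?thesis .
  qed
  then show ?thesis using C0 by blast
qed

text \<open>Coefficients of size 2^(-j(p + 1/2)) meet a sum of absolute dual values of size 2^(j/2).
  Without the localisation of the duals, Cauchy-Schwarz over all 2^j coefficients would lose a
  factor 2^(j/2).\<close>

lemma lproj_bound:
  assumes p: "1 \<le> p" "p \<le> d + 1" and M: "0 \<le> M"
  shows "\<exists>C\<ge>0. \<forall>j\<ge>j0 d. \<forall>f\<in>Wp p M. \<forall>x\<in>{0..1}. \<bar>lproj j f x\<bar> \<le> C * (1 / 2 ^ j) ^ p"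
proof -
  obtain C1 where C1: "0 \<le> C1" "\<And>j k f. j0 d \<le> j \<Longrightarrow> k \<in> {1..2 ^ j} \<Longrightarrow> f \<in> Wp p M \<Longrightarrow>
      (inner01 f (\<psi> j k))\<^sup>2 \<le> C1 * (1 / 2 ^ j) ^ (2 * p + 1)"
    using coef_bound[OF p M] by blast
  obtain C2 where C2: "0 \<le> C2" "\<And>j x. j0 d \<le> j \<Longrightarrow> x \<in> {0..1} \<Longrightarrow> (\<Sum>k\<in>K j. \<bar>dual j k x\<bar>)\<^sup>2 \<le> C2 * 2 ^ j"
    using dual_abs_sum by blast
  have "\<bar>lproj j f x\<bar> \<le> sqrt (C1 * C2) * (1 / 2 ^ j) ^ p"
    if j: "j0 d \<le> j" and f: "f \<in> Wp p M" and x: "x \<in> {0..1}" for j f x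
  proof -
    define E where "E = C1 * (1 / 2 ^ j) ^ (2 * p + 1)"
    define S where "S = (\<Sum>k\<in>K j. \<bar>dual j k x\<bar>)"
    have E0: "0 \<le> E" and S0: "0 \<le> S" using C1 by (auto simp: E_def S_def intro: sum_nonneg)
    have "\<bar>lproj j f x\<bar> \<le> (\<Sum>k\<in>K j. \<bar>inner01 f (\<phi> j k) * dual j k x\<bar>)" unfolding lproj_def by (rule sum_abs)
    also have "\<dots> \<le> (\<Sum>k\<in>K j. sqrt E * \<bar>dual j k x\<bar>)"
    proof (rule sum_mono)
      fix k assume "k \<in> K j"
      then have "(inner01 f (\<phi> j k))\<^sup>2 \<le> E" using C1(2)[OF j _ f, of k] by (simp add: fine_simps[OF j] E_def)
      then have "\<bar>inner01 f (\<phi> j k)\<bar> \<le> sqrt E" using real_sqrt_le_mono by fastforce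
      then show "\<bar>inner01 f (\<phi> j k) * dual j k x\<bar> \<le> sqrt E * \<bar>dual j k x\<bar>"
        unfolding abs_mult by (rule mult_right_mono) simp
    qed
    also have "\<dots> = sqrt E * S" by (simp add: S_def sum_distrib_left)
    finally have "\<bar>lproj j f x\<bar>\<^sup>2 \<le> (sqrt E * S)\<^sup>2" by (intro power_mono) auto
    also have "\<dots> = E * S\<^sup>2" using E0 by (simp add: power_mult_distrib)
    also have "\<dots> \<le> E * (C2 * 2 ^ j)" unfolding S_def by (intro mult_left_mono C2(2) j x E0)
    also have "\<dots> = (sqrt (C1 * C2) * (1 / 2 ^ j) ^ p)\<^sup>2"
      using C1(1) C2(1) by (simp add: E_def power_mult_distrib power_divide power_mult[symmetric] mult.commute[of 2 p])
    finally show ?thesis by (rule power2_le_imp_le) (use C1(1) C2(1) in simp)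
  qed
  then show ?thesis using C1(1) C2(1) by (intro exI[of _ "sqrt (C1 * C2)"]) auto
qed

section \<open>The projection onto the nested spaces and its bias\<close>

definition fproj :: "nat \<Rightarrow> (real \<Rightarrow> real) \<Rightarrow> real \<Rightarrow> real" where
  "fproj J f x = (\<Sum>j\<in>{j0 d - 1..J}. lproj j f x)"

lemma fproj_Suc: "j0 d - 1 \<le> Suc J \<Longrightarrow> fproj (Suc J) f x = fproj J f x + lproj (Suc J) f x"
  by (simp add: fproj_def)

text \<open>Projection on the coarse space through the Gram system of its B-splines; the remainder
  is orthogonal to that space and so in \<open>Usp\<close>.\<close>

lemma Vsp_split:
  assumes "h \<in> Vsp d (Suc j)"
  shows "\<exists>v u. v \<in> Vsp d j \<and> u \<in> Usp d j \<and> h = (\<lambda>x. v x + u x)"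
proof -
  have bh: "bdd01 h" by (rule Vsp_bdd01[OF assms])
  have bB: "bdd01 (Bspl d j k)" if "k \<in> {1..2 ^ j + d}" for k by (rule Vsp_bdd01[OF Bspl_Vsp[OF that]])
  have ind: "\<forall>k\<in>{1..2 ^ j + d}. c k = 0"
    if "l2sq (\<lambda>x. \<Sum>k\<in>{1..2 ^ j + d}. c k * Bspl d j k x) = 0" for c
    using Bspl_l2_independent[OF that] by blast
  obtain c where c: "\<forall>l\<in>{1..2 ^ j + d}. inner01 (\<lambda>x. \<Sum>k\<in>{1..2 ^ j + d}. c k * Bspl d j k x) (Bspl d j l) = inner01 h (Bspl d j l)"
    using gram_solve[of "{1..2 ^ j + d}" "Bspl d j" "\<lambda>l. inner01 h (Bspl d j l)", OF _ bB ind] by auto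
  define v where "v x = (\<Sum>k\<in>{1..2 ^ j + d}. c k * Bspl d j k x)" for x
  have vV: "v \<in> Vsp d j" unfolding v_def by (intro Vsp_lincomb Bspl_Vsp)
  have bv: "bdd01 v" by (rule Vsp_bdd01[OF vV])
  define u where "u x = h x - v x" for x
  have bu: "bdd01 u" unfolding u_def by (intro bdd01_diff bh bv)
  have "u \<in> Usp d j" unfolding Usp_def
  proof (intro CollectI conjI ballI)
    show "u \<in> Vsp d (Suc j)" unfolding u_def using Vsp_Suc vV by (intro Vsp_diff assms) blast
    fix g assume "g \<in> Vsp d j"
    then obtain a where g: "g = (\<lambda>x. \<Sum>k\<in>{1..2 ^ j + d}. a k * Bspl d j k x)" by (auto simp: Vsp_def)
    have "inner01 u (Bspl d j l) = 0" if "l \<in> {1..2 ^ j + d}" for l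
      using c that inner01_diff_left[OF bh bv bB[OF that]] by (simp add: u_def[abs_def] v_def[abs_def])
    moreover have "inner01 u g = (\<Sum>k\<in>{1..2 ^ j + d}. a k * inner01 u (Bspl d j k))"
      unfolding g by (intro inner01_lincomb_right bu bB)
    ultimately show "inner01 u g = 0" by simp
  qed
  then show ?thesis using vV by (intro exI[of _ v] exI[of _ u]) (auto simp: u_def)
qed

text \<open>In the step the new component lies in \<open>Usp\<close> and so does not disturb
  orthogonality to the old space, and the old projection lies in the old space and so does not
  disturb orthogonality to \<open>Usp\<close>. By \<open>Vsp_split\<close> these two kinds of test
  functions generate the larger space.\<close>

lemma fproj_projection:
  assumes f: "bdd01 f" and "j0 d - 1 \<le> J"
  shows "fproj J f \<in> Vsp d (Suc J) \<and> (\<forall>h\<in>Vsp d (Suc J). inner01 (\<lambda>x. f x - fproj J f x) h = 0)"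
  using assms(2)
proof (induction J rule: dec_induct)
  case base
  have e: "fproj (j0 d - 1) f = lproj (j0 d - 1) f" by (simp add: fproj_def fun_eq_iff)
  have s: "Suc (j0 d - 1) = j0 d" using j0_prop[of d] by simp
  show ?case using lproj_Wsp[of "j0 d - 1" f] lproj_orth[OF order_refl f]
    unfolding e s coarse_simps by simp
next
  case (step J)
  have j: "j0 d \<le> Suc J" and j': "j0 d - 1 \<le> Suc J" using step.hyps by auto
  have e: "fproj (Suc J) f = (\<lambda>x. fproj J f x + lproj (Suc J) f x)" using fproj_Suc[OF j'] by (simp add: fun_eq_iff)
  have lU: "lproj (Suc J) f \<in> Usp d (Suc J)" using lproj_Wsp[OF j', of f] fine_simps(3)[OF j] by simp
  have lV: "lproj (Suc J) f \<in> Vsp d (Suc (Suc J))" using lU by (simp add: Usp_def)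
  have P: "fproj J f \<in> Vsp d (Suc J)" and o: "\<And>h. h \<in> Vsp d (Suc J) \<Longrightarrow> inner01 (\<lambda>x. f x - fproj J f x) h = 0"
    using step.IH by auto
  have bP: "bdd01 (fproj J f)" and bl: "bdd01 (lproj (Suc J) f)" using Vsp_bdd01 P lV by blast+
  have "fproj (Suc J) f \<in> Vsp d (Suc (Suc J))"
    unfolding e using Vsp_Suc P lV by (intro Vsp_add) blast+
  moreover have "inner01 (\<lambda>x. f x - fproj (Suc J) f x) h = 0" if h: "h \<in> Vsp d (Suc (Suc J))" for h
  proof -
    obtain v u where vu: "v \<in> Vsp d (Suc J)" "u \<in> Usp d (Suc J)" "h = (\<lambda>x. v x + u x)" using Vsp_split[OF h] by blast
    have uV: "u \<in> Vsp d (Suc (Suc J))" using vu by (simp add: Usp_def)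
    have bv: "bdd01 v" and bu: "bdd01 u" using Vsp_bdd01 vu(1) uV by blast+
    have bd: "bdd01 (\<lambda>x. f x - fproj (Suc J) f x)" unfolding e by (intro bdd01_diff bdd01_add f bP bl)
    have "inner01 (\<lambda>x. f x - fproj (Suc J) f x) h
        = inner01 (\<lambda>x. f x - fproj (Suc J) f x) v + inner01 (\<lambda>x. f x - fproj (Suc J) f x) u"
      unfolding vu(3) by (rule inner01_add_right[OF bv bu bd])
    also have "inner01 (\<lambda>x. f x - fproj (Suc J) f x) v = inner01 (\<lambda>x. f x - fproj J f x) v - inner01 (lproj (Suc J) f) v"
      using inner01_diff_left[OF bdd01_diff[OF f bP] bl bv] by (simp add: e diff_diff_eq)
    also have "\<dots> = 0" using o[OF vu(1)] lU vu(1) by (simp add: Usp_def)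
    also have "inner01 (\<lambda>x. f x - fproj (Suc J) f x) u = inner01 (\<lambda>x. f x - lproj (Suc J) f x) u - inner01 (fproj J f) u"
      using inner01_diff_left[OF bdd01_diff[OF f bl] bP bu] by (simp add: e algebra_simps)
    also have "inner01 (\<lambda>x. f x - lproj (Suc J) f x) u = 0"
      using lproj_orth[OF j' f, of u] vu(2) fine_simps(3)[OF j] by simp
    also have "inner01 (fproj J f) u = 0" using vu(2) P by (simp add: Usp_def inner01_commute[of "fproj J f"])
    finally show ?thesis by simp
  qed
  ultimately show ?case by blast
qed

lemma fproj_best:
  assumes f: "bdd01 f" and J: "j0 d - 1 \<le> J" and v: "v \<in> Vsp d (Suc J)"
  shows "l2sq (\<lambda>x. f x - fproj J f x) \<le> l2sq (\<lambda>x. f x - v x)"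
proof -
  note P = fproj_projection[OF f J]
  have bP: "bdd01 (fproj J f)" and bv: "bdd01 v" using P v Vsp_bdd01 by blast+
  have "inner01 (\<lambda>x. f x - fproj J f x) (\<lambda>x. fproj J f x - v x) = 0"
    using P v by (auto intro: Vsp_diff)
  then have "l2sq (\<lambda>x. (f x - fproj J f x) + (fproj J f x - v x)) = l2sq (\<lambda>x. f x - fproj J f x) + l2sq (\<lambda>x. fproj J f x - v x)"
    by (subst l2sq_add) (auto intro!: bdd01_diff f bP bv)
  then show ?thesis using l2sq_nonneg[of "\<lambda>x. fproj J f x - v x"] by simp
qed

lemma fproj_l2_limit:
  assumes f: "continuous_on {0..1} f" and e: "0 < e"
  shows "\<exists>J'\<ge>J. j0 d - 1 \<le> J' \<and> l2sq (\<lambda>x. f x - fproj J' f x) \<le> e\<^sup>2"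
proof -
  obtain I where I: "\<And>j. j \<ge> I \<Longrightarrow> \<exists>v\<in>Vsp d j. \<forall>x\<in>{0..1}. \<bar>f x - v x\<bar> \<le> e"
    using Vsp_dense[OF f e] by blast
  define J' where "J' = max J (max I (j0 d))"
  have "I \<le> Suc J'" by (simp add: J'_def)
  from I[OF this] obtain v where v: "v \<in> Vsp d (Suc J')" "\<forall>x\<in>{0..1}. \<bar>f x - v x\<bar> \<le> e" by blast
  have "l2sq (\<lambda>x. f x - fproj J' f x) \<le> l2sq (\<lambda>x. f x - v x)"
    by (rule fproj_best[OF continuous_bdd01[OF f] _ v(1)]) (simp add: J'_def)
  also have "\<dots> \<le> l2sq (\<lambda>x. e)"
  proof (rule l2sq_mono)
    show "bdd01 (\<lambda>x. f x - v x)" by (intro bdd01_diff continuous_bdd01[OF f] Vsp_bdd01[OF v(1)])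
  qed (use v e bdd01_const in auto)
  finally show ?thesis by (intro exI[of _ J']) (auto simp: J'_def l2sq_const)
qed

text \<open>The increments are summable in sup-norm, but this identifies no limit. In mean square
  the limit is known to be f, and an error beyond the bound at one point would be beyond it on an
  interval, which the mean-square limit excludes.\<close>

lemma fproj_sup_bound:
  assumes p: "1 \<le> p" "p \<le> d + 1" and M: "0 \<le> M"
  shows "\<exists>C\<ge>0. \<forall>J\<ge>j0 d - 1. \<forall>f\<in>Wp p M. \<forall>x\<in>{0..1}. \<bar>fproj J f x - f x\<bar> \<le> C * (1 / 2 ^ J) ^ p"
proof -
  obtain C where C: "0 \<le> C" "\<And>j f x. j0 d \<le> j \<Longrightarrow> f \<in> Wp p M \<Longrightarrow> x \<in> {0..1} \<Longrightarrow> \<bar>lproj j f x\<bar> \<le> C * (1 / 2 ^ j) ^ p"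
    using lproj_bound[OF p M] by blast
  \<comment> \<open>The right side is a difference so that the induction telescopes; the step uses
    that the p-th power at least halves with each level, as p is at least 1.\<close>
  have tail: "\<bar>fproj J' f x - fproj J f x\<bar> \<le> C * ((1 / 2 ^ J) ^ p - (1 / 2 ^ J') ^ p)"
    if J: "j0 d - 1 \<le> J" and JJ: "J \<le> J'" and f: "f \<in> Wp p M" and x: "x \<in> {0..1}" for J J' f x
    using JJ
  proof (induction J' rule: dec_induct)
    case (step J')
    have j: "j0 d \<le> Suc J'" using J step.hyps by simp
    define a where "a = ((1::real) / 2 ^ Suc J') ^ p"
    have "((1::real) / 2 ^ J') ^ p = 2 ^ p * a" by (simp add: a_def power_mult_distrib power_divide)
    moreover have "2 * a \<le> 2 ^ p * a"
      by (intro mult_right_mono) (use p self_le_power[of "2::real" p] in \<open>auto simp: a_def\<close>)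
    ultimately have a: "a \<le> (1 / 2 ^ J') ^ p - a" by simp
    have "\<bar>fproj (Suc J') f x - fproj J f x\<bar> \<le> \<bar>fproj J' f x - fproj J f x\<bar> + \<bar>lproj (Suc J') f x\<bar>"
      using fproj_Suc[of J' f x] j by simp
    also have "\<dots> \<le> C * ((1 / 2 ^ J) ^ p - (1 / 2 ^ J') ^ p) + C * a"
      unfolding a_def by (intro add_mono step.IH C(2) j f x)
    also have "\<dots> \<le> C * ((1 / 2 ^ J) ^ p - (1 / 2 ^ J') ^ p) + C * ((1 / 2 ^ J') ^ p - a)"
      by (intro add_left_mono mult_left_mono a C)
    finally show ?case by (simp add: a_def algebra_simps)
  qed simp
  have "\<bar>fproj J f x - f x\<bar> \<le> C * (1 / 2 ^ J) ^ p"
    if J: "j0 d - 1 \<le> J" and f: "f \<in> Wp p M" and x: "x \<in> {0..1}" for J f x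
  proof (rule ccontr)
    define e where "e = C * (1 / 2 ^ J) ^ p"
    assume "\<not> \<bar>fproj J f x - f x\<bar> \<le> C * (1 / 2 ^ J) ^ p"
    then have gt: "e < \<bar>fproj J f x - f x\<bar>" by (simp add: e_def)
    define e' where "e' = (e + \<bar>fproj J f x - f x\<bar>) / 2"
    have e': "e < e'" "e' < \<bar>fproj J f x - f x\<bar>" using gt by (auto simp: e'_def)
    note cf = Wp_continuous[OF f]
    have pp: "ppoly d (2 ^ Suc J) (fproj J f)" using fproj_projection[OF Wp_bdd01[OF f] J] Vsp_ppoly by blast
    obtain a b where ab: "a < b" "{a..b} \<subseteq> {0..1}" "\<forall>y\<in>{a..b}. e' < \<bar>fproj J f y - f y\<bar>"
      using ppoly_interval[OF pp _ cf x e'(2)] by auto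
    \<comment> \<open>Chosen such that \<delta>^2 is a quarter of the lower bound (e' - e)^2 (b - a)
      on the squared norm obtained below.\<close>
    define \<delta> where "\<delta> = (e' - e) * sqrt (b - a) / 2"
    have \<delta>: "0 < \<delta>" using e' ab by (simp add: \<delta>_def)
    obtain J' where J': "J \<le> J'" "j0 d - 1 \<le> J'" "l2sq (\<lambda>x. f x - fproj J' f x) \<le> \<delta>\<^sup>2"
      using fproj_l2_limit[OF cf \<delta>] by blast
    have bP: "bdd01 (fproj J' f)" using fproj_projection[OF Wp_bdd01[OF f] J'(2)] Vsp_bdd01 by blast
    have "(e' - e)\<^sup>2 * (b - a) \<le> l2sq (\<lambda>x. f x - fproj J' f x)"
    proof (rule l2sq_lower)
      show "bdd01 (\<lambda>x. f x - fproj J' f x)" by (intro bdd01_diff Wp_bdd01[OF f] bP)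
      fix y assume y: "y \<in> {a..b}"
      then have y01: "y \<in> {0..1}" using ab by auto
      have "\<bar>fproj J' f y - fproj J f y\<bar> \<le> C * ((1 / 2 ^ J) ^ p - (1 / 2 ^ J') ^ p)"
        by (rule tail[OF J J'(1) f y01])
      also have "\<dots> \<le> e" unfolding e_def by (intro mult_left_mono C) simp
      finally have "\<bar>fproj J' f y - fproj J f y\<bar> \<le> e" .
      moreover have "e' < \<bar>fproj J f y - f y\<bar>" using ab y by blast
      ultimately show "e' - e \<le> \<bar>f y - fproj J' f y\<bar>" by linarith
    qed (use ab e' in auto)
    also have "\<dots> \<le> (e' - e)\<^sup>2 * (b - a) / 4" using J'(3) ab by (simp add: \<delta>_def power_mult_distrib power_divide)
    finally have "(e' - e)\<^sup>2 * (b - a) \<le> 0" by (simp add: mult.commute)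
    moreover have "0 < (e' - e)\<^sup>2 * (b - a)" using e' ab by simp
    ultimately show False by simp
  qed
  then show ?thesis using C(1) by blast
qed

lemma fproj_ppoly: "bdd01 f \<Longrightarrow> ppoly d (2 ^ Suc J) (fproj J f)"
proof (cases "j0 d - 1 \<le> J")
  case True
  assume "bdd01 f"
  then show ?thesis using fproj_projection[of f J] True Vsp_ppoly by blast
next
  case False
  then show ?thesis by (simp add: fproj_def[abs_def] ppoly_zero)
qed

text \<open>An inverse inequality does not apply to \<open>fproj J f - f\<close>, since f is no
  polynomial. On a cell the projection q and f are both compared with the Taylor polynomial r of f
  at the left end: q - r is a polynomial of size 2^(-Jp), and norming points turn this into
  2^(-J(p-s)) for its s-th derivative.\<close>

theorem bias_bound:
  assumes p: "1 \<le> p" "p \<le> d + 1" and M: "0 \<le> M"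
  shows "\<exists>C\<ge>0. \<forall>J f s. \<forall>x\<in>{0..1}. f \<in> Wp p M \<longrightarrow> s \<le> p \<longrightarrow>
    \<bar>sderiv s (\<lambda>y. fproj J f y - f y) x\<bar> \<le> C * (1 / 2 ^ J) ^ (p - s)"
proof -
  obtain C1 where C1: "0 \<le> C1" "\<And>J f x. j0 d - 1 \<le> J \<Longrightarrow> f \<in> Wp p M \<Longrightarrow> x \<in> {0..1} \<Longrightarrow>
      \<bar>fproj J f x - f x\<bar> \<le> C1 * (1 / 2 ^ J) ^ p"
    using fproj_sup_bound[OF p M] by blast
  obtain C2 where C2: "0 \<le> C2" "\<And>q s N c x. degree q \<le> d \<Longrightarrow> s \<le> p \<Longrightarrow> 0 < N \<Longrightarrow> c < N \<Longrightarrow>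
     x \<in> {real c / real N..real (Suc c) / real N} \<Longrightarrow>
     \<bar>poly ((pderiv ^^ s) q) x\<bar> \<le> C2 * real N ^ s * (\<Sum>i\<le>d. \<bar>poly q (npt d N c i)\<bar>)"
    using poly_cell_bound[of d p] by blast
  define C3 where "C3 = C2 * 2 ^ p * (real (Suc d) * (C1 + M)) + M"
  \<comment> \<open>The second entry covers the levels below \<open>j0 d - 1\<close>, where
    \<open>fproj\<close> is an empty sum and the bias is -f itself.\<close>
  define C where "C = max C3 (M * (2 ^ j0 d) ^ p)"
  have C30: "0 \<le> C3" using C1 C2 M by (simp add: C3_def)
  have "\<bar>sderiv s (\<lambda>y. fproj J f y - f y) x\<bar> \<le> C * (1 / 2 ^ J) ^ (p - s)"
    if f: "f \<in> Wp p M" and s: "s \<le> p" and x: "x \<in> {0..1}" for J f s x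
  proof (cases "j0 d - 1 \<le> J")
    case True
    define N where "N = (2::nat) ^ Suc J"
    define c where "c = cidx N x"
    have N: "0 < N" by (simp add: N_def)
    have c: "c < N" "x \<in> cell N c" using cidx_less[OF N] cell_cidx[OF N x] by (auto simp: c_def)
    define t where "t = real c / real N"
    have tc: "t \<in> {0..1}" using c N by (simp add: t_def)
    obtain q where q: "degree q \<le> d" "\<forall>x\<in>cell N c. fproj J f x = poly q x"
      using ppolyE[OF fproj_ppoly[OF Wp_bdd01[OF f], of J, folded N_def] c(1)] by blast
    obtain r where r: "degree r \<le> p - 1" "\<And>s x. s \<le> p \<Longrightarrow> x \<in> {0..1} \<Longrightarrow>
        \<bar>sderiv s f x - poly ((pderiv ^^ s) r) x\<bar> \<le> M * \<bar>x - t\<bar> ^ (p - s)"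
      using taylor01[OF Wp_derivs[OF f] Wp_bound[OF f order_refl] tc] by blast
    have near: "\<bar>y - t\<bar> \<le> 1 / 2 ^ J" if "y \<in> cell N c" for y
    proof -
      have "t \<le> y" "y \<le> t + 1 / real N" using cell_Icc[OF N c(1) that] by (auto simp: t_def add_divide_distrib)
      moreover have "1 / real N \<le> 1 / 2 ^ J" by (simp add: N_def field_simps)
      ultimately show ?thesis by auto
    qed
    have Mn: "M * \<bar>y - t\<bar> ^ k \<le> M * (1 / 2 ^ J) ^ k" if "y \<in> cell N c" for y k
      using near[OF that] M by (intro mult_left_mono power_mono) auto
    have "sderiv s (\<lambda>y. fproj J f y - f y) x = poly ((pderiv ^^ s) q) x - sderiv s f x"
      by (rule sderiv_cell[OF N c(1) Wp_derivs[OF f] _ s c(2)]) (use q in auto)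
    moreover have "(pderiv ^^ s) q = (pderiv ^^ s) (q - r) + (pderiv ^^ s) r"
      using higher_pderiv_add[of s "q - r" r] by simp
    ultimately have "sderiv s (\<lambda>y. fproj J f y - f y) x
        = poly ((pderiv ^^ s) (q - r)) x - (sderiv s f x - poly ((pderiv ^^ s) r) x)" by simp
    then have "\<bar>sderiv s (\<lambda>y. fproj J f y - f y) x\<bar>
       \<le> \<bar>poly ((pderiv ^^ s) (q - r)) x\<bar> + \<bar>sderiv s f x - poly ((pderiv ^^ s) r) x\<bar>"
      using abs_triangle_ineq4 by metis
    also have "\<bar>sderiv s f x - poly ((pderiv ^^ s) r) x\<bar> \<le> M * (1 / 2 ^ J) ^ (p - s)"
      using r(2)[OF s x] Mn[OF c(2)] by (rule order_trans)
    also have "\<bar>poly ((pderiv ^^ s) (q - r)) x\<bar> \<le> C2 * real N ^ s * (\<Sum>i\<le>d. \<bar>poly (q - r) (npt d N c i)\<bar>)"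
    proof (rule C2(2)[OF _ s N c(1) cell_Icc[OF N c]])
      show "degree (q - r) \<le> d" using q r p by (intro degree_diff_le) auto
    qed
    also have "\<dots> \<le> C2 * real N ^ s * (\<Sum>i\<le>d. (C1 + M) * (1 / 2 ^ J) ^ p)"
    proof (intro mult_left_mono sum_mono)
      fix i assume i: "i \<in> {..d}"
      define y where "y = npt d N c i"
      have y: "y \<in> cell N c" "y \<in> {0..1}" using npt_cell[OF c(1)] npt_01[OF c(1)] i by (auto simp: y_def)
      have "poly (q - r) y = (fproj J f y - f y) + (f y - poly r y)" using q y by simp
      also have "\<bar>\<dots>\<bar> \<le> \<bar>fproj J f y - f y\<bar> + \<bar>f y - poly r y\<bar>" by (rule abs_triangle_ineq)
      also have "\<dots> \<le> C1 * (1 / 2 ^ J) ^ p + M * (1 / 2 ^ J) ^ p"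
        using C1(2)[OF True f y(2)] r(2)[of 0 y] Mn[OF y(1), of p] y(2) by (intro add_mono) auto
      finally show "\<bar>poly (q - r) (npt d N c i)\<bar> \<le> (C1 + M) * (1 / 2 ^ J) ^ p" by (simp add: y_def distrib_right)
    qed (use C2 in auto)
    also have "\<dots> = C2 * (real N ^ s * (1 / 2 ^ J) ^ s) * (real (Suc d) * (C1 + M)) * (1 / 2 ^ J) ^ (p - s)"
      using s by (simp add: power_add[symmetric] mult_ac)
    also have "real N ^ s * (1 / 2 ^ J) ^ s = 2 ^ s"
    proof -
      have "real N * (1 / 2 ^ J) = 2" by (simp add: N_def)
      then show ?thesis by (simp only: power_mult_distrib[symmetric])
    qed
    also have "C2 * 2 ^ s * (real (Suc d) * (C1 + M)) * (1 / 2 ^ J) ^ (p - s)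
        \<le> C2 * 2 ^ p * (real (Suc d) * (C1 + M)) * (1 / 2 ^ J) ^ (p - s)"
      using s C2 C1 M by (intro mult_right_mono mult_left_mono power_increasing) auto
    finally have "\<bar>sderiv s (\<lambda>y. fproj J f y - f y) x\<bar> \<le> C3 * (1 / 2 ^ J) ^ (p - s)"
      by (simp add: C3_def distrib_right)
    also have "\<dots> \<le> C * (1 / 2 ^ J) ^ (p - s)" by (intro mult_right_mono) (auto simp: C_def)
    finally show ?thesis .
  next
    case False
    then have Jj: "J \<le> j0 d" by simp
    have c: "cidx 1 x < 1" "x \<in> cell 1 (cidx 1 x)" using cidx_less[of 1] cell_cidx[of 1, OF _ x] by auto
    have "sderiv s (\<lambda>y. fproj J f y - f y) x = poly ((pderiv ^^ s) 0) x - sderiv s f x"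
      by (rule sderiv_cell[OF _ c(1) Wp_derivs[OF f] _ s c(2)]) (use False in \<open>auto simp: fproj_def\<close>)
    then have "\<bar>sderiv s (\<lambda>y. fproj J f y - f y) x\<bar> \<le> M" using Wp_bound[OF f s x] by simp
    also have "\<dots> \<le> M * (2 ^ j0 d / 2 ^ J) ^ (p - s)"
    proof -
      have "1 \<le> (2::real) ^ j0 d / 2 ^ J" using Jj by simp
      then have "1 \<le> ((2::real) ^ j0 d / 2 ^ J) ^ (p - s)" by (rule one_le_power)
      then show ?thesis using M mult_left_mono[of 1 _ M] by simp
    qed
    also have "\<dots> = M * (2 ^ j0 d) ^ (p - s) * (1 / 2 ^ J) ^ (p - s)" by (simp add: power_divide)
    also have "\<dots> \<le> C * (1 / 2 ^ J) ^ (p - s)"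
    proof (rule mult_right_mono)
      have "M * (2 ^ j0 d) ^ (p - s) \<le> M * (2 ^ j0 d) ^ p" using M by (intro mult_left_mono power_increasing) auto
      also have "\<dots> \<le> C" by (simp add: C_def)
      finally show "M * (2 ^ j0 d) ^ (p - s) \<le> C" .
    qed simp
    finally show ?thesis .
  qed
  moreover have "0 \<le> C" using C30 by (simp add: C_def)
  ultimately show ?thesis by blast
qed

end

section \<open>Moment generating functions of the data and the noise\<close>

lemma exp_le_quadratic:
  fixes z :: real assumes "\<bar>z\<bar> \<le> 1" shows "exp z \<le> 1 + z + z\<^sup>2"
proof (cases "0 \<le> z")
  case True
  then show ?thesis using assms exp_bound[of z] by simp
next
  case False
  define x where "x = - z"
  have x: "0 < x" using False by (simp add: x_def)
  have "exp (- x) \<le> 1 / (1 + x)"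
    using exp_ge_add_one_self[of x] x by (simp add: exp_minus inverse_eq_divide frac_le)
  also have "\<dots> \<le> 1 - x + x\<^sup>2"
  proof -
    have "1 \<le> 1 + x ^ 3" using x by simp
    also have "\<dots> = (1 - x + x\<^sup>2) * (1 + x)" by (simp add: algebra_simps power2_eq_square power3_eq_cube)
    finally show ?thesis using x by (simp add: divide_le_eq)
  qed
  finally show ?thesis by (simp add: x_def)
qed

lemma nn_integral_half_exponential:
  assumes "0 < l"
  shows "(\<integral>\<^sup>+ y. ennreal (indicator {0..} y * exp (- (l * y))) \<partial>lborel) = ennreal (1 / l)"
proof -
  have "(\<integral>\<^sup>+ y. ennreal (exponential_density l y) \<partial>lborel) = 1"
    using prob_space.emeasure_space_1[OF prob_space_exponential_density[OF assms]]
    by (simp add: emeasure_density)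
  also have "(\<integral>\<^sup>+ y. ennreal (exponential_density l y) \<partial>lborel)
      = (\<integral>\<^sup>+ y. ennreal l * ennreal (indicator {0..} y * exp (- (l * y))) \<partial>lborel)"
    by (rule nn_integral_cong)
      (use assms in \<open>auto simp: exponential_density_def indicator_def mult.commute simp flip: ennreal_mult\<close>)
  also have "\<dots> = ennreal l * (\<integral>\<^sup>+ y. ennreal (indicator {0..} y * exp (- (l * y))) \<partial>lborel)"
    by (rule nn_integral_cmult) auto
  finally have "ennreal l * (\<integral>\<^sup>+ y. ennreal (indicator {0..} y * exp (- (l * y))) \<partial>lborel) = 1" .
  then have "ennreal (1 / l) * (ennreal l * (\<integral>\<^sup>+ y. ennreal (indicator {0..} y * exp (- (l * y))) \<partial>lborel)) = ennreal (1 / l)"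
    by simp
  moreover have "ennreal (1 / l) * ennreal l = 1" using assms by (simp flip: ennreal_mult)
  ultimately show ?thesis by (simp flip: mult.assoc)
qed

lemma sets_laplace [measurable_cong, simp]: "sets laplace = sets borel"
  by (simp add: laplace_def)

lemma laplace_mgf:
  assumes t: "\<bar>t\<bar> < 1"
  shows "(\<integral>\<^sup>+ y. ennreal (exp (t * y)) \<partial>laplace) = ennreal (1 / (1 - t\<^sup>2))"
proof -
  let ?h = "\<lambda>l y. ennreal (indicator {0..} y * exp (- (l * y)))"
  \<comment> \<open>Both half-lines contain the point 0, so the splitting of the density holds off
    this null set. The reflected argument is written \<open>0 + -1 * y\<close> to fit the affine
    change of variables.\<close>
  have AE: "AE y::real in lborel. y \<noteq> 0" by (rule AE_lborel_singleton)
  have "(\<integral>\<^sup>+ y. ennreal (exp (t * y)) \<partial>laplace)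
      = (\<integral>\<^sup>+ y. ennreal (exp (- \<bar>y\<bar>) / 2) * ennreal (exp (t * y)) \<partial>lborel)"
    unfolding laplace_def by (rule nn_integral_density) auto
  also have "\<dots> = (\<integral>\<^sup>+ y. ennreal (1 / 2) * (?h (1 - t) y + ?h (1 + t) (0 + -1 * y)) \<partial>lborel)"
  proof (rule nn_integral_cong_AE, use AE in eventually_elim)
    fix y :: real assume y: "y \<noteq> 0"
    have eq: "exp (- \<bar>y\<bar>) / 2 * exp (t * y)
        = 1 / 2 * (indicator {0..} y * exp (- ((1 - t) * y)) + indicator {0..} (0 + -1 * y) * exp (- ((1 + t) * (0 + -1 * y))))"
      using y by (cases "0 < y") (auto simp: algebra_simps simp flip: exp_add)
    have "ennreal (exp (- \<bar>y\<bar>) / 2) * ennreal (exp (t * y)) = ennreal (exp (- \<bar>y\<bar>) / 2 * exp (t * y))"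
      by (rule ennreal_mult[symmetric]) auto
    also have "\<dots> = ennreal (1 / 2) * ennreal (indicator {0..} y * exp (- ((1 - t) * y)) + indicator {0..} (0 + -1 * y) * exp (- ((1 + t) * (0 + -1 * y))))"
      unfolding eq by (rule ennreal_mult) auto
    also have "ennreal (indicator {0..} y * exp (- ((1 - t) * y)) + indicator {0..} (0 + -1 * y) * exp (- ((1 + t) * (0 + -1 * y))))
        = ?h (1 - t) y + ?h (1 + t) (0 + -1 * y)"
      by (rule ennreal_plus) auto
    finally show "ennreal (exp (- \<bar>y\<bar>) / 2) * ennreal (exp (t * y)) = ennreal (1 / 2) * (?h (1 - t) y + ?h (1 + t) (0 + -1 * y))" .
  qed
  also have "\<dots> = ennreal (1 / 2) * ((\<integral>\<^sup>+ y. ?h (1 - t) y \<partial>lborel) + (\<integral>\<^sup>+ y. ?h (1 + t) (0 + -1 * y) \<partial>lborel))"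
    by (subst nn_integral_cmult, simp, subst nn_integral_add) auto
  also have "(\<integral>\<^sup>+ y. ?h (1 + t) (0 + -1 * y) \<partial>lborel) = (\<integral>\<^sup>+ y. ?h (1 + t) y \<partial>lborel)"
    using nn_integral_real_affine[of "?h (1 + t)" "-1" 0] by simp
  also have "(\<integral>\<^sup>+ y. ?h (1 - t) y \<partial>lborel) = ennreal (1 / (1 - t))"
    by (rule nn_integral_half_exponential) (use t in linarith)
  also have "(\<integral>\<^sup>+ y. ?h (1 + t) y \<partial>lborel) = ennreal (1 / (1 + t))"
    by (rule nn_integral_half_exponential) (use t in linarith)
  also have "ennreal (1 / 2) * (ennreal (1 / (1 - t)) + ennreal (1 / (1 + t))) = ennreal (1 / 2 * (1 / (1 - t) + 1 / (1 + t)))"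
  proof -
    have "0 \<le> 1 / (1 - t)" "0 \<le> 1 / (1 + t)" using t by auto
    then show ?thesis by (simp only: ennreal_plus[symmetric] ennreal_mult'[symmetric])
  qed
  also have "1 / 2 * (1 / (1 - t) + 1 / (1 + t)) = 1 / (1 - t\<^sup>2)"
  proof -
    have "1 - t \<noteq> 0" "1 + t \<noteq> 0" using t by auto
    then have "1 / (1 - t) + 1 / (1 + t) = (1 * (1 + t) + 1 * (1 - t)) / ((1 - t) * (1 + t))" by (rule add_frac_eq)
    then have "1 / 2 * (1 / (1 - t) + 1 / (1 + t)) = 1 / ((1 - t) * (1 + t))" by simp
    then show ?thesis by (simp add: algebra_simps power2_eq_square)
  qed
  finally show ?thesis .
qed

lemma laplace_mgf_le:
  assumes "t\<^sup>2 \<le> 1 / 2"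
  shows "(\<integral>\<^sup>+ y. ennreal (exp (t * y)) \<partial>laplace) \<le> ennreal (exp (2 * t\<^sup>2))"
proof -
  have "t\<^sup>2 < 1" using assms by linarith
  then have t: "\<bar>t\<bar> < 1" by (simp add: abs_square_less_1)
  have "1 / (1 - t\<^sup>2) \<le> 1 + 2 * t\<^sup>2"
  proof -
    have "0 \<le> t\<^sup>2 * (1 - 2 * t\<^sup>2)" using assms by (intro mult_nonneg_nonneg) auto
    then have "1 \<le> (1 + 2 * t\<^sup>2) * (1 - t\<^sup>2)" by (simp add: algebra_simps)
    then show ?thesis using \<open>t\<^sup>2 < 1\<close> by (simp add: divide_le_eq)
  qed
  also have "\<dots> \<le> exp (2 * t\<^sup>2)" by (rule exp_ge_add_one_self)
  finally show ?thesis unfolding laplace_mgf[OF t] by (rule ennreal_leI)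
qed

lemma prob_space_laplace: "prob_space laplace"
proof
  show "emeasure laplace (space laplace) = 1" using laplace_mgf[of 0] by simp
qed

definition obsM :: "(real \<Rightarrow> real) \<Rightarrow> real measure" where
  "obsM f = density lborel (\<lambda>x. ennreal (indicator {0..1} x * f x))"

lemma sets_obsM [measurable_cong, simp]: "sets (obsM f) = sets borel"
  by (simp add: obsM_def)

lemma nn_integral_obsM:
  assumes f: "f \<in> Wp p M" and h: "bdd01 h" "h \<in> borel_measurable borel" "\<And>x. 0 \<le> h x"
  shows "(\<integral>\<^sup>+ x. ennreal (h x) \<partial>obsM f) = ennreal (inner01 f h)"
proof -
  have bf: "bdd01 f" by (rule Wp_bdd01[OF f])
  have f0: "0 \<le> f x" if "x \<in> {0..1}" for x using f that by (auto simp: Wp_def)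
  have m: "(\<lambda>x. indicator {0..1} x * f x) \<in> borel_measurable borel"
    using bf by (simp add: bdd01_def set_borel_measurable_def)
  have "(\<integral>\<^sup>+ x. ennreal (h x) \<partial>obsM f) = (\<integral>\<^sup>+ x. ennreal (indicator {0..1} x * f x) * ennreal (h x) \<partial>lborel)"
    unfolding obsM_def using m h(2) by (intro nn_integral_density) auto
  also have "\<dots> = (\<integral>\<^sup>+ x. ennreal (indicator {0..1} x *\<^sub>R (f x * h x)) \<partial>lborel)"
    by (rule nn_integral_cong) (use f0 h(3) in \<open>auto simp: indicator_def simp flip: ennreal_mult\<close>)
  also have "\<dots> = ennreal (\<integral>x. indicator {0..1} x *\<^sub>R (f x * h x) \<partial>lborel)"
  proof (rule nn_integral_eq_integral)
    show "integrable lborel (\<lambda>x. indicator {0..1} x *\<^sub>R (f x * h x))"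
      using bdd01_integrable[OF bdd01_mult[OF bf h(1)]] by (simp add: set_integrable_def)
    show "AE x in lborel. 0 \<le> indicator {0..1} x *\<^sub>R (f x * h x)"
      using f0 h(3) by (auto simp: indicator_def)
  qed
  finally show ?thesis by (simp add: inner01_def set_lebesgue_integral_def)
qed

lemma inner01_Wp_1: "f \<in> Wp p M \<Longrightarrow> inner01 f (\<lambda>x. 1) = 1"
  by (simp add: inner01_def Wp_def)

lemma prob_space_obsM: assumes f: "f \<in> Wp p M" shows "prob_space (obsM f)"
proof
  have "(\<integral>\<^sup>+ x. ennreal 1 \<partial>obsM f) = ennreal (inner01 f (\<lambda>x. 1))"
    by (rule nn_integral_obsM[OF f bdd01_const]) auto
  then show "emeasure (obsM f) (space (obsM f)) = 1" using inner01_Wp_1[OF f] by simp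
qed

text \<open>Bernstein's estimate for one centred bounded variable: the quadratic bound of the
  exponential leaves, after integration, the variance in the exponent, here enlarged to the second
  moment.\<close>

lemma obsM_mgf_le:
  assumes f: "f \<in> Wp p M" and g: "bdd01 g" "g \<in> borel_measurable borel"
    and t: "\<And>x. x \<in> {0..1} \<Longrightarrow> \<bar>t * (g x - inner01 f g)\<bar> \<le> 1"
  shows "(\<integral>\<^sup>+ x. ennreal (exp (t * (g x - inner01 f g))) \<partial>obsM f)
    \<le> ennreal (exp (t\<^sup>2 * inner01 f (\<lambda>x. (g x)\<^sup>2)))"
proof -
  define e where "e = inner01 f g"
  define V where "V = inner01 f (\<lambda>x. (g x)\<^sup>2)"
  have bf: "bdd01 f" by (rule Wp_bdd01[OF f])
  have f0: "0 \<le> f x" if "x \<in> {0..1}" for x using f that by (auto simp: Wp_def)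
  have bz: "bdd01 (\<lambda>x. t * (g x - e))" by (intro bdd01_cmult bdd01_diff g bdd01_const)
  have be: "bdd01 (\<lambda>x. exp (t * (g x - e)))"
    by (rule bdd01I[where C="exp 1"]) (use g(2) t in \<open>auto simp: e_def abs_le_iff\<close>)
  have bg2: "bdd01 (\<lambda>x. (g x)\<^sup>2)" unfolding power2_eq_square by (intro bdd01_mult g)
  have "inner01 f (\<lambda>x. exp (t * (g x - e))) \<le> inner01 f (\<lambda>x. 1 + t * (g x - e) + (t * (g x - e))\<^sup>2)"
  proof (rule inner01_mono[OF bf be bf])
    show "bdd01 (\<lambda>x. 1 + t * (g x - e) + (t * (g x - e))\<^sup>2)"
      unfolding power2_eq_square by (intro bdd01_add bdd01_const bz bdd01_mult)
    fix x :: real assume "x \<in> {0..1}"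
    then show "f x * exp (t * (g x - e)) \<le> f x * (1 + t * (g x - e) + (t * (g x - e))\<^sup>2)"
      using exp_le_quadratic[of "t * (g x - e)"] t[of x] f0[of x] by (intro mult_left_mono) (auto simp: e_def)
  qed
  \<comment> \<open>Regrouped as a combination of 1, g and g^2, whose pairings with f are 1, e and
    V.\<close>
  also have "(\<lambda>x. 1 + t * (g x - e) + (t * (g x - e))\<^sup>2)
     = (\<lambda>x. ((1 - t * e + t\<^sup>2 * e\<^sup>2) * 1 + (t - 2 * t\<^sup>2 * e) * g x) + t\<^sup>2 * (g x)\<^sup>2)"
    by (rule ext) (simp add: power2_eq_square algebra_simps)
  also have "inner01 f \<dots> = (1 - t * e + t\<^sup>2 * e\<^sup>2) * inner01 f (\<lambda>x. 1) + (t - 2 * t\<^sup>2 * e) * e + t\<^sup>2 * V"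
  proof -
    have b1: "bdd01 (\<lambda>x. (1 - t * e + t\<^sup>2 * e\<^sup>2) * 1)" by (rule bdd01_const)
    have b2: "bdd01 (\<lambda>x. (t - 2 * t\<^sup>2 * e) * g x)" by (intro bdd01_cmult g)
    have b3: "bdd01 (\<lambda>x. t\<^sup>2 * (g x)\<^sup>2)" by (intro bdd01_cmult bg2)
    show ?thesis
      by (simp only: inner01_add_right[OF bdd01_add[OF b1 b2] b3 bf] inner01_add_right[OF b1 b2 bf]
          inner01_cmult_right e_def[symmetric] V_def[symmetric])
  qed
  also have "\<dots> = 1 + t\<^sup>2 * V - t\<^sup>2 * e\<^sup>2" unfolding inner01_Wp_1[OF f] by (simp add: power2_eq_square algebra_simps)
  also have "\<dots> \<le> 1 + t\<^sup>2 * V" by simp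
  also have "\<dots> \<le> exp (t\<^sup>2 * V)" by (rule exp_ge_add_one_self)
  finally have "inner01 f (\<lambda>x. exp (t * (g x - e))) \<le> exp (t\<^sup>2 * V)" .
  moreover have "(\<integral>\<^sup>+ x. ennreal (exp (t * (g x - e))) \<partial>obsM f) = ennreal (inner01 f (\<lambda>x. exp (t * (g x - e))))"
    by (rule nn_integral_obsM[OF f be]) (use g(2) in auto)
  ultimately show ?thesis by (simp add: e_def V_def ennreal_leI)
qed

section \<open>The product measure\<close>

lemma NIdx_Sigma: "NIdx d n = (SIGMA i:{..<n}. SIGMA j:{j0 d - 1..jmax n}. Mset d j)"
  by (auto simp: NIdx_def)

lemma finite_NIdx: "finite (NIdx d n)"
  unfolding NIdx_Sigma by (intro finite_SigmaI) (auto simp: Mset_def)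

lemma dataM_eq: "dataM f n = PiM {..<n} (\<lambda>_. obsM f)"
  by (simp add: dataM_def obsM_def)

lemma prob_space_dataM: "f \<in> Wp p M \<Longrightarrow> prob_space (dataM f n)"
  unfolding dataM_eq by (intro prob_space_PiM prob_space_obsM)

lemma prob_space_noiseM: "prob_space (noiseM d n)"
  unfolding noiseM_def by (intro prob_space_PiM prob_space_laplace)

lemma Ef_const:
  assumes f: "f \<in> Wp p M" shows "Ef d f n (\<lambda>X Y. c) = ennreal c"
proof -
  interpret A: prob_space "dataM f n" by (rule prob_space_dataM[OF f])
  interpret B: prob_space "noiseM d n" by (rule prob_space_noiseM)
  interpret AB: pair_prob_space "dataM f n" "noiseM d n" ..
  show ?thesis by (simp add: Ef_def AB.emeasure_space_1)
qed

lemma data_component_measurable: "i < n \<Longrightarrow> (\<lambda>X. X i) \<in> borel_measurable (dataM f n)"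
proof -
  assume i: "i < n"
  have "(\<lambda>X. X i) \<in> measurable (PiM {..<n} (\<lambda>_. obsM f)) (obsM f)"
    by (rule measurable_component_singleton) (use i in simp)
  then show ?thesis unfolding dataM_eq by (simp cong: measurable_cong_sets)
qed

lemma noise_component_measurable: "z \<in> NIdx d n \<Longrightarrow> (\<lambda>Y. Y z) \<in> borel_measurable (noiseM d n)"
proof -
  assume z: "z \<in> NIdx d n"
  have "(\<lambda>Y. Y z) \<in> measurable (PiM (NIdx d n) (\<lambda>_. laplace)) laplace"
    by (rule measurable_component_singleton) (use z in simp)
  then show ?thesis unfolding noiseM_def by (simp cong: measurable_cong_sets)
qed

text \<open>Independence in the form of Tonelli and product integrals. All factors are nonnegative,
  so the factorisation precedes any knowledge that the moment generating functions are
  finite.\<close>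

lemma Ef_exp_linear:
  assumes f: "f \<in> Wp p M" and g: "g \<in> borel_measurable borel"
  shows "Ef d f n (\<lambda>X Y. exp ((\<Sum>i<n. g (X i)) + (\<Sum>z\<in>NIdx d n. w z * Y z)))
    = (\<integral>\<^sup>+ x. ennreal (exp (g x)) \<partial>obsM f) ^ n * (\<Prod>z\<in>NIdx d n. \<integral>\<^sup>+ y. ennreal (exp (w z * y)) \<partial>laplace)"
proof -
  interpret A: prob_space "dataM f n" by (rule prob_space_dataM[OF f])
  interpret B: prob_space "noiseM d n" by (rule prob_space_noiseM)
  interpret O: product_sigma_finite "\<lambda>_::nat. obsM f"
    using prob_space_imp_sigma_finite[OF prob_space_obsM[OF f]] by (simp add: product_sigma_finite_def)
  interpret L: product_sigma_finite "\<lambda>_::nat \<times> nat \<times> nat. laplace"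
    using prob_space_imp_sigma_finite[OF prob_space_laplace] by (simp add: product_sigma_finite_def)
  define F where "F X = (\<Prod>i<n. ennreal (exp (g (X i))))" for X
  define H where "H Y = (\<Prod>z\<in>NIdx d n. ennreal (exp (w z * Y z)))" for Y
  have split: "ennreal (exp ((\<Sum>i<n. g (X i)) + (\<Sum>z\<in>NIdx d n. w z * Y z))) = F X * H Y" for X Y
  proof -
    have "F X = ennreal (\<Prod>i<n. exp (g (X i)))" unfolding F_def by (intro prod_ennreal) auto
    moreover have "H Y = ennreal (\<Prod>z\<in>NIdx d n. exp (w z * Y z))" unfolding H_def by (intro prod_ennreal) auto
    ultimately show ?thesis by (simp add: exp_add exp_sum finite_NIdx ennreal_mult prod_nonneg)
  qed
  have mF: "F \<in> borel_measurable (dataM f n)" unfolding F_def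
    using g data_component_measurable by (intro borel_measurable_prod_ennreal) auto
  have mH: "H \<in> borel_measurable (noiseM d n)" unfolding H_def
    using noise_component_measurable by (intro borel_measurable_prod_ennreal) auto
  have m: "(\<lambda>\<omega>. F (fst \<omega>) * H (snd \<omega>)) \<in> borel_measurable (dataM f n \<Otimes>\<^sub>M noiseM d n)"
    using mF mH by measurable
  have "Ef d f n (\<lambda>X Y. exp ((\<Sum>i<n. g (X i)) + (\<Sum>z\<in>NIdx d n. w z * Y z)))
     = (\<integral>\<^sup>+ X. \<integral>\<^sup>+ Y. F X * H Y \<partial>noiseM d n \<partial>dataM f n)"
    unfolding Ef_def split using B.nn_integral_fst[OF m] by simp
  also have "\<dots> = (\<integral>\<^sup>+ X. F X * (\<integral>\<^sup>+ Y. H Y \<partial>noiseM d n) \<partial>dataM f n)"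
    by (intro nn_integral_cong nn_integral_cmult mH)
  also have "\<dots> = (\<integral>\<^sup>+ X. F X \<partial>dataM f n) * (\<integral>\<^sup>+ Y. H Y \<partial>noiseM d n)"
    by (rule nn_integral_multc[OF mF])
  also have "(\<integral>\<^sup>+ X. F X \<partial>dataM f n) = (\<Prod>i<n. \<integral>\<^sup>+ x. ennreal (exp (g x)) \<partial>obsM f)"
    unfolding F_def dataM_eq using g by (intro O.product_nn_integral_prod) auto
  also have "(\<integral>\<^sup>+ Y. H Y \<partial>noiseM d n) = (\<Prod>z\<in>NIdx d n. \<integral>\<^sup>+ y. ennreal (exp (w z * y)) \<partial>laplace)"
    unfolding H_def noiseM_def by (intro L.product_nn_integral_prod finite_NIdx) auto
  finally show ?thesis by simp
qed

text \<open>The threshold 4/3 lies below the square root of 2, so the rule covers the three ratios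
  sqrt 2, 2 and 4 that occur for kernels and variances.\<close>

lemma geometric_sum_le:
  fixes q :: real assumes "4 / 3 \<le> q" shows "(\<Sum>j\<in>{m..l}. q ^ j) \<le> 4 * q ^ l"
proof -
  have "(\<Sum>j\<le>l. q ^ j) \<le> 4 * q ^ l"
  proof (induction l)
    case (Suc l)
    have "4 * q ^ l \<le> (3 * q) * q ^ l" using assms by (intro mult_right_mono) auto
    then show ?case using Suc by simp
  qed simp
  moreover have "(\<Sum>j\<in>{m..l}. q ^ j) \<le> (\<Sum>j\<le>l. q ^ j)" by (rule sum_mono2) (use assms in auto)
  ultimately show ?thesis by linarith
qed

lemma jmax_pow: assumes "l \<le> jmax n" "0 < n" shows "2 ^ (3 * l) \<le> real n"
proof -
  have "0 \<le> log 2 (real n) / 3" using assms by simp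
  then have "int l \<le> \<lfloor>log 2 (real n) / 3\<rfloor>" using assms(1) unfolding jmax_def by linarith
  then have "real l \<le> log 2 (real n) / 3" by (simp only: le_floor_iff of_int_of_nat_eq)
  then have "real (3 * l) \<le> log 2 (real n)" by simp
  then have "2 powr real (3 * l) \<le> real n" using assms by (simp add: le_log_iff)
  then show ?thesis unfolding powr_realpow[OF zero_less_numeral] .
qed

text \<open>The cap (log n)/3 enters the exponential moments in this form: it keeps the single
  summands small while the exponential parameter grows like the square root of l.\<close>

lemma jmax_pow': assumes "l \<le> jmax n" "0 < n" shows "real l * 2 ^ l \<le> real n"
proof -
  have "real l \<le> 2 ^ l" using of_nat_less_two_power[of l] by (simp add: less_imp_le)
  then have "real l * 2 ^ l \<le> 2 ^ l * 2 ^ l" by (intro mult_right_mono) auto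
  also have "\<dots> \<le> 2 ^ (3 * l)" by (simp flip: power_add)
  also have "\<dots> \<le> real n" by (rule jmax_pow[OF assms])
  finally show ?thesis .
qed

text \<open>The order of the variance of the level-\<open>l\<close> estimator at a point.\<close>
definition vlev :: "real \<Rightarrow> real \<Rightarrow> nat \<Rightarrow> nat \<Rightarrow> real" where
  "vlev a \<alpha> n l = (2 ^ l + 2 ^ (2 * l) * real l powr (2 * a) / \<alpha>\<^sup>2) / real n"

lemma vlev_pos: "0 < n \<Longrightarrow> 0 < vlev a \<alpha> n l"
  unfolding vlev_def by (intro divide_pos_pos add_pos_nonneg) auto

section \<open>The deviation as a sum of independent variables\<close>

context jia
begin

definition dev :: "real \<Rightarrow> real \<Rightarrow> nat \<Rightarrow> (real \<Rightarrow> real) \<Rightarrow> nat \<Rightarrow> real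
    \<Rightarrow> (nat \<Rightarrow> real) \<Rightarrow> (nat \<times> nat \<times> nat \<Rightarrow> real) \<Rightarrow> real" where
  "dev a \<alpha> n f l y X Y = fhat d a c\<psi> \<psi> \<alpha> n X Y l y - fproj l f y"

text \<open>Kernel of the projection: its pairing with f is \<open>fproj l f y\<close>, and the
  empirical mean of \<open>Ker l y (X i)\<close> is the noiseless part of the estimator at
  y.\<close>

definition Ker :: "nat \<Rightarrow> real \<Rightarrow> real \<Rightarrow> real" where
  "Ker l y x = (\<Sum>j\<in>{j0 d - 1..l}. \<Sum>k\<in>K j. dual j k y * \<phi> j k x)"

text \<open>Zero above level l, so that the deviations of all levels are linear forms over the one
  index set \<open>NIdx d n\<close> of the noise measure.\<close>

definition nwt :: "real \<Rightarrow> real \<Rightarrow> nat \<Rightarrow> nat \<Rightarrow> real \<Rightarrow> nat \<times> nat \<times> nat \<Rightarrow> real" where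
  "nwt a \<alpha> n l y = (\<lambda>(i, j, k). if j \<le> l then sigma d a c\<psi> \<alpha> j * dual j k y / real n else 0)"

lemma Ker_bdd01: "bdd01 (Ker l y)"
  unfolding Ker_def[abs_def] by (intro bdd01_sum bdd01_cmult phi_bdd01) auto

lemma Ker_measurable: "Ker l y \<in> borel_measurable borel"
proof (rule bdd01_measurable[OF Ker_bdd01])
  fix x :: real assume "x \<notin> {0..1}"
  then show "Ker l y x = 0" unfolding Ker_def using Vsp_outside[OF phi_Vsp] by (intro sum.neutral ballI) auto
qed

lemma inner01_Ker: assumes "bdd01 f" shows "inner01 f (Ker l y) = fproj l f y"
proof -
  have b: "bdd01 (\<lambda>x. \<Sum>k\<in>K j. dual j k y * \<phi> j k x)" if "j \<in> {j0 d - 1..l}" for j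
    using that by (intro bdd01_lincomb phi_bdd01) auto
  have "inner01 f (Ker l y) = (\<Sum>j\<in>{j0 d - 1..l}. inner01 f (\<lambda>x. \<Sum>k\<in>K j. dual j k y * \<phi> j k x))"
    unfolding Ker_def[abs_def] inner01_commute[of f] by (rule inner01_sum_left[OF assms b])
  also have "\<dots> = fproj l f y"
    unfolding fproj_def lproj_def
    by (intro sum.cong refl) (subst inner01_lincomb_right, auto simp: assms phi_bdd01 mult.commute)
  finally show ?thesis .
qed

lemma dev_linear:
  assumes n: "0 < n" and l: "l \<le> jmax n" and f: "bdd01 f"
  shows "dev a \<alpha> n f l y X Y
    = (\<Sum>i<n. (Ker l y (X i) - fproj l f y) / real n) + (\<Sum>z\<in>NIdx d n. nwt a \<alpha> n l y z * Y z)"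
proof -
  let ?J = "{j0 d - 1..l}"
  define s where "s = sigma d a c\<psi> \<alpha>"
  have "fhat d a c\<psi> \<psi> \<alpha> n X Y l y
     = (\<Sum>j\<in>?J. \<Sum>k\<in>K j. (\<Sum>i<n. dual j k y * \<phi> j k (X i) / real n) + (\<Sum>i<n. s j * dual j k y / real n * Y (i, j, k)))"
    unfolding fhat_def Zbar_def s_def
    by (intro sum.cong refl)
      (simp add: sum.distrib add_divide_distrib distrib_right distrib_left sum_distrib_right sum_distrib_left sum_divide_distrib mult_ac)
  also have "\<dots> = (\<Sum>j\<in>?J. \<Sum>k\<in>K j. \<Sum>i<n. dual j k y * \<phi> j k (X i) / real n)
      + (\<Sum>j\<in>?J. \<Sum>k\<in>K j. \<Sum>i<n. s j * dual j k y / real n * Y (i, j, k))"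
    by (simp add: sum.distrib)
  also have "(\<Sum>j\<in>?J. \<Sum>k\<in>K j. \<Sum>i<n. dual j k y * \<phi> j k (X i) / real n) = (\<Sum>i<n. Ker l y (X i) / real n)"
  proof -
    have "(\<Sum>j\<in>?J. \<Sum>k\<in>K j. \<Sum>i<n. dual j k y * \<phi> j k (X i) / real n)
      = (\<Sum>j\<in>?J. \<Sum>i<n. \<Sum>k\<in>K j. dual j k y * \<phi> j k (X i) / real n)"
      by (intro sum.cong refl sum.swap)
    also have "\<dots> = (\<Sum>i<n. \<Sum>j\<in>?J. \<Sum>k\<in>K j. dual j k y * \<phi> j k (X i) / real n)" by (rule sum.swap)
    finally show ?thesis by (simp add: Ker_def sum_divide_distrib)
  qed
  also have "(\<Sum>j\<in>?J. \<Sum>k\<in>K j. \<Sum>i<n. s j * dual j k y / real n * Y (i, j, k))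
      = (\<Sum>z\<in>NIdx d n. nwt a \<alpha> n l y z * Y z)"
  proof -
    have "(\<Sum>j\<in>?J. \<Sum>k\<in>K j. \<Sum>i<n. s j * dual j k y / real n * Y (i, j, k))
      = (\<Sum>j\<in>?J. \<Sum>i<n. \<Sum>k\<in>K j. s j * dual j k y / real n * Y (i, j, k))"
      by (intro sum.cong refl sum.swap)
    also have "\<dots> = (\<Sum>i<n. \<Sum>j\<in>?J. \<Sum>k\<in>K j. s j * dual j k y / real n * Y (i, j, k))" by (rule sum.swap)
    also have "\<dots> = (\<Sum>i<n. \<Sum>j\<in>{j0 d - 1..jmax n}. \<Sum>k\<in>K j. nwt a \<alpha> n l y (i, j, k) * Y (i, j, k))"
    proof (rule sum.cong[OF refl])
      fix i
      show "(\<Sum>j\<in>?J. \<Sum>k\<in>K j. s j * dual j k y / real n * Y (i, j, k))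
        = (\<Sum>j\<in>{j0 d - 1..jmax n}. \<Sum>k\<in>K j. nwt a \<alpha> n l y (i, j, k) * Y (i, j, k))"
        by (rule sum.mono_neutral_cong_left) (use l in \<open>auto simp: nwt_def s_def\<close>)
    qed
    also have "\<dots> = (\<Sum>z\<in>NIdx d n. nwt a \<alpha> n l y z * Y z)"
      unfolding NIdx_Sigma by (simp add: sum.Sigma finite_K case_prod_unfold)
    finally show ?thesis .
  qed
  finally show ?thesis using n unfolding dev_def
    by (simp add: diff_divide_distrib sum_subtractf)
qed

lemma dev_measurable:
  assumes "0 < n" "l \<le> jmax n" "bdd01 f"
  shows "(\<lambda>\<omega>. dev a \<alpha> n f l y (fst \<omega>) (snd \<omega>)) \<in> borel_measurable (dataM f n \<Otimes>\<^sub>M noiseM d n)"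
proof -
  have 1: "(\<lambda>\<omega>. fst \<omega> i) \<in> borel_measurable (dataM f n \<Otimes>\<^sub>M noiseM d n)" if "i < n" for i
    using measurable_compose[OF measurable_fst data_component_measurable[OF that]] .
  have 2: "(\<lambda>\<omega>. snd \<omega> z) \<in> borel_measurable (dataM f n \<Otimes>\<^sub>M noiseM d n)" if "z \<in> NIdx d n" for z
    using measurable_compose[OF measurable_snd noise_component_measurable[OF that]] .
  have 3: "(\<lambda>\<omega>. Ker l y (fst \<omega> i)) \<in> borel_measurable (dataM f n \<Otimes>\<^sub>M noiseM d n)" if "i < n" for i
    using measurable_compose[OF 1[OF that] Ker_measurable] .
  show ?thesis unfolding dev_linear[OF assms]
    by (intro borel_measurable_add borel_measurable_sum borel_measurable_divide borel_measurable_diff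
        borel_measurable_times borel_measurable_const 2 3) auto
qed

text \<open>The polynomial factor is taken at the top level l and not at j, so that the later sum
  over j is purely geometric.\<close>

lemma sigma_bound:
  assumes a: "1 < a"
  shows "\<exists>C\<ge>0. \<forall>\<alpha> j l. 0 < \<alpha> \<longrightarrow> j0 d - 1 \<le> j \<longrightarrow> j \<le> l \<longrightarrow> 1 \<le> l \<longrightarrow>
    (sigma d a c\<psi> \<alpha> j)\<^sup>2 \<le> C * real l powr (2 * a) / \<alpha>\<^sup>2 * 2 ^ j"
proof -
  define A B where "A = 4 * (real d + 1)\<^sup>2" and "B = 4 * (3 * real d + 1) * c\<psi> * (a / (a - 1))"
  define C where "C = max (2 * A\<^sup>2) (B\<^sup>2)"
  have "(sigma d a c\<psi> \<alpha> j)\<^sup>2 \<le> C * real l powr (2 * a) / \<alpha>\<^sup>2 * 2 ^ j"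
    if al: "0 < \<alpha>" and j: "j0 d - 1 \<le> j" and jl: "j \<le> l" "1 \<le> l" for \<alpha> j l
    using j
  proof (cases rule: level_cases)
    case 1
    have "sigma d a c\<psi> \<alpha> j = A / \<alpha> * sqrt (2 ^ j0 d)" by (simp add: sigma_def 1 A_def sqrt_pow2)
    then have "(sigma d a c\<psi> \<alpha> j)\<^sup>2 = A\<^sup>2 / \<alpha>\<^sup>2 * 2 ^ j0 d" by (simp add: power_mult_distrib power_divide)
    also have "(2::real) ^ j0 d = 2 * 2 ^ j" using j0_prop[of d] by (simp add: 1 flip: power_Suc)
    also have "A\<^sup>2 / \<alpha>\<^sup>2 * (2 * 2 ^ j) = (2 * A\<^sup>2) * 1 / \<alpha>\<^sup>2 * 2 ^ j" by simp
    also have "\<dots> \<le> C * real l powr (2 * a) / \<alpha>\<^sup>2 * 2 ^ j"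
    proof (intro mult_right_mono divide_right_mono mult_mono)
      show "1 \<le> real l powr (2 * a)" using jl a by (intro ge_one_powr_ge_zero) auto
    qed (auto simp: C_def le_max_iff_disj)
    finally show ?thesis .
  next
    case 2
    have j1: "1 \<le> j" using 2 j0_prop[of d] by linarith
    have "sigma d a c\<psi> \<alpha> j = B / \<alpha> * real j powr a * sqrt (2 ^ j)"
      using 2 by (simp add: sigma_def B_def sqrt_pow2)
    then have "(sigma d a c\<psi> \<alpha> j)\<^sup>2 = B\<^sup>2 * (real j powr a)\<^sup>2 / \<alpha>\<^sup>2 * 2 ^ j" by (simp add: power_mult_distrib power_divide)
    also have "(real j powr a)\<^sup>2 = real j powr (2 * a)" by (simp add: power2_eq_square flip: powr_add)
    also have "B\<^sup>2 * real j powr (2 * a) / \<alpha>\<^sup>2 * 2 ^ j \<le> C * real l powr (2 * a) / \<alpha>\<^sup>2 * 2 ^ j"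
      using jl a by (intro mult_right_mono divide_right_mono mult_mono powr_mono2) (auto simp: C_def le_max_iff_disj)
    finally show ?thesis .
  qed
  moreover have "0 \<le> C" by (simp add: C_def le_max_iff_disj)
  ultimately show ?thesis by blast
qed

end

text \<open>R is arbitrary: the integral of nonnegative functions is monotone without measurability.
  The selected estimator enters expectations only through this rule.\<close>

lemma Ef_mono: "(\<And>X Y. R X Y \<le> R' X Y) \<Longrightarrow> Ef d f n R \<le> Ef d f n R'"
  unfolding Ef_def by (intro nn_integral_mono ennreal_leI)

lemma prod_le_ennreal_exp:
  fixes A :: "'a \<Rightarrow> ennreal"
  assumes "finite I" "\<And>i. i \<in> I \<Longrightarrow> A i \<le> ennreal (exp (b i))"
  shows "(\<Prod>i\<in>I. A i) \<le> ennreal (exp (\<Sum>i\<in>I. b i))"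
  using assms
proof (induction I rule: finite_induct)
  case (insert i I)
  then have "A i * (\<Prod>i\<in>I. A i) \<le> ennreal (exp (b i)) * ennreal (exp (\<Sum>i\<in>I. b i))"
    by (intro mult_mono) auto
  then show ?case using insert by (simp add: exp_add ennreal_mult)
qed simp

lemma sq_le_exp: "0 \<le> z \<Longrightarrow> z\<^sup>2 \<le> 2 * exp (z::real)"
  using exp_lower_Taylor_quadratic[of z] by simp

lemma quad_le_exp: assumes "0 \<le> z" shows "z ^ 4 \<le> 64 * exp (z::real)"
proof -
  have "(z / 2)\<^sup>2 \<le> 2 * exp (z / 2)" by (rule sq_le_exp) (use assms in simp)
  then have "z\<^sup>2 \<le> 8 * exp (z / 2)" by (simp add: power_divide)
  then have "(z\<^sup>2)\<^sup>2 \<le> (8 * exp (z / 2))\<^sup>2" by (intro power_mono) auto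
  also have "\<dots> = 64 * exp z" by (simp add: power_mult_distrib exp_double[symmetric])
  finally show ?thesis by (simp flip: power_mult)
qed

lemma inner01_Wp_le:
  assumes f: "f \<in> Wp p M" and g: "bdd01 g" and B: "\<And>x. x \<in> {0..1} \<Longrightarrow> \<bar>g x\<bar> \<le> B"
  shows "\<bar>inner01 f g\<bar> \<le> B"
proof -
  have f0: "0 \<le> f x" if "x \<in> {0..1}" for x using f that by (auto simp: Wp_def)
  have c: "inner01 f (\<lambda>x. c) = c" for c
    using inner01_cmult_right[of f c "\<lambda>x. 1"] inner01_Wp_1[OF f] by simp
  have "inner01 f g \<le> inner01 f (\<lambda>x. B)"
    by (rule inner01_mono[OF Wp_bdd01[OF f] g Wp_bdd01[OF f] bdd01_const])
      (use B f0 in \<open>auto intro!: mult_left_mono simp: abs_le_iff\<close>)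
  moreover have "inner01 f (\<lambda>x. - B) \<le> inner01 f g"
  proof (rule inner01_mono[OF Wp_bdd01[OF f] bdd01_const Wp_bdd01[OF f] g])
    fix x :: real assume x: "x \<in> {0..1}"
    show "f x * - B \<le> f x * g x" by (rule mult_left_mono) (use B[OF x] f0[OF x] in auto)
  qed
  ultimately show ?thesis unfolding c by simp
qed

lemma inner01_Wp_sq_le:
  assumes f: "f \<in> Wp p M" and g: "bdd01 g"
  shows "inner01 f (\<lambda>x. (g x)\<^sup>2) \<le> M * l2sq g"
proof -
  have bg2: "bdd01 (\<lambda>x. (g x)\<^sup>2)" unfolding power2_eq_square by (intro bdd01_mult g)
  have "inner01 f (\<lambda>x. (g x)\<^sup>2) \<le> inner01 (\<lambda>x. M) (\<lambda>x. (g x)\<^sup>2)"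
  proof (rule inner01_mono[OF Wp_bdd01[OF f] bg2 bdd01_const bg2])
    fix x :: real assume x: "x \<in> {0..1}"
    have "f x \<le> M" using Wp_bound[OF f _ x, of 0] by simp
    then show "f x * (g x)\<^sup>2 \<le> M * (g x)\<^sup>2" by (rule mult_right_mono) simp
  qed
  also have "\<dots> = M * inner01 (\<lambda>x. 1) (\<lambda>x. (g x)\<^sup>2)" using inner01_cmult_left[of M "\<lambda>x. 1"] by simp
  also have "inner01 (\<lambda>x. 1) (\<lambda>x. (g x)\<^sup>2) = l2sq g" by (simp add: l2sq_def inner01_def power2_eq_square)
  finally show ?thesis .
qed

section \<open>Exponential, second and fourth moments of the deviation\<close>

context jia
begin

text \<open>The orders are those of a kernel of bandwidth 2^(-l): the sup-norm comes from
  Cauchy-Schwarz between wavelets and duals, the squared norm from the upper Riesz bound within each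
  level.\<close>

lemma Ker_bounds:
  "\<exists>C\<ge>0. \<forall>l. \<forall>y\<in>{0..1}. (\<forall>x\<in>{0..1}. \<bar>Ker l y x\<bar> \<le> C * 2 ^ l) \<and> l2sq (Ker l y) \<le> C * 2 ^ l"
proof -
  obtain C1 where C1: "0 \<le> C1" "\<And>j x. j0 d - 1 \<le> j \<Longrightarrow> x \<in> {0..1} \<Longrightarrow> (\<Sum>k\<in>K j. (\<phi> j k x)\<^sup>2) \<le> C1 * 2 ^ j"
    using phi_sq_sum by blast
  obtain C2 where C2: "0 \<le> C2" "\<And>j x. j0 d - 1 \<le> j \<Longrightarrow> x \<in> {0..1} \<Longrightarrow> (\<Sum>k\<in>K j. (dual j k x)\<^sup>2) \<le> C2 * 2 ^ j"
    using dual_sq_sum by blast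
  obtain C3 where C3: "0 \<le> C3" "\<And>j c. j0 d - 1 \<le> j \<Longrightarrow> l2sq (\<lambda>x. \<Sum>k\<in>K j. c k * \<phi> j k x) \<le> C3 * (\<Sum>k\<in>K j. (c k)\<^sup>2)"
    using phi_riesz_upper by blast
  define D where "D = sqrt (C1 * C2)"
  define E where "E = C3 * C2"
  have D0: "0 \<le> D" and E0: "0 \<le> E" using C1 C2 C3 by (auto simp: D_def E_def)
  define A where "A y j x = (\<Sum>k\<in>K j. dual j k y * \<phi> j k x)" for y j x
  have Aeq: "Ker l y x = (\<Sum>j\<in>{j0 d - 1..l}. A y j x)" for l y x by (simp add: Ker_def A_def)
  have bA: "bdd01 (A y j)" if "j0 d - 1 \<le> j" for y j
    unfolding A_def by (intro bdd01_lincomb phi_bdd01 that)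
  have sup: "\<bar>A y j x\<bar> \<le> D * 2 ^ j" if j: "j0 d - 1 \<le> j" and y: "y \<in> {0..1}" and x: "x \<in> {0..1}" for y j x
  proof (rule power2_le_imp_le)
    have "(A y j x)\<^sup>2 \<le> (\<Sum>k\<in>K j. (dual j k y)\<^sup>2) * (\<Sum>k\<in>K j. (\<phi> j k x)\<^sup>2)"
      unfolding A_def by (rule Cauchy_Schwarz_ineq_sum)
    also have "\<dots> \<le> (C2 * 2 ^ j) * (C1 * 2 ^ j)"
      using C1(1) C2(1) by (intro mult_mono C1(2) C2(2) j x y sum_nonneg) auto
    also have "\<dots> = (D * 2 ^ j)\<^sup>2" using C1 C2 by (simp add: D_def power_mult_distrib power2_eq_square)
    finally show "\<bar>A y j x\<bar>\<^sup>2 \<le> (D * 2 ^ j)\<^sup>2" by simp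
  qed (use D0 in simp)
  have l2: "l2sq (A y j) \<le> E * 2 ^ j" if j: "j0 d - 1 \<le> j" and y: "y \<in> {0..1}" for y j
  proof -
    have "l2sq (A y j) \<le> C3 * (\<Sum>k\<in>K j. (dual j k y)\<^sup>2)" unfolding A_def by (rule C3(2)[OF j])
    also have "\<dots> \<le> C3 * (C2 * 2 ^ j)" by (intro mult_left_mono C2(2) j y C3)
    finally show ?thesis by (simp add: E_def mult.assoc)
  qed
  define q :: real where "q = sqrt 2"
  have q2: "q\<^sup>2 = 2" by (simp add: q_def)
  have q43: "4 / 3 \<le> q" unfolding q_def by (rule real_le_rsqrt) (simp add: power_divide)
  then have q0: "0 < q" by simp
  have qq: "q ^ j * q ^ j = 2 ^ j" for j 
    using power_mult_distrib[of q q j] q2 by (simp add: power2_eq_square)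
  text \<open>Weights \<open>2^(j/2)\<close> in the Cauchy--Schwarz inequality avoid a factor equal to the number of levels.\<close>
  have K2: "l2sq (Ker l y) \<le> (16 * E) * 2 ^ l" if y: "y \<in> {0..1}" for l y
  proof -
    let ?J = "{j0 d - 1..l}"
    have bw: "bdd01 (\<lambda>x. (A y j x)\<^sup>2)" if "j \<in> ?J" for j
      unfolding power2_eq_square using that by (intro bdd01_mult bA) auto
    have pw: "Ker l y x * Ker l y x \<le> 1 * (\<Sum>j\<in>?J. (4 * q ^ l / q ^ j) * (A y j x)\<^sup>2)" for x
    proof -
      have "Ker l y x = (\<Sum>j\<in>?J. sqrt (q ^ j) * (A y j x / sqrt (q ^ j)))"
        unfolding Aeq using q0 by (intro sum.cong) auto
      then have "(Ker l y x)\<^sup>2 \<le> (\<Sum>j\<in>?J. (sqrt (q ^ j))\<^sup>2) * (\<Sum>j\<in>?J. (A y j x / sqrt (q ^ j))\<^sup>2)"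
        by (simp only: Cauchy_Schwarz_ineq_sum)
      also have "\<dots> = (\<Sum>j\<in>?J. q ^ j) * (\<Sum>j\<in>?J. (A y j x)\<^sup>2 / q ^ j)"
        using q0 by (simp add: power_divide)
      also have "\<dots> \<le> (4 * q ^ l) * (\<Sum>j\<in>?J. (A y j x)\<^sup>2 / q ^ j)"
        using q0 by (intro mult_right_mono geometric_sum_le q43 sum_nonneg) auto
      finally show ?thesis by (simp add: power2_eq_square sum_distrib_left)
    qed
    have "l2sq (Ker l y) \<le> inner01 (\<lambda>x. 1) (\<lambda>x. \<Sum>j\<in>?J. (4 * q ^ l / q ^ j) * (A y j x)\<^sup>2)"
      unfolding l2sq_def
      by (rule inner01_mono[OF Ker_bdd01 Ker_bdd01 bdd01_const bdd01_sum pw]) (intro bdd01_cmult bw)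
    also have "\<dots> = (\<Sum>j\<in>?J. (4 * q ^ l / q ^ j) * inner01 (\<lambda>x. 1) (\<lambda>x. (A y j x)\<^sup>2))"
      by (rule inner01_lincomb_right[OF bdd01_const bw])
    also have "\<dots> = (\<Sum>j\<in>?J. (4 * q ^ l / q ^ j) * l2sq (A y j))"
      by (simp add: l2sq_def inner01_def power2_eq_square)
    also have "\<dots> \<le> (\<Sum>j\<in>?J. (4 * q ^ l / q ^ j) * (E * 2 ^ j))"
      using q0 by (intro sum_mono mult_left_mono l2 y) auto
    also have "\<dots> = (4 * E * q ^ l) * (\<Sum>j\<in>?J. q ^ j)"
      unfolding sum_distrib_left by (intro sum.cong) (use q0 in \<open>auto simp: qq[symmetric]\<close>)
    also have "\<dots> \<le> (4 * E * q ^ l) * (4 * q ^ l)"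
      using q0 E0 by (intro mult_left_mono geometric_sum_le q43) auto
    also have "\<dots> = (16 * E) * (q ^ l * q ^ l)" by simp
    finally show ?thesis unfolding qq .
  qed
  have K1: "\<bar>Ker l y x\<bar> \<le> (4 * D) * 2 ^ l" if y: "y \<in> {0..1}" and x: "x \<in> {0..1}" for l y x
  proof -
    have "\<bar>Ker l y x\<bar> \<le> (\<Sum>j\<in>{j0 d - 1..l}. \<bar>A y j x\<bar>)" unfolding Aeq by (rule sum_abs)
    also have "\<dots> \<le> (\<Sum>j\<in>{j0 d - 1..l}. D * 2 ^ j)" by (intro sum_mono sup y x) auto
    also have "\<dots> = D * (\<Sum>j\<in>{j0 d - 1..l}. 2 ^ j)" by (simp add: sum_distrib_left)
    also have "\<dots> \<le> D * (4 * 2 ^ l)" by (intro mult_left_mono geometric_sum_le D0) auto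
    finally show ?thesis by (simp add: mult_ac)
  qed
  define C where "C = max (4 * D) (16 * E)"
  have "\<bar>Ker l y x\<bar> \<le> C * 2 ^ l" if "y \<in> {0..1}" "x \<in> {0..1}" for l y x
    using K1[OF that, of l] by (rule order_trans) (intro mult_right_mono, auto simp: C_def)
  moreover have "l2sq (Ker l y) \<le> C * 2 ^ l" if "y \<in> {0..1}" for l y
    using K2[OF that, of l] by (rule order_trans) (intro mult_right_mono, auto simp: C_def)
  moreover have "0 \<le> C" using D0 by (simp add: C_def le_max_iff_disj)
  ultimately show ?thesis by blast
qed

text \<open>The largest weight decides how far the Laplace moment generating function may be used,
  the sum of squares becomes the exponent. Both are compared with the noise part of
  \<open>vlev\<close> alone.\<close>

lemma nwt_bounds:
  assumes a: "1 < a"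
  shows "\<exists>C\<ge>0. \<forall>\<alpha> n l. \<forall>y\<in>{0..1}. 0 < \<alpha> \<longrightarrow> 0 < n \<longrightarrow> 1 \<le> l \<longrightarrow> l \<le> jmax n \<longrightarrow>
    (\<forall>z\<in>NIdx d n. (nwt a \<alpha> n l y z)\<^sup>2 \<le> C * vlev a \<alpha> n l / real n)
    \<and> (\<Sum>z\<in>NIdx d n. (nwt a \<alpha> n l y z)\<^sup>2) \<le> C * vlev a \<alpha> n l"
proof -
  obtain C2 where C2: "0 \<le> C2" "\<And>j x. j0 d - 1 \<le> j \<Longrightarrow> x \<in> {0..1} \<Longrightarrow> (\<Sum>k\<in>K j. (dual j k x)\<^sup>2) \<le> C2 * 2 ^ j"
    using dual_sq_sum by blast
  obtain Cs where Cs: "0 \<le> Cs" "\<And>\<alpha> j l. 0 < \<alpha> \<Longrightarrow> j0 d - 1 \<le> j \<Longrightarrow> j \<le> l \<Longrightarrow> 1 \<le> l \<Longrightarrow>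
    (sigma d a c\<psi> \<alpha> j)\<^sup>2 \<le> Cs * real l powr (2 * a) / \<alpha>\<^sup>2 * 2 ^ j"
    using sigma_bound[OF a] by blast
  define C where "C = 4 * (Cs * C2)"
  have C0: "0 \<le> C" using C2 Cs by (simp add: C_def)
  have "(\<forall>z\<in>NIdx d n. (nwt a \<alpha> n l y z)\<^sup>2 \<le> C * vlev a \<alpha> n l / real n)
    \<and> (\<Sum>z\<in>NIdx d n. (nwt a \<alpha> n l y z)\<^sup>2) \<le> C * vlev a \<alpha> n l"
    if y: "y \<in> {0..1}" and al: "0 < \<alpha>" and n: "0 < n" and l: "1 \<le> l" "l \<le> jmax n" for \<alpha> n l y
  proof -
    define Q where "Q = real l powr (2 * a) / \<alpha>\<^sup>2"
    have Q0: "0 \<le> Q" by (simp add: Q_def)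
    have QV: "2 ^ (2 * l) * Q \<le> real n * vlev a \<alpha> n l" using n by (simp add: vlev_def Q_def)
    have sum_dual: "(\<Sum>k\<in>K j. (sigma d a c\<psi> \<alpha> j * dual j k y / real n)\<^sup>2) \<le> (Cs * C2) * Q * 4 ^ j / (real n)\<^sup>2"
      if j: "j0 d - 1 \<le> j" "j \<le> l" for j
    proof -
      have "(\<Sum>k\<in>K j. (sigma d a c\<psi> \<alpha> j * dual j k y / real n)\<^sup>2)
         = (sigma d a c\<psi> \<alpha> j)\<^sup>2 * (\<Sum>k\<in>K j. (dual j k y)\<^sup>2) / (real n)\<^sup>2"
        by (simp add: power_mult_distrib power_divide sum_distrib_left sum_divide_distrib)
      also have "\<dots> \<le> (Cs * Q * 2 ^ j) * (C2 * 2 ^ j) / (real n)\<^sup>2"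
        using Cs(2)[OF al j l(1)] Cs(1) Q0
        by (intro divide_right_mono mult_mono C2(2) j y sum_nonneg) (auto simp: Q_def)
      also have "\<dots> = (Cs * C2) * Q * 4 ^ j / (real n)\<^sup>2"
        by (simp add: power_mult_distrib[symmetric] mult_ac)
      finally show ?thesis .
    qed
    have "(nwt a \<alpha> n l y z)\<^sup>2 \<le> C * vlev a \<alpha> n l / real n" if z: "z \<in> NIdx d n" for z
    proof -
      obtain i j k where zz: "z = (i, j, k)" "j0 d - 1 \<le> j" "k \<in> K j" using z by (auto simp: NIdx_def)
      show ?thesis
      proof (cases "j \<le> l")
        case True
        have "(nwt a \<alpha> n l y z)\<^sup>2 = (sigma d a c\<psi> \<alpha> j * dual j k y / real n)\<^sup>2" using True by (simp add: nwt_def zz)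
        also have "\<dots> \<le> (\<Sum>k\<in>K j. (sigma d a c\<psi> \<alpha> j * dual j k y / real n)\<^sup>2)"
          by (rule member_le_sum[OF zz(3)]) (auto simp: finite_K)
        also have "\<dots> \<le> (Cs * C2) * Q * 4 ^ j / (real n)\<^sup>2" by (rule sum_dual[OF zz(2) True])
        also have "\<dots> \<le> (Cs * C2) * Q * 4 ^ l / (real n)\<^sup>2"
          using True Cs C2 Q0 by (intro divide_right_mono mult_left_mono power_increasing) auto
        also have "\<dots> = (Cs * C2) * (2 ^ (2 * l) * Q) / (real n)\<^sup>2" by (simp add: power_mult)
        also have "\<dots> \<le> (Cs * C2) * (real n * vlev a \<alpha> n l) / (real n)\<^sup>2"
          using Cs C2 by (intro divide_right_mono mult_left_mono QV) auto
        also have "\<dots> = (Cs * C2) * vlev a \<alpha> n l / real n" using n by (simp add: power2_eq_square)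
        also have "\<dots> \<le> C * vlev a \<alpha> n l / real n"
          using Cs C2 vlev_pos[OF n, of a \<alpha> l] by (intro divide_right_mono mult_right_mono) (auto simp: C_def)
        finally show ?thesis .
      next
        case False
        then show ?thesis using C0 vlev_pos[OF n, of a \<alpha> l] n by (simp add: nwt_def zz)
      qed
    qed
    moreover have "(\<Sum>z\<in>NIdx d n. (nwt a \<alpha> n l y z)\<^sup>2) \<le> C * vlev a \<alpha> n l"
    proof -
      have "(\<Sum>z\<in>NIdx d n. (nwt a \<alpha> n l y z)\<^sup>2)
         = (\<Sum>i<n. \<Sum>j\<in>{j0 d - 1..jmax n}. \<Sum>k\<in>K j. (nwt a \<alpha> n l y (i, j, k))\<^sup>2)"
        unfolding NIdx_Sigma by (simp add: sum.Sigma finite_K case_prod_unfold)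
      also have "\<dots> = (\<Sum>i<n. \<Sum>j\<in>{j0 d - 1..l}. \<Sum>k\<in>K j. (sigma d a c\<psi> \<alpha> j * dual j k y / real n)\<^sup>2)"
        by (intro sum.cong refl sum.mono_neutral_cong_right) (use l in \<open>auto simp: nwt_def\<close>)
      also have "\<dots> \<le> (\<Sum>i<n. \<Sum>j\<in>{j0 d - 1..l}. (Cs * C2) * Q / (real n)\<^sup>2 * 4 ^ j)"
        using sum_dual by (intro sum_mono) auto
      also have "\<dots> = real n * ((Cs * C2) * Q / (real n)\<^sup>2 * (\<Sum>j\<in>{j0 d - 1..l}. 4 ^ j))"
        by (simp add: sum_distrib_left)
      also have "\<dots> \<le> real n * ((Cs * C2) * Q / (real n)\<^sup>2 * (4 * 4 ^ l))"
        using Cs C2 Q0 by (intro mult_left_mono geometric_sum_le) auto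
      also have "\<dots> = C * (2 ^ (2 * l) * Q) / real n" using n by (simp add: C_def power_mult power2_eq_square)
      also have "\<dots> \<le> C * (real n * vlev a \<alpha> n l) / real n"
        using C0 by (intro divide_right_mono mult_left_mono QV) auto
      finally show ?thesis using n by simp
    qed
    ultimately show ?thesis by blast
  qed
  then show ?thesis using C0 by blast
qed

text \<open>Gaussian behaviour in a restricted range: when t^2 v is at most \<kappa>^2 l, every
  summand of t D is small enough for its quadratic bound, and the exponents add up to a multiple of
  t^2 v. Two parameters are kept, t for both signs and \<mu> for both the tail scale sqrt l and the
  moment scale 1.\<close>

lemma dev_mgf:
  assumes a: "1 < a" and M: "0 \<le> M"
  shows "\<exists>\<kappa>>0. \<forall>n \<alpha> f l t \<mu>. \<forall>y\<in>{0..1}. 0 < n \<longrightarrow> 0 < \<alpha> \<longrightarrow> 1 \<le> l \<longrightarrow> l \<le> jmax n \<longrightarrow> f \<in> Wp p M \<longrightarrow>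
    \<mu>\<^sup>2 \<le> real l \<longrightarrow> t\<^sup>2 * vlev a \<alpha> n l \<le> \<kappa>\<^sup>2 * \<mu>\<^sup>2 \<longrightarrow>
    Ef d f n (\<lambda>X Y. exp (t * dev a \<alpha> n f l y X Y)) \<le> ennreal (exp (\<mu>\<^sup>2))"
proof -
  obtain C where C: "0 \<le> C" "\<And>l y x. y \<in> {0..1} \<Longrightarrow> x \<in> {0..1} \<Longrightarrow> \<bar>Ker l y x\<bar> \<le> C * 2 ^ l"
    "\<And>l y. y \<in> {0..1} \<Longrightarrow> l2sq (Ker l y) \<le> C * 2 ^ l"
    using Ker_bounds by blast
  obtain W where W: "0 \<le> W" "\<And>\<alpha> n l y z. y \<in> {0..1} \<Longrightarrow> 0 < \<alpha> \<Longrightarrow> 0 < n \<Longrightarrow> 1 \<le> l \<Longrightarrow> l \<le> jmax n \<Longrightarrow>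
      z \<in> NIdx d n \<Longrightarrow> (nwt a \<alpha> n l y z)\<^sup>2 \<le> W * vlev a \<alpha> n l / real n"
    "\<And>\<alpha> n l y. y \<in> {0..1} \<Longrightarrow> 0 < \<alpha> \<Longrightarrow> 0 < n \<Longrightarrow> 1 \<le> l \<Longrightarrow> l \<le> jmax n \<Longrightarrow>
      (\<Sum>z\<in>NIdx d n. (nwt a \<alpha> n l y z)\<^sup>2) \<le> W * vlev a \<alpha> n l"
    using nwt_bounds[OF a] by blast
  \<comment> \<open>It exceeds every demand: 4 C^2 for the range of the data terms, 2 W for the
    range of the Laplace terms, M C + 2 W for the total exponent. With \<kappa>^2 = 1/T all of them
    are met.\<close>
  define T where "T = 4 * C\<^sup>2 + M * C + 2 * W + 1"
  have T: "0 < T" "4 * C\<^sup>2 \<le> T" "M * C + 2 * W \<le> T" "2 * W \<le> T"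
    using C(1) M W(1) by (auto simp: T_def intro!: add_nonneg_pos add_nonneg_nonneg)
  define \<kappa> where "\<kappa> = sqrt (1 / T)"
  have k2: "\<kappa>\<^sup>2 = 1 / T" and k0: "0 < \<kappa>" using T by (auto simp: \<kappa>_def)
  have "Ef d f n (\<lambda>X Y. exp (t * dev a \<alpha> n f l y X Y)) \<le> ennreal (exp (\<mu>\<^sup>2))"
    if y: "y \<in> {0..1}" and n: "0 < n" and al: "0 < \<alpha>" and l: "1 \<le> l" "l \<le> jmax n" and f: "f \<in> Wp p M"
      and lam: "\<mu>\<^sup>2 \<le> real l" and t: "t\<^sup>2 * vlev a \<alpha> n l \<le> \<kappa>\<^sup>2 * \<mu>\<^sup>2" for n \<alpha> f l t \<mu> y
  proof -
    define V where "V = vlev a \<alpha> n l"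
    have V0: "0 < V" unfolding V_def by (rule vlev_pos[OF n])
    have nV: "2 ^ l \<le> real n * V" using n by (simp add: V_def vlev_def)
    have tV: "t\<^sup>2 * V \<le> \<kappa>\<^sup>2 * \<mu>\<^sup>2" using t by (simp add: V_def)
    have tVl: "t\<^sup>2 * V \<le> \<kappa>\<^sup>2 * real l" using tV lam by (meson mult_left_mono order_trans zero_le_power2)
    have ln: "real l * 2 ^ l \<le> real n" by (rule jmax_pow'[OF l(2) n])
    have ln': "real l \<le> real n"
    proof -
      have "real l * 1 \<le> real l * 2 ^ l" by (intro mult_left_mono) auto
      then show ?thesis using ln by simp
    qed
    \<comment> \<open>The two factors 2^l are spent differently: one is below n V by the form of
      \<open>vlev\<close>, the other together with l is below n by the cap on the levels.\<close>
    have t4: "t\<^sup>2 * (2 ^ l)\<^sup>2 \<le> \<kappa>\<^sup>2 * (real n)\<^sup>2"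
    proof -
      have "t\<^sup>2 * (2 ^ l)\<^sup>2 = (t\<^sup>2 * 2 ^ l) * 2 ^ l" by (simp add: power2_eq_square)
      also have "\<dots> \<le> (t\<^sup>2 * (real n * V)) * 2 ^ l" by (intro mult_right_mono mult_left_mono nV) auto
      also have "\<dots> = (t\<^sup>2 * V) * (real n * 2 ^ l)" by simp
      also have "\<dots> \<le> (\<kappa>\<^sup>2 * real l) * (real n * 2 ^ l)" by (intro mult_right_mono tVl) auto
      also have "\<dots> = \<kappa>\<^sup>2 * real n * (real l * 2 ^ l)" by simp
      also have "\<dots> \<le> \<kappa>\<^sup>2 * real n * real n" by (intro mult_left_mono ln) auto
      finally show ?thesis by (simp add: power2_eq_square)
    qed
    define e where "e = fproj l f y"
    have e: "e = inner01 f (Ker l y)" by (simp add: e_def inner01_Ker Wp_bdd01[OF f])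
    have e_le: "\<bar>e\<bar> \<le> C * 2 ^ l" unfolding e by (rule inner01_Wp_le[OF f Ker_bdd01 C(2)[OF y]])
    define u where "u = t / real n"
    define v where "v = inner01 f (\<lambda>x. (Ker l y x)\<^sup>2)"
    have v_le: "v \<le> M * (C * 2 ^ l)"
      unfolding v_def using inner01_Wp_sq_le[OF f Ker_bdd01] mult_left_mono[OF C(3)[OF y] M] by (rule order_trans)
    have data: "(\<integral>\<^sup>+ x. ennreal (exp (u * (Ker l y x - e))) \<partial>obsM f) \<le> ennreal (exp (u\<^sup>2 * v))"
      unfolding e v_def
    proof (rule obsM_mgf_le[OF f Ker_bdd01 Ker_measurable])
      fix x :: real assume x: "x \<in> {0..1}"
      have "\<bar>Ker l y x - e\<bar> \<le> \<bar>Ker l y x\<bar> + \<bar>e\<bar>" by (rule abs_triangle_ineq4)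
      also have "\<dots> \<le> 2 * C * 2 ^ l" using C(2)[OF y x, of l] e_le by simp
      finally have "\<bar>Ker l y x - e\<bar> \<le> 2 * C * 2 ^ l" .
      then have "\<bar>Ker l y x - e\<bar>\<^sup>2 \<le> (2 * C * 2 ^ l)\<^sup>2" by (intro power_mono) auto
      then have "(u * (Ker l y x - e))\<^sup>2 \<le> u\<^sup>2 * (2 * C * 2 ^ l)\<^sup>2"
        unfolding power_mult_distrib[of u] power2_abs by (intro mult_left_mono) auto
      also have "\<dots> = 4 * C\<^sup>2 * (t\<^sup>2 * (2 ^ l)\<^sup>2) / (real n)\<^sup>2" by (simp add: u_def power_mult_distrib power_divide)
      also have "\<dots> \<le> 4 * C\<^sup>2 * (\<kappa>\<^sup>2 * (real n)\<^sup>2) / (real n)\<^sup>2" by (intro divide_right_mono mult_left_mono t4) auto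
      also have "\<dots> = 4 * C\<^sup>2 / T" using n by (simp add: k2)
      also have "\<dots> \<le> 1" using T by simp
      finally show "\<bar>u * (Ker l y x - inner01 f (Ker l y))\<bar> \<le> 1" by (simp add: e abs_square_le_1)
    qed
    define w where "w z = nwt a \<alpha> n l y z" for z
    have noise: "(\<integral>\<^sup>+ x. ennreal (exp ((t * w z) * x)) \<partial>laplace) \<le> ennreal (exp (2 * (t * w z)\<^sup>2))" if z: "z \<in> NIdx d n" for z
    proof (rule laplace_mgf_le)
      have "(t * w z)\<^sup>2 \<le> t\<^sup>2 * (W * V / real n)"
        unfolding power_mult_distrib w_def V_def by (intro mult_left_mono W(2) y al n l z) auto
      also have "\<dots> = W / real n * (t\<^sup>2 * V)" by simp
      also have "\<dots> \<le> W / real n * (\<kappa>\<^sup>2 * real l)" using W(1) by (intro mult_left_mono tVl) auto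
      also have "\<dots> \<le> W / real n * (\<kappa>\<^sup>2 * real n)" using W(1) by (intro mult_left_mono ln') auto
      also have "\<dots> = W / T" using n by (simp add: k2)
      also have "\<dots> \<le> 1 / 2" using T by (simp add: field_simps)
      finally show "(t * w z)\<^sup>2 \<le> 1 / 2" .
    qed
    have "Ef d f n (\<lambda>X Y. exp (t * dev a \<alpha> n f l y X Y))
       = Ef d f n (\<lambda>X Y. exp ((\<Sum>i<n. u * (Ker l y (X i) - e)) + (\<Sum>z\<in>NIdx d n. (t * w z) * Y z)))"
      unfolding dev_linear[OF n l(2) Wp_bdd01[OF f]]
      by (simp add: distrib_left sum_distrib_left u_def e_def w_def mult.assoc)
    also have "\<dots> = (\<integral>\<^sup>+ x. ennreal (exp (u * (Ker l y x - e))) \<partial>obsM f) ^ n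
        * (\<Prod>z\<in>NIdx d n. \<integral>\<^sup>+ x. ennreal (exp ((t * w z) * x)) \<partial>laplace)"
    proof (rule Ef_exp_linear[OF f])
      show "(\<lambda>x. u * (Ker l y x - e)) \<in> borel_measurable borel" using Ker_measurable by measurable
    qed
    also have "\<dots> \<le> ennreal (exp (u\<^sup>2 * v)) ^ n * ennreal (exp (\<Sum>z\<in>NIdx d n. 2 * (t * w z)\<^sup>2))"
      by (intro mult_mono power_mono data prod_le_ennreal_exp finite_NIdx noise) auto
    also have "\<dots> = ennreal (exp (real n * (u\<^sup>2 * v) + (\<Sum>z\<in>NIdx d n. 2 * (t * w z)\<^sup>2)))"
      by (simp add: ennreal_power exp_of_nat_mult[symmetric] ennreal_mult[symmetric] exp_add)
    also have "\<dots> \<le> ennreal (exp (\<mu>\<^sup>2))"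
    proof (intro ennreal_leI, simp only: exp_le_cancel_iff)
      have "real n * (u\<^sup>2 * v) \<le> real n * (u\<^sup>2 * (M * (C * 2 ^ l)))" by (intro mult_left_mono v_le) auto
      also have "\<dots> = M * C / real n * (t\<^sup>2 * 2 ^ l)" using n by (simp add: u_def power_divide power2_eq_square)
      also have "\<dots> \<le> M * C / real n * (t\<^sup>2 * (real n * V))" using M C(1) by (intro mult_left_mono nV) auto
      also have "\<dots> = M * C * (t\<^sup>2 * V)" using n by simp
      finally have 1: "real n * (u\<^sup>2 * v) \<le> M * C * (t\<^sup>2 * V)" .
      have "(\<Sum>z\<in>NIdx d n. 2 * (t * w z)\<^sup>2) = 2 * t\<^sup>2 * (\<Sum>z\<in>NIdx d n. (w z)\<^sup>2)"
        by (simp add: sum_distrib_left power_mult_distrib mult.assoc)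
      also have "\<dots> \<le> 2 * t\<^sup>2 * (W * V)" unfolding w_def V_def by (intro mult_left_mono W(3) y al n l) auto
      finally have 2: "(\<Sum>z\<in>NIdx d n. 2 * (t * w z)\<^sup>2) \<le> 2 * W * (t\<^sup>2 * V)" by (simp add: mult_ac)
      have "real n * (u\<^sup>2 * v) + (\<Sum>z\<in>NIdx d n. 2 * (t * w z)\<^sup>2) \<le> (M * C + 2 * W) * (t\<^sup>2 * V)"
        using 1 2 by (simp add: distrib_right)
      also have "\<dots> \<le> T * (t\<^sup>2 * V)" using V0 by (intro mult_right_mono T) auto
      also have "\<dots> \<le> T * (\<kappa>\<^sup>2 * \<mu>\<^sup>2)" using T by (intro mult_left_mono tV) auto
      also have "\<dots> = \<mu>\<^sup>2" using T by (simp add: k2)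
      finally show "real n * (u\<^sup>2 * v) + (\<Sum>z\<in>NIdx d n. 2 * (t * w z)\<^sup>2) \<le> \<mu>\<^sup>2" .
    qed
    finally show ?thesis .
  qed
  then show ?thesis using k0 by blast
qed

lemma dev_abs_mgf:
  assumes a: "1 < a" and M: "0 \<le> M"
  shows "\<exists>\<kappa>>0. \<forall>n \<alpha> f l \<mu>. \<forall>y\<in>{0..1}. 0 < n \<longrightarrow> 0 < \<alpha> \<longrightarrow> 1 \<le> l \<longrightarrow> l \<le> jmax n \<longrightarrow> f \<in> Wp p M \<longrightarrow>
    \<mu>\<^sup>2 \<le> real l \<longrightarrow>
    Ef d f n (\<lambda>X Y. exp (\<kappa> * \<mu> * (\<bar>dev a \<alpha> n f l y X Y\<bar> / sqrt (vlev a \<alpha> n l)))) \<le> ennreal (2 * exp (\<mu>\<^sup>2))"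
proof -
  obtain \<kappa> where k1: "0 < \<kappa>" and k2: "\<forall>n \<alpha> f l t \<mu>. \<forall>y\<in>{0..1}. 0 < n \<longrightarrow> 0 < \<alpha> \<longrightarrow> 1 \<le> l \<longrightarrow> l \<le> jmax n \<longrightarrow> f \<in> Wp p M \<longrightarrow>
    \<mu>\<^sup>2 \<le> real l \<longrightarrow> t\<^sup>2 * vlev a \<alpha> n l \<le> \<kappa>\<^sup>2 * \<mu>\<^sup>2 \<longrightarrow>
    Ef d f n (\<lambda>X Y. exp (t * dev a \<alpha> n f l y X Y)) \<le> ennreal (exp (\<mu>\<^sup>2))"
    using dev_mgf[where p=p, OF a M] by (elim exE conjE) (rule that)
  note k = k1 k2[rule_format]
  have "Ef d f n (\<lambda>X Y. exp (\<kappa> * \<mu> * (\<bar>dev a \<alpha> n f l y X Y\<bar> / sqrt (vlev a \<alpha> n l)))) \<le> ennreal (2 * exp (\<mu>\<^sup>2))"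
    if y: "y \<in> {0..1}" and n: "0 < n" and al: "0 < \<alpha>" and l: "1 \<le> l" "l \<le> jmax n" and f: "f \<in> Wp p M"
      and lam: "\<mu>\<^sup>2 \<le> real l" for n \<alpha> f l \<mu> y
  proof -
    define V where "V = vlev a \<alpha> n l"
    have V0: "0 < V" unfolding V_def by (rule vlev_pos[OF n])
    define t where "t = \<kappa> * \<mu> / sqrt V"
    have t: "t\<^sup>2 * vlev a \<alpha> n l \<le> \<kappa>\<^sup>2 * \<mu>\<^sup>2" "(- t)\<^sup>2 * vlev a \<alpha> n l \<le> \<kappa>\<^sup>2 * \<mu>\<^sup>2"
      using V0 by (auto simp: t_def power_divide power_mult_distrib V_def)
    define D where "D X Y = dev a \<alpha> n f l y X Y" for X Y
    have m: "(\<lambda>\<omega>. D (fst \<omega>) (snd \<omega>)) \<in> borel_measurable (dataM f n \<Otimes>\<^sub>M noiseM d n)"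
      unfolding D_def by (rule dev_measurable[OF n l(2) Wp_bdd01[OF f]])
    have "Ef d f n (\<lambda>X Y. exp (\<kappa> * \<mu> * (\<bar>D X Y\<bar> / sqrt V)))
       \<le> Ef d f n (\<lambda>X Y. exp (t * D X Y) + exp (- t * D X Y))"
    proof (rule Ef_mono)
      fix X Y
      have "\<kappa> * \<mu> * (\<bar>D X Y\<bar> / sqrt V) = t * D X Y \<or> \<kappa> * \<mu> * (\<bar>D X Y\<bar> / sqrt V) = - t * D X Y"
        by (cases "0 \<le> D X Y") (auto simp: t_def)
      then show "exp (\<kappa> * \<mu> * (\<bar>D X Y\<bar> / sqrt V)) \<le> exp (t * D X Y) + exp (- t * D X Y)"
        using exp_gt_zero[of "t * D X Y"] exp_gt_zero[of "- t * D X Y"] by (auto simp del: exp_gt_zero)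
    qed
    also have "\<dots> = Ef d f n (\<lambda>X Y. exp (t * D X Y)) + Ef d f n (\<lambda>X Y. exp (- t * D X Y))"
      unfolding Ef_def using m by (subst nn_integral_add[symmetric]) (auto simp: ennreal_plus)
    also have "\<dots> \<le> ennreal (exp (\<mu>\<^sup>2)) + ennreal (exp (\<mu>\<^sup>2))"
      unfolding D_def by (intro add_mono k(2)[OF y n al l f lam] t)
    also have "\<dots> = ennreal (2 * exp (\<mu>\<^sup>2))" by (simp flip: ennreal_plus)
    finally show ?thesis by (simp add: D_def V_def)
  qed
  then show ?thesis using k(1) by blast
qed

text \<open>The first bound is the case \<mu> = sqrt l, needed for tails uniform over about 2^l
  points. The moments come from \<mu> = 1, which l \<ge> 1 allows, and so carry no factor l.\<close>

lemma dev_moments: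
  assumes a: "1 < a" and M: "0 \<le> M"
  shows "\<exists>\<kappa>>0. \<exists>C\<ge>0. \<forall>n \<alpha> f l. \<forall>y\<in>{0..1}. 0 < n \<longrightarrow> 0 < \<alpha> \<longrightarrow> 1 \<le> l \<longrightarrow> l \<le> jmax n \<longrightarrow> f \<in> Wp p M \<longrightarrow>
      Ef d f n (\<lambda>X Y. exp (\<kappa> * sqrt (real l) * (\<bar>dev a \<alpha> n f l y X Y\<bar> / sqrt (vlev a \<alpha> n l)))) \<le> ennreal (2 * exp (real l))
    \<and> Ef d f n (\<lambda>X Y. (dev a \<alpha> n f l y X Y)\<^sup>2) \<le> ennreal (C * vlev a \<alpha> n l)
    \<and> Ef d f n (\<lambda>X Y. (dev a \<alpha> n f l y X Y) ^ 4) \<le> ennreal (C * (vlev a \<alpha> n l)\<^sup>2)"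
proof -
  obtain \<kappa> where k1: "0 < \<kappa>" and k2: "\<forall>n \<alpha> f l \<mu>. \<forall>y\<in>{0..1}. 0 < n \<longrightarrow> 0 < \<alpha> \<longrightarrow> 1 \<le> l \<longrightarrow> l \<le> jmax n \<longrightarrow> f \<in> Wp p M \<longrightarrow>
    \<mu>\<^sup>2 \<le> real l \<longrightarrow>
    Ef d f n (\<lambda>X Y. exp (\<kappa> * \<mu> * (\<bar>dev a \<alpha> n f l y X Y\<bar> / sqrt (vlev a \<alpha> n l)))) \<le> ennreal (2 * exp (\<mu>\<^sup>2))"
    using dev_abs_mgf[where p=p, OF a M] by (elim exE conjE) (rule that)
  note k = k1 k2[rule_format]
  define C where "C = max (4 * exp 1 / \<kappa>\<^sup>2) (128 * exp 1 / \<kappa> ^ 4)"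
  have C0: "0 \<le> C" by (simp add: C_def le_max_iff_disj)
  have "Ef d f n (\<lambda>X Y. exp (\<kappa> * sqrt (real l) * (\<bar>dev a \<alpha> n f l y X Y\<bar> / sqrt (vlev a \<alpha> n l)))) \<le> ennreal (2 * exp (real l))
    \<and> Ef d f n (\<lambda>X Y. (dev a \<alpha> n f l y X Y)\<^sup>2) \<le> ennreal (C * vlev a \<alpha> n l)
    \<and> Ef d f n (\<lambda>X Y. (dev a \<alpha> n f l y X Y) ^ 4) \<le> ennreal (C * (vlev a \<alpha> n l)\<^sup>2)"
    if y: "y \<in> {0..1}" and n: "0 < n" and al: "0 < \<alpha>" and l: "1 \<le> l" "l \<le> jmax n" and f: "f \<in> Wp p M" for n \<alpha> f l y
  proof (intro conjI)
    show "Ef d f n (\<lambda>X Y. exp (\<kappa> * sqrt (real l) * (\<bar>dev a \<alpha> n f l y X Y\<bar> / sqrt (vlev a \<alpha> n l)))) \<le> ennreal (2 * exp (real l))"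
      using k(2)[OF y n al l f, of "sqrt (real l)"] by simp
    define V where "V = vlev a \<alpha> n l"
    have V0: "0 < V" unfolding V_def by (rule vlev_pos[OF n])
    define D where "D X Y = dev a \<alpha> n f l y X Y" for X Y
    define z where "z X Y = \<kappa> * 1 * (\<bar>D X Y\<bar> / sqrt V)" for X Y
    have z0: "0 \<le> z X Y" for X Y using k(1) V0 by (simp add: z_def)
    have m: "(\<lambda>\<omega>. D (fst \<omega>) (snd \<omega>)) \<in> borel_measurable (dataM f n \<Otimes>\<^sub>M noiseM d n)"
      unfolding D_def by (rule dev_measurable[OF n l(2) Wp_bdd01[OF f]])
    have base: "Ef d f n (\<lambda>X Y. exp (z X Y)) \<le> ennreal (2 * exp 1)"
      using k(2)[OF y n al l f, of 1] l by (simp add: z_def D_def V_def)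
    have scale: "Ef d f n (\<lambda>X Y. c * exp (z X Y)) \<le> ennreal (c * (2 * exp 1))" if c: "0 \<le> c" for c
    proof -
      have "Ef d f n (\<lambda>X Y. c * exp (z X Y)) = ennreal c * Ef d f n (\<lambda>X Y. exp (z X Y))"
        unfolding Ef_def using m c by (subst nn_integral_cmult[symmetric]) (auto simp: ennreal_mult z_def)
      also have "\<dots> \<le> ennreal c * ennreal (2 * exp 1)" by (intro mult_left_mono base) auto
      finally show ?thesis using c by (simp add: ennreal_mult)
    qed
    have zD: "D X Y ^ 2 = V / \<kappa>\<^sup>2 * z X Y ^ 2" for X Y
      using k(1) V0 by (simp add: z_def power_mult_distrib power_divide)
    have "Ef d f n (\<lambda>X Y. (D X Y)\<^sup>2) \<le> Ef d f n (\<lambda>X Y. (2 * V / \<kappa>\<^sup>2) * exp (z X Y))"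
    proof (rule Ef_mono)
      fix X Y
      have "(D X Y)\<^sup>2 \<le> V / \<kappa>\<^sup>2 * (2 * exp (z X Y))"
        unfolding zD using V0 by (intro mult_left_mono sq_le_exp z0) auto
      then show "(D X Y)\<^sup>2 \<le> (2 * V / \<kappa>\<^sup>2) * exp (z X Y)" by (simp add: mult_ac)
    qed
    also have "\<dots> \<le> ennreal ((2 * V / \<kappa>\<^sup>2) * (2 * exp 1))" using V0 by (intro scale) auto
    also have "\<dots> \<le> ennreal (C * V)"
    proof (rule ennreal_leI)
      have "(2 * V / \<kappa>\<^sup>2) * (2 * exp 1) = (4 * exp 1 / \<kappa>\<^sup>2) * V" by simp
      also have "\<dots> \<le> C * V" using V0 by (intro mult_right_mono) (auto simp: C_def)
      finally show "(2 * V / \<kappa>\<^sup>2) * (2 * exp 1) \<le> C * V" .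
    qed
    finally show "Ef d f n (\<lambda>X Y. (dev a \<alpha> n f l y X Y)\<^sup>2) \<le> ennreal (C * vlev a \<alpha> n l)" by (simp add: D_def V_def)
    have "Ef d f n (\<lambda>X Y. (D X Y) ^ 4) \<le> Ef d f n (\<lambda>X Y. (64 * V\<^sup>2 / \<kappa> ^ 4) * exp (z X Y))"
    proof (rule Ef_mono)
      fix X Y
      have "D X Y ^ 4 = (D X Y ^ 2) ^ 2" by simp
      also have "\<dots> = V\<^sup>2 / \<kappa> ^ 4 * z X Y ^ 4" unfolding zD by (simp add: power_mult_distrib power_divide)
      also have "\<dots> \<le> V\<^sup>2 / \<kappa> ^ 4 * (64 * exp (z X Y))" using k(1) by (intro mult_left_mono quad_le_exp z0) auto
      finally show "(D X Y) ^ 4 \<le> (64 * V\<^sup>2 / \<kappa> ^ 4) * exp (z X Y)" by (simp add: mult_ac)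
    qed
    also have "\<dots> \<le> ennreal ((64 * V\<^sup>2 / \<kappa> ^ 4) * (2 * exp 1))" using k(1) by (intro scale) auto
    also have "\<dots> \<le> ennreal (C * V\<^sup>2)"
    proof (rule ennreal_leI)
      have "(64 * V\<^sup>2 / \<kappa> ^ 4) * (2 * exp 1) = (128 * exp 1 / \<kappa> ^ 4) * V\<^sup>2" by simp
      also have "\<dots> \<le> C * V\<^sup>2" by (intro mult_right_mono) (auto simp: C_def)
      finally show "(64 * V\<^sup>2 / \<kappa> ^ 4) * (2 * exp 1) \<le> C * V\<^sup>2" .
    qed
    finally show "Ef d f n (\<lambda>X Y. (dev a \<alpha> n f l y X Y) ^ 4) \<le> ennreal (C * (vlev a \<alpha> n l)\<^sup>2)" by (simp add: D_def V_def)
  qed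
  then show ?thesis using k(1) C0 by blast
qed

end

section \<open>Properties of the variance proxy and the oracle level\<close>

lemma vlev_mono:
  assumes "l \<le> l'" "0 \<le> a" shows "vlev a \<alpha> n l \<le> vlev a \<alpha> n l'"
  unfolding vlev_def using assms
  by (intro divide_right_mono add_mono mult_mono power_increasing powr_mono2) auto

text \<open>Serves the levels above the oracle; the crude factor is exponential in l and is beaten
  later by the choice of \<open>Gm\<close>.\<close>

lemma vlev_growth:
  assumes "1 \<le> j" "j \<le> l" "0 \<le> a"
  shows "vlev a \<alpha> n l \<le> 4 ^ (l - j) * real l powr (2 * a) * vlev a \<alpha> n j"
proof -
  define g where "g = (4::real) ^ (l - j) * real l powr (2 * a)"
  have l1: "1 \<le> real l powr (2 * a)" and j1: "1 \<le> real j powr (2 * a)"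
    using assms by (auto intro!: ge_one_powr_ge_zero)
  have "(2::real) ^ l = 2 ^ (l - j) * 2 ^ j" using assms by (simp flip: power_add)
  also have "\<dots> \<le> g * 2 ^ j"
  proof (rule mult_right_mono)
    have "(2::real) ^ (l - j) * 1 \<le> 4 ^ (l - j) * real l powr (2 * a)" by (intro mult_mono power_mono l1) auto
    then show "(2::real) ^ (l - j) \<le> g" by (simp add: g_def)
  qed simp
  finally have 1: "(2::real) ^ l \<le> g * 2 ^ j" .
  have "(2::real) ^ (2 * l) = 4 ^ (l - j) * 2 ^ (2 * j)" using assms by (simp add: power_mult flip: power_add)
  then have "(2::real) ^ (2 * l) * real l powr (2 * a) / \<alpha>\<^sup>2 = g * (2 ^ (2 * j) * 1 / \<alpha>\<^sup>2)" by (simp add: g_def)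
  also have "\<dots> \<le> g * (2 ^ (2 * j) * real j powr (2 * a) / \<alpha>\<^sup>2)"
    by (intro mult_left_mono divide_right_mono j1) (auto simp: g_def)
  finally have "2 ^ l + 2 ^ (2 * l) * real l powr (2 * a) / \<alpha>\<^sup>2 \<le> g * (2 ^ j + 2 ^ (2 * j) * real j powr (2 * a) / \<alpha>\<^sup>2)"
    using 1 by (simp add: distrib_left)
  then show ?thesis unfolding vlev_def g_def[symmetric]
    by (metis divide_right_mono of_nat_0_le_iff times_divide_eq_right)
qed

text \<open>The factors are 2 for the level number, 4 for 4^l and 4^a for the power 2a of l, as l +
  1 \<le> 2 l.\<close>

lemma vlev_Suc:
  assumes "1 \<le> j" "1 < a" shows "real (Suc j) * vlev a \<alpha> n (Suc j) \<le> 8 * 4 powr a * (real j * vlev a \<alpha> n j)"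
proof -
  have j2: "real (Suc j) \<le> 2 * real j" using assms by simp
  have "real (Suc j) powr (2 * a) \<le> (2 * real j) powr (2 * a)" using assms j2 by (intro powr_mono2) auto
  also have "\<dots> = 2 powr (2 * a) * real j powr (2 * a)" by (simp add: powr_mult)
  also have "2 powr (2 * a) = (4::real) powr a"
    using powr_powr[of 2 2 a] by simp
  finally have p: "real (Suc j) powr (2 * a) \<le> 4 powr a * real j powr (2 * a)" .
  have a1: "1 \<le> (4::real) powr a" using assms by (intro ge_one_powr_ge_zero) auto
  have 1: "(2::real) ^ Suc j \<le> 4 * 4 powr a * 2 ^ j"
  proof -
    have "(2::real) ^ Suc j \<le> 4 * 1 * 2 ^ j" by simp
    also have "\<dots> \<le> 4 * 4 powr a * 2 ^ j" by (intro mult_right_mono mult_left_mono a1) auto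
    finally show ?thesis .
  qed
  have 2: "2 ^ (2 * Suc j) * real (Suc j) powr (2 * a) / \<alpha>\<^sup>2 \<le> 4 * 4 powr a * (2 ^ (2 * j) * real j powr (2 * a) / \<alpha>\<^sup>2)"
  proof -
    have "2 ^ (2 * Suc j) * real (Suc j) powr (2 * a) / \<alpha>\<^sup>2 \<le> 2 ^ (2 * Suc j) * (4 powr a * real j powr (2 * a)) / \<alpha>\<^sup>2"
      by (intro divide_right_mono mult_left_mono p) auto
    then show ?thesis by (simp add: mult_ac)
  qed
  have "vlev a \<alpha> n (Suc j) \<le> 4 * 4 powr a * (2 ^ j + 2 ^ (2 * j) * real j powr (2 * a) / \<alpha>\<^sup>2) / real n"
    unfolding vlev_def distrib_left by (intro divide_right_mono add_mono 1 2) simp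
  then have v: "vlev a \<alpha> n (Suc j) \<le> 4 * 4 powr a * vlev a \<alpha> n j" by (simp add: vlev_def)
  have v0: "0 \<le> vlev a \<alpha> n j" "0 \<le> vlev a \<alpha> n (Suc j)" by (auto simp: vlev_def)
  have "real (Suc j) * vlev a \<alpha> n (Suc j) \<le> (2 * real j) * (4 * 4 powr a * vlev a \<alpha> n j)"
    using v v0 by (intro mult_mono j2) auto
  then show ?thesis by (simp add: mult_ac)
qed

text \<open>A bound free of n and \<alpha>, for the two places where only boundedly many levels
  matter: an oracle at level 1, and the n for which the grid is too coarse.\<close>

lemma vlev_le:
  assumes "1 \<le> n" "0 < \<alpha>" "1 \<le> real n * \<alpha>\<^sup>2"
  shows "vlev a \<alpha> n l \<le> 2 ^ l + 4 ^ l * real l powr (2 * a)"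
proof -
  have n: "1 \<le> real n" using assms(1) by simp
  have "vlev a \<alpha> n l = 2 ^ l / real n + 4 ^ l * real l powr (2 * a) / (real n * \<alpha>\<^sup>2)"
  proof -
    have "(2::real) ^ (2 * l) = 4 ^ l" by (simp add: power_mult)
    then show ?thesis unfolding vlev_def by (simp only: add_divide_distrib divide_divide_eq_left mult.commute[of "\<alpha>\<^sup>2"])
  qed
  also have "2 ^ l / real n \<le> 2 ^ l" using n mult_left_mono[of 1 "real n" "2 ^ l"] by (simp add: divide_le_eq)
  also have "4 ^ l * real l powr (2 * a) / (real n * \<alpha>\<^sup>2) \<le> 4 ^ l * real l powr (2 * a)"
  proof -
    have "4 ^ l * real l powr (2 * a) * 1 \<le> 4 ^ l * real l powr (2 * a) * (real n * \<alpha>\<^sup>2)"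
      by (intro mult_left_mono assms(3)) auto
    then show ?thesis using assms(3) by (simp add: divide_le_eq)
  qed
  finally show ?thesis by simp
qed

text \<open>The smallest level at which the squared bias is dominated by the threshold, capped at the
  largest admissible level.\<close>
definition jora :: "nat \<Rightarrow> real \<Rightarrow> real \<Rightarrow> nat \<Rightarrow> nat" where
  "jora p a \<alpha> n = (LEAST j. 1 \<le> j \<and> j \<le> jmax n \<and> (j = jmax n \<or> (1 / 2 ^ j) ^ (2 * p) \<le> real j * vlev a \<alpha> n j))"

lemma jmax_ge1: assumes "8 \<le> n" shows "1 \<le> jmax n"
proof -
  have "log 2 8 \<le> log 2 (real n)" using assms by simp
  moreover have "log 2 (8::real) = 3" using log_pow_cancel[of 2 3] by simp
  ultimately have "1 \<le> log 2 (real n) / 3" by simp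
  then have "1 \<le> \<lfloor>log 2 (real n) / 3\<rfloor>" by (simp add: le_floor_iff)
  then show ?thesis unfolding jmax_def by linarith
qed

lemma jora_prop:
  assumes "8 \<le> n"
  shows "1 \<le> jora p a \<alpha> n \<and> jora p a \<alpha> n \<le> jmax n
    \<and> (jora p a \<alpha> n = jmax n \<or> (1 / 2 ^ jora p a \<alpha> n) ^ (2 * p) \<le> real (jora p a \<alpha> n) * vlev a \<alpha> n (jora p a \<alpha> n))"
  unfolding jora_def by (rule LeastI[where k="jmax n"]) (use jmax_ge1[OF assms] in simp)

lemma jora_min:
  assumes "1 \<le> j" "j < jora p a \<alpha> n" "8 \<le> n"
  shows "real j * vlev a \<alpha> n j < (1 / 2 ^ j) ^ (2 * p)"
proof -
  have "j \<le> jmax n" using assms jora_prop[OF assms(3), of p a \<alpha>] by linarith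
  moreover have "\<not> (1 \<le> j \<and> j \<le> jmax n \<and> (j = jmax n \<or> (1 / 2 ^ j) ^ (2 * p) \<le> real j * vlev a \<alpha> n j))"
    using assms(2) unfolding jora_def by (rule not_less_Least)
  ultimately show ?thesis using assms(1) by auto
qed

text \<open>Minimality of the oracle: one level below, the bias still dominates, and one level
  changes either side by a constant factor only. At level 1 there is no level below, and the
  assumption on n \<alpha>^2 bounds the variance outright.\<close>

lemma jora_variance:
  assumes n: "8 \<le> n" and al: "0 < \<alpha>" "1 \<le> real n * \<alpha>\<^sup>2" and a: "1 < a"
  shows "real (jora p a \<alpha> n) * vlev a \<alpha> n (jora p a \<alpha> n) \<le> 8 * 4 powr a * 4 ^ p * (1 / 2 ^ jora p a \<alpha> n) ^ (2 * p)"
proof -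
  define j where "j = jora p a \<alpha> n"
  have j1: "1 \<le> j" using jora_prop[OF n] by (simp add: j_def)
  have a1: "1 \<le> (4::real) powr a" using a by (intro ge_one_powr_ge_zero) auto
  show ?thesis
  proof (cases "j = 1")
    case True
    have "real j * vlev a \<alpha> n j \<le> 6" using vlev_le[of n \<alpha> a 1] n al True by simp
    also have "\<dots> \<le> 8 * 4 powr a * (4 ^ p * (1 / 2) ^ (2 * p))"
    proof -
      have "(4::real) ^ p * (1 / 2) ^ (2 * p) = 1" by (simp add: power_mult power_divide)
      then show ?thesis using a1 by simp
    qed
    finally show ?thesis using True by (simp add: j_def)
  next
    case False
    then obtain i where i: "j = Suc i" "1 \<le> i" using j1 by (cases j) auto
    have "real j * vlev a \<alpha> n j \<le> 8 * 4 powr a * (real i * vlev a \<alpha> n i)" unfolding i(1) by (rule vlev_Suc[OF i(2) a])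
    also have "\<dots> \<le> 8 * 4 powr a * (1 / 2 ^ i) ^ (2 * p)"
      using jora_min[OF i(2) _ n, of p a \<alpha>] i by (intro mult_left_mono) (auto simp: j_def)
    also have "(1 / 2 ^ i) ^ (2 * p) = 4 ^ p * ((1::real) / 2 ^ j) ^ (2 * p)"
      by (simp add: i power_mult power_mult_distrib power_divide)
    finally show ?thesis by (simp add: j_def mult.assoc)
  qed
qed

lemma jmax_lower: assumes "0 < n" shows "real n powr (1 / 3) \<le> 2 * 2 ^ jmax n"
proof -
  have "log 2 (real n) / 3 \<le> real (jmax n) + 1" unfolding jmax_def by linarith
  then have "2 powr (log 2 (real n) / 3) \<le> 2 powr (real (jmax n) + 1)" by (intro powr_mono) auto
  moreover have "2 powr (log 2 (real n) / 3) = real n powr (1 / 3)"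
  proof -
    have "2 powr (log 2 (real n) * (1 / 3)) = (2 powr log 2 (real n)) powr (1 / 3)" by (simp only: powr_powr)
    then show ?thesis using assms by simp
  qed
  moreover have "2 powr (real (jmax n) + 1) = 2 * (2::real) ^ jmax n" by (simp add: powr_add powr_realpow)
  ultimately show ?thesis by simp
qed

lemma ln_8_ge: "8 \<le> n \<Longrightarrow> 1 \<le> ln (real n)"
proof -
  assume "8 \<le> n"
  then have "exp 1 \<le> real n" using exp_le by simp
  then have "ln (exp 1) \<le> ln (real n)" by (intro ln_mono) auto
  then show ?thesis by simp
qed

lemma jmax_le_ln: assumes "8 \<le> n" shows "real (jmax n) \<le> ln (real n)"
proof -
  have "0 \<le> log 2 (real n) / 3" using assms by simp
  then have "real (jmax n) \<le> log 2 (real n) / 3" unfolding jmax_def by linarith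
  also have "\<dots> = ln (real n) / (3 * ln 2)" by (simp add: log_def)
  also have "\<dots> \<le> ln (real n) / 1"
  proof (rule divide_left_mono)
    have "ln (1 / 2) \<le> 1 / 2 - (1::real)" by (rule ln_le_minus_one) simp
    then show "1 \<le> 3 * ln (2::real)" by (simp add: ln_div)
  qed (use ln_8_ge[OF assms] in auto)
  finally show ?thesis by simp
qed

lemma powr_pow_le:
  fixes x y :: real
  assumes "0 < x" "x ^ m \<le> y" "0 < m" "0 < y"
  shows "x ^ k \<le> y powr (real k / real m)"
proof -
  have "(x ^ m) powr (real k / real m) \<le> y powr (real k / real m)" using assms by (intro powr_mono2) auto
  moreover have "(x ^ m) powr (real k / real m) = x ^ k"
    using assms by (simp add: powr_powr flip: powr_realpow)
  ultimately show ?thesis by simp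
qed

text \<open>The oracle bias is limited either by the cap or by the threshold. In the second case x =
  2^(-j) satisfies an inequality with a sampling term and a privacy term, and solving it for x with
  the larger of the two gives one of the two rates.\<close>

lemma oracle_rate:
  assumes n: "8 \<le> n" and al: "0 < \<alpha>" and a: "1 < a" and s: "s + 1 \<le> p"
  shows "(1 / 2 ^ jora p a \<alpha> n) ^ (2 * (p - s)) \<le> 4 ^ p * rate p s a \<alpha> n"
proof -
  define j where "j = jora p a \<alpha> n"
  define x :: real where "x = 1 / 2 ^ j"
  define k where "k = 2 * (p - s)"
  define L where "L = ln (real n)"
  have x0: "0 < x" by (simp add: x_def)
  have L1: "1 \<le> L" unfolding L_def by (rule ln_8_ge[OF n])
  have n0: "0 < real n" using n by simp
  have kp: "real k = 2 * (real p - real s)" using s by (simp add: k_def)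
  have k2p: "k \<le> 2 * p" by (simp add: k_def)
  have j: "1 \<le> j" "j \<le> jmax n" and jc: "j = jmax n \<or> x ^ (2 * p) \<le> real j * vlev a \<alpha> n j"
    using jora_prop[OF n, of p a \<alpha>] by (auto simp: j_def x_def)
  have jL: "real j \<le> L" using j(2) jmax_le_ln[OF n] unfolding L_def by (meson of_nat_mono order_trans)
  define R1 R2 where "R1 = (real n / L) powr (- real k / (2 * real p + 1))"
    and "R2 = (real n * \<alpha>\<^sup>2 / L powr (1 + 2 * a)) powr (- real k / (2 * real p + 2))"
  have rate: "rate p s a \<alpha> n = max R2 R1" by (simp add: rate_def R1_def R2_def L_def kp)
  have R0: "0 \<le> R1" "0 \<le> R2" by (auto simp: R1_def R2_def)
  have two: "2 powr (real k / m) \<le> 4 ^ p" if "1 \<le> m" for m :: real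
  proof -
    have "2 powr (real k / m) \<le> 2 powr real (2 * p)"
    proof (rule powr_mono)
      have "real k / m \<le> real k / 1" using that by (intro divide_left_mono) auto
      then show "real k / m \<le> real (2 * p)" using k2p by linarith
    qed simp
    also have "\<dots> = 4 ^ p" by (subst powr_realpow) (auto simp: power_mult)
    finally show ?thesis .
  qed
  have inv: "(2 / A) powr e \<le> 4 ^ p * A powr (- e)" if "0 < A" "e = real k / m" "1 \<le> m" for A e m :: real
  proof -
    have "(2 / A) powr e = 2 powr e * A powr (- e)" using that(1) by (simp add: powr_divide powr_minus_divide)
    also have "\<dots> \<le> 4 ^ p * A powr (- e)" using two[OF that(3)] that(2) by (intro mult_right_mono) auto
    finally show ?thesis .
  qed
  show ?thesis
  \<comment> \<open>At the cap x is of order n^(-1/3). Since p \<ge> 1, the exponent 1/(2p+1) is at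
    most 1/3, so the cap costs no more than the rate without privacy.\<close>
  proof (cases "j = jmax n")
    case True
    have "x \<le> 2 * real n powr (- (1 / 3))"
    proof -
      have "real n powr (1 / 3) \<le> 2 * 2 ^ j" using jmax_lower[of n] n True by simp
      then have "1 \<le> (2 * 2 ^ j) * real n powr (- (1 / 3))" using n0 by (simp add: powr_minus field_simps)
      then show ?thesis by (simp add: x_def field_simps)
    qed
    then have "x ^ k \<le> (2 * real n powr (- (1 / 3))) ^ k" using x0 by (intro power_mono) auto
    also have "\<dots> = 2 ^ k * real n powr (- (real k / 3))"
      using n0 by (simp add: power_mult_distrib powr_power)
    also have "\<dots> \<le> 4 ^ p * R1"
    proof (rule mult_mono)
      have "(2::real) ^ k \<le> 2 ^ (2 * p)" by (intro power_increasing k2p) auto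
      then show "(2::real) ^ k \<le> 4 ^ p" by (simp add: power_mult)
      have "real n powr (- (real k / 3)) \<le> real n powr (- real k / (2 * real p + 1))"
      proof (rule powr_mono)
        have "real k / (2 * real p + 1) \<le> real k / 3" using s by (intro divide_left_mono) auto
        then show "- (real k / 3) \<le> - real k / (2 * real p + 1)" by simp
      qed (use n in simp)
      also have "\<dots> \<le> R1" unfolding R1_def
      proof (rule powr_mono2')
        show "real n / L \<le> real n" using L1 n0 by (simp add: divide_le_eq)
      qed (use L1 n0 in auto)
      finally show "real n powr (- (real k / 3)) \<le> R1" .
    qed auto
    also have "\<dots> \<le> 4 ^ p * rate p s a \<alpha> n" unfolding rate by (intro mult_left_mono) auto
    finally show ?thesis by (simp add: x_def j_def k_def)
  next
    case False
    define A1 A2 where "A1 = real n / L" and "A2 = real n * \<alpha>\<^sup>2 / L powr (1 + 2 * a)"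
    have A0: "0 < A1" "0 < A2" using n0 L1 al by (auto simp: A1_def A2_def)
    have "x ^ (2 * p) \<le> real j * vlev a \<alpha> n j" using jc False by simp
    also have "\<dots> \<le> L * ((1 / x + (1 / x)\<^sup>2 * L powr (2 * a) / \<alpha>\<^sup>2) / real n)"
    proof (rule mult_mono[OF jL])
      have "real j powr (2 * a) \<le> L powr (2 * a)" using jL a by (intro powr_mono2) auto
      then have "(1 / x)\<^sup>2 * real j powr (2 * a) / \<alpha>\<^sup>2 \<le> (1 / x)\<^sup>2 * L powr (2 * a) / \<alpha>\<^sup>2"
        by (intro divide_right_mono mult_left_mono) auto
      moreover have "(2::real) ^ (2 * j) = (1 / x)\<^sup>2" by (simp add: x_def power_mult[symmetric] mult.commute)
      ultimately show "vlev a \<alpha> n j \<le> (1 / x + (1 / x)\<^sup>2 * L powr (2 * a) / \<alpha>\<^sup>2) / real n"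
        unfolding vlev_def by (intro divide_right_mono) (auto simp: x_def)
    qed (use L1 in \<open>auto simp: vlev_def\<close>)
    also have "\<dots> = 1 / (x * A1) + 1 / (x\<^sup>2 * A2)"
      using L1 by (simp add: A1_def A2_def powr_add add_divide_distrib distrib_left power_divide mult_ac)
    finally have le: "x ^ (2 * p) \<le> 1 / (x * A1) + 1 / (x\<^sup>2 * A2)" .
    consider "x ^ (2 * p) \<le> 2 * (1 / (x * A1))" | "x ^ (2 * p) \<le> 2 * (1 / (x\<^sup>2 * A2))"
      using le by linarith
    then show ?thesis
    proof cases
      case 1
      then have "x ^ (2 * p) * x \<le> 2 / A1" using x0 A0 by (simp add: field_simps)
      then have "x ^ (2 * p + 1) \<le> 2 / A1" by (simp add: mult.commute)
      then have "x ^ k \<le> (2 / A1) powr (real k / real (2 * p + 1))"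
        using x0 A0 by (intro powr_pow_le) auto
      also have "\<dots> \<le> 4 ^ p * A1 powr (- (real k / real (2 * p + 1)))"
        by (rule inv[OF A0(1) refl]) simp
      also have "\<dots> = 4 ^ p * R1" by (simp add: R1_def A1_def add.commute)
      also have "\<dots> \<le> 4 ^ p * rate p s a \<alpha> n" unfolding rate by (intro mult_left_mono) auto
      finally show ?thesis by (simp add: x_def j_def k_def)
    next
      case 2
      then have "x ^ (2 * p) * x\<^sup>2 \<le> 2 / A2" using x0 A0 by (simp add: field_simps)
      then have "x ^ (2 * p + 2) \<le> 2 / A2" by (simp only: power_add)
      then have "x ^ k \<le> (2 / A2) powr (real k / real (2 * p + 2))"
        using x0 A0 by (intro powr_pow_le) auto
      also have "\<dots> \<le> 4 ^ p * A2 powr (- (real k / real (2 * p + 2)))"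
        by (rule inv[OF A0(2) refl]) simp
      also have "\<dots> = 4 ^ p * R2" by (simp add: R2_def A2_def add.commute)
      also have "\<dots> \<le> 4 ^ p * rate p s a \<alpha> n" unfolding rate by (intro mult_left_mono) auto
      finally show ?thesis by (simp add: x_def j_def k_def)
    qed
  qed
qed

section \<open>From the grid to the whole interval\<close>

text \<open>A bootstrap: the value at a norming point differs from a nearby grid value by at most a
  derivative bound times the mesh, and that derivative is bounded by the sum T of the values at
  norming points themselves. On a fine enough grid this gives T \<le> e sqrt S + T/2.\<close>

lemma grid_norming:
  "\<exists>G>0. \<exists>C\<ge>0. \<forall>g s N Mn S. ppoly d N g \<longrightarrow> 0 < N \<longrightarrow> G * real N \<le> real Mn \<longrightarrow> 0 \<le> S \<longrightarrow>
     (\<forall>t\<le>Mn. (sderiv s g (real t / real Mn))\<^sup>2 \<le> S) \<longrightarrow> (\<forall>x\<in>{0..1}. (sderiv s g x)\<^sup>2 \<le> C * S)"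
proof -
  obtain C where C0: "0 \<le> C" and C: "\<And>q s N c x. degree q \<le> d \<Longrightarrow> s \<le> 1 \<Longrightarrow> 0 < N \<Longrightarrow> c < N \<Longrightarrow>
     x \<in> {real c / real N..real (Suc c) / real N} \<Longrightarrow>
     \<bar>poly ((pderiv ^^ s) q) x\<bar> \<le> C * real N ^ s * (\<Sum>i\<le>d. \<bar>poly q (npt d N c i)\<bar>)"
    using poly_cell_bound[of d 1] by blast
  define e where "e = real d + 1"
  \<comment> \<open>The part e puts the next grid point into the same cell, as norming points keep
    the distance 1/(eN) from its right end; the part 2 e C makes the derivative error at most T/(2e)
    per point.\<close>
  define G where "G = e + 2 * e * C"
  have e1: "1 \<le> e" by (simp add: e_def)
  have G: "0 < G" "e \<le> G" "2 * e * C \<le> G" using e1 C0 by (auto simp: G_def intro: add_pos_nonneg)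
  have "(sderiv s g x)\<^sup>2 \<le> (C * (2 * e))\<^sup>2 * S"
    if g: "ppoly d N g" and N: "0 < N" and Mn: "G * real N \<le> real Mn" and S: "0 \<le> S"
      and grid: "\<forall>t\<le>Mn. (sderiv s g (real t / real Mn))\<^sup>2 \<le> S" and x: "x \<in> {0..1}" for g s N Mn S x
  proof -
    define c where "c = cidx N x"
    have c: "c < N" "x \<in> cell N c" using cidx_less cell_cidx N x by (auto simp: c_def)
    obtain q where q: "degree q \<le> d" "\<forall>x\<in>cell N c. g x = poly q x" using ppolyE[OF g c(1)] by blast
    define r where "r = (pderiv ^^ s) q"
    have dr: "degree r \<le> d" using q by (simp add: r_def degree_higher_pderiv)
    have gr: "sderiv s g y = poly r y" if "y \<in> cell N c" for y
      unfolding r_def by (rule sderiv_cell_poly[OF N c(1) _ that]) (use q in auto)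
    define T where "T = (\<Sum>i\<le>d. \<bar>poly r (npt d N c i)\<bar>)"
    have N0: "0 < real N" using N by simp
    have Mn0: "0 < real Mn" using Mn G N0 by (meson less_le_trans mult_pos_pos)
    have step: "\<bar>poly r (npt d N c i)\<bar> \<le> sqrt S + T / (2 * e)" if i: "i \<le> d" for i
    proof -
      define y where "y = npt d N c i"
      \<comment> \<open>Rounded up, so that the grid point lies to the right of y, where the
        half-open cell has room left.\<close>
      define t where "t = nat \<lceil>y * real Mn\<rceil>"
      define z where "z = real t / real Mn"
      have yc: "y \<in> cell N c" unfolding y_def by (rule npt_cell[OF c(1) i])
      have y0: "0 \<le> y" using npt_01[OF c(1) i] by (simp add: y_def)
      have t: "y * real Mn \<le> real t" "real t < y * real Mn + 1"
        using y0 Mn0 unfolding t_def by (auto simp: of_nat_nat ceiling_less_iff) linarith+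
      have z: "y \<le> z" "z < y + 1 / real Mn" using t Mn0 by (auto simp: z_def field_simps)
      have "e * real N \<le> real Mn" using Mn G N0 by (meson mult_right_mono less_imp_le order_trans)
      then have "1 / real Mn \<le> 1 / (e * real N)" using e1 N0 Mn0 by (intro divide_left_mono mult_pos_pos) auto
      moreover have "y + 1 / (e * real N) \<le> real (Suc c) / real N"
      proof -
        have "real i + 1 \<le> e" using i by (simp add: e_def)
        then have "real i / e + 1 / e \<le> 1" using e1 by (simp add: add_divide_distrib[symmetric])
        moreover have "y + 1 / (e * real N) = (real c + (real i / e + 1 / e)) / real N"
          by (simp add: y_def npt_def e_def add_divide_distrib)
        ultimately show ?thesis by (simp add: divide_right_mono)
      qed
      ultimately have zlt: "z < real (Suc c) / real N" using z by linarith
      have ylo: "real c / real N \<le> y" using cell_Icc[OF N c(1) yc] by simp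
      have zc: "z \<in> cell N c" using zlt ylo z by (simp add: cell_def)
      have "z \<le> 1" using cell_subset[OF c(1)] zc by auto
      then have tM: "t \<le> Mn" using Mn0 by (simp add: z_def divide_le_eq)
      have "(poly r z)\<^sup>2 \<le> S" using grid tM gr[OF zc] by (auto simp: z_def)
      then have pz: "\<bar>poly r z\<bar> \<le> sqrt S" by (simp add: real_le_rsqrt)
      have "norm (poly r z - poly r y) \<le> (C * real N * T) * norm (z - y)"
      proof (rule field_differentiable_bound[where S="{y..z}" and f'="poly (pderiv r)"])
        show "norm (poly (pderiv r) w) \<le> C * real N * T" if w: "w \<in> {y..z}" for w
          using C[OF dr _ N c(1), of 1 w] w ylo zlt by (simp add: T_def)
      qed (use z in \<open>auto intro: has_field_derivative_at_within poly_DERIV\<close>)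
      also have "\<dots> \<le> (C * real N * T) * (1 / real Mn)"
        using z C0 by (intro mult_left_mono) (auto simp: T_def intro!: mult_nonneg_nonneg sum_nonneg)
      also have "\<dots> \<le> T / (2 * e)"
      proof -
        have "2 * e * C * real N \<le> real Mn" using Mn G N0 by (meson mult_right_mono less_imp_le order_trans)
        then have "(2 * e * C * real N) * T \<le> real Mn * T" by (intro mult_right_mono) (auto simp: T_def sum_nonneg)
        then show ?thesis using e1 Mn0 by (simp add: field_simps)
      qed
      finally show ?thesis using pz unfolding y_def real_norm_def by linarith
    qed
    have "T \<le> (\<Sum>i\<le>d. sqrt S + T / (2 * e))" unfolding T_def[of] by (rule sum_mono) (use step in \<open>auto simp: T_def\<close>)
    also have "\<dots> = e * (sqrt S + T / (2 * e))" by (simp add: e_def)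
    also have "\<dots> = e * sqrt S + T / 2" using e1 by (simp add: distrib_left)
    finally have T: "T \<le> 2 * e * sqrt S" by simp
    have "\<bar>sderiv s g x\<bar> \<le> C * T"
      using C[OF dr _ N c(1), of 0 x] cell_Icc[OF N c] gr[OF c(2)] by (simp add: T_def)
    also have "\<dots> \<le> C * (2 * e * sqrt S)" by (intro mult_left_mono T C0)
    finally have "\<bar>sderiv s g x\<bar>\<^sup>2 \<le> (C * (2 * e * sqrt S))\<^sup>2" by (intro power_mono) auto
    then show ?thesis using S by (simp add: power_mult_distrib)
  qed
  then show ?thesis using G(1) by (intro exI[of _ G] conjI exI[of _ "(C * (2 * e))\<^sup>2"]) auto
qed

text \<open>The function g is arbitrary: if its square is not integrable the integral is 0 by
  convention, and \<open>integral_mono'\<close> covers both cases.\<close>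

lemma l2sq_le_sup:
  assumes "\<And>x. x \<in> {0..1} \<Longrightarrow> (g x)\<^sup>2 \<le> S" shows "l2sq g \<le> S"
proof -
  have S0: "0 \<le> S" using assms[of 0] by (meson atLeastAtMost_iff order_trans zero_le_power2 zero_le_one order_refl)
  have int: "integrable lborel (\<lambda>x::real. S * indicator {0..1} x)"
    by (intro integrable_mult_right integrable_real_indicator) (auto simp: emeasure_lborel_Icc_eq)
  have "l2sq g \<le> (LINT x|lborel. S * indicator {0..1::real} x)"
    unfolding l2sq_def inner01_def set_lebesgue_integral_def
  proof (rule integral_mono')
    show "integrable lborel (\<lambda>x::real. S * indicator {0..1} x)" by (rule int)
    fix x :: real
    show "indicator {0..1} x *\<^sub>R (g x * g x) \<le> S * indicator {0..1} x"
      using assms[of x] by (simp add: indicator_def power2_eq_square)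
    show "0 \<le> S * indicator {0..1} x" using S0 by simp
  qed
  then show ?thesis by simp
qed

lemma l2sq_le_average:
  assumes N: "0 < N" and U: "\<And>x. x \<in> {0..1} \<Longrightarrow> (g x)\<^sup>2 \<le> U (cidx N x)"
  shows "l2sq g \<le> (\<Sum>c<N. U c / real N)"
proof -
  have U0: "0 \<le> U c" if "c < N" for c
  proof -
    have x: "real c / real N \<in> cell N c" using that N by (auto simp: cell_def intro!: divide_strict_right_mono)
    then have "real c / real N \<in> {0..1}" "c = cidx N (real c / real N)"
      using mem_cell_iff[OF N, of c "real c / real N"] that by auto
    then show ?thesis using U[of "real c / real N"] by (metis order_trans zero_le_power2)
  qed
  define h where "h x = (\<Sum>c<N. U c * indicator {real c / real N..real (Suc c) / real N} x)" for x :: real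
  have int: "integrable lborel (\<lambda>x. U c * indicator {real c / real N..real (Suc c) / real N} x)" for c
    by (intro integrable_mult_right integrable_real_indicator) (auto simp: emeasure_lborel_Icc_eq)
  have inth: "integrable lborel h" unfolding h_def by (intro Bochner_Integration.integrable_sum int)
  have "l2sq g \<le> (LINT x|lborel. h x)"
    unfolding l2sq_def inner01_def set_lebesgue_integral_def
  proof (rule integral_mono'[OF inth])
    fix x :: real
    show h0: "0 \<le> h x" unfolding h_def using U0 by (intro sum_nonneg mult_nonneg_nonneg) auto
    show "indicator {0..1} x *\<^sub>R (g x * g x) \<le> h x"
    proof (cases "x \<in> {0..1}")
      case True
      define c where "c = cidx N x"
      have c: "c < N" "x \<in> {real c / real N..real (Suc c) / real N}"
        using cidx_less[OF N] cell_Icc[OF N _ cell_cidx[OF N True]] by (auto simp: c_def)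
      have "g x * g x \<le> U c * indicator {real c / real N..real (Suc c) / real N} x"
        using U[OF True] c by (simp add: c_def power2_eq_square)
      also have "\<dots> \<le> h x" unfolding h_def
        by (rule member_le_sum[of c "{..<N}" "\<lambda>c. U c * indicator {real c / real N..real (Suc c) / real N} x"])
          (use U0 c in auto)
      finally show ?thesis using True by simp
    qed (use h0 in simp)
  qed
  also have "\<dots> = (\<Sum>c<N. LINT x|lborel. U c * indicator {real c / real N..real (Suc c) / real N} x)"
    unfolding h_def by (rule Bochner_Integration.integral_sum[OF int])
  also have "\<dots> = (\<Sum>c<N. U c / real N)"
  proof (rule sum.cong[OF refl])
    fix c
    have "real c / real N \<le> real (Suc c) / real N" by (intro divide_right_mono) auto
    then have "measure lborel {real c / real N..real (Suc c) / real N} = 1 / real N"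
      by (simp add: add_divide_distrib)
    then show "(LINT x|lborel. U c * indicator {real c / real N..real (Suc c) / real N} x) = U c / real N" by simp
  qed
  finally show ?thesis .
qed

section \<open>A calculus of expectation bounds\<close>

text \<open>Measurability and nonnegativity travel with the bound because additivity of the
  integral, unlike monotonicity, depends on them.\<close>

definition EB :: "nat \<Rightarrow> (real \<Rightarrow> real) \<Rightarrow> nat \<Rightarrow> ((nat \<Rightarrow> real) \<Rightarrow> (nat \<times> nat \<times> nat \<Rightarrow> real) \<Rightarrow> real) \<Rightarrow> real \<Rightarrow> bool" where
  "EB d f n R b \<longleftrightarrow> (\<lambda>\<omega>. R (fst \<omega>) (snd \<omega>)) \<in> borel_measurable (dataM f n \<Otimes>\<^sub>M noiseM d n)
     \<and> (\<forall>X Y. 0 \<le> R X Y) \<and> 0 \<le> b \<and> Ef d f n R \<le> ennreal b"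

lemma EB_Ef: "EB d f n R b \<Longrightarrow> Ef d f n R \<le> ennreal b" by (simp add: EB_def)

lemma EB_mono: "EB d f n R b \<Longrightarrow> b \<le> b' \<Longrightarrow> EB d f n R b'"
  unfolding EB_def by (meson ennreal_leI order_trans)

lemma EB_const: "f \<in> Wp p M \<Longrightarrow> 0 \<le> c \<Longrightarrow> EB d f n (\<lambda>X Y. c) c"
  by (simp add: EB_def Ef_const)

lemma EB_add: assumes "EB d f n R b" "EB d f n R' b'" shows "EB d f n (\<lambda>X Y. R X Y + R' X Y) (b + b')"
proof -
  have "Ef d f n (\<lambda>X Y. R X Y + R' X Y) = Ef d f n R + Ef d f n R'"
    unfolding Ef_def using assms
    by (subst nn_integral_add[symmetric]) (auto simp: EB_def ennreal_plus)
  also have "\<dots> \<le> ennreal b + ennreal b'" using assms by (intro add_mono) (auto simp: EB_def)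
  also have "\<dots> = ennreal (b + b')" using assms by (simp add: EB_def)
  finally show ?thesis using assms by (auto simp: EB_def)
qed

lemma EB_cmult: assumes "EB d f n R b" "0 \<le> c" shows "EB d f n (\<lambda>X Y. c * R X Y) (c * b)"
proof -
  have "Ef d f n (\<lambda>X Y. c * R X Y) = ennreal c * Ef d f n R"
    unfolding Ef_def using assms
    by (subst nn_integral_cmult[symmetric]) (auto simp: EB_def ennreal_mult)
  also have "\<dots> \<le> ennreal c * ennreal b" using assms by (intro mult_left_mono) (auto simp: EB_def)
  also have "\<dots> = ennreal (c * b)" using assms by (simp add: EB_def ennreal_mult)
  finally show ?thesis using assms by (auto simp: EB_def)
qed

lemma EB_sum:
  assumes f: "f \<in> Wp p M" and "finite I" "\<And>i. i \<in> I \<Longrightarrow> EB d f n (R i) (b i)"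
  shows "EB d f n (\<lambda>X Y. \<Sum>i\<in>I. R i X Y) (\<Sum>i\<in>I. b i)"
  using assms(2,3)
proof (induction I rule: finite_induct)
  case empty
  then show ?case using EB_const[OF f order_refl] by simp
next
  case (insert i I)
  then have "EB d f n (\<lambda>X Y. R i X Y + (\<Sum>i\<in>I. R i X Y)) (b i + (\<Sum>i\<in>I. b i))" by (intro EB_add) auto
  then show ?case using insert by simp
qed

section \<open>The adaptive estimator\<close>

text \<open>One instance of the estimation problem. The bounds proved so far enter as assumptions
  with constants fixed from outside, so that the final constant cannot depend on n, \<alpha>, f or
  the grid. The conditions on \<tau> say that the biases of two levels together stay below half of
  the root threshold, and that the deviation left over pushes the exponential weight at some norming
  point above 1. In \<open>Gm\<close> the summand 2 pays for the number of points and for the bound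
  on the moment generating function; the bracket pays for the growth 4^(l(p+1)) l^(2a) of variance
  and derivatives and leaves a factor e^(-l); the 4 is there because the AM-GM weight keeps only a
  fourth root of the exponential.\<close>

locale lepski = jia d \<psi> c\<psi> for d \<psi> c\<psi> +
  fixes p :: nat and a M B Cn \<kappa> Cm \<tau> Gr Cg Gm :: real
    and n :: nat and \<alpha> :: real and Mn :: nat and f :: "real \<Rightarrow> real"
  assumes p1: "1 \<le> p" and a1: "1 < a" and n8: "8 \<le> n" and al: "0 < \<alpha>" "1 \<le> real n * \<alpha>\<^sup>2" and fW: "f \<in> Wp p M"
    and B0: "0 \<le> B"
    and bias: "\<And>J s x. x \<in> {0..1} \<Longrightarrow> s \<le> p \<Longrightarrow> \<bar>sderiv s (\<lambda>y. fproj J f y - f y) x\<bar> \<le> B * (1 / 2 ^ J) ^ (p - s)"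
    and Cn1: "1 \<le> Cn"
    and norming: "\<And>g s N x. ppoly d N g \<Longrightarrow> s \<le> p \<Longrightarrow> 0 < N \<Longrightarrow> x \<in> {0..1} \<Longrightarrow>
      \<bar>sderiv s g x\<bar> \<le> Cn * real N ^ s * (\<Sum>i\<le>d. \<bar>g (npt d N (cidx N x) i)\<bar>)"
    and k0: "0 < \<kappa>" and Cm0: "0 \<le> Cm"
    and mom1: "\<And>l y. y \<in> {0..1} \<Longrightarrow> 1 \<le> l \<Longrightarrow> l \<le> jmax n \<Longrightarrow>
      Ef d f n (\<lambda>X Y. exp (\<kappa> * sqrt (real l) * (\<bar>dev a \<alpha> n f l y X Y\<bar> / sqrt (vlev a \<alpha> n l)))) \<le> ennreal (2 * exp (real l))"
    and mom2: "\<And>l y. y \<in> {0..1} \<Longrightarrow> 1 \<le> l \<Longrightarrow> l \<le> jmax n \<Longrightarrow>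
      Ef d f n (\<lambda>X Y. (dev a \<alpha> n f l y X Y)\<^sup>2) \<le> ennreal (Cm * vlev a \<alpha> n l)"
    and mom4: "\<And>l y. y \<in> {0..1} \<Longrightarrow> 1 \<le> l \<Longrightarrow> l \<le> jmax n \<Longrightarrow>
      Ef d f n (\<lambda>X Y. (dev a \<alpha> n f l y X Y) ^ 4) \<le> ennreal (Cm * (vlev a \<alpha> n l)\<^sup>2)"
    and Gr0: "0 < Gr" and Cg0: "0 \<le> Cg"
    and grid: "\<And>g s N S x. ppoly d N g \<Longrightarrow> 0 < N \<Longrightarrow> Gr * real N \<le> real Mn \<Longrightarrow> 0 \<le> S \<Longrightarrow>
      (\<forall>t\<le>Mn. (sderiv s g (real t / real Mn))\<^sup>2 \<le> S) \<Longrightarrow> x \<in> {0..1} \<Longrightarrow> (sderiv s g x)\<^sup>2 \<le> Cg * S"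
    and tau: "0 \<le> \<tau>" "4 * B \<le> sqrt \<tau>" "Gm * (4 * Cn * 2 ^ p * (real d + 1)) \<le> \<kappa> * sqrt \<tau>"
    and Gm: "Gm = 4 * (2 * (real p + 1) + 2 * a + 1) + 2"
begin

abbreviation L where "L \<equiv> jmax n"
abbreviation v where "v \<equiv> vlev a \<alpha> n"
abbreviation jo where "jo \<equiv> jora p a \<alpha> n"
abbreviation D where "D \<equiv> dev a \<alpha> n f"
abbreviation F where "F X Y \<equiv> fhat d a c\<psi> \<psi> \<alpha> n X Y"
abbreviation jh where "jh \<equiv> jhat d p a c\<psi> \<psi> \<tau> \<alpha> Mn n"

definition C5 where "C5 = Cn\<^sup>2 * 4 ^ p * (real d + 1)"

definition Q :: "nat \<Rightarrow> real \<Rightarrow> (nat \<Rightarrow> real) \<Rightarrow> (nat \<times> nat \<times> nat \<Rightarrow> real) \<Rightarrow> real" where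
  "Q l x X Y = (\<Sum>i\<le>d. (D l (npt d (2 ^ Suc l) (cidx (2 ^ Suc l) x) i) X Y)\<^sup>2)"

definition Q4 :: "nat \<Rightarrow> real \<Rightarrow> (nat \<Rightarrow> real) \<Rightarrow> (nat \<times> nat \<times> nat \<Rightarrow> real) \<Rightarrow> real" where
  "Q4 l x X Y = (real d + 1) * (\<Sum>i\<le>d. (D l (npt d (2 ^ Suc l) (cidx (2 ^ Suc l) x) i) X Y) ^ 4)"

text \<open>At least one as soon as some deviation at a norming point of level \<open>l\<close> is large, so that it
  replaces the indicator of that event.\<close>
definition Wt :: "nat \<Rightarrow> (nat \<Rightarrow> real) \<Rightarrow> (nat \<times> nat \<times> nat \<Rightarrow> real) \<Rightarrow> real" where
  "Wt l X Y = (\<Sum>c<2 ^ Suc l. \<Sum>i\<le>d. exp (- (Gm * real l)) *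
     exp (\<kappa> * sqrt (real l) * (\<bar>D l (npt d (2 ^ Suc l) c i) X Y\<bar> / sqrt (v l))))"

definition thr :: "nat \<Rightarrow> nat \<Rightarrow> real" where
  "thr l s = \<tau> * 4 ^ (l * s) * (real l * v l)"

text \<open>The AM-GM weight: small enough for the fourth moments to be summable over the levels, large
  enough for \<open>1 / \<theta>\<close> to be compensated by the expectation of \<open>Wt\<close>.\<close>
definition \<theta> :: "nat \<Rightarrow> nat \<Rightarrow> real" where
  "\<theta> s l = exp (- ((Gm - 2) * real l / 4)) / (4 ^ (l * s) * v l)"

text \<open>Covers the finitely many \<open>n\<close> for which the grid is too coarse to norm the splines.\<close>
definition crude :: "nat \<Rightarrow> real \<Rightarrow> (nat \<Rightarrow> real) \<Rightarrow> (nat \<times> nat \<times> nat \<Rightarrow> real) \<Rightarrow> real" where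
  "crude s x X Y = (if real Mn < Gr * 2 ^ Suc jo then (\<Sum>l\<in>{1..L}. (2 * C5 * 4 ^ (l * s)) * Q l x X Y) + 2 * B\<^sup>2 else 0)"

text \<open>Majorant of the deviation when l is selected above the oracle. The weights start at l -
  1, the level whose rejection made l the minimal choice.\<close>

definition late :: "nat \<Rightarrow> real \<Rightarrow> (nat \<Rightarrow> real) \<Rightarrow> (nat \<times> nat \<times> nat \<Rightarrow> real) \<Rightarrow> nat \<Rightarrow> real" where
  "late s x X Y l = 2 * C5 * ((\<theta> s l * (4 ^ (l * s))\<^sup>2) * Q4 l x X Y + (1 / \<theta> s l) * (\<Sum>m\<in>{l - 1..L}. Wt m X Y))"

text \<open>The factors 4 and 2 come from applying (x + y)^2 \<le> 2 x^2 + 2 y^2 twice: for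
  deviation plus bias at the oracle level, and for the distance between the selected and the oracle
  level.\<close>

definition U :: "nat \<Rightarrow> real \<Rightarrow> (nat \<Rightarrow> real) \<Rightarrow> (nat \<times> nat \<times> nat \<Rightarrow> real) \<Rightarrow> real" where
  "U s x X Y = (4 * C5 * 4 ^ (jo * s)) * Q jo x X Y + (4 * B\<^sup>2 * (1 / 2 ^ jo) ^ (2 * (p - s)) + 2 * Cg * thr jo s)
     + crude s x X Y + (\<Sum>l\<in>{Suc jo..L}. late s x X Y l)"

lemma npos: "0 < n" using n8 by simp

lemma v_pos: "0 < v l" by (rule vlev_pos[OF npos])

lemma C5_nonneg: "0 \<le> C5" by (simp add: C5_def)

lemma jo: "1 \<le> jo" "jo \<le> L" "jo = L \<or> (1 / 2 ^ jo) ^ (2 * p) \<le> real jo * v jo"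
  using jora_prop[OF n8, of p a \<alpha>] by blast+

lemma fhat_ppoly: "ppoly d (2 ^ Suc l) (F X Y l)"
  unfolding fhat_def
proof (intro ppoly_sum ppoly_cmult)
  fix j k assume j: "j \<in> {j0 d - 1..l}" and k: "k \<in> K j"
  then have "ppoly d (2 ^ Suc j) (dual j k)" by (intro Vsp_ppoly dual_Vsp) auto
  then show "ppoly d (2 ^ Suc l) (dual j k)" by (rule ppoly_refine_pow2) (use j in simp)
qed

lemma fproj_pp: "ppoly d (2 ^ Suc l) (fproj l f)"
  by (rule fproj_ppoly[OF Wp_bdd01[OF fW]])

lemma dev_ppoly: "ppoly d (2 ^ Suc l) (\<lambda>y. D l y X Y)"
  unfolding dev_def by (intro ppoly_diff fhat_ppoly fproj_pp)

lemma sderiv_dev: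
  assumes x: "x \<in> {0..1}" and s: "s \<le> p"
  shows "\<bar>sderiv s (\<lambda>y. D l y X Y) x\<bar> \<le> Cn * 2 ^ p * 2 ^ (l * s) * (\<Sum>i\<le>d. \<bar>D l (npt d (2 ^ Suc l) (cidx (2 ^ Suc l) x) i) X Y\<bar>)"
proof -
  have "\<bar>sderiv s (\<lambda>y. D l y X Y) x\<bar> \<le> Cn * real (2 ^ Suc l) ^ s * (\<Sum>i\<le>d. \<bar>D l (npt d (2 ^ Suc l) (cidx (2 ^ Suc l) x) i) X Y\<bar>)"
    by (rule norming[OF dev_ppoly s _ x]) simp
  also have "\<dots> \<le> (Cn * 2 ^ p * 2 ^ (l * s)) * (\<Sum>i\<le>d. \<bar>D l (npt d (2 ^ Suc l) (cidx (2 ^ Suc l) x) i) X Y\<bar>)"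
  proof (rule mult_right_mono)
    have "real (2 ^ Suc l) ^ s = 2 ^ s * 2 ^ (l * s)" by (simp add: power_mult_distrib power_mult)
    also have "\<dots> \<le> 2 ^ p * 2 ^ (l * s)" using s by (intro mult_right_mono power_increasing) auto
    finally show "Cn * real (2 ^ Suc l) ^ s \<le> Cn * 2 ^ p * 2 ^ (l * s)" using Cn1 by (simp add: mult.assoc)
  qed (intro sum_nonneg abs_ge_zero)
  finally show ?thesis .
qed

lemma sderiv_dev_sq:
  assumes x: "x \<in> {0..1}" and s: "s \<le> p"
  shows "(sderiv s (\<lambda>y. D l y X Y) x)\<^sup>2 \<le> C5 * 4 ^ (l * s) * Q l x X Y"
proof -
  define h where "h i = \<bar>D l (npt d (2 ^ Suc l) (cidx (2 ^ Suc l) x) i) X Y\<bar>" for i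
  have "\<bar>sderiv s (\<lambda>y. D l y X Y) x\<bar>\<^sup>2 \<le> (Cn * 2 ^ p * 2 ^ (l * s) * (\<Sum>i\<le>d. h i))\<^sup>2"
    using sderiv_dev[OF x s, of l X Y] unfolding h_def by (intro power_mono) auto
  also have "\<dots> = Cn\<^sup>2 * 4 ^ p * 4 ^ (l * s) * (\<Sum>i\<le>d. 1 * h i)\<^sup>2"
  proof -
    have "((2::real) ^ k)\<^sup>2 = 4 ^ k" for k by (simp add: power2_eq_square flip: power_mult_distrib)
    then show ?thesis by (simp only: power_mult_distrib mult_1)
  qed
  also have "\<dots> \<le> Cn\<^sup>2 * 4 ^ p * 4 ^ (l * s) * ((\<Sum>i\<le>d. 1\<^sup>2) * (\<Sum>i\<le>d. (h i)\<^sup>2))"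
    by (intro mult_left_mono Cauchy_Schwarz_ineq_sum) auto
  finally show ?thesis by (simp add: C5_def Q_def h_def mult_ac add.commute)
qed

lemma err_decomp:
  assumes x: "x \<in> {0..1}" and s: "s \<le> p"
  shows "sderiv s (\<lambda>y. F X Y l y - f y) x = sderiv s (\<lambda>y. D l y X Y) x + sderiv s (\<lambda>y. fproj l f y - f y) x"
proof -
  have "sderiv s (\<lambda>y. D l y X Y + fproj l f y - f y) x = sderiv s (\<lambda>y. D l y X Y) x + sderiv s (\<lambda>y. fproj l f y - f y) x"
    by (rule sderiv_ppoly_diff_fun[OF dev_ppoly fproj_pp _ x _ s]) (use fW in \<open>auto simp: Wp_def\<close>)
  moreover have "(\<lambda>y. F X Y l y - f y) = (\<lambda>y. D l y X Y + fproj l f y - f y)" by (simp add: dev_def)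
  ultimately show ?thesis by simp
qed

lemma sq_add_le: "(x + y)\<^sup>2 \<le> 2 * x\<^sup>2 + 2 * (y::real)\<^sup>2"
  using zero_le_power2[of "x - y"] by (simp add: power2_eq_square algebra_simps)

lemma err_sq:
  assumes x: "x \<in> {0..1}" and s: "s \<le> p"
  shows "(sderiv s (\<lambda>y. F X Y l y - f y) x)\<^sup>2 \<le> (2 * C5 * 4 ^ (l * s)) * Q l x X Y + 2 * B\<^sup>2 * (1 / 2 ^ l) ^ (2 * (p - s))"
proof -
  have "\<bar>sderiv s (\<lambda>y. fproj l f y - f y) x\<bar>\<^sup>2 \<le> (B * (1 / 2 ^ l) ^ (p - s))\<^sup>2"
    by (intro power_mono bias x s) auto
  then have b: "(sderiv s (\<lambda>y. fproj l f y - f y) x)\<^sup>2 \<le> B\<^sup>2 * (1 / 2 ^ l) ^ (2 * (p - s))"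
    by (simp add: power_mult_distrib power_mult[symmetric] mult.commute[of 2])
  show ?thesis
    unfolding err_decomp[OF x s]
    using sq_add_le[of "sderiv s (\<lambda>y. D l y X Y) x" "sderiv s (\<lambda>y. fproj l f y - f y) x"] b sderiv_dev_sq[OF x s, of l X Y]
    by linarith
qed

lemma diff_err:
  assumes x: "x \<in> {0..1}" and s: "s \<le> p"
  shows "sderiv s (\<lambda>y. F X Y j y - F X Y l y) x = sderiv s (\<lambda>y. F X Y j y - f y) x - sderiv s (\<lambda>y. F X Y l y - f y) x"
proof -
  let ?N = "2 ^ Suc (max j l) :: nat"
  have pj: "ppoly d ?N (F X Y j)" and pl: "ppoly d ?N (F X Y l)"
    by (rule ppoly_refine_pow2[OF fhat_ppoly], simp)+
  have "sderiv s (\<lambda>y. (F X Y j y - F X Y l y) + F X Y l y - f y) x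
     = sderiv s (\<lambda>y. F X Y j y - F X Y l y) x + sderiv s (\<lambda>y. F X Y l y - f y) x"
    by (rule sderiv_ppoly_diff_fun[OF ppoly_diff[OF pj pl] pl _ x _ s]) (use fW in \<open>auto simp: Wp_def\<close>)
  then show ?thesis by simp
qed

section \<open>The selection rule and the domination of the error\<close>

definition test :: "(nat \<Rightarrow> real) \<Rightarrow> (nat \<times> nat \<times> nat \<Rightarrow> real) \<Rightarrow> nat \<Rightarrow> bool" where
  "test X Y j \<longleftrightarrow> (\<forall>l\<in>{1..L}. j < l \<longrightarrow> (\<forall>s\<le>p. l2sq (sderiv s (\<lambda>x. F X Y j x - F X Y l x)) \<le> thr l s
     \<and> (\<forall>t\<le>Mn. (sderiv s (\<lambda>x. F X Y j x - F X Y l x) (real t / real Mn))\<^sup>2 \<le> thr l s)))"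

lemma thr_eq: "\<tau> / real n * 2 ^ (2 * l * s) * real l * (2 ^ l + 2 ^ (2 * l) * real l powr (2 * a) / \<alpha>\<^sup>2) = thr l s"
proof -
  have "(2::real) ^ (2 * l * s) = 4 ^ (l * s)" by (simp add: mult.assoc power_mult)
  then show ?thesis by (simp add: thr_def vlev_def)
qed

lemma jhat_eq: "jh X Y = (LEAST j. j \<in> {1..L} \<and> test X Y j)"
  unfolding jhat_def Let_def thr_eq test_def ..

text \<open>The top level passes vacuously, having no level above it in the range, so
  \<open>LEAST\<close> denotes an admissible level.\<close>

lemma jhat_range: "jh X Y \<in> {1..L} \<and> test X Y (jh X Y)"
  unfolding jhat_eq by (rule LeastI[where k=L]) (use jmax_ge1[OF n8] in \<open>auto simp: test_def\<close>)

lemma jhat_min: "1 \<le> j \<Longrightarrow> j < jh X Y \<Longrightarrow> \<not> test X Y j"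
  using not_less_Least[of j "\<lambda>j. j \<in> {1..L} \<and> test X Y j"] jhat_range[of X Y] by (auto simp: jhat_eq)

lemma Wt_nonneg: "0 \<le> Wt l X Y"
  unfolding Wt_def by (intro sum_nonneg mult_nonneg_nonneg) auto

text \<open>A derivative of this size forces one of the d + 1 norming values to reach the average
  share b, and the condition on \<tau> makes the exponent at that point at least
  \<open>Gm * real l\<close>. The powers 2^(l s) cancel, so one weight serves all orders s.\<close>

lemma Wt_ge_1:
  assumes l: "1 \<le> l" and x: "x \<in> {0..1}" and s: "s \<le> p"
    and big: "sqrt \<tau> / 4 * (2 ^ (l * s) * sqrt (real l * v l)) \<le> \<bar>sderiv s (\<lambda>y. D l y X Y) x\<bar>"
  shows "1 \<le> Wt l X Y"
proof -
  define c where "c = cidx (2 ^ Suc l) x"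
  have c: "c < 2 ^ Suc l" unfolding c_def by (rule cidx_less) simp
  define h where "h i = \<bar>D l (npt d (2 ^ Suc l) c i) X Y\<bar>" for i
  define A where "A = Cn * 2 ^ p"
  have A0: "0 < A" using Cn1 by (simp add: A_def)
  define b where "b = sqrt \<tau> / (4 * A * (real d + 1)) * sqrt (real l * v l)"
  have "sqrt \<tau> / 4 * (2 ^ (l * s) * sqrt (real l * v l)) \<le> A * 2 ^ (l * s) * (\<Sum>i\<le>d. h i)"
    using order_trans[OF big sderiv_dev[OF x s, of l X Y]] unfolding A_def h_def c_def .
  then have "2 ^ (l * s) * (sqrt \<tau> / 4 * sqrt (real l * v l)) \<le> 2 ^ (l * s) * (A * (\<Sum>i\<le>d. h i))" by (simp add: mult_ac)
  then have "sqrt \<tau> / 4 * sqrt (real l * v l) \<le> A * (\<Sum>i\<le>d. h i)" by (subst (asm) mult_le_cancel_left_pos) auto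
  moreover have "sqrt \<tau> / 4 * sqrt (real l * v l) = A * ((real d + 1) * b)"
  proof -
    define e where "e = real d + 1"
    have "0 < e" by (simp add: e_def)
    then show ?thesis using A0 unfolding b_def e_def[symmetric] by simp
  qed
  ultimately have "(real d + 1) * b \<le> (\<Sum>i\<le>d. h i)" using A0 by simp
  then have sum: "(\<Sum>i\<le>d. b) \<le> (\<Sum>i\<le>d. h i)" by (simp add: add.commute)
  have "\<exists>i\<le>d. b \<le> h i"
  proof (rule ccontr)
    assume "\<not> (\<exists>i\<le>d. b \<le> h i)"
    then have "\<And>i. i \<in> {..d} \<Longrightarrow> h i < b" by (simp add: not_le) (metis not_le)
    then have "(\<Sum>i\<le>d. h i) < (\<Sum>i\<le>d. b)" by (intro sum_strict_mono) auto
    then show False using sum by simp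
  qed
  then obtain i where i: "i \<le> d" "b \<le> h i" by blast
  have "Gm * real l \<le> \<kappa> * sqrt (real l) * (b / sqrt (v l))"
  proof -
    have "b / sqrt (v l) = sqrt \<tau> / (4 * A * (real d + 1)) * sqrt (real l)"
      using v_pos[of l] by (simp add: b_def real_sqrt_mult)
    then have "\<kappa> * sqrt (real l) * (b / sqrt (v l)) = \<kappa> * sqrt \<tau> / (4 * A * (real d + 1)) * (sqrt (real l) * sqrt (real l))" by simp
    also have "sqrt (real l) * sqrt (real l) = real l" by simp
    finally have e: "\<kappa> * sqrt (real l) * (b / sqrt (v l)) = \<kappa> * sqrt \<tau> / (4 * A * (real d + 1)) * real l" .
    have "0 < 4 * A * (real d + 1)" using A0 by (intro mult_pos_pos) auto
    then have "Gm \<le> \<kappa> * sqrt \<tau> / (4 * A * (real d + 1))" using tau(3) by (simp add: A_def le_divide_eq mult_ac)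
    then show ?thesis unfolding e by (rule mult_right_mono) simp
  qed
  also have "\<dots> \<le> \<kappa> * sqrt (real l) * (h i / sqrt (v l))"
    using i k0 v_pos[of l] by (intro mult_left_mono divide_right_mono) auto
  finally have "1 \<le> exp (- (Gm * real l)) * exp (\<kappa> * sqrt (real l) * (h i / sqrt (v l)))"
    by (simp add: exp_add[symmetric])
  also have "\<dots> \<le> (\<Sum>i\<le>d. exp (- (Gm * real l)) * exp (\<kappa> * sqrt (real l) * (h i / sqrt (v l))))"
    by (rule member_le_sum[of i "{..d}" "\<lambda>i. exp (- (Gm * real l)) * exp (\<kappa> * sqrt (real l) * (h i / sqrt (v l)))"])
      (use i in auto)
  also have "\<dots> \<le> Wt l X Y"
    unfolding Wt_def h_def
    by (rule member_le_sum[of c "{..<2 ^ Suc l}" "\<lambda>c. \<Sum>i\<le>d. exp (- (Gm * real l)) *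
     exp (\<kappa> * sqrt (real l) * (\<bar>D l (npt d (2 ^ Suc l) c i) X Y\<bar> / sqrt (v l)))"])
      (use c in \<open>auto intro!: sum_nonneg\<close>)
  finally show ?thesis .
qed

lemma lv_mono: "j \<le> l \<Longrightarrow> real j * v j \<le> real l * v l"
  using a1 v_pos[of j] by (intro mult_mono vlev_mono) auto

text \<open>The condition \<open>jo < L\<close> excludes a capped oracle, whose bias may exceed the
  threshold; a capped oracle has no levels above it to compare with.\<close>

lemma bias_le:
  assumes x: "x \<in> {0..1}" and s: "s \<le> p" and j: "jo \<le> j" "jo < L"
  shows "\<bar>sderiv s (\<lambda>y. fproj j f y - f y) x\<bar> \<le> B * (2 ^ (j * s) * sqrt (real j * v j))"
proof -
  have "\<bar>sderiv s (\<lambda>y. fproj j f y - f y) x\<bar> \<le> B * (1 / 2 ^ j) ^ (p - s)" by (rule bias[OF x s])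
  also have "\<dots> \<le> B * (2 ^ (j * s) * sqrt (real j * v j))"
  proof (rule mult_left_mono[OF _ B0])
    have "((1::real) / 2 ^ j) ^ (2 * p) \<le> (1 / 2 ^ jo) ^ (2 * p)"
      using j by (intro power_mono divide_left_mono power_increasing) auto
    also have "\<dots> \<le> real jo * v jo" using jo(3) j by simp
    also have "\<dots> \<le> real j * v j" by (rule lv_mono[OF j(1)])
    finally have "sqrt (((1 / 2 ^ j) ^ p)\<^sup>2) \<le> sqrt (real j * v j)"
      by (intro real_sqrt_le_mono) (simp add: power_mult[symmetric] mult.commute)
    then have "(1 / 2 ^ j) ^ p \<le> sqrt (real j * v j)" by simp
    then have "2 ^ (j * s) * (1 / 2 ^ j) ^ p \<le> 2 ^ (j * s) * sqrt (real j * v j)" by (intro mult_left_mono) auto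
    moreover have "(2::real) ^ (j * s) * (1 / 2 ^ j) ^ p = (1 / 2 ^ j) ^ (p - s)"
    proof -
      have "((1::real) / 2 ^ j) ^ p = (1 / 2 ^ j) ^ (p - s) * (1 / 2 ^ j) ^ s" using s by (simp flip: power_add)
      then show ?thesis by (simp add: power_mult power_divide)
    qed
    ultimately show "(1 / 2 ^ j) ^ (p - s) \<le> 2 ^ (j * s) * sqrt (real j * v j)" by simp
  qed
  finally show ?thesis .
qed

text \<open>From the oracle on, the two biases use up at most half of the root threshold, so a
  rejection forces one of the two deviations to reach a quarter of it, and \<open>Wt_ge_1\<close>
  applies at that level. No probability is involved: this holds for every outcome.\<close>

lemma test_fails:
  assumes j: "jo \<le> j" and fail: "\<not> test X Y j"
  shows "1 \<le> (\<Sum>m\<in>{j..L}. Wt m X Y)"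
proof -
  obtain l s where l: "l \<in> {1..L}" "j < l" and s: "s \<le> p"
    and nt: "\<not> (l2sq (sderiv s (\<lambda>x. F X Y j x - F X Y l x)) \<le> thr l s
     \<and> (\<forall>t\<le>Mn. (sderiv s (\<lambda>x. F X Y j x - F X Y l x) (real t / real Mn))\<^sup>2 \<le> thr l s))"
    using fail unfolding test_def by blast
  have jL: "jo < L" and j1: "1 \<le> j" using j l jo by auto
  \<comment> \<open>Whichever part of the test fails, mean square or grid, the squared derivative
    exceeds the threshold at some point of [0,1], as both are dominated by the supremum.\<close>
  have "\<exists>x\<in>{0..1}. thr l s < (sderiv s (\<lambda>x. F X Y j x - F X Y l x) x)\<^sup>2"
  proof (rule ccontr)
    assume "\<not> ?thesis"
    then have all: "\<And>x. x \<in> {0..1} \<Longrightarrow> (sderiv s (\<lambda>x. F X Y j x - F X Y l x) x)\<^sup>2 \<le> thr l s" by (auto simp: not_less)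
    have pt: "real t / real Mn \<in> {0..1}" if "t \<le> Mn" for t using that by (auto simp: divide_le_eq)
    have "l2sq (sderiv s (\<lambda>x. F X Y j x - F X Y l x)) \<le> thr l s" by (rule l2sq_le_sup[OF all])
    moreover have "\<forall>t\<le>Mn. (sderiv s (\<lambda>x. F X Y j x - F X Y l x) (real t / real Mn))\<^sup>2 \<le> thr l s"
      by (intro allI impI all pt)
    ultimately show False using nt by simp
  qed
  then obtain x where x: "x \<in> {0..1}" and big: "thr l s < (sderiv s (\<lambda>x. F X Y j x - F X Y l x) x)\<^sup>2" by blast
  define R where "R = 2 ^ (l * s) * sqrt (real l * v l)"
  have R0: "0 \<le> R" using v_pos[of l] by (simp add: R_def)
  have Rj: "2 ^ (j * s) * sqrt (real j * v j) \<le> R"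
    unfolding R_def using l v_pos[of j] by (intro mult_mono power_increasing real_sqrt_le_mono lv_mono) auto
  have "thr l s = (sqrt \<tau> * R)\<^sup>2"
    using tau(1) v_pos[of l] by (simp add: thr_def R_def power_mult_distrib power_mult[symmetric] mult.commute[of _ 2])
      (simp add: power_mult)
  then have "(sqrt \<tau> * R)\<^sup>2 < \<bar>sderiv s (\<lambda>x. F X Y j x - F X Y l x) x\<bar>\<^sup>2" using big by simp
  then have gt: "sqrt \<tau> * R < \<bar>sderiv s (\<lambda>x. F X Y j x - F X Y l x) x\<bar>" by (rule power2_less_imp_less) simp
  define dj dl bj bl where "dj = sderiv s (\<lambda>y. D j y X Y) x" and "dl = sderiv s (\<lambda>y. D l y X Y) x"
    and "bj = sderiv s (\<lambda>y. fproj j f y - f y) x" and "bl = sderiv s (\<lambda>y. fproj l f y - f y) x"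
  have e: "sderiv s (\<lambda>x. F X Y j x - F X Y l x) x = (dj + bj) - (dl + bl)"
    unfolding diff_err[OF x s] err_decomp[OF x s] dj_def dl_def bj_def bl_def ..
  have "\<bar>bj\<bar> \<le> B * R" unfolding bj_def
    using bias_le[OF x s j jL] mult_left_mono[OF Rj B0] by (rule order_trans)
  moreover have "\<bar>bl\<bar> \<le> B * R" unfolding bl_def R_def by (rule bias_le[OF x s _ jL]) (use j l in simp)
  moreover have "4 * B * R \<le> sqrt \<tau> * R" by (rule mult_right_mono[OF tau(2) R0])
  ultimately have "sqrt \<tau> / 4 * R \<le> \<bar>dj\<bar> \<or> sqrt \<tau> / 4 * R \<le> \<bar>dl\<bar>" using gt unfolding e by linarith
  then obtain m where m: "m \<in> {j..L}" "1 \<le> Wt m X Y"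
  proof
    assume "sqrt \<tau> / 4 * R \<le> \<bar>dj\<bar>"
    moreover have "sqrt \<tau> / 4 * (2 ^ (j * s) * sqrt (real j * v j)) \<le> sqrt \<tau> / 4 * R"
      using tau(1) by (intro mult_left_mono Rj) auto
    ultimately have "1 \<le> Wt j X Y" unfolding dj_def by (intro Wt_ge_1[OF j1 x s]) auto
    then show ?thesis using that[of j] l by auto
  next
    assume "sqrt \<tau> / 4 * R \<le> \<bar>dl\<bar>"
    then have "1 \<le> Wt l X Y" unfolding dl_def R_def using l by (intro Wt_ge_1[OF _ x s]) auto
    then show ?thesis using that[of l] l by auto
  qed
  have "Wt m X Y \<le> (\<Sum>m\<in>{j..L}. Wt m X Y)" by (rule member_le_sum[OF m(1)]) (auto intro: Wt_nonneg)
  then show ?thesis using m(2) by simp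
qed

lemma Q_nonneg: "0 \<le> Q l x X Y" unfolding Q_def by (intro sum_nonneg) auto

lemma Q_sq: "(Q l x X Y)\<^sup>2 \<le> Q4 l x X Y"
proof -
  define h where "h i = (D l (npt d (2 ^ Suc l) (cidx (2 ^ Suc l) x) i) X Y)\<^sup>2" for i
  have "(\<Sum>i\<le>d. 1 * h i)\<^sup>2 \<le> (\<Sum>i\<le>d. 1\<^sup>2) * (\<Sum>i\<le>d. (h i)\<^sup>2)" by (rule Cauchy_Schwarz_ineq_sum)
  then show ?thesis by (simp add: Q_def Q4_def h_def add.commute)
qed

lemma Q4_nonneg: "0 \<le> Q4 l x X Y"
  using Q_sq[of l x X Y] zero_le_power2 order_trans by blast

lemma \<theta>_pos: "0 < \<theta> s l" using v_pos[of l] by (simp add: \<theta>_def)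

lemma late_nonneg: "0 \<le> late s x X Y l"
  unfolding late_def using C5_nonneg \<theta>_pos[of s l]
  by (intro mult_nonneg_nonneg add_nonneg_nonneg Q4_nonneg sum_nonneg Wt_nonneg) auto

lemma crude_nonneg: "0 \<le> crude s x X Y"
  unfolding crude_def using C5_nonneg by (auto intro!: add_nonneg_nonneg sum_nonneg mult_nonneg_nonneg Q_nonneg)

lemma thr_nonneg: "0 \<le> thr l s" using tau(1) v_pos[of l] by (simp add: thr_def)

text \<open>A deterministic inequality for every outcome and every x. The right side no longer
  mentions the selected level, which is what makes it measurable and its expectation computable term
  by term.\<close>

lemma pointwise:
  assumes x: "x \<in> {0..1}" and s: "s \<le> p"
  shows "(sderiv s (\<lambda>y. fest d p a c\<psi> \<psi> \<tau> \<alpha> Mn n X Y y - f y) x)\<^sup>2 \<le> U s x X Y"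
proof -
  define J where "J = jh X Y"
  have J: "1 \<le> J" "J \<le> L" and tJ: "test X Y J" using jhat_range[of X Y] by (auto simp: J_def)
  define e where "e l = sderiv s (\<lambda>y. F X Y l y - f y) x" for l
  define \<beta> where "\<beta> = ((1::real) / 2 ^ jo) ^ (2 * (p - s))"
  have \<beta>0: "0 \<le> \<beta>" by (simp add: \<beta>_def)
  have fest: "sderiv s (\<lambda>y. fest d p a c\<psi> \<psi> \<tau> \<alpha> Mn n X Y y - f y) x = e J"
    by (simp add: fest_def J_def e_def)
  have sl: "0 \<le> (\<Sum>l\<in>{Suc jo..L}. late s x X Y l)" by (intro sum_nonneg late_nonneg)
  define q where "q = (2 * C5 * 4 ^ (jo * s)) * Q jo x X Y"
  have q0: "0 \<le> q" using C5_nonneg Q_nonneg by (simp add: q_def)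
  define w where "w = B\<^sup>2 * \<beta>"
  define T where "T = Cg * thr jo s"
  have Ueq: "U s x X Y = 2 * q + (4 * w + 2 * T) + crude s x X Y + (\<Sum>l\<in>{Suc jo..L}. late s x X Y l)"
    by (simp add: U_def q_def \<beta>_def w_def T_def)
  have ct: "0 \<le> T" using Cg0 thr_nonneg by (simp add: T_def)
  have B2: "0 \<le> w" using \<beta>0 by (simp add: w_def)
  have ejo: "(e jo)\<^sup>2 \<le> q + 2 * w"
    using err_sq[OF x s, of X Y jo] by (simp add: e_def q_def \<beta>_def w_def mult.assoc)
  have bJ: "B\<^sup>2 * (1 / 2 ^ J) ^ (2 * (p - s)) \<le> B\<^sup>2 * 1" by (intro mult_left_mono power_le_one) auto
  have eJ: "(e J)\<^sup>2 \<le> (2 * C5 * 4 ^ (J * s)) * Q J x X Y + 2 * (B\<^sup>2 * (1 / 2 ^ J) ^ (2 * (p - s)))"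
    unfolding e_def using err_sq[OF x s, of X Y J] by simp
  consider "J \<le> jo" "Gr * 2 ^ Suc jo \<le> real Mn" | "J \<le> jo" "real Mn < Gr * 2 ^ Suc jo" | "jo < J" by linarith
  then show ?thesis
  proof cases
    case 1
    show ?thesis
    proof (cases "J = jo")
      case True
      show ?thesis unfolding fest Ueq True using ejo q0 ct B2 sl crude_nonneg[of s x X Y] by linarith
    next
      case False
      then have lt: "J < jo" using 1 by simp
      have pp: "ppoly d (2 ^ Suc jo) (\<lambda>x. F X Y J x - F X Y jo x)"
        using lt by (intro ppoly_diff ppoly_refine_pow2[OF fhat_ppoly]) auto
      \<comment> \<open>The test of \<open>J\<close> against the oracle level speaks only at grid
        points; norming on the grid extends it to x at the cost of \<open>Cg\<close>.\<close>
      have "(sderiv s (\<lambda>x. F X Y J x - F X Y jo x) x)\<^sup>2 \<le> Cg * thr jo s"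
      proof (rule grid[OF pp _ _ thr_nonneg _ x])
        show "\<forall>t\<le>Mn. (sderiv s (\<lambda>x. F X Y J x - F X Y jo x) (real t / real Mn))\<^sup>2 \<le> thr jo s"
          using tJ jo lt s unfolding test_def by auto
      qed (use 1 in auto)
      then have "(e J - e jo)\<^sup>2 \<le> T" unfolding diff_err[OF x s] e_def T_def .
      moreover have "(e J)\<^sup>2 \<le> 2 * (e J - e jo)\<^sup>2 + 2 * (e jo)\<^sup>2"
        using sq_add_le[of "e J - e jo" "e jo"] by simp
      ultimately show ?thesis unfolding fest Ueq using ejo sl crude_nonneg[of s x X Y] by linarith
    qed
  next
    case 2
    have "(2 * C5 * 4 ^ (J * s)) * Q J x X Y \<le> (\<Sum>l\<in>{1..L}. (2 * C5 * 4 ^ (l * s)) * Q l x X Y)"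
      by (rule member_le_sum[of J "{1..L}" "\<lambda>l. (2 * C5 * 4 ^ (l * s)) * Q l x X Y"])
        (use J C5_nonneg Q_nonneg in auto)
    then have "(e J)\<^sup>2 \<le> crude s x X Y" using eJ bJ 2 by (simp add: crude_def)
    then show ?thesis unfolding fest Ueq using q0 B2 ct sl by linarith
  next
    case 3
    \<comment> \<open>Minimality: \<open>J - 1\<close> is at least the oracle level, hence at least
      1, and was rejected.\<close>
    have "1 \<le> (\<Sum>m\<in>{J - 1..L}. Wt m X Y)"
      by (rule test_fails) (use 3 jo J jhat_min[of "J - 1" X Y] in \<open>auto simp: J_def\<close>)
    \<comment> \<open>For this outcome the sum of weights is at least 1, so it may be multiplied to
      1/\<theta>; its expectation is so small that 1/\<theta> may be large.\<close>
    then have W: "1 / \<theta> s J * 1 \<le> 1 / \<theta> s J * (\<Sum>m\<in>{J - 1..L}. Wt m X Y)"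
      using \<theta>_pos[of s J] by (intro mult_left_mono) auto
    define z where "z = 4 ^ (J * s) * Q J x X Y"
    have "z \<le> \<theta> s J * z\<^sup>2 + 1 / \<theta> s J"
    proof -
      have "0 \<le> \<theta> s J * (z - 1 / \<theta> s J)\<^sup>2" using \<theta>_pos[of s J] by simp
      also have "\<dots> = \<theta> s J * z\<^sup>2 - 2 * z + 1 / \<theta> s J"
        using \<theta>_pos[of s J] by (simp add: power2_eq_square field_simps)
      finally have "2 * z \<le> \<theta> s J * z\<^sup>2 + 1 / \<theta> s J" by simp
      moreover have "0 \<le> z" unfolding z_def using Q_nonneg by simp
      ultimately show ?thesis by simp
    qed
    also have "\<theta> s J * z\<^sup>2 \<le> (\<theta> s J * (4 ^ (J * s))\<^sup>2) * Q4 J x X Y"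
      using Q_sq[of J x X Y] \<theta>_pos[of s J] by (simp add: z_def power_mult_distrib mult_left_mono)
    finally have "z \<le> (\<theta> s J * (4 ^ (J * s))\<^sup>2) * Q4 J x X Y + 1 / \<theta> s J * (\<Sum>m\<in>{J - 1..L}. Wt m X Y)"
      using W by simp
    then have "2 * C5 * z \<le> late s x X Y J" unfolding late_def using C5_nonneg by (intro mult_left_mono) auto
    also have "\<dots> \<le> (\<Sum>l\<in>{Suc jo..L}. late s x X Y l)"
      by (rule member_le_sum) (use 3 J late_nonneg in auto)
    finally have z: "2 * C5 * z \<le> (\<Sum>l\<in>{Suc jo..L}. late s x X Y l)" .
    have "((1::real) / 2 ^ J) ^ (2 * (p - s)) \<le> \<beta>"
      unfolding \<beta>_def using 3 by (intro power_mono divide_left_mono power_increasing) auto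
    then have "B\<^sup>2 * (1 / 2 ^ J) ^ (2 * (p - s)) \<le> w" unfolding w_def by (intro mult_left_mono) auto
    moreover have "(e J)\<^sup>2 \<le> 2 * C5 * z + 2 * (B\<^sup>2 * (1 / 2 ^ J) ^ (2 * (p - s)))"
      using eJ by (simp add: z_def mult.assoc)
    ultimately show ?thesis unfolding fest Ueq using z q0 B2 ct crude_nonneg[of s x X Y] by linarith
  qed
qed

section \<open>Expectation of the majorant\<close>

lemma dev_meas: "l \<le> L \<Longrightarrow> (\<lambda>\<omega>. D l y (fst \<omega>) (snd \<omega>)) \<in> borel_measurable (dataM f n \<Otimes>\<^sub>M noiseM d n)"
  by (rule dev_measurable[OF npos _ Wp_bdd01[OF fW]])

lemma EB_Q:
  assumes x: "x \<in> {0..1}" and l: "1 \<le> l" "l \<le> L"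
  shows "EB d f n (Q l x) ((real d + 1) * (Cm * v l))"
proof -
  let ?y = "\<lambda>i. npt d (2 ^ Suc l) (cidx (2 ^ Suc l) x) i"
  have "EB d f n (\<lambda>X Y. \<Sum>i\<le>d. (D l (?y i) X Y)\<^sup>2) (\<Sum>i\<le>d. Cm * v l)"
  proof (rule EB_sum[OF fW])
    fix i assume i: "i \<in> {..d}"
    have y: "?y i \<in> {0..1}" using i by (intro npt_01 cidx_less) auto
    show "EB d f n (\<lambda>X Y. (D l (?y i) X Y)\<^sup>2) (Cm * v l)"
      unfolding EB_def using mom2[OF y l] dev_meas[OF l(2)] Cm0 v_pos[of l] by auto
  qed simp
  then show ?thesis by (simp add: Q_def[abs_def] add.commute)
qed

lemma EB_Q4:
  assumes x: "x \<in> {0..1}" and l: "1 \<le> l" "l \<le> L"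
  shows "EB d f n (Q4 l x) ((real d + 1) * ((real d + 1) * (Cm * (v l)\<^sup>2)))"
proof -
  let ?y = "\<lambda>i. npt d (2 ^ Suc l) (cidx (2 ^ Suc l) x) i"
  have "EB d f n (\<lambda>X Y. (real d + 1) * (\<Sum>i\<le>d. (D l (?y i) X Y) ^ 4)) ((real d + 1) * (\<Sum>i\<le>d. Cm * (v l)\<^sup>2))"
  proof (intro EB_cmult EB_sum[OF fW])
    fix i assume i: "i \<in> {..d}"
    have y: "?y i \<in> {0..1}" using i by (intro npt_01 cidx_less) auto
    show "EB d f n (\<lambda>X Y. (D l (?y i) X Y) ^ 4) (Cm * (v l)\<^sup>2)"
      unfolding EB_def using mom4[OF y l] dev_meas[OF l(2)] Cm0 v_pos[of l] by auto
  qed auto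
  then show ?thesis by (simp add: Q4_def[abs_def] add.commute)
qed

text \<open>There are (d + 1) 2^(l+1) norming points, each with an exponential moment of at most 2
  e^l; with 2^l \<le> e^l the two factors reduce \<open>Gm\<close> to \<open>Gm - 2\<close>.\<close>

lemma EB_Wt:
  assumes l: "1 \<le> l" "l \<le> L"
  shows "EB d f n (Wt l) (4 * (real d + 1) * exp (- ((Gm - 2) * real l)))"
proof -
  have "EB d f n (Wt l) (\<Sum>c<(2::nat) ^ Suc l. \<Sum>i\<le>d. exp (- (Gm * real l)) * (2 * exp (real l)))"
    unfolding Wt_def[abs_def]
  proof (intro EB_sum[OF fW] EB_cmult)
    fix c i assume c: "c \<in> {..<(2::nat) ^ Suc l}" and i: "i \<in> {..d}"
    have y: "npt d (2 ^ Suc l) c i \<in> {0..1}" using c i by (intro npt_01) auto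
    show "EB d f n (\<lambda>X Y. exp (\<kappa> * sqrt (real l) * (\<bar>D l (npt d (2 ^ Suc l) c i) X Y\<bar> / sqrt (v l)))) (2 * exp (real l))"
      unfolding EB_def using mom1[OF y l] dev_meas[OF l(2)] by auto
  qed auto
  moreover have "(\<Sum>c<(2::nat) ^ Suc l. \<Sum>i\<le>d. exp (- (Gm * real l)) * (2 * exp (real l)))
     \<le> 4 * (real d + 1) * exp (- ((Gm - 2) * real l))"
  proof -
    have "(\<Sum>c<(2::nat) ^ Suc l. \<Sum>i\<le>d. exp (- (Gm * real l)) * (2 * exp (real l)))
      = 4 * (real d + 1) * (2 ^ l * (exp (- (Gm * real l)) * exp (real l)))" by (simp add: add.commute mult_ac)
    also have "\<dots> \<le> 4 * (real d + 1) * (exp (real l) * (exp (- (Gm * real l)) * exp (real l)))"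
    proof (intro mult_left_mono mult_right_mono)
      have "(2::real) ^ l \<le> exp 1 ^ l" using exp_ge_add_one_self[of 1] by (intro power_mono) auto
      then show "2 ^ l \<le> exp (real l)" by (simp flip: exp_of_nat_mult)
    qed auto
    also have "exp (real l) * (exp (- (Gm * real l)) * exp (real l)) = exp (- ((Gm - 2) * real l))"
      by (simp add: exp_add[symmetric] algebra_simps)
    finally show ?thesis .
  qed
  ultimately show ?thesis by (rule EB_mono)
qed

definition bU :: "nat \<Rightarrow> real" where
  "bU s = (4 * C5 * 4 ^ (jo * s)) * ((real d + 1) * (Cm * v jo)) + (4 * B\<^sup>2 * (1 / 2 ^ jo) ^ (2 * (p - s)) + 2 * Cg * thr jo s)
     + (if real Mn < Gr * 2 ^ Suc jo then (\<Sum>l\<in>{1..L}. (2 * C5 * 4 ^ (l * s)) * ((real d + 1) * (Cm * v l))) + 2 * B\<^sup>2 else 0)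
     + (\<Sum>l\<in>{Suc jo..L}. 2 * C5 * ((\<theta> s l * (4 ^ (l * s))\<^sup>2) * ((real d + 1) * ((real d + 1) * (Cm * (v l)\<^sup>2)))
          + (1 / \<theta> s l) * (\<Sum>m\<in>{l - 1..L}. 4 * (real d + 1) * exp (- ((Gm - 2) * real m)))))"

lemma EB_U:
  assumes x: "x \<in> {0..1}" and s: "s \<le> p"
  shows "EB d f n (U s x) (bU s)"
proof -
  have c0: "0 \<le> 4 * B\<^sup>2 * (1 / 2 ^ jo) ^ (2 * (p - s)) + 2 * Cg * thr jo s"
    using Cg0 thr_nonneg[of jo s] by simp
  have 1: "EB d f n (crude s x) (if real Mn < Gr * 2 ^ Suc jo then (\<Sum>l\<in>{1..L}. (2 * C5 * 4 ^ (l * s)) * ((real d + 1) * (Cm * v l))) + 2 * B\<^sup>2 else 0)"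
  proof (cases "real Mn < Gr * 2 ^ Suc jo")
    case True
    have "EB d f n (\<lambda>X Y. (\<Sum>l\<in>{1..L}. (2 * C5 * 4 ^ (l * s)) * Q l x X Y) + 2 * B\<^sup>2)
       ((\<Sum>l\<in>{1..L}. (2 * C5 * 4 ^ (l * s)) * ((real d + 1) * (Cm * v l))) + 2 * B\<^sup>2)"
      using C5_nonneg by (intro EB_add EB_sum[OF fW] EB_cmult EB_Q x EB_const[OF fW]) auto
    then show ?thesis using True by (simp add: crude_def[abs_def])
  next
    case False
    then show ?thesis using EB_const[OF fW order_refl] by (simp add: crude_def[abs_def])
  qed
  have 2: "EB d f n (\<lambda>X Y. late s x X Y l)
      (2 * C5 * ((\<theta> s l * (4 ^ (l * s))\<^sup>2) * ((real d + 1) * ((real d + 1) * (Cm * (v l)\<^sup>2)))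
          + (1 / \<theta> s l) * (\<Sum>m\<in>{l - 1..L}. 4 * (real d + 1) * exp (- ((Gm - 2) * real m)))))"
    if l: "l \<in> {Suc jo..L}" for l
    unfolding late_def using l jo C5_nonneg \<theta>_pos[of s l]
    by (intro EB_cmult EB_add EB_Q4 x EB_sum[OF fW] EB_Wt) auto
  show ?thesis
    unfolding U_def[abs_def] bU_def
    using C5_nonneg jo by (intro EB_add 1 EB_sum[OF fW] 2 EB_const[OF fW c0] EB_cmult EB_Q x) auto
qed

text \<open>All norming points up to level L are determined by the cell of x at the finest level, so
  x may be replaced by the left end of that cell.\<close>

lemma Q_cell:
  assumes x: "x \<in> {0..1}" and l: "l \<le> L"
  shows "Q l (real (cidx (2 ^ Suc L) x) / real (2 ^ Suc L)) X Y = Q l x X Y"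
    "Q4 l (real (cidx (2 ^ Suc L) x) / real (2 ^ Suc L)) X Y = Q4 l x X Y"
proof -
  let ?N = "2 ^ Suc L :: nat"
  define c where "c = cidx ?N x"
  have c: "c < ?N" unfolding c_def by (rule cidx_less) simp
  define x' where "x' = real c / real ?N"
  have "x' \<in> cell ?N c" by (auto simp: cell_def x'_def intro!: divide_strict_right_mono simp del: of_nat_power)
  then have x': "x' \<in> {0..1}" "c = cidx ?N x'" using mem_cell_iff[of ?N c x'] c by auto
  have N: "2 ^ (L - l) * 2 ^ Suc l = ?N" using l by (simp flip: power_add power_Suc)
  have "cidx (2 ^ Suc l) x' = cidx (2 ^ Suc l) x"
    using cidx_div[of "2 ^ (L - l)" "2 ^ Suc l" x'] cidx_div[of "2 ^ (L - l)" "2 ^ Suc l" x] x x'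
    unfolding N by (simp add: c_def)
  then show "Q l (real (cidx ?N x) / real ?N) X Y = Q l x X Y" "Q4 l (real (cidx ?N x) / real ?N) X Y = Q4 l x X Y"
    unfolding Q_def Q4_def c_def[symmetric] x'_def[symmetric] by auto
qed

lemma U_cell:
  assumes x: "x \<in> {0..1}"
  shows "U s (real (cidx (2 ^ Suc L) x) / real (2 ^ Suc L)) X Y = U s x X Y"
proof -
  let ?x = "real (cidx (2 ^ Suc L) x) / real (2 ^ Suc L)"
  have "(\<Sum>l\<in>{1..L}. (2 * C5 * 4 ^ (l * s)) * Q l ?x X Y) = (\<Sum>l\<in>{1..L}. (2 * C5 * 4 ^ (l * s)) * Q l x X Y)"
    by (intro sum.cong refl) (simp only: atLeastAtMost_iff Q_cell[OF x])
  then have "crude s ?x X Y = crude s x X Y" unfolding crude_def by (simp only:)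
  moreover have "(\<Sum>l\<in>{Suc jo..L}. late s ?x X Y l) = (\<Sum>l\<in>{Suc jo..L}. late s x X Y l)"
    by (intro sum.cong refl) (simp only: atLeastAtMost_iff late_def Q_cell[OF x])
  moreover have "Q jo ?x X Y = Q jo x X Y" by (rule Q_cell[OF x jo(2)])
  ultimately show ?thesis unfolding U_def by (simp only:)
qed

lemma risk_pointwise:
  assumes x: "x \<in> {0..1}" and s: "s \<le> p"
  shows "Ef d f n (\<lambda>X Y. (sderiv s (\<lambda>y. fest d p a c\<psi> \<psi> \<tau> \<alpha> Mn n X Y y - f y) x)\<^sup>2) \<le> ennreal (bU s)"
  using Ef_mono[OF pointwise[OF x s]] EB_Ef[OF EB_U[OF x s]] by (rule order_trans)

text \<open>The majorant takes finitely many values in x, so the integrated error is below a finite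
  average of majorants, and the expectation passes through a finite sum. The integral over x is
  never exchanged with the expectation, which would call for joint measurability of the selected
  estimator.\<close>

lemma risk_L2:
  assumes s: "s \<le> p"
  shows "Ef d f n (\<lambda>X Y. l2sq (sderiv s (\<lambda>y. fest d p a c\<psi> \<psi> \<tau> \<alpha> Mn n X Y y - f y))) \<le> ennreal (bU s)"
proof -
  let ?N = "2 ^ Suc L :: nat"
  have N: "0 < ?N" by simp
  have "EB d f n (\<lambda>X Y. \<Sum>c<?N. (1 / real ?N) * U s (real c / real ?N) X Y) (\<Sum>c<?N. (1 / real ?N) * bU s)"
  proof (intro EB_sum[OF fW] EB_cmult EB_U s)
    fix c assume "c \<in> {..<?N}"
    then show "real c / real ?N \<in> {0..1}" by (simp del: of_nat_power power_Suc)
  qed auto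
  then have 1: "Ef d f n (\<lambda>X Y. \<Sum>c<?N. (1 / real ?N) * U s (real c / real ?N) X Y) \<le> ennreal (bU s)"
    by (intro EB_Ef) (simp del: power_Suc)
  have "l2sq (sderiv s (\<lambda>y. fest d p a c\<psi> \<psi> \<tau> \<alpha> Mn n X Y y - f y))
     \<le> (\<Sum>c<?N. (1 / real ?N) * U s (real c / real ?N) X Y)" for X Y
  proof -
    define g where "g = sderiv s (\<lambda>y. fest d p a c\<psi> \<psi> \<tau> \<alpha> Mn n X Y y - f y)"
    define u where "u c = U s (real c / real ?N) X Y" for c
    have "(g x)\<^sup>2 \<le> u (cidx ?N x)" if x: "x \<in> {0..1}" for x
      unfolding g_def u_def U_cell[OF x] by (rule pointwise[OF x s])
    then have "l2sq g \<le> (\<Sum>c<?N. u c / real ?N)" by (rule l2sq_le_average[OF N])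
    then show ?thesis unfolding g_def[symmetric] u_def[symmetric] by (simp only: times_divide_eq_left mult_1_left)
  qed
  then have "Ef d f n (\<lambda>X Y. l2sq (sderiv s (\<lambda>y. fest d p a c\<psi> \<psi> \<tau> \<alpha> Mn n X Y y - f y)))
    \<le> Ef d f n (\<lambda>X Y. \<Sum>c<?N. (1 / real ?N) * U s (real c / real ?N) X Y)" by (rule Ef_mono)
  then show ?thesis using 1 by (rule order_trans)
qed

end

lemma half_geometric_sum_le:
  fixes r :: real assumes r: "0 \<le> r" "r \<le> 1 / 2" shows "(\<Sum>m\<in>{k..l}. r ^ m) \<le> 2 * r ^ k"
proof (cases "k \<le> l")
  case True
  then have "(\<Sum>m\<in>{k..l}. r ^ m) \<le> 2 * r ^ k - r ^ l"
  proof (induction l rule: dec_induct)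
    case (step l)
    have "r * r ^ l \<le> 1 / 2 * r ^ l" using r by (intro mult_right_mono) auto
    then show ?case using step by simp
  qed simp
  also have "\<dots> \<le> 2 * r ^ k" using r by simp
  finally show ?thesis .
qed (use r in simp)

text \<open>Explicit in order to show that the constant is free of n, \<alpha>, f and the grid size.
  \<open>N\<close> bounds every n for which the grid can be too coarse, \<open>H\<close> bounds the
  variances for such n, and \<open>C6\<close> is the oracle constant of
  \<open>jora_variance\<close>.\<close>

definition lepskiK :: "nat \<Rightarrow> nat \<Rightarrow> real \<Rightarrow> real \<Rightarrow> real \<Rightarrow> real \<Rightarrow> real \<Rightarrow> real \<Rightarrow> real \<Rightarrow> real \<Rightarrow> real" where
  "lepskiK d p a B C5 Cm \<tau> Gr Cg c0 =
    (let e = real d + 1; C6 = 8 * 4 powr a * 4 ^ p; N = nat \<lceil>2 * Gr / c0\<rceil>;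
         H = 2 ^ N + 4 ^ N * real N powr (2 * a);
         C7 = 2 * C5 * (e * (e * Cm) + 8 * e)
     in (4 * C5 * (e * Cm)) * C6 + 4 * B\<^sup>2 + 2 * Cg * (\<tau> * C6)
        + (real N * ((2 * C5 * 4 ^ (N * p)) * (e * (Cm * H))) + 2 * B\<^sup>2) * 4 ^ (N * p) + 2 * C7 * C6)"

context lepski
begin

lemma bU_bound:
  assumes s: "s \<le> p" and c0: "0 < c0" and Mn: "c0 * real n powr (4 / 3) \<le> real Mn"
  shows "bU s \<le> lepskiK d p a B C5 Cm \<tau> Gr Cg c0 * (1 / 2 ^ jo) ^ (2 * (p - s))"
proof -
  define e where "e = real d + 1"
  define C6 where "C6 = 8 * 4 powr a * 4 ^ p"
  define N where "N = nat \<lceil>2 * Gr / c0\<rceil>"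
  define H where "H = 2 ^ N + 4 ^ N * real N powr (2 * a)"
  define C7 where "C7 = 2 * C5 * (e * (e * Cm) + 8 * e)"
  define H3 where "H3 = real N * ((2 * C5 * 4 ^ (N * p)) * (e * (Cm * H))) + 2 * B\<^sup>2"
  define \<beta> where "\<beta> = ((1::real) / 2 ^ jo) ^ (2 * (p - s))"
  have e0: "0 < e" and \<beta>0: "0 < \<beta>" and C60: "0 < C6" and H0: "0 \<le> H" by (auto simp: e_def \<beta>_def C6_def H_def)
  have C70: "0 \<le> C7" unfolding C7_def using C5_nonneg e0 Cm0 by (intro mult_nonneg_nonneg add_nonneg_nonneg) auto
  have H30: "0 \<le> H3" unfolding H3_def using C5_nonneg e0 Cm0 H0 by (intro mult_nonneg_nonneg add_nonneg_nonneg) auto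
  \<comment> \<open>The oracle balance at derivative order s: multiplication by 4^(jo s) turns the
    squared bias 2^(-2 jo p) into 2^(-2 jo (p-s)).\<close>
  have S1: "4 ^ (jo * s) * (real jo * v jo) \<le> C6 * \<beta>"
  proof -
    have "4 ^ (jo * s) * (real jo * v jo) \<le> 4 ^ (jo * s) * (C6 * (1 / 2 ^ jo) ^ (2 * p))"
      using jora_variance[OF n8 al a1, of p] by (intro mult_left_mono) (auto simp: C6_def)
    also have "\<dots> = C6 * (4 ^ (jo * s) * (1 / 2 ^ jo) ^ (2 * s)) * \<beta>"
    proof -
      have "2 * p = 2 * s + 2 * (p - s)" using s by simp
      then have "((1::real) / 2 ^ jo) ^ (2 * p) = (1 / 2 ^ jo) ^ (2 * s) * \<beta>" unfolding \<beta>_def by (metis power_add)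
      then show ?thesis by simp
    qed
    also have "(4::real) ^ (jo * s) * (1 / 2 ^ jo) ^ (2 * s) = 1"
    proof -
      have "((1::real) / 2 ^ jo) ^ (2 * s) = ((1 / 2 ^ jo * (1 / 2 ^ jo)) ^ s)"
        by (simp only: power_mult power2_eq_square)
      also have "(1::real) / 2 ^ jo * (1 / 2 ^ jo) = 1 / (2 * 2) ^ jo"
        by (simp only: power_mult_distrib times_divide_times_eq mult_1_left)
      finally have "((1::real) / 2 ^ jo) ^ (2 * s) = 1 / (4 ^ jo) ^ s" by (simp add: power_divide)
      then show ?thesis by (simp add: power_mult)
    qed
    finally show ?thesis by simp
  qed
  have S2: "4 ^ (jo * s) * v jo \<le> C6 * \<beta>"
  proof -
    have "1 * v jo \<le> real jo * v jo" using jo(1) v_pos[of jo] by (intro mult_right_mono) auto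
    then have "4 ^ (jo * s) * v jo \<le> 4 ^ (jo * s) * (real jo * v jo)" by simp
    then show ?thesis using S1 by linarith
  qed
  have b1: "(4 * C5 * 4 ^ (jo * s)) * (e * (Cm * v jo)) \<le> (4 * C5 * (e * Cm)) * C6 * \<beta>"
  proof -
    have "(4 * C5 * 4 ^ (jo * s)) * (e * (Cm * v jo)) = (4 * C5 * (e * Cm)) * (4 ^ (jo * s) * v jo)" by simp
    also have "\<dots> \<le> (4 * C5 * (e * Cm)) * (C6 * \<beta>)"
      using C5_nonneg e0 Cm0 by (intro mult_left_mono S2) auto
    finally show ?thesis by (simp only: mult.assoc)
  qed
  have b2: "2 * Cg * thr jo s \<le> 2 * Cg * (\<tau> * C6) * \<beta>"
  proof -
    have "thr jo s = \<tau> * (4 ^ (jo * s) * (real jo * v jo))" by (simp add: thr_def)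
    also have "\<dots> \<le> \<tau> * (C6 * \<beta>)" using tau(1) by (intro mult_left_mono S1)
    finally have "2 * Cg * thr jo s \<le> 2 * Cg * (\<tau> * (C6 * \<beta>))" using Cg0 by (intro mult_left_mono) auto
    then show ?thesis by (simp only: mult.assoc)
  qed
  have b3: "(if real Mn < Gr * 2 ^ Suc jo then (\<Sum>l\<in>{1..L}. (2 * C5 * 4 ^ (l * s)) * (e * (Cm * v l))) + 2 * B\<^sup>2 else 0)
     \<le> H3 * 4 ^ (N * p) * \<beta>"
  proof (cases "real Mn < Gr * 2 ^ Suc jo")
    case True
    \<comment> \<open>A coarse grid bounds n: c0 n^(4/3) \<le> Mn < 2 Gr 2^jo and 2^jo \<le> n^(1/3)
      give c0 n \<le> 2 Gr. This is where the exponent 4/3 of the grid size is used.\<close>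
    have nN: "real n \<le> 2 * Gr / c0"
    proof -
      have "2 ^ jo \<le> real n powr (1 / 3)"
      proof -
        have "(2::real) ^ (3 * jo) \<le> real n" by (rule jmax_pow[OF jo(2) npos])
        then have "((2::real) ^ (3 * jo)) powr (1 / 3) \<le> real n powr (1 / 3)" by (intro powr_mono2) auto
        moreover have "((2::real) ^ (3 * jo)) powr (1 / 3) = 2 ^ jo"
        proof -
          have "((2::real) ^ (3 * jo)) powr (1 / 3) = 2 powr (real (3 * jo) * (1 / 3))"
            by (simp only: powr_realpow[OF zero_less_numeral, symmetric] powr_powr)
          also have "real (3 * jo) * (1 / 3) = real jo" by simp
          finally show ?thesis by (simp add: powr_realpow)
        qed
        ultimately show ?thesis by simp
      qed
      then have "c0 * (real n * 2 ^ jo) \<le> c0 * (real n * real n powr (1 / 3))" using c0 by (intro mult_left_mono) auto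
      also have "real n * real n powr (1 / 3) = real n powr (4 / 3)"
        using npos powr_add[of "real n" 1 "1 / 3"] by simp
      also have "c0 * real n powr (4 / 3) \<le> Gr * 2 ^ Suc jo" using Mn True by linarith
      finally have "(c0 * real n) * 2 ^ jo \<le> (2 * Gr) * 2 ^ jo" by (simp add: mult_ac)
      then have "c0 * real n \<le> 2 * Gr" by simp
      then show ?thesis using c0 by (simp add: le_divide_eq mult.commute)
    qed
    then have "real n \<le> real N" unfolding N_def by linarith
    then have nN': "n \<le> N" by simp
    have LN: "L \<le> N"
    proof -
      have "L < 2 ^ L" by (rule less_exp)
      also have "(2::nat) ^ L \<le> 2 ^ (3 * L)" by (intro power_increasing) auto
      also have "\<dots> \<le> n" using jmax_pow[OF order_refl npos] by (simp only: of_nat_le_iff[symmetric, where 'a=real] of_nat_power of_nat_numeral)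
      finally show ?thesis using nN' by simp
    qed
    have vH: "v l \<le> H" if "l \<le> L" for l
    proof -
      have "v l \<le> 2 ^ l + 4 ^ l * real l powr (2 * a)" by (rule vlev_le) (use n8 al in auto)
      also have "\<dots> \<le> H" unfolding H_def
        using that LN a1 by (intro add_mono mult_mono power_increasing powr_mono2) auto
      finally show ?thesis .
    qed
    have "(\<Sum>l\<in>{1..L}. (2 * C5 * 4 ^ (l * s)) * (e * (Cm * v l))) \<le> (\<Sum>l\<in>{1..L}. (2 * C5 * 4 ^ (N * p)) * (e * (Cm * H)))"
    proof (rule sum_mono)
      fix l assume l: "l \<in> {1..L}"
      have "l * s \<le> N * p" using l LN s by (intro mult_le_mono) auto
      then have "2 * C5 * 4 ^ (l * s) \<le> 2 * C5 * 4 ^ (N * p)" using C5_nonneg by (intro mult_left_mono power_increasing) auto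
      moreover have "e * (Cm * v l) \<le> e * (Cm * H)" using l e0 Cm0 by (intro mult_left_mono vH) auto
      ultimately show "(2 * C5 * 4 ^ (l * s)) * (e * (Cm * v l)) \<le> (2 * C5 * 4 ^ (N * p)) * (e * (Cm * H))"
        by (rule mult_mono) (use C5_nonneg e0 Cm0 v_pos[of l] in \<open>auto intro!: mult_nonneg_nonneg\<close>)
    qed
    also have "\<dots> = real L * ((2 * C5 * 4 ^ (N * p)) * (e * (Cm * H)))" by simp
    also have "\<dots> \<le> real N * ((2 * C5 * 4 ^ (N * p)) * (e * (Cm * H)))"
      using LN C5_nonneg e0 Cm0 H0 by (intro mult_right_mono) auto
    finally have "(\<Sum>l\<in>{1..L}. (2 * C5 * 4 ^ (l * s)) * (e * (Cm * v l))) + 2 * B\<^sup>2 \<le> H3" by (simp add: H3_def)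
    also have "H3 = H3 * 1" by simp
    \<comment> \<open>For bounded n the quantity \<beta> is bounded below, so a plain constant has
      the required form.\<close>
    also have "\<dots> \<le> H3 * (4 ^ (N * p) * \<beta>)"
    proof (rule mult_left_mono[OF _ H30])
      have "jo * (2 * (p - s)) \<le> N * (2 * p)" using jo(2) LN by (intro mult_le_mono) auto
      then have "(2::real) ^ (jo * (2 * (p - s))) \<le> 2 ^ (N * (2 * p))" by (intro power_increasing) auto
      also have "(2::real) ^ (N * (2 * p)) = 4 ^ (N * p)" by (simp add: mult.left_commute[of N 2] power_mult)
      finally have "2 ^ (jo * (2 * (p - s))) * \<beta> \<le> 4 ^ (N * p) * \<beta>" using \<beta>0 by (intro mult_right_mono) auto
      moreover have "2 ^ (jo * (2 * (p - s))) * \<beta> = 1" by (simp add: \<beta>_def power_divide power_mult)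
      ultimately show "1 \<le> 4 ^ (N * p) * \<beta>" by simp
    qed
    finally show ?thesis using True by (simp add: mult.assoc)
  next
    case False
    then show ?thesis using H30 \<beta>0 by simp
  qed
  define \<Gamma> where "\<Gamma> = Gm - 2"
  have \<Gamma>: "\<Gamma> = 4 * (2 * (real p + 1) + 2 * a + 1)" using Gm by (simp add: \<Gamma>_def)
  have \<Gamma>1: "1 \<le> \<Gamma>" unfolding \<Gamma> using a1 by simp
  have half: "exp (- 1) \<le> (1::real) / 2"
  proof -
    have "2 \<le> exp (1::real)" using exp_ge_add_one_self[of 1] by simp
    then show ?thesis by (simp add: exp_minus field_simps)
  qed
  have halfG: "exp (- \<Gamma>) \<le> 1 / 2" using half \<Gamma>1 by (meson exp_le_cancel_iff neg_le_iff_le order_trans)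
  \<comment> \<open>At one level above the oracle both halves of the AM-GM split become multiples of
    x E, with x the variance scale of the s-th derivative and E the numerator of \<theta>;
    \<open>xE\<close> then gives geometric decay in l.\<close>
  have b4: "2 * C5 * ((\<theta> s l * (4 ^ (l * s))\<^sup>2) * (e * (e * (Cm * (v l)\<^sup>2)))
          + (1 / \<theta> s l) * (\<Sum>m\<in>{l - 1..L}. 4 * e * exp (- ((Gm - 2) * real m)))) \<le> C7 * (C6 * \<beta>) * exp (- 1) ^ l"
    if l: "l \<in> {Suc jo..L}" for l
  proof -
    have l2: "2 \<le> l" using l jo(1) by auto
    define x where "x = 4 ^ (l * s) * v l"
    define E where "E = exp (- (\<Gamma> * real l / 4))"
    have x0: "0 < x" using v_pos[of l] by (simp add: x_def)
    have E0: "0 < E" by (simp add: E_def)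
    have th: "\<theta> s l = E / x" by (simp add: \<theta>_def E_def x_def \<Gamma>_def)
    have t1: "(\<theta> s l * (4 ^ (l * s))\<^sup>2) * (e * (e * (Cm * (v l)\<^sup>2))) = (e * (e * Cm)) * (x * E)"
    proof -
      have "(\<theta> s l * (4 ^ (l * s))\<^sup>2) * (e * (e * (Cm * (v l)\<^sup>2))) = E / x * x\<^sup>2 * (e * (e * Cm))"
        unfolding th x_def by (simp add: power_mult_distrib mult_ac)
      also have "E / x * x\<^sup>2 = x * E" using x0 by (simp add: power2_eq_square)
      finally show ?thesis by simp
    qed
    have t2: "(1 / \<theta> s l) * (\<Sum>m\<in>{l - 1..L}. 4 * e * exp (- ((Gm - 2) * real m))) \<le> (8 * e) * (x * E)"
    proof -
      have "(\<Sum>m\<in>{l - 1..L}. 4 * e * exp (- ((Gm - 2) * real m))) = 4 * e * (\<Sum>m\<in>{l - 1..L}. exp (- \<Gamma>) ^ m)"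
      proof -
        have "exp (- ((Gm - 2) * real m)) = exp (- \<Gamma>) ^ m" for m
          by (subst exp_of_nat_mult[symmetric]) (simp add: \<Gamma>_def mult.commute[of "real m"] flip: mult_minus_left)
        then show ?thesis by (simp only: sum_distrib_left)
      qed
      also have "\<dots> \<le> 4 * e * (2 * exp (- \<Gamma>) ^ (l - 1))"
        using e0 halfG by (intro mult_left_mono half_geometric_sum_le) auto
      \<comment> \<open>Since l \<ge> 2, l - 1 is at least l/2, so the weights from level l - 1 on
        still provide exp(-\<Gamma> l/2), which is E twice: one E cancels the 1/E in 1/\<theta>, the
        other remains.\<close>
      also have "exp (- \<Gamma>) ^ (l - 1) \<le> E * E"
      proof -
        have "real l / 2 \<le> real (l - 1)" using l2 by (simp add: of_nat_diff)
        then have "\<Gamma> * (real l / 2) \<le> \<Gamma> * real (l - 1)" using \<Gamma>1 by (intro mult_left_mono) auto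
        then show ?thesis by (simp add: E_def mult.commute flip: exp_of_nat_mult exp_add)
      qed
      finally have "(\<Sum>m\<in>{l - 1..L}. 4 * e * exp (- ((Gm - 2) * real m))) \<le> (8 * e) * (E * E)"
        using e0 by simp
      then have "(1 / \<theta> s l) * (\<Sum>m\<in>{l - 1..L}. 4 * e * exp (- ((Gm - 2) * real m))) \<le> (x / E) * ((8 * e) * (E * E))"
        unfolding th by (rule mult_mono[rotated]) (use x0 E0 e0 in \<open>auto intro!: sum_nonneg\<close>)
      also have "\<dots> = (8 * e) * (x * E)" using E0 by simp
      finally show ?thesis .
    qed
    \<comment> \<open>Relative to the oracle level x grows by at most exp(2 (p+1) l + 2 a l), and
      \<Gamma>/4 exceeds that exponent per level by exactly 1.\<close>
    have xE: "x * E \<le> (C6 * \<beta>) * exp (- 1) ^ l"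
    proof -
      have "x \<le> 4 ^ (l * s) * (4 ^ (l - jo) * real l powr (2 * a) * v jo)"
        unfolding x_def using l jo a1 by (intro mult_left_mono vlev_growth) auto
      also have "\<dots> = (4 ^ (jo * s) * v jo) * (4 ^ ((l - jo) * (s + 1)) * real l powr (2 * a))"
      proof -
        obtain m where "l = jo + m" using l le_Suc_ex[of jo l] by auto
        then have "l * s + (l - jo) = jo * s + (l - jo) * (s + 1)" by (simp add: algebra_simps)
        then have "(4::real) ^ (l * s) * 4 ^ (l - jo) = 4 ^ (jo * s) * 4 ^ ((l - jo) * (s + 1))" by (simp only: power_add[symmetric])
        then show ?thesis by simp
      qed
      also have "\<dots> \<le> (C6 * \<beta>) * (exp (2 * (real p + 1) * real l) * exp (2 * a * real l))"
      proof (rule mult_mono[OF S2 mult_mono])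
        have "(l - jo) * (s + 1) \<le> l * (p + 1)" using s by (intro mult_le_mono) auto
        then have "(4::real) ^ ((l - jo) * (s + 1)) \<le> 4 ^ (l * (p + 1))" by (intro power_increasing) auto
        also have "\<dots> \<le> exp 2 ^ (l * (p + 1))"
        proof (rule power_mono)
          have "(2::real)\<^sup>2 \<le> (exp 1)\<^sup>2" using exp_ge_add_one_self[of 1] by (intro power_mono) auto
          also have "(exp 1)\<^sup>2 = exp (2::real)" by (simp add: exp_double[symmetric])
          finally show "4 \<le> exp (2::real)" by simp
        qed simp
        also have "\<dots> = exp (2 * (real p + 1) * real l)"
          by (subst exp_of_nat_mult[symmetric]) (simp add: algebra_simps)
        finally show "(4::real) ^ ((l - jo) * (s + 1)) \<le> exp (2 * (real p + 1) * real l)" .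
        have "real l \<le> exp (real l)" using exp_ge_add_one_self[of "real l"] by linarith
        then have "real l powr (2 * a) \<le> exp (real l) powr (2 * a)" using a1 by (intro powr_mono2) auto
        then show "real l powr (2 * a) \<le> exp (2 * a * real l)" by (simp add: powr_def)
      qed (use C60 \<beta>0 in auto)
      finally have "x * E \<le> (C6 * \<beta>) * (exp (2 * (real p + 1) * real l) * exp (2 * a * real l)) * E"
        using E0 by (intro mult_right_mono) auto
      also have "\<dots> = (C6 * \<beta>) * (exp (2 * (real p + 1) * real l) * exp (2 * a * real l) * E)" by simp
      also have "exp (2 * (real p + 1) * real l) * exp (2 * a * real l) * E = exp (- real l)"
        unfolding E_def \<Gamma> exp_add[symmetric] by (simp add: algebra_simps)
      also have "exp (- real l) = exp (- 1) ^ l" by (simp flip: exp_of_nat_mult)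
      finally show ?thesis .
    qed
    have "2 * C5 * ((\<theta> s l * (4 ^ (l * s))\<^sup>2) * (e * (e * (Cm * (v l)\<^sup>2)))
          + (1 / \<theta> s l) * (\<Sum>m\<in>{l - 1..L}. 4 * e * exp (- ((Gm - 2) * real m)))) \<le> 2 * C5 * ((e * (e * Cm)) * (x * E) + (8 * e) * (x * E))"
      unfolding t1 using C5_nonneg by (intro mult_left_mono add_left_mono t2) auto
    also have "\<dots> = C7 * (x * E)" by (simp add: C7_def distrib_left distrib_right)
    also have "\<dots> \<le> C7 * ((C6 * \<beta>) * exp (- 1) ^ l)" by (intro mult_left_mono xE C70)
    finally show ?thesis by (simp only: mult.assoc)
  qed
  have b4s: "(\<Sum>l\<in>{Suc jo..L}. 2 * C5 * ((\<theta> s l * (4 ^ (l * s))\<^sup>2) * (e * (e * (Cm * (v l)\<^sup>2)))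
          + (1 / \<theta> s l) * (\<Sum>m\<in>{l - 1..L}. 4 * e * exp (- ((Gm - 2) * real m))))) \<le> 2 * C7 * C6 * \<beta>"
  proof -
    have "(\<Sum>l\<in>{Suc jo..L}. C7 * (C6 * \<beta>) * exp (- 1) ^ l) = C7 * (C6 * \<beta>) * (\<Sum>l\<in>{Suc jo..L}. exp (- 1) ^ l)"
      by (simp only: sum_distrib_left)
    also have "\<dots> \<le> C7 * (C6 * \<beta>) * (2 * exp (- 1) ^ Suc jo)"
      using C70 C60 \<beta>0 half by (intro mult_left_mono half_geometric_sum_le) auto
    also have "\<dots> \<le> C7 * (C6 * \<beta>) * (2 * 1)"
      using C70 C60 \<beta>0 by (intro mult_left_mono power_le_one) auto
    also have "\<dots> = 2 * C7 * C6 * \<beta>" by (simp only: mult_1_right mult_ac)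
    finally show ?thesis by (rule order_trans[OF sum_mono[OF b4], rotated])
  qed
  have K: "lepskiK d p a B C5 Cm \<tau> Gr Cg c0
     = (4 * C5 * (e * Cm)) * C6 + 4 * B\<^sup>2 + 2 * Cg * (\<tau> * C6) + H3 * 4 ^ (N * p) + 2 * C7 * C6"
    unfolding lepskiK_def Let_def H3_def H_def C7_def C6_def N_def e_def ..
  show ?thesis
    unfolding K bU_def e_def[symmetric] \<beta>_def[symmetric] distrib_right
    using b1 b2 b3 b4s by linarith
qed

end

text \<open>The suprema over f and x are expressed by the order of the quantifiers: K is chosen
  before them, and before n, \<alpha>, the grid and s. The bound \<open>8 \<le> n\<close> makes the
  set of levels nonempty, and the bound on n \<alpha>^2 controls the variance at the lowest
  level.\<close>

theorem mainTheorem9: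
  fixes d p :: nat and a M c0 c\<psi> :: real and \<psi> :: "nat \<Rightarrow> nat \<Rightarrow> real \<Rightarrow> real"
  assumes "p \<le> d + 1" and "1 < a" and "0 < M" and "0 < c0"
    and "jia_wavelets d \<psi> c\<psi>"
  shows "\<exists>\<tau>0. \<forall>\<tau>\<ge>\<tau>0. \<exists>K. \<forall>n \<alpha> (Mn::nat) f s x.
           8 \<le> n \<longrightarrow> 0 < \<alpha> \<longrightarrow> 1 \<le> real n * \<alpha>\<^sup>2 \<longrightarrow>
           c0 * real n powr (4/3) \<le> real Mn \<longrightarrow> f \<in> Wp p M \<longrightarrow> s + 1 \<le> p \<longrightarrow> x \<in> {0..1} \<longrightarrow>
           Ef d f n (\<lambda>X Y. l2sq (sderiv s (\<lambda>y. fest d p a c\<psi> \<psi> \<tau> \<alpha> Mn n X Y y - f y)))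
              \<le> ennreal (K * rate p s a \<alpha> n)
         \<and> Ef d f n (\<lambda>X Y. (sderiv s (\<lambda>y. fest d p a c\<psi> \<psi> \<tau> \<alpha> Mn n X Y y - f y) x)\<^sup>2)
              \<le> ennreal (K * rate p s a \<alpha> n)"
proof (cases "p = 0")
  \<comment> \<open>No order s satisfies s + 1 \<le> 0, so the claim is vacuous.\<close>
  case True
  then show ?thesis by simp
next
  case False
  then have p1: "1 \<le> p" by simp
  have M0: "0 \<le> M" using assms(3) by simp
  interpret jia d \<psi> c\<psi> by unfold_locales (rule assms(5))
  obtain B where B0: "0 \<le> B" and bias: "\<forall>J f s. \<forall>x\<in>{0..1}. f \<in> Wp p M \<longrightarrow> s \<le> p \<longrightarrow>
    \<bar>sderiv s (\<lambda>y. fproj J f y - f y) x\<bar> \<le> B * (1 / 2 ^ J) ^ (p - s)"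
    using bias_bound[OF p1 assms(1) M0] by (elim exE conjE) (rule that)
  obtain Cb where Cb0: "0 \<le> Cb" and Cb: "\<forall>g s N x. ppoly d N g \<longrightarrow> s \<le> p \<longrightarrow> 0 < N \<longrightarrow> x \<in> {0..1} \<longrightarrow>
     \<bar>sderiv s g x\<bar> \<le> Cb * real N ^ s * (\<Sum>i\<le>d. \<bar>g (npt d N (cidx N x) i)\<bar>)"
    using sderiv_ppoly_bound[of d p] by (elim exE conjE) (rule that)
  define Cn where "Cn = max 1 Cb"
  have norming: "\<bar>sderiv s g x\<bar> \<le> Cn * real N ^ s * (\<Sum>i\<le>d. \<bar>g (npt d N (cidx N x) i)\<bar>)"
    if "ppoly d N g" "s \<le> p" "0 < N" "x \<in> {0..1}" for g s N x
  proof -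
    have "\<bar>sderiv s g x\<bar> \<le> Cb * real N ^ s * (\<Sum>i\<le>d. \<bar>g (npt d N (cidx N x) i)\<bar>)" using Cb that by blast
    also have "\<dots> \<le> Cn * real N ^ s * (\<Sum>i\<le>d. \<bar>g (npt d N (cidx N x) i)\<bar>)"
      by (intro mult_right_mono sum_nonneg) (auto simp: Cn_def)
    finally show ?thesis .
  qed
  obtain \<kappa> Cm where k0: "0 < \<kappa>" and Cm0: "0 \<le> Cm" and mom: "\<forall>n \<alpha> f l. \<forall>y\<in>{0..1}. 0 < n \<longrightarrow> 0 < \<alpha> \<longrightarrow> 1 \<le> l \<longrightarrow> l \<le> jmax n \<longrightarrow> f \<in> Wp p M \<longrightarrow>
      Ef d f n (\<lambda>X Y. exp (\<kappa> * sqrt (real l) * (\<bar>dev a \<alpha> n f l y X Y\<bar> / sqrt (vlev a \<alpha> n l)))) \<le> ennreal (2 * exp (real l))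
    \<and> Ef d f n (\<lambda>X Y. (dev a \<alpha> n f l y X Y)\<^sup>2) \<le> ennreal (Cm * vlev a \<alpha> n l)
    \<and> Ef d f n (\<lambda>X Y. (dev a \<alpha> n f l y X Y) ^ 4) \<le> ennreal (Cm * (vlev a \<alpha> n l)\<^sup>2)"
    using dev_moments[where p=p, OF assms(2) M0] by (elim exE conjE) (rule that)
  obtain Gr Cg where Gr0: "0 < Gr" and Cg0: "0 \<le> Cg" and grid: "\<forall>g s N Mn S. ppoly d N g \<longrightarrow> 0 < N \<longrightarrow> Gr * real N \<le> real Mn \<longrightarrow> 0 \<le> S \<longrightarrow>
     (\<forall>t\<le>Mn. (sderiv s g (real t / real Mn))\<^sup>2 \<le> S) \<longrightarrow> (\<forall>x\<in>{0..1}. (sderiv s g x)\<^sup>2 \<le> Cg * S)"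
    using grid_norming[of d] by (elim exE conjE) (rule that)
  define Gm where "Gm = 4 * (2 * (real p + 1) + 2 * a + 1) + 2"
  \<comment> \<open>The smallest root of \<tau> that meets both conditions of \<open>lepski\<close>:
    domination of the biases, and a large exponent at a norming point.\<close>
  define r0 where "r0 = max (4 * B) (Gm * (4 * Cn * 2 ^ p * (real d + 1)) / \<kappa>)"
  have r00: "0 \<le> r0" using B0 by (simp add: r0_def le_max_iff_disj)
  show ?thesis
  proof (rule exI[of _ "r0\<^sup>2"], intro allI impI)
    fix \<tau> assume \<tau>: "r0\<^sup>2 \<le> \<tau>"
    have \<tau>0: "0 \<le> \<tau>" using \<tau> zero_le_power2 order_trans by blast
    have "r0 \<le> sqrt \<tau>" using \<tau> by (rule real_le_rsqrt)
    then have sq: "4 * B \<le> sqrt \<tau>" "Gm * (4 * Cn * 2 ^ p * (real d + 1)) / \<kappa> \<le> sqrt \<tau>" by (auto simp: r0_def)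
    define C5' where "C5' = Cn\<^sup>2 * 4 ^ p * (real d + 1)"
    \<comment> \<open>The maximum with 0 allows multiplication with the oracle inequality.\<close>
    define KK where "KK = max 0 (lepskiK d p a B C5' Cm \<tau> Gr Cg c0)"
    show "\<exists>K. \<forall>n \<alpha> (Mn::nat) f s x.
           8 \<le> n \<longrightarrow> 0 < \<alpha> \<longrightarrow> 1 \<le> real n * \<alpha>\<^sup>2 \<longrightarrow>
           c0 * real n powr (4/3) \<le> real Mn \<longrightarrow> f \<in> Wp p M \<longrightarrow> s + 1 \<le> p \<longrightarrow> x \<in> {0..1} \<longrightarrow>
           Ef d f n (\<lambda>X Y. l2sq (sderiv s (\<lambda>y. fest d p a c\<psi> \<psi> \<tau> \<alpha> Mn n X Y y - f y)))
              \<le> ennreal (K * rate p s a \<alpha> n)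
         \<and> Ef d f n (\<lambda>X Y. (sderiv s (\<lambda>y. fest d p a c\<psi> \<psi> \<tau> \<alpha> Mn n X Y y - f y) x)\<^sup>2)
              \<le> ennreal (K * rate p s a \<alpha> n)"
    proof (intro exI[of _ "KK * 4 ^ p"] allI impI)
      fix n :: nat and \<alpha> :: real and Mn :: nat and f :: "real \<Rightarrow> real" and s :: nat and x :: real
      assume n: "8 \<le> n" and al: "0 < \<alpha>" "1 \<le> real n * \<alpha>\<^sup>2" and Mn: "c0 * real n powr (4/3) \<le> real Mn"
        and f: "f \<in> Wp p M" and s1: "s + 1 \<le> p" and x: "x \<in> {0..1}"
      have n0: "0 < n" using n by simp
      interpret lp: lepski d \<psi> c\<psi> p a M B Cn \<kappa> Cm \<tau> Gr Cg Gm n \<alpha> Mn f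
      proof unfold_locales
        show "Gm * (4 * Cn * 2 ^ p * (real d + 1)) \<le> \<kappa> * sqrt \<tau>"
          using sq(2) k0 by (simp add: divide_le_eq mult.commute)
        show "\<bar>sderiv s (\<lambda>y. fproj J f y - f y) x\<bar> \<le> B * (1 / 2 ^ J) ^ (p - s)" if "x \<in> {0..1}" "s \<le> p" for J s x
          using bias that f by blast
        show "(sderiv s g x)\<^sup>2 \<le> Cg * S"
          if "ppoly d N g" "0 < N" "Gr * real N \<le> real Mn" "0 \<le> S"
            "\<forall>t\<le>Mn. (sderiv s g (real t / real Mn))\<^sup>2 \<le> S" "x \<in> {0..1}" for g s N S x
          using grid that by blast
      qed (use p1 assms(2) n al f B0 norming k0 Cm0 mom n0 Gr0 Cg0 \<tau>0 sq(1) Gm_def in \<open>auto simp: Cn_def\<close>)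
      have s: "s \<le> p" using s1 by simp
      define \<beta> where "\<beta> = ((1::real) / 2 ^ jora p a \<alpha> n) ^ (2 * (p - s))"
      have C5: "lp.C5 = C5'" by (simp add: lp.C5_def C5'_def)
      have "lp.bU s \<le> lepskiK d p a B C5' Cm \<tau> Gr Cg c0 * \<beta>"
        using lp.bU_bound[OF s assms(4) Mn] unfolding C5 \<beta>_def .
      also have "\<dots> \<le> KK * \<beta>" by (intro mult_right_mono) (auto simp: KK_def \<beta>_def)
      also have "\<dots> \<le> KK * (4 ^ p * rate p s a \<alpha> n)"
        unfolding \<beta>_def by (intro mult_left_mono oracle_rate n al(1) assms(2) s1) (simp add: KK_def)
      finally have "ennreal (lp.bU s) \<le> ennreal (KK * 4 ^ p * rate p s a \<alpha> n)"
        by (intro ennreal_leI) (simp only: mult.assoc)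
      then show "Ef d f n (\<lambda>X Y. l2sq (sderiv s (\<lambda>y. fest d p a c\<psi> \<psi> \<tau> \<alpha> Mn n X Y y - f y)))
              \<le> ennreal (KK * 4 ^ p * rate p s a \<alpha> n)
         \<and> Ef d f n (\<lambda>X Y. (sderiv s (\<lambda>y. fest d p a c\<psi> \<psi> \<tau> \<alpha> Mn n X Y y - f y) x)\<^sup>2)
              \<le> ennreal (KK * 4 ^ p * rate p s a \<alpha> n)"
        using lp.risk_L2[OF s] lp.risk_pointwise[OF x s] order_trans by blast
    qed
  qed
qed

end
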